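(* Let $X=(E\times E)/\rho$, the quotient by the diagonal action of $\rho$; it is an abelian surface. Over the field $\mathbb Q(\mathrm i,\sqrt2)$ of eighth roots of unity, taking the image in $X$ of the diagonally embedded point $[\sqrt2,0,1,1]\in E$ as origin of $X$, the involution of $X$ induced by the diagonal action of $\tau$ is the negation, and the variety $\mathcal B/\sigma$ is isomorphic to the Kummer variety $X/\pm$.
   Context: The box variety is $\mathcal B=\mathrm{proj}(B\otimes_{\mathbb Q}\mathbb C)$, with $\mathbb Q$-structure $\mathrm{proj}(B)$, where $B=\mathbb Q[Z_1,Z_2,Z_3,W_1,W_2,W_3,C]$ (generators of degree one) has defining relations $W_1^2+W_2^2=Z_3^2$, $W_1^2+W_3^2=Z_2^2$, $W_2^2+W_3^2=Z_1^2$, $W_1^2+W_2^2+W_3^2=C^2$. $\sigma$ is the involution with $\sigma(Z_3)=-Z_3$ fixing the other generators; the quotient $\mathcal B/\sigma$ has the $\mathbb Q$-structure $\mathrm{proj}(B^\sigma)$. $E=\mathrm{proj}\,\mathbb Q[a,b,c,d]\subset\mathbb P^3_{\mathbb Q}$ is the elliptic curve over $\mathbb Q$ with defining relations $a^2=c^2+d^2$, $b^2=c^2-d^2$ (generators of degree one); points are written in homogeneous coordinates $[a,b,c,d]$. $\tau$ and $\rho$ are the automorphisms of $E$ given by $$\tau(a,b,c,d)=(a,-b,c,d),\qquad\rho(a,b,c,d)=(a,b,-c,-d).$$ *)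

theory Defs
  imports "HOL-Analysis.Analysis" "HOL-Algebra.Group"
begin

section \<open>Varieties over a subfield of the complex numbers\<close>

text \<open>
  A variety over a subfield K of the complex numbers is rendered as its set of complex points
  together with its K-structure: the Zariski topology whose closed sets are those defined over K,
  and, for each open U, the complex-valued functions on U that are regular and defined over K.
  For reduced schemes V of finite type over K this loses nothing: on affine V the functions on
  the set V(\<complex>) recover the coordinate K-algebra, and the structure-preserving maps between
  complex point sets are exactly the morphisms over K.
\<close>

record 'a fspace =
  fs_top :: "'a topology"
  fs_reg :: "'a set \<Rightarrow> ('a \<Rightarrow> complex) \<Rightarrow> bool"

abbreviation points :: "'a fspace \<Rightarrow> 'a set" where
  "points X \<equiv> topspace (fs_top X)"

definition function_space :: "'a fspace \<Rightarrow> bool" where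
  "function_space X \<longleftrightarrow>
     (\<forall>U \<phi>. fs_reg X U \<phi> \<longrightarrow> openin (fs_top X) U) \<and>
     (\<forall>U \<phi> \<psi>. fs_reg X U \<phi> \<longrightarrow> (\<forall>x\<in>U. \<phi> x = \<psi> x) \<longrightarrow> fs_reg X U \<psi>) \<and>
     (\<forall>U V \<phi>. fs_reg X U \<phi> \<longrightarrow> openin (fs_top X) V \<longrightarrow> V \<subseteq> U \<longrightarrow> fs_reg X V \<phi>) \<and>
     (\<forall>U \<phi>. openin (fs_top X) U \<longrightarrow> (\<forall>x\<in>U. \<exists>V. x \<in> V \<and> V \<subseteq> U \<and> fs_reg X V \<phi>) \<longrightarrow> fs_reg X U \<phi>)"

definition morphism :: "'a fspace \<Rightarrow> 'b fspace \<Rightarrow> ('a \<Rightarrow> 'b) \<Rightarrow> bool" where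
  "morphism X Y f \<longleftrightarrow>
     continuous_map (fs_top X) (fs_top Y) f \<and>
     (\<forall>U \<phi>. fs_reg Y U \<phi> \<longrightarrow> fs_reg X {x \<in> points X. f x \<in> U} (\<phi> \<circ> f))"

definition isomorphic :: "'a fspace \<Rightarrow> 'b fspace \<Rightarrow> bool" where
  "isomorphic X Y \<longleftrightarrow>
     (\<exists>f g. morphism X Y f \<and> morphism Y X g \<and>
        (\<forall>x\<in>points X. g (f x) = x) \<and> (\<forall>y\<in>points Y. f (g y) = y))"

definition open_subspace :: "'a fspace \<Rightarrow> 'a set \<Rightarrow> 'a fspace" where
  "open_subspace X U =
     \<lparr>fs_top = subtopology (fs_top X) U, fs_reg = (\<lambda>V \<phi>. V \<subseteq> U \<and> fs_reg X V \<phi>)\<rparr>"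

definition tensor_funs :: "'a fspace \<Rightarrow> 'b fspace \<Rightarrow> 'a set \<Rightarrow> 'b set \<Rightarrow> ('a \<times> 'b \<Rightarrow> complex) set" where
  "tensor_funs X Y U V =
     {\<lambda>(x, y). \<Sum>i<n. f i x * g i y | (n::nat) f g.
        (\<forall>i<n. fs_reg X U (f i)) \<and> (\<forall>i<n. fs_reg Y V (g i))}"

text \<open>
  The product of varieties: if U and V are affine, the basic open sets and regular functions
  below are those of the affine variety with coordinate ring the tensor product over K of the
  coordinate rings of U and V.
\<close>

definition product :: "'a fspace \<Rightarrow> 'b fspace \<Rightarrow> ('a \<times> 'b) fspace" where
  "product X Y =
    (let T = topology_generated_by
       {{p \<in> U \<times> V. h p \<noteq> 0} | U V h.
          openin (fs_top X) U \<and> openin (fs_top Y) V \<and> h \<in> tensor_funs X Y U V}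
     in \<lparr>fs_top = T,
         fs_reg = (\<lambda>W \<phi>. openin T W \<and>
           (\<forall>p\<in>W. \<exists>U V f h. openin (fs_top X) U \<and> openin (fs_top Y) V \<and> p \<in> U \<times> V \<and>
              f \<in> tensor_funs X Y U V \<and> h \<in> tensor_funs X Y U V \<and> h p \<noteq> 0 \<and>
              (\<forall>q \<in> W \<inter> (U \<times> V). h q \<noteq> 0 \<longrightarrow> \<phi> q = f q / h q)))\<rparr>)"

text \<open>
  The quotient by the group generated by an involution s: its points are the orbits, a set of
  orbits is open if its preimage is, and its regular functions are the s-invariant regular
  functions on the preimage.  For the projective variety of a graded K-algebra B on which s acts,
  this is the projective variety of the ring of invariants of s in B.
\<close>

definition orbit_map :: "('a \<Rightarrow> 'a) \<Rightarrow> 'a \<Rightarrow> 'a set" where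
  "orbit_map s x = {x, s x}"

definition quotient_by :: "'a fspace \<Rightarrow> ('a \<Rightarrow> 'a) \<Rightarrow> 'a set fspace" where
  "quotient_by X s =
     \<lparr>fs_top = topology (\<lambda>U. U \<subseteq> orbit_map s ` points X \<and>
                             openin (fs_top X) {x \<in> points X. orbit_map s x \<in> U}),
      fs_reg = (\<lambda>U \<phi>. U \<subseteq> orbit_map s ` points X \<and>
                        fs_reg X {x \<in> points X. orbit_map s x \<in> U} (\<phi> \<circ> orbit_map s))\<rparr>"

lemma openin_quotient_by:
  "openin (fs_top (quotient_by X s)) U \<longleftrightarrow>
     U \<subseteq> orbit_map s ` points X \<and> openin (fs_top X) {x \<in> points X. orbit_map s x \<in> U}"
proof -
  let ?L = "\<lambda>U. U \<subseteq> orbit_map s ` points X \<and> openin (fs_top X) {x \<in> points X. orbit_map s x \<in> U}"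
  have inter: "?L (A \<inter> B)" if "?L A" "?L B" for A B
  proof -
    have "{x \<in> points X. orbit_map s x \<in> A \<inter> B} =
      {x \<in> points X. orbit_map s x \<in> A} \<inter> {x \<in> points X. orbit_map s x \<in> B}" by blast
    with that show ?thesis by (auto intro: openin_Int)
  qed
  have union: "?L (\<Union>\<K>)" if "\<forall>K\<in>\<K>. ?L K" for \<K>
  proof -
    have "{x \<in> points X. orbit_map s x \<in> \<Union>\<K>} =
      (\<Union>K\<in>\<K>. {x \<in> points X. orbit_map s x \<in> K})" by blast
    with that show ?thesis by (auto intro!: openin_Union)
  qed
  have "istopology ?L"
    unfolding istopology_def using inter union by blast
  then show ?thesis
    by (simp add: quotient_by_def topology_inverse')
qed

section \<open>Affine and projective varieties\<close>

text \<open>Polynomial functions with coefficients in K in the variables with index in I.\<close>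

inductive_set polys :: "complex set \<Rightarrow> 'v set \<Rightarrow> (('v \<Rightarrow> complex) \<Rightarrow> complex) set"
  for K :: "complex set" and I :: "'v set" where
  const: "c \<in> K \<Longrightarrow> (\<lambda>_. c) \<in> polys K I"
| var: "i \<in> I \<Longrightarrow> (\<lambda>v. v i) \<in> polys K I"
| add: "f \<in> polys K I \<Longrightarrow> g \<in> polys K I \<Longrightarrow> (\<lambda>v. f v + g v) \<in> polys K I"
| mult: "f \<in> polys K I \<Longrightarrow> g \<in> polys K I \<Longrightarrow> (\<lambda>v. f v * g v) \<in> polys K I"

text \<open>Forms of degree d with coefficients in K, all elements of the type being variables.\<close>

inductive form :: "complex set \<Rightarrow> nat \<Rightarrow> (('v \<Rightarrow> complex) \<Rightarrow> complex) \<Rightarrow> bool"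
  for K :: "complex set" where
  const: "c \<in> K \<Longrightarrow> form K 0 (\<lambda>_. c)"
| var: "form K 1 (\<lambda>v. v i)"
| add: "form K d f \<Longrightarrow> form K d g \<Longrightarrow> form K d (\<lambda>v. f v + g v)"
| mult: "form K d f \<Longrightarrow> form K e g \<Longrightarrow> form K (d + e) (\<lambda>v. f v * g v)"

definition affine_var :: "complex set \<Rightarrow> nat \<Rightarrow> ((nat \<Rightarrow> complex) \<Rightarrow> complex) set
    \<Rightarrow> (nat \<Rightarrow> complex) fspace" where
  "affine_var K n R =
    (let P = {v \<in> {..<n} \<rightarrow>\<^sub>E UNIV. \<forall>r\<in>R. r v = 0};
         T = topology_generated_by {{v \<in> P. g v \<noteq> 0} | g. g \<in> polys K {..<n}}
     in \<lparr>fs_top = T,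
         fs_reg = (\<lambda>U \<phi>. openin T U \<and>
           (\<forall>p\<in>U. \<exists>f\<in>polys K {..<n}. \<exists>g\<in>polys K {..<n}.
              g p \<noteq> 0 \<and> (\<forall>q\<in>U. g q \<noteq> 0 \<longrightarrow> \<phi> q = f q / g q)))\<rparr>)"

text \<open>A point of projective space is represented by the set of its homogeneous coordinate vectors.\<close>

definition proj_pt :: "('v \<Rightarrow> complex) \<Rightarrow> ('v \<Rightarrow> complex) set" where
  "proj_pt v = {\<lambda>i. c * v i | c. c \<noteq> 0}"

text \<open>
  The projective variety over K with homogeneous coordinates indexed by the type of v
  and defining relations r = 0 for the forms r in R.
\<close>

definition proj_var :: "complex set \<Rightarrow> (('v \<Rightarrow> complex) \<Rightarrow> complex) set
    \<Rightarrow> ('v \<Rightarrow> complex) set fspace" where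
  "proj_var K R =
    (let P = {proj_pt v | v. (\<exists>i. v i \<noteq> 0) \<and> (\<forall>r\<in>R. r v = 0)};
         T = topology_generated_by {{p \<in> P. \<forall>v\<in>p. g v \<noteq> 0} | g. \<exists>d. form K d g}
     in \<lparr>fs_top = T,
         fs_reg = (\<lambda>U \<phi>. openin T U \<and>
           (\<forall>p\<in>U. \<exists>d f g. form K d f \<and> form K d g \<and> (\<forall>v\<in>p. g v \<noteq> 0) \<and>
              (\<forall>q\<in>U. \<forall>v\<in>q. g v \<noteq> 0 \<longrightarrow> \<phi> q = f v / g v)))\<rparr>)"

section \<open>Abelian surfaces\<close>

definition variety :: "complex set \<Rightarrow> 'a fspace \<Rightarrow> bool" where
  "variety K X \<longleftrightarrow>
     function_space X \<and>
     (\<exists>\<U>. finite \<U> \<and> \<Union>\<U> = points X \<and>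
        (\<forall>U\<in>\<U>. openin (fs_top X) U \<and>
           (\<exists>n R. R \<subseteq> polys K {..<n} \<and> isomorphic (open_subspace X U) (affine_var K n R)))) \<and>
     closedin (fs_top (product X X)) {(x, x) | x. x \<in> points X}"

text \<open>
  Since the closedness of the projection is local on the second factor, affine second factors
  suffice.
\<close>

definition complete_var :: "complex set \<Rightarrow> 'a fspace \<Rightarrow> bool" where
  "complete_var K X \<longleftrightarrow>
     (\<forall>n R. R \<subseteq> polys K {..<n} \<longrightarrow>
        closed_map (fs_top (product X (affine_var K n R))) (fs_top (affine_var K n R)) snd)"

definition rational_pt :: "complex set \<Rightarrow> 'a fspace \<Rightarrow> 'a \<Rightarrow> bool" where
  "rational_pt K X x \<longleftrightarrow> x \<in> points X \<and> (\<forall>U \<phi>. x \<in> U \<longrightarrow> fs_reg X U \<phi> \<longrightarrow> \<phi> x \<in> K)"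

definition irreducible_in :: "'a topology \<Rightarrow> 'a set \<Rightarrow> bool" where
  "irreducible_in T Z \<longleftrightarrow>
     Z \<noteq> {} \<and> Z \<subseteq> topspace T \<and>
     (\<forall>A B. closedin T A \<longrightarrow> closedin T B \<longrightarrow> Z \<subseteq> A \<union> B \<longrightarrow> Z \<subseteq> A \<or> Z \<subseteq> B)"

definition irreducible_chain :: "'a topology \<Rightarrow> nat \<Rightarrow> (nat \<Rightarrow> 'a set) \<Rightarrow> bool" where
  "irreducible_chain T n Z \<longleftrightarrow>
     (\<forall>i\<le>n. closedin T (Z i) \<and> irreducible_in T (Z i)) \<and> (\<forall>i<n. Z i \<subset> Z (Suc i))"

definition has_dimension :: "'a fspace \<Rightarrow> nat \<Rightarrow> bool" where
  "has_dimension X n \<longleftrightarrow>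
     (\<exists>Z. irreducible_chain (fs_top X) n Z) \<and>
     (\<forall>m Z. irreducible_chain (fs_top X) m Z \<longrightarrow> m \<le> n)"

text \<open>
  G is the group law.  An irreducible variety over K with a K-rational point and a group law
  over K is geometrically irreducible, and it is smooth since the characteristic is 0, so neither
  has to be required.
\<close>

definition abelian_variety :: "complex set \<Rightarrow> 'a fspace \<Rightarrow> 'a monoid \<Rightarrow> bool" where
  "abelian_variety K X G \<longleftrightarrow>
     variety K X \<and> irreducible_in (fs_top X) (points X) \<and> complete_var K X \<and>
     group G \<and> carrier G = points X \<and>
     morphism (product X X) X (\<lambda>(x, y). x \<otimes>\<^bsub>G\<^esub> y) \<and>
     morphism X X (\<lambda>x. inv\<^bsub>G\<^esub> x) \<and>
     rational_pt K X \<one>\<^bsub>G\<^esub>"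

definition abelian_surface :: "complex set \<Rightarrow> 'a fspace \<Rightarrow> 'a monoid \<Rightarrow> bool" where
  "abelian_surface K X G \<longleftrightarrow> abelian_variety K X G \<and> has_dimension X 2"

definition kummer :: "'a fspace \<Rightarrow> 'a monoid \<Rightarrow> 'a set fspace" where
  "kummer X G = quotient_by X (\<lambda>x. inv\<^bsub>G\<^esub> x)"

section \<open>The box variety and the surface X\<close>

datatype box_var = Z1 | Z2 | Z3 | W1 | W2 | W3 | Cc

definition box_variety :: "complex set \<Rightarrow> (box_var \<Rightarrow> complex) set fspace" where
  "box_variety K = proj_var K
     {\<lambda>v. (v W1)\<^sup>2 + (v W2)\<^sup>2 - (v Z3)\<^sup>2,
      \<lambda>v. (v W1)\<^sup>2 + (v W3)\<^sup>2 - (v Z2)\<^sup>2,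
      \<lambda>v. (v W2)\<^sup>2 + (v W3)\<^sup>2 - (v Z1)\<^sup>2,
      \<lambda>v. (v W1)\<^sup>2 + (v W2)\<^sup>2 + (v W3)\<^sup>2 - (v Cc)\<^sup>2}"

definition box_sigma :: "(box_var \<Rightarrow> complex) set \<Rightarrow> (box_var \<Rightarrow> complex) set" where
  "box_sigma p = (\<lambda>v. v(Z3 := - v Z3)) ` p"

datatype E_var = Ea | Eb | Ec | Ed

definition E_curve :: "complex set \<Rightarrow> (E_var \<Rightarrow> complex) set fspace" where
  "E_curve K = proj_var K
     {\<lambda>v. (v Ea)\<^sup>2 - ((v Ec)\<^sup>2 + (v Ed)\<^sup>2),
      \<lambda>v. (v Eb)\<^sup>2 - ((v Ec)\<^sup>2 - (v Ed)\<^sup>2)}"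

definition E_pt :: "complex \<Rightarrow> complex \<Rightarrow> complex \<Rightarrow> complex \<Rightarrow> (E_var \<Rightarrow> complex) set" where
  "E_pt a b c d = proj_pt (\<lambda>i. case i of Ea \<Rightarrow> a | Eb \<Rightarrow> b | Ec \<Rightarrow> c | Ed \<Rightarrow> d)"

definition E_tau :: "(E_var \<Rightarrow> complex) set \<Rightarrow> (E_var \<Rightarrow> complex) set" where
  "E_tau p = (\<lambda>v. v(Eb := - v Eb)) ` p"

definition E_rho :: "(E_var \<Rightarrow> complex) set \<Rightarrow> (E_var \<Rightarrow> complex) set" where
  "E_rho p = (\<lambda>v. v(Ec := - v Ec, Ed := - v Ed)) ` p"

type_synonym X_point = "((E_var \<Rightarrow> complex) set \<times> (E_var \<Rightarrow> complex) set) set"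

definition X_surface :: "complex set \<Rightarrow> X_point fspace" where
  "X_surface K = quotient_by (product (E_curve K) (E_curve K)) (map_prod E_rho E_rho)"

definition X_image :: "(E_var \<Rightarrow> complex) set \<times> (E_var \<Rightarrow> complex) set \<Rightarrow> X_point" where
  "X_image = orbit_map (map_prod E_rho E_rho)"

text \<open>As tau and rho commute, the diagonal action of tau maps orbits of rho to orbits of rho.\<close>

definition X_tau :: "X_point \<Rightarrow> X_point" where
  "X_tau x = map_prod E_tau E_tau ` x"

definition X_origin :: X_point where
  "X_origin = X_image (E_pt (sqrt 2) 0 1 1, E_pt (sqrt 2) 0 1 1)"

definition complex_subfield :: "complex set \<Rightarrow> bool" where
  "complex_subfield K \<longleftrightarrow>
     0 \<in> K \<and> 1 \<in> K \<and>
     (\<forall>x\<in>K. \<forall>y\<in>K. x + y \<in> K \<and> x * y \<in> K) \<and> (\<forall>x\<in>K. - x \<in> K \<and> inverse x \<in> K)"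

text \<open>The field generated over the rationals by i and the square root of 2.\<close>

definition Q_zeta8 :: "complex set" where
  "Q_zeta8 = complex_subfield hull {\<i>, complex_of_real (sqrt 2)}"

end

theory Submission
  imports Defs "Jordan_Normal_Form.Determinant" "HOL-Computational_Algebra.Fundamental_Theorem_Algebra"
begin

text \<open>
  Write (a, b, c, d) and (a', b', c', d') for the coordinates on the two factors of E x E.  The
  rational map Z1 = cc' + dd', Z2 = cc' - dd', W1 = cd' - dc', W2 = cd' + dc', W3 = bb', C = aa'
  satisfies the relations of the box variety except for the one with Z3, which is determined up to
  sign by Z3^2 = W1^2 + W2^2.  The functions of bidegree (d, d) on E x E that are invariant under the
  diagonal actions of rho and tau are exactly the polynomials of degree d in aa', bb', cc', cd', dc',
  dd': a normal form monomial has exponents at most 1 in a, b, a', b', so that invariance forces these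
  to agree in the two factors.  Hence the graded rings of B/sigma and of (E x E)/(rho, tau)
  coincide.  It remains to see that tau is the negation for the stated origin, that is, that
  p + tau p is constant on E.

  The group law on E is given by two bihomogeneous addition laws (those of the Jacobi elliptic
  functions) covering E x E.  Associativity holds generically by a polynomial identity, and everywhere
  since two regular maps to E that agree at infinitely many points agree.  Both laws change by the
  sign of rho when an argument is moved by rho, so they descend to X.  Completeness of X is the main
  theorem of elimination theory for E, by resultants; the dimension is bounded by the quadratic growth
  of the ring of X; the affine charts are those where a coordinate c or d on each factor does not
  vanish.
\<close>

section \<open>Function spaces of graded rings of functions\<close>

text \<open>Points are complex, while open sets and functions are defined over K, so an argument at
  a point tends to produce complex coefficients. Two devices deal with this: complex spans of
  functions over K, and statements proved with complex coefficients and then applied to forms over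
  K. Affine and projective varieties, products, quotients and basic open pieces are all brought to
  one shape, a cone with graded sets of functions over K, so that continuity, regularity and
  closedness reduce to exhibiting functions of a given degree.

  The group law is set up once with the rational origin [1, 1, 1, 0]. For it p + tau p is the
  constant [1, -1, 1, 0], so tau is not yet the negation. Adding n = [sqrt 2, 0, 1, -1], the
  negative of the stated origin, to every sum makes the stated origin neutral and turns that
  constant into [sqrt 2, 0, 1, 1]. This translation is the reason why the square root of 2 has to
  lie in the field.\<close>

locale subfield =
  fixes K :: "complex set"
  assumes subfield: "complex_subfield K"
begin

lemma K_zero [simp, intro]: "0 \<in> K" and K_one [simp, intro]: "1 \<in> K"
  and K_add [intro]: "x \<in> K \<Longrightarrow> y \<in> K \<Longrightarrow> x + y \<in> K"
  and K_mult [intro]: "x \<in> K \<Longrightarrow> y \<in> K \<Longrightarrow> x * y \<in> K"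
  and K_uminus [intro]: "x \<in> K \<Longrightarrow> - x \<in> K"
  and K_inverse [intro]: "x \<in> K \<Longrightarrow> inverse x \<in> K"
  using subfield by (auto simp: complex_subfield_def)

lemma K_diff [intro]: "x \<in> K \<Longrightarrow> y \<in> K \<Longrightarrow> x - y \<in> K"
  using K_add[of x "- y"] by auto

lemma K_divide [intro]: "x \<in> K \<Longrightarrow> y \<in> K \<Longrightarrow> x / y \<in> K"
  by (auto simp: divide_inverse)

lemma K_of_nat [simp, intro]: "of_nat n \<in> K"
  by (induction n) auto

lemma K_numeral [simp, intro]: "numeral n \<in> K"
  using K_of_nat[of "numeral n"] by simp

lemma K_sum: "(\<And>i. i \<in> I \<Longrightarrow> f i \<in> K) \<Longrightarrow> sum f I \<in> K"
  by (induction I rule: infinite_finite_induct) auto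

lemma infinite_K: "infinite K"
proof -
  have "range (of_nat :: nat \<Rightarrow> complex) \<subseteq> K" by auto
  moreover have "infinite (range (of_nat :: nat \<Rightarrow> complex))"
    by (rule range_inj_infinite) (simp add: inj_on_def)
  ultimately show ?thesis using finite_subset by blast
qed

lemma K_avoid: "finite B \<Longrightarrow> \<exists>t\<in>K. t \<notin> B"
  using infinite_K by (meson finite_subset subsetI)

end

text \<open>Openness is stated pointwise on the cone, by one basic open set around each point,
  instead of as generation by basic sets. A proof then only has to exhibit one function
  \<open>g\<close>, whose degree may vary with the point.\<close>

definition gopen :: "'c set \<Rightarrow> ('c \<Rightarrow> 'a) \<Rightarrow> (nat \<Rightarrow> ('c \<Rightarrow> complex) set) \<Rightarrow> 'a set \<Rightarrow> bool" where
  "gopen C q A W \<longleftrightarrow> W \<subseteq> q ` C \<and>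
     (\<forall>c\<in>C. q c \<in> W \<longrightarrow> (\<exists>d. \<exists>g\<in>A d. g c \<noteq> 0 \<and> (\<forall>x\<in>C. g x \<noteq> 0 \<longrightarrow> q x \<in> W)))"

text \<open>
  All spaces below are of the form Proj: C is a cone over the set of points with projection q,
  and A d consists of the functions of degree d on C.
\<close>

definition gspace :: "'c set \<Rightarrow> ('c \<Rightarrow> 'a) \<Rightarrow> (nat \<Rightarrow> ('c \<Rightarrow> complex) set) \<Rightarrow> 'a fspace" where
  "gspace C q A = \<lparr>fs_top = topology (gopen C q A),
     fs_reg = (\<lambda>W \<phi>. gopen C q A W \<and>
       (\<forall>c\<in>C. q c \<in> W \<longrightarrow> (\<exists>d. \<exists>f\<in>A d. \<exists>g\<in>A d. g c \<noteq> 0 \<and>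
          (\<forall>x\<in>C. q x \<in> W \<longrightarrow> g x \<noteq> 0 \<longrightarrow> \<phi> (q x) = f x / g x))))\<rparr>"

text \<open>The equation says that all ratios of functions of equal degree agree at the two points.
  The functions f(c) g(x) - f(x) g(c) on pairs are defined over \<open>K\<close> and cut out the
  diagonal, even where a single complex point is not cut out over \<open>K\<close>.\<close>

definition gseparating :: "'c set \<Rightarrow> ('c \<Rightarrow> 'a) \<Rightarrow> (nat \<Rightarrow> ('c \<Rightarrow> complex) set) \<Rightarrow> bool" where
  "gseparating C q A \<longleftrightarrow>
     (\<forall>c\<in>C. \<forall>x\<in>C. (\<forall>d. \<forall>f\<in>A d. \<forall>g\<in>A d. f c * g x = f x * g c) \<longrightarrow> q c = q x)"

text \<open>These are sections of the powers of a line bundle without base points: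
  \<open>A_nz\<close> provides a section of degree one at every point, and \<open>A_proj\<close>
  says that cone points over the same point differ by a scalar acting on degree d through its d-th
  power.\<close>

locale graded = subfield +
  fixes C :: "'c set" and q :: "'c \<Rightarrow> 'a" and A :: "nat \<Rightarrow> ('c \<Rightarrow> complex) set"
  assumes A_const: "k \<in> K \<Longrightarrow> (\<lambda>_. k) \<in> A 0"
    and A_add: "f \<in> A d \<Longrightarrow> g \<in> A d \<Longrightarrow> (\<lambda>x. f x + g x) \<in> A d"
    and A_mult: "f \<in> A d \<Longrightarrow> g \<in> A e \<Longrightarrow> (\<lambda>x. f x * g x) \<in> A (d + e)"
    and A_nz: "c \<in> C \<Longrightarrow> \<exists>g\<in>A 1. g c \<noteq> 0"
    and A_proj: "c \<in> C \<Longrightarrow> c' \<in> C \<Longrightarrow> q c = q c' \<Longrightarrow>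
      \<exists>l. l \<noteq> 0 \<and> (\<forall>d. \<forall>f\<in>A d. f c' = l ^ d * f c)"
begin

lemma A_smult: "k \<in> K \<Longrightarrow> f \<in> A d \<Longrightarrow> (\<lambda>x. k * f x) \<in> A d"
  using A_mult[OF A_const, of k f d] by simp

lemma A_power: "f \<in> A d \<Longrightarrow> (\<lambda>x. f x ^ n) \<in> A (n * d)"
proof (induction n)
  case (Suc n)
  then show ?case using A_mult[of f d "\<lambda>x. f x ^ n" "n * d"] by simp
qed (simp add: A_const)

lemma A_diff: "f \<in> A d \<Longrightarrow> g \<in> A d \<Longrightarrow> (\<lambda>x. f x - g x) \<in> A d"
  using A_add[of f d "\<lambda>x. -1 * g x"] A_smult[of "-1" g d] by auto

lemma A_nz_deg: "c \<in> C \<Longrightarrow> \<exists>g\<in>A d. g c \<noteq> 0"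
  using A_nz[of c] A_power[of _ 1 d] by (metis mult.right_neutral power_not_zero)

lemma zero_iff: "c \<in> C \<Longrightarrow> x \<in> C \<Longrightarrow> q c = q x \<Longrightarrow> f \<in> A d \<Longrightarrow> f c = 0 \<longleftrightarrow> f x = 0"
  using A_proj[of c x] by (metis mult_eq_0_iff power_not_zero)

lemma ratio_eq:
  assumes "c \<in> C" "x \<in> C" "q c = q x" "f \<in> A d" "g \<in> A d"
  shows "f c / g c = f x / g x"
proof -
  obtain l where "l \<noteq> 0" "f x = l ^ d * f c" "g x = l ^ d * g c"
    using A_proj[OF assms(1-3)] assms(4,5) by blast
  then show ?thesis by simp
qed

lemma cross_eq:
  assumes "c \<in> C" "x \<in> C" "q c = q x" "f \<in> A d" "g \<in> A d"
  shows "f c * g x = f x * g c"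
proof -
  obtain l where "l \<noteq> 0" "f x = l ^ d * f c" "g x = l ^ d * g c"
    using A_proj[OF assms(1-3)] assms(4,5) by blast
  then show ?thesis by simp
qed

lemma mem_D:
  assumes "x \<in> C" "g \<in> A d"
  shows "q x \<in> q ` {x \<in> C. g x \<noteq> 0} \<longleftrightarrow> g x \<noteq> 0"
proof
  assume "q x \<in> q ` {x \<in> C. g x \<noteq> 0}"
  then obtain y where "y \<in> C" "g y \<noteq> 0" "q x = q y" by blast
  then show "g x \<noteq> 0" using zero_iff[of x y, OF assms(1) _ _ assms(2)] by blast
qed (use assms in blast)

lemma gopen_D: "g \<in> A d \<Longrightarrow> gopen C q A (q ` {x \<in> C. g x \<noteq> 0})"
  unfolding gopen_def
proof (intro conjI ballI impI)
  assume g: "g \<in> A d"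
  fix c assume c: "c \<in> C" "q c \<in> q ` {x \<in> C. g x \<noteq> 0}"
  then have "g c \<noteq> 0" using mem_D[OF c(1) g] by blast
  then show "\<exists>d. \<exists>h\<in>A d. h c \<noteq> 0 \<and> (\<forall>x\<in>C. h x \<noteq> 0 \<longrightarrow> q x \<in> q ` {x \<in> C. g x \<noteq> 0})"
    by (intro exI[of _ d] bexI[of _ g] conjI ballI impI g) auto
qed blast

lemma istopology_gopen: "istopology (gopen C q A)"
  unfolding istopology_def
proof (intro conjI allI impI)
  fix S T assume S: "gopen C q A S" and T: "gopen C q A T"
  show "gopen C q A (S \<inter> T)"
    unfolding gopen_def
  proof (intro conjI ballI impI)
    show "S \<inter> T \<subseteq> q ` C" using S by (auto simp: gopen_def)
    fix c assume c: "c \<in> C" "q c \<in> S \<inter> T"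
    obtain d g where g: "g \<in> A d" "g c \<noteq> 0" "\<forall>x\<in>C. g x \<noteq> 0 \<longrightarrow> q x \<in> S"
      using S c unfolding gopen_def by blast
    obtain e h where h: "h \<in> A e" "h c \<noteq> 0" "\<forall>x\<in>C. h x \<noteq> 0 \<longrightarrow> q x \<in> T"
      using T c unfolding gopen_def by blast
    show "\<exists>d. \<exists>g\<in>A d. g c \<noteq> 0 \<and> (\<forall>x\<in>C. g x \<noteq> 0 \<longrightarrow> q x \<in> S \<inter> T)"
    proof (rule exI[of _ "d + e"], rule bexI[of _ "\<lambda>x. g x * h x"])
      show "(\<lambda>x. g x * h x) \<in> A (d + e)" by (intro A_mult g h)
    qed (use g h in auto)
  qed
next
  fix F assume F: "\<forall>S\<in>F. gopen C q A S"
  show "gopen C q A (\<Union> F)"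
    unfolding gopen_def
  proof (intro conjI ballI impI)
    show "\<Union> F \<subseteq> q ` C" using F by (auto simp: gopen_def)
    fix c assume c: "c \<in> C" "q c \<in> \<Union> F"
    then obtain S where S: "S \<in> F" "q c \<in> S" by blast
    then obtain d g where "g \<in> A d" "g c \<noteq> 0" "\<forall>x\<in>C. g x \<noteq> 0 \<longrightarrow> q x \<in> S"
      using F c unfolding gopen_def by blast
    with S show "\<exists>d. \<exists>g\<in>A d. g c \<noteq> 0 \<and> (\<forall>x\<in>C. g x \<noteq> 0 \<longrightarrow> q x \<in> \<Union> F)" by blast
  qed
qed

lemma openin_gspace [simp]: "openin (fs_top (gspace C q A)) W \<longleftrightarrow> gopen C q A W"
  by (simp add: gspace_def istopology_gopen topology_inverse')

lemma gopen_all: "gopen C q A (q ` C)"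
  unfolding gopen_def using A_nz by blast

lemma points_gspace [simp]: "points (gspace C q A) = q ` C"
proof -
  have "q ` C \<subseteq> points (gspace C q A)"
    by (rule openin_subset) (simp add: gopen_all)
  moreover have "points (gspace C q A) \<subseteq> q ` C"
    using openin_topspace[of "fs_top (gspace C q A)"] unfolding openin_gspace gopen_def by blast
  ultimately show ?thesis by blast
qed

lemma reg_gspace: "fs_reg (gspace C q A) W \<phi> \<longleftrightarrow> gopen C q A W \<and>
   (\<forall>c\<in>C. q c \<in> W \<longrightarrow> (\<exists>d. \<exists>f\<in>A d. \<exists>g\<in>A d. g c \<noteq> 0 \<and>
     (\<forall>x\<in>C. q x \<in> W \<longrightarrow> g x \<noteq> 0 \<longrightarrow> \<phi> (q x) = f x / g x)))"
  by (simp add: gspace_def)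

lemma gopenE:
  assumes "gopen C q A W" "c \<in> C" "q c \<in> W"
  obtains d g where "g \<in> A d" "g c \<noteq> 0" "\<forall>x\<in>C. g x \<noteq> 0 \<longrightarrow> q x \<in> W"
  using assms unfolding gopen_def by blast

lemma regE:
  assumes "fs_reg (gspace C q A) W \<phi>" "c \<in> C" "q c \<in> W"
  obtains d f g where "f \<in> A d" "g \<in> A d" "g c \<noteq> 0"
    "\<forall>x\<in>C. q x \<in> W \<longrightarrow> g x \<noteq> 0 \<longrightarrow> \<phi> (q x) = f x / g x"
proof -
  have "\<exists>d. \<exists>f\<in>A d. \<exists>g\<in>A d. g c \<noteq> 0 \<and>
     (\<forall>x\<in>C. q x \<in> W \<longrightarrow> g x \<noteq> 0 \<longrightarrow> \<phi> (q x) = f x / g x)"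
    using assms by (simp add: reg_gspace)
  then show thesis by (elim exE bexE conjE) (rule that)
qed

lemma regI:
  assumes "gopen C q A W"
    and "\<And>c. c \<in> C \<Longrightarrow> q c \<in> W \<Longrightarrow> \<exists>d f g. f \<in> A d \<and> g \<in> A d \<and> g c \<noteq> 0 \<and>
     (\<forall>x\<in>C. q x \<in> W \<longrightarrow> g x \<noteq> 0 \<longrightarrow> \<phi> (q x) = f x / g x)"
  shows "fs_reg (gspace C q A) W \<phi>"
  unfolding reg_gspace
proof (intro conjI ballI impI assms(1))
  fix c assume "c \<in> C" "q c \<in> W"
  from assms(2)[OF this]
  show "\<exists>d. \<exists>f\<in>A d. \<exists>g\<in>A d. g c \<noteq> 0 \<and>
     (\<forall>x\<in>C. q x \<in> W \<longrightarrow> g x \<noteq> 0 \<longrightarrow> \<phi> (q x) = f x / g x)"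
    by (elim exE conjE) (rule exI, rule bexI, rule bexI, rule conjI)
qed

lemma gopen_Int: "gopen C q A S \<Longrightarrow> gopen C q A T \<Longrightarrow> gopen C q A (S \<inter> T)"
  using istopology_gopen by (auto simp: istopology_def)

lemma function_space_gspace: "function_space (gspace C q A)"
  unfolding function_space_def
proof (intro conjI allI impI)
  fix U \<phi> assume "fs_reg (gspace C q A) U \<phi>"
  then show "openin (fs_top (gspace C q A)) U" by (simp add: reg_gspace)
next
  fix U and \<phi> \<psi> :: "'a \<Rightarrow> complex"
  assume *: "fs_reg (gspace C q A) U \<phi>" "\<forall>x\<in>U. \<phi> x = \<psi> x"
  have "(\<forall>x\<in>C. q x \<in> U \<longrightarrow> g x \<noteq> 0 \<longrightarrow> \<phi> (q x) = f x / g x) \<longleftrightarrow>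
        (\<forall>x\<in>C. q x \<in> U \<longrightarrow> g x \<noteq> 0 \<longrightarrow> \<psi> (q x) = f x / g x)" for f g
    using *(2) by metis
  with *(1) show "fs_reg (gspace C q A) U \<psi>" by (simp add: reg_gspace)
next
  fix U V \<phi>
  assume U: "fs_reg (gspace C q A) U \<phi>" and V: "openin (fs_top (gspace C q A)) V" "V \<subseteq> U"
  show "fs_reg (gspace C q A) V \<phi>"
  proof (rule regI)
    show "gopen C q A V" using V by simp
    fix c assume c: "c \<in> C" "q c \<in> V"
    then have "q c \<in> U" using V by blast
    with U c(1) obtain d f g where fg: "f \<in> A d" "g \<in> A d" "g c \<noteq> 0"
      "\<forall>x\<in>C. q x \<in> U \<longrightarrow> g x \<noteq> 0 \<longrightarrow> \<phi> (q x) = f x / g x" by (rule regE)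
    then show "\<exists>d f g. f \<in> A d \<and> g \<in> A d \<and> g c \<noteq> 0 \<and>
      (\<forall>x\<in>C. q x \<in> V \<longrightarrow> g x \<noteq> 0 \<longrightarrow> \<phi> (q x) = f x / g x)"
      by (rule_tac exI[of _ d], rule_tac exI[of _ f], rule_tac exI[of _ g]) (use V in auto)
  qed
next
  fix U \<phi>
  assume U: "openin (fs_top (gspace C q A)) U"
    and loc: "\<forall>x\<in>U. \<exists>V. x \<in> V \<and> V \<subseteq> U \<and> fs_reg (gspace C q A) V \<phi>"
  show "fs_reg (gspace C q A) U \<phi>"
    unfolding reg_gspace
  proof (intro conjI ballI impI)
    show "gopen C q A U" using U by simp
    fix c assume c: "c \<in> C" "q c \<in> U"
    then obtain V where V: "q c \<in> V" "V \<subseteq> U" "fs_reg (gspace C q A) V \<phi>" using loc by blast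
    obtain d f g where fg: "f \<in> A d" "g \<in> A d" "g c \<noteq> 0"
      "\<forall>x\<in>C. q x \<in> V \<longrightarrow> g x \<noteq> 0 \<longrightarrow> \<phi> (q x) = f x / g x"
      using V(3) c(1) V(1) by (rule regE)
    have "gopen C q A V" using V(3) by (simp add: reg_gspace)
    then obtain e h where h: "h \<in> A e" "h c \<noteq> 0" "\<forall>x\<in>C. h x \<noteq> 0 \<longrightarrow> q x \<in> V"
      using c(1) V(1) by (rule gopenE)
    show "\<exists>d. \<exists>f\<in>A d. \<exists>g\<in>A d. g c \<noteq> 0 \<and>
          (\<forall>x\<in>C. q x \<in> U \<longrightarrow> g x \<noteq> 0 \<longrightarrow> \<phi> (q x) = f x / g x)"
    proof (rule exI[of _ "d + e"], rule bexI[of _ "\<lambda>x. f x * h x"], rule bexI[of _ "\<lambda>x. g x * h x"])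
      show "g c * h c \<noteq> 0 \<and> (\<forall>x\<in>C. q x \<in> U \<longrightarrow> g x * h x \<noteq> 0 \<longrightarrow>
          \<phi> (q x) = f x * h x / (g x * h x))"
        using fg h by simp
    qed (intro A_mult fg h)+
  qed
qed

lemma closedin_gspace: "closedin (fs_top (gspace C q A)) Z \<longleftrightarrow> Z \<subseteq> q ` C \<and>
   (\<forall>c\<in>C. q c \<notin> Z \<longrightarrow> (\<exists>d. \<exists>g\<in>A d. g c \<noteq> 0 \<and> (\<forall>x\<in>C. q x \<in> Z \<longrightarrow> g x = 0)))"
  unfolding closedin_def points_gspace openin_gspace gopen_def by blast

lemma closedin_zero_set:
  assumes "f \<in> A d" shows "closedin (fs_top (gspace C q A)) (q ` {x \<in> C. f x = 0})"
  unfolding closedin_gspace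
proof (intro conjI ballI impI)
  fix c assume "c \<in> C" "q c \<notin> q ` {x \<in> C. f x = 0}"
  moreover have "\<forall>x\<in>C. q x \<in> q ` {x \<in> C. f x = 0} \<longrightarrow> f x = 0"
    using zero_iff[OF _ _ _ assms] by blast
  ultimately show "\<exists>d. \<exists>g\<in>A d. g c \<noteq> 0 \<and> (\<forall>x\<in>C. q x \<in> q ` {x \<in> C. f x = 0} \<longrightarrow> g x = 0)"
    using assms by blast
qed blast

text \<open>Homogeneous avoidance for finitely many points. If \<open>g\<close> works for
  \<open>F\<close> and \<open>h\<close> for the new point, a combination g^e + t h^d of equal degree
  vanishes where both do, so it still stays inside \<open>W\<close>. The degrees are kept positive
  so that no power degenerates to 1.\<close>

lemma gopen_avoid:
  assumes W: "gopen C q A W" and F: "finite F" "F \<subseteq> C" "q ` F \<subseteq> W" and "F \<noteq> {}"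
  shows "\<exists>d\<ge>1. \<exists>g\<in>A d. (\<forall>c\<in>F. g c \<noteq> 0) \<and> (\<forall>x\<in>C. g x \<noteq> 0 \<longrightarrow> q x \<in> W)"
  using F(1) \<open>F \<noteq> {}\<close> F(2-)
proof (induction F rule: finite_ne_induct)
  case (singleton c)
  then have c: "c \<in> C" "q c \<in> W" by auto
  obtain e g where g: "g \<in> A e" "g c \<noteq> 0" "\<forall>x\<in>C. g x \<noteq> 0 \<longrightarrow> q x \<in> W"
    using W c unfolding gopen_def by blast
  obtain l where l: "l \<in> A 1" "l c \<noteq> 0" using A_nz c by blast
  show ?case
  proof (rule exI[of _ "e + 1"], intro conjI bexI[of _ "\<lambda>x. g x * l x"])
    show "(\<lambda>x. g x * l x) \<in> A (e + 1)" by (intro A_mult g l)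
  qed (use g l in auto)
next
  case (insert c F)
  then obtain d g where g: "d \<ge> 1" "g \<in> A d" "\<forall>c\<in>F. g c \<noteq> 0" "\<forall>x\<in>C. g x \<noteq> 0 \<longrightarrow> q x \<in> W"
    by auto
  have c: "c \<in> C" "q c \<in> W" using insert by auto
  obtain e0 h0 where h0: "h0 \<in> A e0" "h0 c \<noteq> 0" "\<forall>x\<in>C. h0 x \<noteq> 0 \<longrightarrow> q x \<in> W"
    using W c unfolding gopen_def by blast
  obtain l where l: "l \<in> A 1" "l c \<noteq> 0" using A_nz c by blast
  define e h where "e = e0 + 1" and "h = (\<lambda>x. h0 x * l x)"
  have h: "h \<in> A e" "h c \<noteq> 0" "\<forall>x\<in>C. h x \<noteq> 0 \<longrightarrow> q x \<in> W"
    using A_mult[OF h0(1) l(1)] h0 l by (auto simp: e_def h_def)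
  have e: "e \<ge> 1" by (simp add: e_def)
  \<comment> \<open>Each point at which \<open>h\<close> does not vanish forbids a single value of
    \<open>t\<close>, and \<open>K\<close> is infinite.\<close>
  obtain t where t: "t \<in> K" "t \<notin> insert (- (g c ^ e / h c ^ d)) ((\<lambda>x. - (g x ^ e / h x ^ d)) ` F)"
    using K_avoid[of "insert (- (g c ^ e / h c ^ d)) ((\<lambda>x. - (g x ^ e / h x ^ d)) ` F)"] insert.hyps
    by auto
  define k where "k = (\<lambda>x. g x ^ e + t * h x ^ d)"
  have k1: "k \<in> A (e * d)"
    unfolding k_def
    by (rule A_add[OF A_power[OF g(2)] A_smult[OF t(1)]])
       (use A_power[OF h(1), of d] in \<open>simp add: mult.commute\<close>)
  have k2: "k x \<noteq> 0" if x: "x \<in> insert c F" for x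
  proof (cases "h x = 0")
    case True
    then have "x \<in> F" using x h by auto
    then show ?thesis using True g(1,3) by (auto simp: k_def power_0_left)
  next
    case False
    have "t \<noteq> - (g x ^ e / h x ^ d)" using t(2) x by auto
    then show ?thesis using False by (simp add: k_def field_simps eq_neg_iff_add_eq_0)
  qed
  have k3: "q x \<in> W" if "x \<in> C" "k x \<noteq> 0" for x
  proof (cases "g x = 0")
    case True
    then have "h x \<noteq> 0" using that(2) e g(1) by (auto simp: k_def power_0_left)
    then show ?thesis using h(3) that(1) by blast
  next
    case False
    then show ?thesis using g(4) that(1) by blast
  qed
  have k4: "e * d \<ge> 1" using e g(1) by simp
  show ?case
  proof (rule exI[of _ "e * d"], rule conjI[OF k4], rule bexI[OF _ k1])
    show "(\<forall>c\<in>insert c F. k c \<noteq> 0) \<and> (\<forall>x\<in>C. k x \<noteq> 0 \<longrightarrow> q x \<in> W)"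
      using k2 k3 by simp
  qed
qed

end

context graded
begin

text \<open>The spaces of the statement carry topologies generated by a subbase; the hypothesis
  \<open>cover\<close> says that the family is already a base, which makes the two descriptions of
  open sets agree.\<close>

lemma topology_generated_eq:
  assumes basis: "\<And>S. S \<in> B \<Longrightarrow> gopen C q A S"
    and cover: "\<And>W c. gopen C q A W \<Longrightarrow> c \<in> C \<Longrightarrow> q c \<in> W \<Longrightarrow> \<exists>S\<in>B. q c \<in> S \<and> S \<subseteq> W"
  shows "topology_generated_by B = fs_top (gspace C q A)"
  unfolding topology_eq openin_gspace
proof (intro allI iffI)
  fix S assume "openin (topology_generated_by B) S"
  then have "generate_topology_on B S" by (simp add: openin_topology_generated_by_iff)
  then show "gopen C q A S"
  proof induction
    case Empty
    show ?case by (simp add: gopen_def)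
  next
    case (Int a b)
    then show ?case by (blast intro: gopen_Int)
  next
    case (UN F)
    then show ?case using istopology_gopen unfolding istopology_def by blast
  next
    case (Basis s)
    then show ?case by (rule basis)
  qed
next
  fix W assume W: "gopen C q A W"
  have "W = \<Union> {S\<in>B. S \<subseteq> W}"
  proof (intro equalityI subsetI)
    fix p assume p: "p \<in> W"
    then obtain c where "c \<in> C" "p = q c" using W unfolding gopen_def by blast
    with cover[OF W, of c] p show "p \<in> \<Union> {S\<in>B. S \<subseteq> W}" by blast
  qed blast
  moreover have "openin (topology_generated_by B) (\<Union> {S\<in>B. S \<subseteq> W})"
    by (rule openin_Union) (auto intro: topology_generated_by_Basis)
  ultimately show "openin (topology_generated_by B) W" by simp
qed

lemma fspace_eqI:
  assumes "fs_top X = fs_top (gspace C q A)"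
    and "\<And>W \<phi>. gopen C q A W \<Longrightarrow> fs_reg X W \<phi> \<Longrightarrow> fs_reg (gspace C q A) W \<phi>"
    and "\<And>W \<phi>. fs_reg X W \<phi> \<Longrightarrow> gopen C q A W"
    and "\<And>W \<phi>. fs_reg (gspace C q A) W \<phi> \<Longrightarrow> fs_reg X W \<phi>"
  shows "X = gspace C q A"
proof -
  have "fs_reg X W \<phi> = fs_reg (gspace C q A) W \<phi>" for W \<phi>
    using assms(2-4) by blast
  then have "fs_reg X = fs_reg (gspace C q A)" by (intro ext)
  with assms(1) show ?thesis by (intro fspace.equality) auto
qed

text \<open>A quotient of two functions of equal degree does not depend on the chosen cone point, so
  it can be evaluated at an arbitrary representative.\<close>

lemma reg_ratio:
  assumes f: "f \<in> A d" and l: "l \<in> A d"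
  shows "\<exists>\<phi>. fs_reg (gspace C q A) (q ` {x \<in> C. l x \<noteq> 0}) \<phi> \<and> (\<forall>x\<in>C. l x \<noteq> 0 \<longrightarrow> \<phi> (q x) = f x / l x)"
proof -
  define r where "r = (\<lambda>p. SOME x. x \<in> C \<and> q x = p)"
  have r: "r (q x) \<in> C \<and> q (r (q x)) = q x" if "x \<in> C" for x
    unfolding r_def by (rule someI[of _ x]) (use that in auto)
  define \<phi> where "\<phi> = (\<lambda>p. f (r p) / l (r p))"
  have \<phi>: "\<phi> (q x) = f x / l x" if "x \<in> C" for x
    unfolding \<phi>_def using ratio_eq[OF _ that _ f l] r[OF that] by blast
  have "fs_reg (gspace C q A) (q ` {x \<in> C. l x \<noteq> 0}) \<phi>"
  proof (rule regI[OF gopen_D[OF l]])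
    fix c assume c: "c \<in> C" "q c \<in> q ` {x \<in> C. l x \<noteq> 0}"
    then have "l c \<noteq> 0" using mem_D[OF c(1) l] by blast
    then show "\<exists>d f g. f \<in> A d \<and> g \<in> A d \<and> g c \<noteq> 0 \<and>
      (\<forall>x\<in>C. q x \<in> q ` {x \<in> C. l x \<noteq> 0} \<longrightarrow> g x \<noteq> 0 \<longrightarrow> \<phi> (q x) = f x / g x)"
      by (rule_tac exI[of _ d], rule_tac exI[of _ f], rule_tac exI[of _ l]) (use f l \<phi> in simp)
  qed
  with \<phi> show ?thesis by (intro exI[of _ \<phi>]) simp
qed

end

section \<open>Projective and affine varieties as spaces of graded functions\<close>

lemma proj_pt_eq_iff: "proj_pt u = proj_pt v \<longleftrightarrow> (\<exists>l. l \<noteq> 0 \<and> v = (\<lambda>i. l * u i))"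
proof
  assume eq: "proj_pt u = proj_pt v"
  have "v \<in> proj_pt v" unfolding proj_pt_def by (rule CollectI) (auto intro!: exI[of _ 1])
  with eq have "v \<in> proj_pt u" by simp
  then show "\<exists>l. l \<noteq> 0 \<and> v = (\<lambda>i. l * u i)" unfolding proj_pt_def by blast
next
  assume "\<exists>l. l \<noteq> 0 \<and> v = (\<lambda>i. l * u i)"
  then obtain l where l: "l \<noteq> 0" "v = (\<lambda>i. l * u i)" by blast
  show "proj_pt u = proj_pt v"
  proof (intro equalityI subsetI)
    fix w assume "w \<in> proj_pt u"
    then obtain c where "c \<noteq> 0" "w = (\<lambda>i. c * u i)" unfolding proj_pt_def by blast
    then have "c / l \<noteq> 0 \<and> w = (\<lambda>i. (c / l) * v i)" using l by (auto simp: fun_eq_iff)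
    then show "w \<in> proj_pt v" unfolding proj_pt_def by blast
  next
    fix w assume "w \<in> proj_pt v"
    then obtain c where "c \<noteq> 0" "w = (\<lambda>i. c * v i)" unfolding proj_pt_def by blast
    then have "c * l \<noteq> 0 \<and> w = (\<lambda>i. (c * l) * u i)" using l by (auto simp: fun_eq_iff)
    then show "w \<in> proj_pt u" unfolding proj_pt_def by blast
  qed
qed

lemma proj_pt_self: "v \<in> proj_pt v"
  unfolding proj_pt_def by (rule CollectI) (auto intro!: exI[of _ 1])

lemma proj_pt_scale: "l \<noteq> 0 \<Longrightarrow> proj_pt (\<lambda>i. l * v i) = proj_pt v"
  using proj_pt_eq_iff[of v "\<lambda>i. l * v i"] by blast

lemma form_scale: "form K d f \<Longrightarrow> f (\<lambda>i. c * v i) = c ^ d * f v"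
  by (induction rule: form.induct) (auto simp: algebra_simps power_add)

lemma form_proj_ne: "form K d g \<Longrightarrow> (\<forall>v\<in>proj_pt c. g v \<noteq> 0) \<longleftrightarrow> g c \<noteq> 0"
  using proj_pt_self[of c] by (auto simp: proj_pt_def form_scale)

abbreviation proj_cone :: "(('v \<Rightarrow> complex) \<Rightarrow> complex) set \<Rightarrow> ('v \<Rightarrow> complex) set" where
  "proj_cone R \<equiv> {v. (\<exists>i. v i \<noteq> 0) \<and> (\<forall>r\<in>R. r v = 0)}"

abbreviation forms :: "complex set \<Rightarrow> nat \<Rightarrow> (('v \<Rightarrow> complex) \<Rightarrow> complex) set" where
  "forms K d \<equiv> {f. form K d f}"

lemma (in subfield) graded_proj: "graded K (proj_cone R) proj_pt (forms K)"
proof unfold_locales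
  fix c assume "c \<in> proj_cone R"
  then obtain i where "c i \<noteq> 0" by blast
  then show "\<exists>g\<in>forms K 1. g c \<noteq> 0" using form.var[of K i] by (intro bexI[of _ "\<lambda>v. v i"]) simp_all
next
  fix c c' :: "'v \<Rightarrow> complex" assume "proj_pt c = proj_pt c'"
  then obtain l where "l \<noteq> 0" "c' = (\<lambda>i. l * c i)" by (auto simp: proj_pt_eq_iff)
  then show "\<exists>l. l \<noteq> 0 \<and> (\<forall>d. \<forall>f\<in>forms K d. f c' = l ^ d * f c)"
    by (intro exI[of _ l]) (auto simp: form_scale)
qed (auto intro: form.intros)

text \<open>The original definition quantifies over all coordinate vectors of a point, the graded
  one over one cone point; homogeneity of the forms makes these conditions equivalent.\<close>

lemma (in subfield) proj_var_gspace: "proj_var K R = gspace (proj_cone R) proj_pt (forms K)"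
proof -
  interpret graded K "proj_cone R" proj_pt "forms K" by (rule graded_proj)
  let ?P = "{proj_pt v |v. (\<exists>i. v i \<noteq> 0) \<and> (\<forall>r\<in>R. r v = 0)}"
  let ?B = "{{p \<in> ?P. \<forall>v\<in>p. g v \<noteq> 0} |g. \<exists>d. form K d g}"
  have P: "?P = proj_pt ` proj_cone R" by blast
  have D: "{p \<in> ?P. \<forall>v\<in>p. g v \<noteq> 0} = proj_pt ` {v \<in> proj_cone R. g v \<noteq> 0}" if "form K d g" for d g
    unfolding P
  proof (intro equalityI subsetI)
    fix p assume "p \<in> {p \<in> proj_pt ` proj_cone R. \<forall>v\<in>p. g v \<noteq> 0}"
    then obtain c where c: "c \<in> proj_cone R" "p = proj_pt c" "\<forall>v\<in>proj_pt c. g v \<noteq> 0" by blast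
    have "g c \<noteq> 0" using c(3) proj_pt_self by blast
    with c(1) have "c \<in> {v \<in> proj_cone R. g v \<noteq> 0}" by simp
    then show "p \<in> proj_pt ` {v \<in> proj_cone R. g v \<noteq> 0}"
      unfolding c(2) by (rule imageI)
  next
    fix p assume "p \<in> proj_pt ` {v \<in> proj_cone R. g v \<noteq> 0}"
    then obtain c where "p = proj_pt c" "c \<in> {v \<in> proj_cone R. g v \<noteq> 0}" by (rule imageE)
    then have c: "c \<in> proj_cone R" "p = proj_pt c" "g c \<noteq> 0" by blast+
    have "\<forall>v\<in>proj_pt c. g v \<noteq> 0" using form_proj_ne[OF that, of c] c(3) by blast
    moreover have "p \<in> proj_pt ` proj_cone R" unfolding c(2) by (rule imageI[OF c(1)])
    ultimately show "p \<in> {p \<in> proj_pt ` proj_cone R. \<forall>v\<in>p. g v \<noteq> 0}"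
      unfolding c(2) by (rule_tac CollectI, rule_tac conjI)
  qed
  have T: "topology_generated_by ?B = fs_top (gspace (proj_cone R) proj_pt (forms K))"
  proof (rule topology_generated_eq)
    fix S assume "S \<in> ?B"
    then obtain g d where "form K d g" "S = {p \<in> ?P. \<forall>v\<in>p. g v \<noteq> 0}" by blast
    then show "gopen (proj_cone R) proj_pt (forms K) S" using gopen_D[of g d] D[of d g] by simp
  next
    fix W c assume *: "gopen (proj_cone R) proj_pt (forms K) W" "c \<in> proj_cone R" "proj_pt c \<in> W"
    then obtain d g where g: "g \<in> forms K d" "g c \<noteq> 0" "\<forall>x\<in>proj_cone R. g x \<noteq> 0 \<longrightarrow> proj_pt x \<in> W"
      by (rule gopenE)
    let ?S = "{p \<in> ?P. \<forall>v\<in>p. g v \<noteq> 0}"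
    have SB: "?S \<in> ?B" using g(1) by blast
    have S: "?S = proj_pt ` {v \<in> proj_cone R. g v \<noteq> 0}" by (rule D[of d g]) (use g(1) in simp)
    have c: "c \<in> {v \<in> proj_cone R. g v \<noteq> 0}" using *(2) g(2) by blast
    have 1: "proj_pt c \<in> ?S" unfolding S by (rule imageI[OF c])
    have 2: "?S \<subseteq> W" unfolding S
    proof
      fix p assume "p \<in> proj_pt ` {v \<in> proj_cone R. g v \<noteq> 0}"
      then obtain x where "p = proj_pt x" "x \<in> {v \<in> proj_cone R. g v \<noteq> 0}" by (rule imageE)
      then show "p \<in> W" using g(3) by simp
    qed
    show "\<exists>S\<in>?B. proj_pt c \<in> S \<and> S \<subseteq> W" by (rule bexI[of _ ?S, OF _ SB]) (intro conjI 1 2)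
  qed
  have reg: "fs_reg (proj_var K R) W \<phi> \<longleftrightarrow> gopen (proj_cone R) proj_pt (forms K) W \<and>
      (\<forall>p\<in>W. \<exists>d f g. form K d f \<and> form K d g \<and> (\<forall>v\<in>p. g v \<noteq> 0) \<and>
              (\<forall>q\<in>W. \<forall>v\<in>q. g v \<noteq> 0 \<longrightarrow> \<phi> q = f v / g v))" for W \<phi>
    unfolding proj_var_def Let_def fspace.simps T openin_gspace by (rule refl)
  show ?thesis
  proof (rule fspace_eqI)
    show "fs_top (proj_var K R) = fs_top (gspace (proj_cone R) proj_pt (forms K))"
      unfolding proj_var_def Let_def fspace.simps by (rule T)
  next
    fix W \<phi> assume *: "fs_reg (proj_var K R) W \<phi>"
    then show "gopen (proj_cone R) proj_pt (forms K) W"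
      unfolding reg by (rule conjunct1)
  next
    fix W \<phi> assume W: "gopen (proj_cone R) proj_pt (forms K) W" and "fs_reg (proj_var K R) W \<phi>"
    then have *: "\<forall>p\<in>W. \<exists>d f g. form K d f \<and> form K d g \<and> (\<forall>v\<in>p. g v \<noteq> 0) \<and>
              (\<forall>q\<in>W. \<forall>v\<in>q. g v \<noteq> 0 \<longrightarrow> \<phi> q = f v / g v)"
      unfolding reg by (rule_tac conjunct2)
    show "fs_reg (gspace (proj_cone R) proj_pt (forms K)) W \<phi>"
    proof (rule regI[OF W])
      fix c assume "c \<in> proj_cone R" "proj_pt c \<in> W"
      then obtain d f g where fg: "form K d f" "form K d g" "\<forall>v\<in>proj_pt c. g v \<noteq> 0"
        "\<forall>q\<in>W. \<forall>v\<in>q. g v \<noteq> 0 \<longrightarrow> \<phi> q = f v / g v" using bspec[OF * \<open>proj_pt c \<in> W\<close>] by (elim exE conjE) (rule that)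
      then show "\<exists>d f g. f \<in> forms K d \<and> g \<in> forms K d \<and> g c \<noteq> 0 \<and>
         (\<forall>x\<in>proj_cone R. proj_pt x \<in> W \<longrightarrow> g x \<noteq> 0 \<longrightarrow> \<phi> (proj_pt x) = f x / g x)"
        by (rule_tac exI[of _ d], rule_tac exI[of _ f], rule_tac exI[of _ g])
           (use proj_pt_self in auto)
    qed
  next
    fix W \<phi> assume *: "fs_reg (gspace (proj_cone R) proj_pt (forms K)) W \<phi>"
    then have W: "gopen (proj_cone R) proj_pt (forms K) W" by (simp add: reg_gspace)
    have "\<exists>d f g. form K d f \<and> form K d g \<and> (\<forall>v\<in>p. g v \<noteq> 0) \<and>
              (\<forall>q\<in>W. \<forall>v\<in>q. g v \<noteq> 0 \<longrightarrow> \<phi> q = f v / g v)" if p: "p \<in> W" for p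
    proof -
      obtain c where c: "c \<in> proj_cone R" "p = proj_pt c" using W p unfolding gopen_def by blast
      obtain d f g where fg: "f \<in> forms K d" "g \<in> forms K d" "g c \<noteq> 0"
        "\<forall>x\<in>proj_cone R. proj_pt x \<in> W \<longrightarrow> g x \<noteq> 0 \<longrightarrow> \<phi> (proj_pt x) = f x / g x"
        using * c(1) p[unfolded c(2)] by (rule regE)
      have "\<phi> q = f v / g v" if q: "q \<in> W" "v \<in> q" "g v \<noteq> 0" for q v
      proof -
        obtain x where x: "x \<in> proj_cone R" "q = proj_pt x" using W q(1) unfolding gopen_def by blast
        obtain l where l: "l \<noteq> 0" "v = (\<lambda>i. l * x i)" using q x unfolding proj_pt_def by blast
        have fv: "f v = l ^ d * f x" "g v = l ^ d * g x"
          using fg(1,2) l(2) by (auto simp: form_scale)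
        then have "g x \<noteq> 0" using q(3) by auto
        then show ?thesis using fg(4) x q(1) fv l(1) by simp
      qed
      then show ?thesis
        by (rule_tac exI[of _ d], rule_tac exI[of _ f], rule_tac exI[of _ g])
           (use fg c form_proj_ne[of K d g c] in auto)
    qed
    then show "fs_reg (proj_var K R) W \<phi>" using W unfolding reg by blast
  qed
qed

abbreviation affine_pts :: "nat \<Rightarrow> ((nat \<Rightarrow> complex) \<Rightarrow> complex) set \<Rightarrow> (nat \<Rightarrow> complex) set" where
  "affine_pts n R \<equiv> {v \<in> {..<n} \<rightarrow>\<^sub>E UNIV. \<forall>r\<in>R. r v = 0}"

text \<open>An affine variety is its own cone, with the same ring in every degree; the scalar in
  \<open>A_proj\<close> is then 1.\<close>

lemma (in subfield) graded_affine: "graded K (affine_pts n R) (\<lambda>x. x) (\<lambda>_. polys K {..<n})"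
proof unfold_locales
  show "\<exists>g\<in>polys K {..<n}. g c \<noteq> 0" for c
    by (rule bexI[of _ "\<lambda>_. 1"]) (auto intro: polys.const)
  show "\<exists>l. l \<noteq> 0 \<and> (\<forall>d. \<forall>f\<in>polys K {..<n}. f c' = l ^ d * f c)" if "c = c'" for c c' :: "nat \<Rightarrow> complex"
    using that by (intro exI[of _ 1]) simp
qed (auto intro: polys.intros)

lemma (in subfield) affine_var_gspace:
  "affine_var K n R = gspace (affine_pts n R) (\<lambda>x. x) (\<lambda>_. polys K {..<n})"
proof -
  let ?P = "affine_pts n R" and ?A = "\<lambda>_::nat. polys K {..<n}"
  interpret graded K ?P "\<lambda>x. x" ?A by (rule graded_affine)
  let ?B = "{{v \<in> ?P. g v \<noteq> 0} | g. g \<in> polys K {..<n}}"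
  have T: "topology_generated_by ?B = fs_top (gspace ?P (\<lambda>x. x) ?A)"
  proof (rule topology_generated_eq)
    fix S assume "S \<in> ?B"
    then obtain g where "g \<in> polys K {..<n}" "S = {v \<in> ?P. g v \<noteq> 0}" by blast
    then show "gopen ?P (\<lambda>x. x) ?A S" using gopen_D[of g] by simp
  next
    fix W c assume *: "gopen ?P (\<lambda>x. x) ?A W" "c \<in> ?P" "c \<in> W"
    then obtain d :: nat and g where g: "g \<in> polys K {..<n}" "g c \<noteq> 0" "\<forall>x\<in>?P. g x \<noteq> 0 \<longrightarrow> x \<in> W"
      by (rule gopenE)
    then show "\<exists>S\<in>?B. c \<in> S \<and> S \<subseteq> W" using *(2) by (intro bexI[of _ "{v \<in> ?P. g v \<noteq> 0}"]) auto
  qed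
  have reg: "fs_reg (affine_var K n R) W \<phi> \<longleftrightarrow> gopen ?P (\<lambda>x. x) ?A W \<and>
      (\<forall>p\<in>W. \<exists>f\<in>polys K {..<n}. \<exists>g\<in>polys K {..<n}.
              g p \<noteq> 0 \<and> (\<forall>q\<in>W. g q \<noteq> 0 \<longrightarrow> \<phi> q = f q / g q))" for W \<phi>
    unfolding affine_var_def Let_def fspace.simps T openin_gspace by (rule refl)
  show ?thesis
  proof (rule fspace_eqI)
    show "fs_top (affine_var K n R) = fs_top (gspace ?P (\<lambda>x. x) ?A)"
      unfolding affine_var_def Let_def fspace.simps by (rule T)
  next
    fix W \<phi> assume *: "fs_reg (affine_var K n R) W \<phi>"
    then show "gopen ?P (\<lambda>x. x) ?A W"
      unfolding reg by (rule conjunct1)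
  next
    fix W \<phi> assume W: "gopen ?P (\<lambda>x. x) ?A W" and "fs_reg (affine_var K n R) W \<phi>"
    then have *: "\<forall>p\<in>W. \<exists>f\<in>polys K {..<n}. \<exists>g\<in>polys K {..<n}.
              g p \<noteq> 0 \<and> (\<forall>q\<in>W. g q \<noteq> 0 \<longrightarrow> \<phi> q = f q / g q)"
      unfolding reg by (rule_tac conjunct2)
    show "fs_reg (gspace ?P (\<lambda>x. x) ?A) W \<phi>"
    proof (rule regI[OF W])
      fix c assume "c \<in> ?P" "c \<in> W"
      then obtain f g where fg: "f \<in> polys K {..<n}" "g \<in> polys K {..<n}" "g c \<noteq> 0"
        "\<forall>q\<in>W. g q \<noteq> 0 \<longrightarrow> \<phi> q = f q / g q" using bspec[OF * \<open>c \<in> W\<close>] by (elim bexE conjE) (rule that)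
      then show "\<exists>d f g. f \<in> ?A d \<and> g \<in> ?A d \<and> g c \<noteq> 0 \<and>
         (\<forall>x\<in>?P. x \<in> W \<longrightarrow> g x \<noteq> 0 \<longrightarrow> \<phi> x = f x / g x)"
        by (rule_tac exI[of _ 0], rule_tac exI[of _ f], rule_tac exI[of _ g]) auto
    qed
  next
    fix W \<phi> assume *: "fs_reg (gspace ?P (\<lambda>x. x) ?A) W \<phi>"
    then have W: "gopen ?P (\<lambda>x. x) ?A W" by (simp add: reg_gspace)
    have "\<exists>f\<in>polys K {..<n}. \<exists>g\<in>polys K {..<n}.
              g p \<noteq> 0 \<and> (\<forall>q\<in>W. g q \<noteq> 0 \<longrightarrow> \<phi> q = f q / g q)" if p: "p \<in> W" for p
    proof -
      have c: "p \<in> ?P" using W p unfolding gopen_def by blast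
      obtain d f g where fg: "f \<in> polys K {..<n}" "g \<in> polys K {..<n}" "g p \<noteq> 0"
        "\<forall>x\<in>?P. x \<in> W \<longrightarrow> g x \<noteq> 0 \<longrightarrow> \<phi> x = f x / g x"
        using * c p by (rule regE)
      show ?thesis
      proof (rule bexI[OF _ fg(1)], rule bexI[OF _ fg(2)], intro conjI ballI impI fg(3))
        fix q assume "q \<in> W" "g q \<noteq> 0"
        moreover from this have "q \<in> ?P" using W unfolding gopen_def by blast
        ultimately show "\<phi> q = f q / g q" using fg(4) by blast
      qed
    qed
    then show "fs_reg (affine_var K n R) W \<phi>" using W unfolding reg by blast
  qed
qed

section \<open>Products and bihomogeneous functions\<close>

text \<open>Applied to functions of degree d on both factors this is bidegree (d, d), the grading of
  the Segre embedding. There are no rules for scalars or zero, since these can be absorbed into a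
  factor.\<close>

inductive_set tens :: "('c \<Rightarrow> complex) set \<Rightarrow> ('e \<Rightarrow> complex) set \<Rightarrow> ('c \<times> 'e \<Rightarrow> complex) set"
  for A :: "('c \<Rightarrow> complex) set" and B :: "('e \<Rightarrow> complex) set" where
  prod: "f \<in> A \<Longrightarrow> g \<in> B \<Longrightarrow> (\<lambda>p. f (fst p) * g (snd p)) \<in> tens A B"
| add: "f \<in> tens A B \<Longrightarrow> g \<in> tens A B \<Longrightarrow> (\<lambda>p. f p + g p) \<in> tens A B"

lemma tens_mult:
  assumes "f \<in> tens A B" "g \<in> tens A' B'"
    and A: "\<And>a a'. a \<in> A \<Longrightarrow> a' \<in> A' \<Longrightarrow> (\<lambda>x. a x * a' x) \<in> A''"
    and B: "\<And>a a'. a \<in> B \<Longrightarrow> a' \<in> B' \<Longrightarrow> (\<lambda>x. a x * a' x) \<in> B''"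
  shows "(\<lambda>p. f p * g p) \<in> tens A'' B''"
  using assms(1)
proof induction
  case (prod f1 f2)
  from assms(2) show ?case
  proof induction
    case (prod g1 g2)
    have eq: "(\<lambda>p. f1 (fst p) * f2 (snd p) * (g1 (fst p) * g2 (snd p))) =
      (\<lambda>p. (\<lambda>x. f1 x * g1 x) (fst p) * (\<lambda>x. f2 x * g2 x) (snd p))"
      by (simp add: algebra_simps)
    show ?case
      unfolding eq by (rule tens.prod[OF A[OF \<open>f1 \<in> A\<close> prod(1)] B[OF \<open>f2 \<in> B\<close> prod(2)]])
  next
    case (add g h)
    then show ?case using tens.add[OF add(3) add(4)] by (simp add: distrib_left)
  qed
next
  case (add f1 f2)
  then show ?case using tens.add[OF add(3) add(4)] by (simp add: distrib_right)
qed

lemma tens_map: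
  assumes "f \<in> tens A B"
    and "\<And>a. a \<in> A \<Longrightarrow> (\<lambda>x. a (\<alpha> x)) \<in> A'" "\<And>b. b \<in> B \<Longrightarrow> (\<lambda>x. b (\<beta> x)) \<in> B'"
  shows "(\<lambda>p. f (map_prod \<alpha> \<beta> p)) \<in> tens A' B'"
  using assms(1)
proof induction
  case (prod f g)
  then show ?case using tens.prod[OF assms(2)[OF prod(1)] assms(3)[OF prod(2)]] by simp
next
  case (add f g)
  then show ?case using tens.add[OF add(3) add(4)] by simp
qed

lemma graded_tens:
  assumes "graded K C q A" "graded K C' q' A'"
  shows "graded K (C \<times> C') (map_prod q q') (\<lambda>d. tens (A d) (A' d))"
proof -
  interpret X: graded K C q A by fact
  interpret Y: graded K C' q' A' by fact
  show ?thesis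
  proof unfold_locales
    show "(\<lambda>_. k) \<in> tens (A 0) (A' 0)" if "k \<in> K" for k
      using tens.prod[OF X.A_const[OF that] Y.A_const[OF X.K_one]] by simp
    show "(\<lambda>x. f x * g x) \<in> tens (A (d + e)) (A' (d + e))"
      if "f \<in> tens (A d) (A' d)" "g \<in> tens (A e) (A' e)" for f g d e
      using that by (rule tens_mult) (auto intro: X.A_mult Y.A_mult)
    show "\<exists>g\<in>tens (A 1) (A' 1). g c \<noteq> 0" if "c \<in> C \<times> C'" for c
    proof -
      have "fst c \<in> C" "snd c \<in> C'" using that by auto
      then obtain g g' where "g \<in> A 1" "g (fst c) \<noteq> 0" "g' \<in> A' 1" "g' (snd c) \<noteq> 0"
        using X.A_nz[of "fst c"] Y.A_nz[of "snd c"] by auto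
      then show ?thesis by (intro bexI[OF _ tens.prod[of g _ g']]) auto
    qed
    fix c c' assume c: "c \<in> C \<times> C'" "c' \<in> C \<times> C'" "map_prod q q' c = map_prod q q' c'"
    have "fst c \<in> C" "fst c' \<in> C" "q (fst c) = q (fst c')" using c by auto
    from X.A_proj[OF this] obtain l where l: "l \<noteq> 0" "\<forall>d. \<forall>f\<in>A d. f (fst c') = l ^ d * f (fst c)"
      by (elim exE conjE) (rule that)
    have "snd c \<in> C'" "snd c' \<in> C'" "q' (snd c) = q' (snd c')" using c by auto
    from Y.A_proj[OF this] obtain m where m: "m \<noteq> 0" "\<forall>d. \<forall>f\<in>A' d. f (snd c') = m ^ d * f (snd c)"
      by (elim exE conjE) (rule that)
    have "f c' = (l * m) ^ d * f c" if "f \<in> tens (A d) (A' d)" for d f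
      using that
    proof induction
      case (prod f g)
      have "f (fst c') = l ^ d * f (fst c)" "g (snd c') = m ^ d * g (snd c)" using l(2) m(2) prod by blast+
      then show ?case by (simp add: power_mult_distrib)
    next
      case (add f g)
      then show ?case by (simp add: distrib_left)
    qed
    then show "\<exists>l. l \<noteq> 0 \<and> (\<forall>d. \<forall>f\<in>tens (A d) (A' d). f c' = l ^ d * f c)"
      using l(1) m(1) by (intro exI[of _ "l * m"]) simp
  qed (rule tens.add)
qed

lemma sum_lessThan_add: "(\<Sum>i<n + m. f i) = (\<Sum>i<n. f i) + (\<Sum>i<m. f (n + i))"
  for n m :: nat and f :: "nat \<Rightarrow> 'a::comm_monoid_add"
  by (induction m) (simp_all add: add.assoc)

lemma tensor_funsE:
  assumes "f \<in> tensor_funs X Y U V"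
  obtains n :: nat and f1 f2 where "f = (\<lambda>(x, y). \<Sum>i<n. f1 i x * f2 i y)"
    "\<forall>i<n. fs_reg X U (f1 i)" "\<forall>i<n. fs_reg Y V (f2 i)"
  using assms unfolding tensor_funs_def mem_Collect_eq by (elim exE conjE) (rule that)

lemma tensor_funs_add:
  assumes "f \<in> tensor_funs X Y U V" "g \<in> tensor_funs X Y U V"
  shows "(\<lambda>p. f p + g p) \<in> tensor_funs X Y U V"
proof -
  obtain n :: nat and f1 f2 where f: "f = (\<lambda>(x, y). \<Sum>i<n. f1 i x * f2 i y)"
    "\<forall>i<n. fs_reg X U (f1 i)" "\<forall>i<n. fs_reg Y V (f2 i)"
    using assms(1) by (rule tensor_funsE)
  obtain m :: nat and g1 g2 where g: "g = (\<lambda>(x, y). \<Sum>i<m. g1 i x * g2 i y)"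
    "\<forall>i<m. fs_reg X U (g1 i)" "\<forall>i<m. fs_reg Y V (g2 i)"
    using assms(2) by (rule tensor_funsE)
  define h1 h2 where "h1 = (\<lambda>i. if i < n then f1 i else g1 (i - n))"
    and "h2 = (\<lambda>i. if i < n then f2 i else g2 (i - n))"
  have "(\<Sum>i<n + m. h1 i x * h2 i y) = (\<Sum>i<n. f1 i x * f2 i y) + (\<Sum>i<m. g1 i x * g2 i y)" for x y
    by (simp add: sum_lessThan_add h1_def h2_def)
  then have "(\<lambda>p. f p + g p) = (\<lambda>(x, y). \<Sum>i<n + m. h1 i x * h2 i y)"
    unfolding f(1) g(1) by (auto simp: fun_eq_iff)
  moreover have "\<forall>i<n + m. fs_reg X U (h1 i)" "\<forall>i<n + m. fs_reg Y V (h2 i)"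
    using f g by (auto simp: h1_def h2_def)
  ultimately show ?thesis
    unfolding tensor_funs_def
    by (intro CollectI exI[of _ "n + m"] exI[of _ h1] exI[of _ h2] conjI)
qed

lemma tensor_funs_prod:
  assumes "fs_reg X U f" "fs_reg Y V g"
  shows "(\<lambda>p. f (fst p) * g (snd p)) \<in> tensor_funs X Y U V"
  unfolding tensor_funs_def
  by (rule CollectI, rule exI[of _ 1], rule exI[of _ "\<lambda>_. f"], rule exI[of _ "\<lambda>_. g"])
     (use assms in \<open>auto simp: fun_eq_iff\<close>)

locale graded_pair = X: graded K C q A + Y: graded K C' q' A'
  for K and C :: "'c set" and q :: "'c \<Rightarrow> 'a" and A and C' :: "'e set" and q' :: "'e \<Rightarrow> 'b" and A'
begin

sublocale XY: graded K "C \<times> C'" "map_prod q q'" "\<lambda>d. tens (A d) (A' d)"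
  by (rule graded_tens) unfold_locales

text \<open>The two fractions have different degrees d and d'. Extending the first by a function of
  degree d' and the second by one of degree d gives both the degree d + d', as needed for a bidegree
  on the diagonal.\<close>

lemma tens_fraction:
  assumes "c \<in> C" "e \<in> C'" "f \<in> A d" "g \<in> A d" "g c \<noteq> 0" "f' \<in> A' d'" "g' \<in> A' d'" "g' e \<noteq> 0"
  shows "\<exists>D F L. F \<in> tens (A D) (A' D) \<and> L \<in> tens (A D) (A' D) \<and> L (c, e) \<noteq> 0 \<and>
    (\<forall>x y. L (x, y) \<noteq> 0 \<longrightarrow> g x \<noteq> 0 \<and> g' y \<noteq> 0 \<and> F (x, y) / L (x, y) = (f x / g x) * (f' y / g' y))"
proof -
  obtain m where m: "m \<in> A d'" "m c \<noteq> 0" using X.A_nz_deg assms(1) by blast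
  obtain m' where m': "m' \<in> A' d" "m' e \<noteq> 0" using Y.A_nz_deg assms(2) by blast
  have 1: "(\<lambda>x. f x * m x) \<in> A (d + d')" "(\<lambda>x. g x * m x) \<in> A (d + d')"
    using assms m by (auto intro: X.A_mult)
  have 2: "(\<lambda>x. m' x * f' x) \<in> A' (d + d')" "(\<lambda>x. m' x * g' x) \<in> A' (d + d')"
    using assms m' by (auto intro: Y.A_mult)
  show ?thesis
    using tens.prod[OF 1(1) 2(1)] tens.prod[OF 1(2) 2(2)] assms m m'
    by (rule_tac exI[of _ "d + d'"],
        rule_tac exI[of _ "\<lambda>p. f (fst p) * m (fst p) * (m' (snd p) * f' (snd p))"],
        rule_tac exI[of _ "\<lambda>p. g (fst p) * m (fst p) * (m' (snd p) * g' (snd p))"]) simp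
qed

abbreviation "GX \<equiv> gspace C q A"
abbreviation "GY \<equiv> gspace C' q' A'"
abbreviation "GXY \<equiv> gspace (C \<times> C') (map_prod q q') (\<lambda>d. tens (A d) (A' d))"

text \<open>A finite sum of products of local fractions is put over a common denominator, one
  summand at a time. The denominator also records that the point lies over \<open>U\<close> and
  \<open>V\<close>.\<close>

lemma tensor_fun_local:
  assumes h: "h \<in> tensor_funs GX GY U V" and U: "gopen C q A U" and V: "gopen C' q' A' V"
    and c: "c \<in> C" "e \<in> C'" "q c \<in> U" "q' e \<in> V"
  shows "\<exists>D F L. F \<in> tens (A D) (A' D) \<and> L \<in> tens (A D) (A' D) \<and> L (c, e) \<noteq> 0 \<and>
    (\<forall>x\<in>C. \<forall>y\<in>C'. L (x, y) \<noteq> 0 \<longrightarrow> q x \<in> U \<and> q' y \<in> V \<and> h (q x, q' y) = F (x, y) / L (x, y))"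
proof -
  obtain n :: nat and f1 f2 where f: "h = (\<lambda>(x, y). \<Sum>i<n. f1 i x * f2 i y)"
    "\<forall>i<n. fs_reg GX U (f1 i)" "\<forall>i<n. fs_reg GY V (f2 i)"
    using h by (rule tensor_funsE)
  have "\<exists>D F L. F \<in> tens (A D) (A' D) \<and> L \<in> tens (A D) (A' D) \<and> L (c, e) \<noteq> 0 \<and>
    (\<forall>x\<in>C. \<forall>y\<in>C'. L (x, y) \<noteq> 0 \<longrightarrow> q x \<in> U \<and> q' y \<in> V \<and>
       (\<Sum>i<k. f1 i (q x) * f2 i (q' y)) = F (x, y) / L (x, y))" if "k \<le> n" for k
    using that
  proof (induction k)
    case 0
    obtain d g where g: "g \<in> A d" "g c \<noteq> 0" "\<forall>x\<in>C. g x \<noteq> 0 \<longrightarrow> q x \<in> U"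
      using U c(1,3) by (rule X.gopenE)
    obtain d' g' where g': "g' \<in> A' d'" "g' e \<noteq> 0" "\<forall>x\<in>C'. g' x \<noteq> 0 \<longrightarrow> q' x \<in> V"
      using V c(2,4) by (rule Y.gopenE)
    obtain D F L where L: "F \<in> tens (A D) (A' D)" "L \<in> tens (A D) (A' D)" "L (c, e) \<noteq> 0"
      "\<forall>x y. L (x, y) \<noteq> 0 \<longrightarrow> g x \<noteq> 0 \<and> g' y \<noteq> 0 \<and> F (x, y) / L (x, y) = (g x / g x) * (g' y / g' y)"
      using tens_fraction[OF c(1,2) g(1,1,2) g'(1,1,2)] by (elim exE conjE) (rule that)
    \<comment> \<open>The empty sum is the zero function, written in degree \<open>D\<close>. Its
      denominator \<open>L\<close> comes from the trivial fractions g/g and g'/g' and only serves to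
      confine the point to \<open>U\<close> and \<open>V\<close>.\<close>
    have "(\<lambda>p. 0 * L p) \<in> tens (A D) (A' D)" by (rule XY.A_smult[OF X.K_zero L(2)])
    then show ?case using L g(3) g'(3)
      by (rule_tac exI[of _ D], rule_tac exI[of _ "\<lambda>p. 0 * L p"], rule_tac exI[of _ L]) simp
  next
    case (Suc k)
    then obtain D F L where L: "F \<in> tens (A D) (A' D)" "L \<in> tens (A D) (A' D)" "L (c, e) \<noteq> 0"
      "\<forall>x\<in>C. \<forall>y\<in>C'. L (x, y) \<noteq> 0 \<longrightarrow> q x \<in> U \<and> q' y \<in> V \<and>
       (\<Sum>i<k. f1 i (q x) * f2 i (q' y)) = F (x, y) / L (x, y)"
      using Suc.IH[OF Suc_leD[OF Suc.prems]] by (elim exE conjE) (rule that)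
    have k: "k < n" using Suc.prems by simp
    obtain d a b where ab: "a \<in> A d" "b \<in> A d" "b c \<noteq> 0"
      "\<forall>x\<in>C. q x \<in> U \<longrightarrow> b x \<noteq> 0 \<longrightarrow> f1 k (q x) = a x / b x"
      using f(2)[rule_format, OF k] c(1,3) by (rule X.regE)
    obtain d' a' b' where ab': "a' \<in> A' d'" "b' \<in> A' d'" "b' e \<noteq> 0"
      "\<forall>x\<in>C'. q' x \<in> V \<longrightarrow> b' x \<noteq> 0 \<longrightarrow> f2 k (q' x) = a' x / b' x"
      using f(3)[rule_format, OF k] c(2,4) by (rule Y.regE)
    obtain D' F' L' where L': "F' \<in> tens (A D') (A' D')" "L' \<in> tens (A D') (A' D')" "L' (c, e) \<noteq> 0"
      "\<forall>x y. L' (x, y) \<noteq> 0 \<longrightarrow> b x \<noteq> 0 \<and> b' y \<noteq> 0 \<and> F' (x, y) / L' (x, y) = (a x / b x) * (a' y / b' y)"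
      using tens_fraction[OF c(1,2) ab(1-3) ab'(1-3)] by (elim exE conjE) (rule that)
    have 1: "(\<lambda>p. F p * L' p + L p * F' p) \<in> tens (A (D + D')) (A' (D + D'))"
      "(\<lambda>p. L p * L' p) \<in> tens (A (D + D')) (A' (D + D'))"
      using L L' by (auto intro!: XY.A_add XY.A_mult)
    have "q x \<in> U \<and> q' y \<in> V \<and> (\<Sum>i<Suc k. f1 i (q x) * f2 i (q' y)) =
        (F (x, y) * L' (x, y) + L (x, y) * F' (x, y)) / (L (x, y) * L' (x, y))"
      if "x \<in> C" "y \<in> C'" "L (x, y) * L' (x, y) \<noteq> 0" for x y
    proof -
      have nz: "L (x, y) \<noteq> 0" "L' (x, y) \<noteq> 0" using that by auto
      have *: "q x \<in> U" "q' y \<in> V" "(\<Sum>i<k. f1 i (q x) * f2 i (q' y)) = F (x, y) / L (x, y)"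
        using L(4) that nz by auto
      have "b x \<noteq> 0" "b' y \<noteq> 0" "F' (x, y) / L' (x, y) = (a x / b x) * (a' y / b' y)"
        using L'(4) nz by auto
      moreover from this have "f1 k (q x) = a x / b x" "f2 k (q' y) = a' y / b' y"
        using ab(4) ab'(4) that * by auto
      ultimately have "f1 k (q x) * f2 k (q' y) = F' (x, y) / L' (x, y)" by simp
      with * nz show ?thesis by (simp add: add_divide_distrib)
    qed
    then show ?case using 1 L(3) L'(3)
      by (rule_tac exI[of _ "D + D'"], rule_tac exI[of _ "\<lambda>p. F p * L' p + L p * F' p"],
          rule_tac exI[of _ "\<lambda>p. L p * L' p"]) simp
  qed
  from this[of n] show ?thesis by (simp add: f(1))
qed

text \<open>Dehomogenisation: dividing a bihomogeneous function by one function of the same degree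
  on each factor turns every product into a product of regular functions.\<close>

lemma tens_tensor_fun:
  assumes "g \<in> tens (A d) (A' d)" and l: "l \<in> A d" "l' \<in> A' d"
  shows "\<exists>h\<in>tensor_funs GX GY (q ` {x \<in> C. l x \<noteq> 0}) (q' ` {y \<in> C'. l' y \<noteq> 0}).
    \<forall>x\<in>C. \<forall>y\<in>C'. l x \<noteq> 0 \<longrightarrow> l' y \<noteq> 0 \<longrightarrow> h (q x, q' y) = g (x, y) / (l x * l' y)"
  using assms(1)
proof induction
  case (prod f g)
  obtain \<phi> where \<phi>: "fs_reg GX (q ` {x \<in> C. l x \<noteq> 0}) \<phi>" "\<forall>x\<in>C. l x \<noteq> 0 \<longrightarrow> \<phi> (q x) = f x / l x"
    using X.reg_ratio[OF prod(1) l(1)] by blast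
  obtain \<psi> where \<psi>: "fs_reg GY (q' ` {x \<in> C'. l' x \<noteq> 0}) \<psi>" "\<forall>x\<in>C'. l' x \<noteq> 0 \<longrightarrow> \<psi> (q' x) = g x / l' x"
    using Y.reg_ratio[OF prod(2) l(2)] by blast
  show ?case
    by (rule bexI[OF _ tensor_funs_prod[OF \<phi>(1) \<psi>(1)]]) (use \<phi>(2) \<psi>(2) in simp)
next
  case (add f g)
  then obtain h k where "h \<in> tensor_funs GX GY (q ` {x \<in> C. l x \<noteq> 0}) (q' ` {y \<in> C'. l' y \<noteq> 0})"
    "\<forall>x\<in>C. \<forall>y\<in>C'. l x \<noteq> 0 \<longrightarrow> l' y \<noteq> 0 \<longrightarrow> h (q x, q' y) = f (x, y) / (l x * l' y)"
    "k \<in> tensor_funs GX GY (q ` {x \<in> C. l x \<noteq> 0}) (q' ` {y \<in> C'. l' y \<noteq> 0})"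
    "\<forall>x\<in>C. \<forall>y\<in>C'. l x \<noteq> 0 \<longrightarrow> l' y \<noteq> 0 \<longrightarrow> k (q x, q' y) = g (x, y) / (l x * l' y)"
    by (elim bexE) (rule that)
  then show ?case
    by (intro bexI[OF _ tensor_funs_add[of h _ _ _ _ k]]) (simp_all add: add_divide_distrib)
qed

lemma product_gspace: "product GX GY = GXY"
proof -
  define B where "B = {{p \<in> U \<times> V. h p \<noteq> 0} | U V h. openin (fs_top GX) U \<and> openin (fs_top GY) V \<and>
     h \<in> tensor_funs GX GY U V}"
  have T: "topology_generated_by B = fs_top GXY"
  proof (rule XY.topology_generated_eq)
    fix S assume "S \<in> B"
    then obtain U V h where S: "S = {p \<in> U \<times> V. h p \<noteq> 0}" and U: "gopen C q A U" "gopen C' q' A' V"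
      and h: "h \<in> tensor_funs GX GY U V" unfolding B_def by auto
    show "gopen (C \<times> C') (map_prod q q') (\<lambda>d. tens (A d) (A' d)) S"
      unfolding gopen_def
    proof (intro conjI ballI impI)
      show "S \<subseteq> map_prod q q' ` (C \<times> C')"
        using U unfolding S gopen_def map_prod_surj_on[OF refl refl] by blast
      fix p assume p: "p \<in> C \<times> C'" "map_prod q q' p \<in> S"
      obtain c e where ce: "p = (c, e)" "c \<in> C" "e \<in> C'" using p(1) by blast
      then have *: "q c \<in> U" "q' e \<in> V" "h (q c, q' e) \<noteq> 0" using p(2) S by auto
      obtain D F L where L: "F \<in> tens (A D) (A' D)" "L \<in> tens (A D) (A' D)" "L (c, e) \<noteq> 0"
        "\<forall>x\<in>C. \<forall>y\<in>C'. L (x, y) \<noteq> 0 \<longrightarrow> q x \<in> U \<and> q' y \<in> V \<and> h (q x, q' y) = F (x, y) / L (x, y)"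
        using tensor_fun_local[OF h U ce(2,3) *(1,2)] by (elim exE conjE) (rule that)
      \<comment> \<open>Nonvanishing of the product gives both: the fraction F/L is defined, hence
        the point lies over \<open>U\<close> and \<open>V\<close>, and its value \<open>h\<close> is
        not zero.\<close>
      have "(\<lambda>p. F p * L p) \<in> tens (A (D + D)) (A' (D + D))" using L by (intro XY.A_mult)
      moreover have "F p * L p \<noteq> 0" using L ce * by auto
      moreover have "\<forall>x\<in>C \<times> C'. F x * L x \<noteq> 0 \<longrightarrow> map_prod q q' x \<in> S" unfolding S using L(4) by auto
      ultimately show "\<exists>d. \<exists>g\<in>tens (A d) (A' d). g p \<noteq> 0 \<and> (\<forall>x\<in>C \<times> C'. g x \<noteq> 0 \<longrightarrow> map_prod q q' x \<in> S)"
        by (rule_tac exI[of _ "D + D"], rule_tac bexI[of _ "\<lambda>p. F p * L p"]) auto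
    qed
  next
    fix W p assume *: "gopen (C \<times> C') (map_prod q q') (\<lambda>d. tens (A d) (A' d)) W" "p \<in> C \<times> C'" "map_prod q q' p \<in> W"
    obtain d g where g: "g \<in> tens (A d) (A' d)" "g p \<noteq> 0" "\<forall>x\<in>C \<times> C'. g x \<noteq> 0 \<longrightarrow> map_prod q q' x \<in> W"
      using * by (rule XY.gopenE)
    obtain c e where ce: "p = (c, e)" "c \<in> C" "e \<in> C'" using *(2) by blast
    obtain l where l: "l \<in> A d" "l c \<noteq> 0" using X.A_nz_deg ce by blast
    obtain l' where l': "l' \<in> A' d" "l' e \<noteq> 0" using Y.A_nz_deg ce by blast
    define U V where "U = q ` {x \<in> C. l x \<noteq> 0}" and "V = q' ` {y \<in> C'. l' y \<noteq> 0}"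
    obtain h where h: "h \<in> tensor_funs GX GY U V"
      "\<forall>x\<in>C. \<forall>y\<in>C'. l x \<noteq> 0 \<longrightarrow> l' y \<noteq> 0 \<longrightarrow> h (q x, q' y) = g (x, y) / (l x * l' y)"
      using tens_tensor_fun[OF g(1) l(1) l'(1)] unfolding U_def[symmetric] V_def[symmetric] by (elim bexE) (rule that)
    have S: "{p \<in> U \<times> V. h p \<noteq> 0} \<in> B"
      unfolding B_def using h(1) X.gopen_D[OF l(1)] Y.gopen_D[OF l'(1)]
      by (intro CollectI exI[of _ U] exI[of _ V] exI[of _ h]) (simp add: U_def V_def)
    have "map_prod q q' p \<in> {p \<in> U \<times> V. h p \<noteq> 0}"
      using h(2) ce l l' g(2) by (auto simp: U_def V_def)
    moreover have "{p \<in> U \<times> V. h p \<noteq> 0} \<subseteq> W"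
    proof
      fix r assume r: "r \<in> {p \<in> U \<times> V. h p \<noteq> 0}"
      then obtain x y where xy: "x \<in> C" "l x \<noteq> 0" "y \<in> C'" "l' y \<noteq> 0" "r = (q x, q' y)"
        unfolding U_def V_def by auto
      then have "g (x, y) \<noteq> 0" using r h(2) by auto
      then show "r \<in> W" using g(3) xy by auto
    qed
    ultimately show "\<exists>S\<in>B. map_prod q q' p \<in> S \<and> S \<subseteq> W"
      by (rule_tac bexI[of _ "{p \<in> U \<times> V. h p \<noteq> 0}", OF _ S]) (rule conjI)
  qed
  have reg: "fs_reg (product GX GY) W \<phi> \<longleftrightarrow> gopen (C \<times> C') (map_prod q q') (\<lambda>d. tens (A d) (A' d)) W \<and>
      (\<forall>p\<in>W. \<exists>U V f h. gopen C q A U \<and> gopen C' q' A' V \<and> p \<in> U \<times> V \<and>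
              f \<in> tensor_funs GX GY U V \<and> h \<in> tensor_funs GX GY U V \<and> h p \<noteq> 0 \<and>
              (\<forall>r \<in> W \<inter> (U \<times> V). h r \<noteq> 0 \<longrightarrow> \<phi> r = f r / h r))" for W \<phi>
    unfolding product_def Let_def fspace.simps unfolding B_def[symmetric] T
    unfolding XY.openin_gspace X.openin_gspace Y.openin_gspace by (rule refl)
  show ?thesis
  proof (rule XY.fspace_eqI)
    show "fs_top (product GX GY) = fs_top GXY"
      unfolding product_def Let_def fspace.simps unfolding B_def[symmetric] by (rule T)
  next
    fix W \<phi> assume "fs_reg (product GX GY) W \<phi>"
    then show "gopen (C \<times> C') (map_prod q q') (\<lambda>d. tens (A d) (A' d)) W" unfolding reg by (rule conjunct1)
  next
    fix W \<phi> assume W: "gopen (C \<times> C') (map_prod q q') (\<lambda>d. tens (A d) (A' d)) W"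
      and "fs_reg (product GX GY) W \<phi>"
    then have *: "\<forall>p\<in>W. \<exists>U V f h. gopen C q A U \<and> gopen C' q' A' V \<and> p \<in> U \<times> V \<and>
              f \<in> tensor_funs GX GY U V \<and> h \<in> tensor_funs GX GY U V \<and> h p \<noteq> 0 \<and>
              (\<forall>r \<in> W \<inter> (U \<times> V). h r \<noteq> 0 \<longrightarrow> \<phi> r = f r / h r)" unfolding reg by (rule_tac conjunct2)
    show "fs_reg GXY W \<phi>"
    proof (rule XY.regI[OF W])
      fix p assume p: "p \<in> C \<times> C'" "map_prod q q' p \<in> W"
      obtain c e where ce: "p = (c, e)" "c \<in> C" "e \<in> C'" using p(1) by blast
      obtain U V f h where fh: "gopen C q A U" "gopen C' q' A' V" "map_prod q q' p \<in> U \<times> V"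
          "f \<in> tensor_funs GX GY U V" "h \<in> tensor_funs GX GY U V" "h (map_prod q q' p) \<noteq> 0"
          "\<forall>r \<in> W \<inter> (U \<times> V). h r \<noteq> 0 \<longrightarrow> \<phi> r = f r / h r"
        using bspec[OF * p(2)] by (elim exE conjE) (rule that)
      have UV: "q c \<in> U" "q' e \<in> V" using fh(3) ce by auto
      obtain D F L where L: "F \<in> tens (A D) (A' D)" "L \<in> tens (A D) (A' D)" "L (c, e) \<noteq> 0"
        "\<forall>x\<in>C. \<forall>y\<in>C'. L (x, y) \<noteq> 0 \<longrightarrow> q x \<in> U \<and> q' y \<in> V \<and> f (q x, q' y) = F (x, y) / L (x, y)"
        using tensor_fun_local[OF fh(4,1,2) ce(2,3) UV] by (elim exE conjE) (rule that)
      obtain D' F' L' where L': "F' \<in> tens (A D') (A' D')" "L' \<in> tens (A D') (A' D')" "L' (c, e) \<noteq> 0"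
        "\<forall>x\<in>C. \<forall>y\<in>C'. L' (x, y) \<noteq> 0 \<longrightarrow> q x \<in> U \<and> q' y \<in> V \<and> h (q x, q' y) = F' (x, y) / L' (x, y)"
        using tensor_fun_local[OF fh(5,1,2) ce(2,3) UV] by (elim exE conjE) (rule that)
      \<comment> \<open>The quotient (F/L) / (F'/L') is F L' / (L F'). Both terms are multiplied by
        L L' once more, so that nonvanishing of \<open>M\<close> makes all of \<open>L\<close>,
        \<open>L'\<close> and \<open>F'\<close> nonzero.\<close>
      define N M where "N = (\<lambda>p. (F p * L p) * (L' p * L' p))" and "M = (\<lambda>p. (L p * L p) * (F' p * L' p))"
      have NM: "N \<in> tens (A ((D + D) + (D' + D'))) (A' ((D + D) + (D' + D')))"
        "M \<in> tens (A ((D + D) + (D' + D'))) (A' ((D + D) + (D' + D')))"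
        unfolding N_def M_def using L L' by (auto intro!: XY.A_mult)
      have "h (q c, q' e) = F' (c, e) / L' (c, e)" "h (q c, q' e) \<noteq> 0" using L' ce fh(6) by auto
      then have Mp: "M p \<noteq> 0" unfolding M_def ce(1) using L(3) L'(3) by auto
      have "\<phi> (map_prod q q' x) = N x / M x" if x: "x \<in> C \<times> C'" "map_prod q q' x \<in> W" "M x \<noteq> 0" for x
      proof -
        obtain y z where yz: "x = (y, z)" "y \<in> C" "z \<in> C'" using x(1) by blast
        have nz: "L x \<noteq> 0" "L' x \<noteq> 0" "F' x \<noteq> 0" using x(3) unfolding M_def by auto
        have f: "q y \<in> U" "q' z \<in> V" "f (q y, q' z) = F x / L x" "h (q y, q' z) = F' x / L' x"
          using L(4) L'(4) yz nz by auto
        have "\<phi> (q y, q' z) = f (q y, q' z) / h (q y, q' z)"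
          using fh(7) x(2) f nz yz(1) by auto
        also have "\<dots> = N x / M x" unfolding f N_def M_def using nz by (simp add: field_simps)
        finally show ?thesis using yz by simp
      qed
      with NM Mp show "\<exists>d f g. f \<in> tens (A d) (A' d) \<and> g \<in> tens (A d) (A' d) \<and> g p \<noteq> 0 \<and>
         (\<forall>x\<in>C \<times> C'. map_prod q q' x \<in> W \<longrightarrow> g x \<noteq> 0 \<longrightarrow> \<phi> (map_prod q q' x) = f x / g x)"
        by (rule_tac exI[of _ "(D + D) + (D' + D')"], rule_tac exI[of _ N], rule_tac exI[of _ M]) simp
    qed
  next
    fix W \<phi> assume *: "fs_reg GXY W \<phi>"
    then have W: "gopen (C \<times> C') (map_prod q q') (\<lambda>d. tens (A d) (A' d)) W" by (simp add: XY.reg_gspace)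
    have "\<exists>U V f h. gopen C q A U \<and> gopen C' q' A' V \<and> r \<in> U \<times> V \<and>
              f \<in> tensor_funs GX GY U V \<and> h \<in> tensor_funs GX GY U V \<and> h r \<noteq> 0 \<and>
              (\<forall>r \<in> W \<inter> (U \<times> V). h r \<noteq> 0 \<longrightarrow> \<phi> r = f r / h r)" if r: "r \<in> W" for r
    proof -
      obtain c e where ce: "r = map_prod q q' (c, e)" "c \<in> C" "e \<in> C'" using W r unfolding gopen_def by auto
      have p: "(c, e) \<in> C \<times> C'" "map_prod q q' (c, e) \<in> W" using ce r by auto
      obtain d F G where FG: "F \<in> tens (A d) (A' d)" "G \<in> tens (A d) (A' d)" "G (c, e) \<noteq> 0"
        "\<forall>x\<in>C \<times> C'. map_prod q q' x \<in> W \<longrightarrow> G x \<noteq> 0 \<longrightarrow> \<phi> (map_prod q q' x) = F x / G x"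
        using * p by (rule XY.regE)
      obtain l where l: "l \<in> A d" "l c \<noteq> 0" using X.A_nz_deg ce by blast
      obtain l' where l': "l' \<in> A' d" "l' e \<noteq> 0" using Y.A_nz_deg ce by blast
      define U V where "U = q ` {x \<in> C. l x \<noteq> 0}" and "V = q' ` {y \<in> C'. l' y \<noteq> 0}"
      obtain f where f: "f \<in> tensor_funs GX GY U V"
        "\<forall>x\<in>C. \<forall>y\<in>C'. l x \<noteq> 0 \<longrightarrow> l' y \<noteq> 0 \<longrightarrow> f (q x, q' y) = F (x, y) / (l x * l' y)"
        using tens_tensor_fun[OF FG(1) l(1) l'(1)] unfolding U_def[symmetric] V_def[symmetric] by (elim bexE) (rule that)
      obtain h where h: "h \<in> tensor_funs GX GY U V"
        "\<forall>x\<in>C. \<forall>y\<in>C'. l x \<noteq> 0 \<longrightarrow> l' y \<noteq> 0 \<longrightarrow> h (q x, q' y) = G (x, y) / (l x * l' y)"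
        using tens_tensor_fun[OF FG(2) l(1) l'(1)] unfolding U_def[symmetric] V_def[symmetric] by (elim bexE) (rule that)
      have "h r \<noteq> 0" using h(2) l l' FG(3) ce by simp
      moreover have "r \<in> U \<times> V" using l l' ce by (auto simp: U_def V_def)
      moreover have "\<phi> s = f s / h s" if s: "s \<in> W \<inter> (U \<times> V)" "h s \<noteq> 0" for s
      proof -
        obtain x y where xy: "x \<in> C" "l x \<noteq> 0" "y \<in> C'" "l' y \<noteq> 0" "s = (q x, q' y)"
          using s(1) unfolding U_def V_def by auto
        have "f s = F (x, y) / (l x * l' y)" "h s = G (x, y) / (l x * l' y)" using f(2) h(2) xy by auto
        moreover from this have "G (x, y) \<noteq> 0" using s(2) by auto
        moreover from this have "\<phi> s = F (x, y) / G (x, y)" using FG(4) xy s(1) by auto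
        ultimately show ?thesis using xy by simp
      qed
      ultimately show ?thesis
        using f(1) h(1) X.gopen_D[OF l(1)] Y.gopen_D[OF l'(1)]
        by (rule_tac exI[of _ U], rule_tac exI[of _ V], rule_tac exI[of _ f], rule_tac exI[of _ h])
           (simp add: U_def V_def)
    qed
    then show "fs_reg (product GX GY) W \<phi>" unfolding reg by (intro conjI W ballI)
  qed
qed

end

section \<open>Morphisms and isomorphisms of spaces of graded functions\<close>

lemma gseparatingD:
  assumes "gseparating C q A" "c \<in> C" "x \<in> C"
    and "\<And>d f g. f \<in> A d \<Longrightarrow> g \<in> A d \<Longrightarrow> f c * g x = f x * g c"
  shows "q c = q x"
proof -
  have "\<forall>d. \<forall>f\<in>A d. \<forall>g\<in>A d. f c * g x = f x * g c" by (intro allI ballI assms(4))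
  then show ?thesis
    by (rule mp[OF bspec[OF bspec[OF assms(1)[unfolded gseparating_def] assms(2)] assms(3)]])
qed

lemma gseparatingE:
  assumes "gseparating C q A" "c \<in> C" "x \<in> C" "q c \<noteq> q x"
  obtains d f g where "f \<in> A d" "g \<in> A d" "f c * g x \<noteq> f x * g c"
proof -
  note result = that
  have False if nt: "\<not> thesis"
  proof -
    have "f c * g x = f x * g c" if fg: "f \<in> A d" "g \<in> A d" for d f g
    proof (rule ccontr)
      assume "f c * g x \<noteq> f x * g c"
      from result[OF fg this] nt show False by simp
    qed
    then have "q c = q x" by (rule gseparatingD[OF assms(1-3)])
    with assms(4) show False by simp
  qed
  then show thesis by blast
qed

text \<open>
  A map between two such spaces is a morphism if it lifts locally to the cones in such a way that
  pairs of functions of equal degree pull back, up to a common factor, to pairs of equal degree.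
\<close>

definition pulls_back :: "'c set \<Rightarrow> (nat \<Rightarrow> ('c \<Rightarrow> complex) set) \<Rightarrow> ('c \<Rightarrow> 'e) \<Rightarrow>
    (nat \<Rightarrow> ('e \<Rightarrow> complex) set) \<Rightarrow> bool" where
  "pulls_back C A \<Phi> A' \<longleftrightarrow> (\<forall>d. \<forall>f'\<in>A' d. \<forall>g'\<in>A' d. \<exists>m f g l. f \<in> A m \<and> g \<in> A m \<and>
     (\<forall>c\<in>C. l c \<noteq> 0 \<and> f c = l c * f' (\<Phi> c) \<and> g c = l c * g' (\<Phi> c)))"

lemma pulls_backE:
  assumes "pulls_back C A \<Phi> A'" "f' \<in> A' d" "g' \<in> A' d"
  obtains m f g l where "f \<in> A m" "g \<in> A m" "\<forall>c\<in>C. l c \<noteq> (0::complex)"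
    "\<forall>c\<in>C. f c = l c * f' (\<Phi> c)" "\<forall>c\<in>C. g c = l c * g' (\<Phi> c)"
proof -
  have "\<exists>m f g l. f \<in> A m \<and> g \<in> A m \<and>
     (\<forall>c\<in>C. l c \<noteq> 0 \<and> f c = l c * f' (\<Phi> c) \<and> g c = l c * g' (\<Phi> c))"
    using assms unfolding pulls_back_def by simp
  then obtain m f g l where *: "f \<in> A m" "g \<in> A m"
     "\<forall>c\<in>C. l c \<noteq> 0 \<and> f c = l c * f' (\<Phi> c) \<and> g c = l c * g' (\<Phi> c)"
    by (elim exE conjE) (rule that)
  show thesis by (rule that[OF *(1,2), of l]) (use *(3) in simp_all)
qed

lemma pulls_back_direct:
  assumes "\<And>d f'. f' \<in> A' d \<Longrightarrow> \<exists>f\<in>A (k * d). \<forall>c\<in>C. f c = f' (\<Phi> c)"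
  shows "pulls_back C A \<Phi> A'"
  unfolding pulls_back_def
proof (intro allI ballI)
  fix d f' g' assume "f' \<in> A' d" "g' \<in> A' d"
  then obtain f g where "f \<in> A (k * d)" "\<forall>c\<in>C. f c = f' (\<Phi> c)" "g \<in> A (k * d)" "\<forall>c\<in>C. g c = g' (\<Phi> c)"
    using assms by (metis (no_types))
  then show "\<exists>m f g l. f \<in> A m \<and> g \<in> A m \<and>
     (\<forall>c\<in>C. l c \<noteq> 0 \<and> f c = l c * f' (\<Phi> c) \<and> g c = l c * g' (\<Phi> c))"
    by (rule_tac exI[of _ "k * d"], rule_tac exI[of _ f], rule_tac exI[of _ g], rule_tac exI[of _ "\<lambda>_. 1"]) simp
qed

context graded_pair
begin

text \<open>The lift to the cones is required only on a basic open set around each point. This is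
  what the group law needs: each addition law represents it only on part of the product.\<close>

lemma morphism_gspace:
  assumes loc: "\<And>c. c \<in> C \<Longrightarrow> \<exists>e g0 \<Phi>. g0 \<in> A e \<and> g0 c \<noteq> 0 \<and>
     (\<forall>x\<in>C. g0 x \<noteq> 0 \<longrightarrow> \<Phi> x \<in> C' \<and> q' (\<Phi> x) = h (q x)) \<and> pulls_back {x\<in>C. g0 x \<noteq> 0} A \<Phi> A'"
  shows "morphism GX GY h"
proof -
  have h: "h (q c) \<in> q' ` C'" if c: "c \<in> C" for c
  proof -
    obtain e g0 \<Phi> where "g0 \<in> A e" "g0 c \<noteq> 0" "\<forall>x\<in>C. g0 x \<noteq> 0 \<longrightarrow> \<Phi> x \<in> C' \<and> q' (\<Phi> x) = h (q x)"
      using loc[OF c] by (elim exE conjE) (rule that)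
    then have "\<Phi> c \<in> C'" "q' (\<Phi> c) = h (q c)" using c by auto
    then show ?thesis by (metis imageI)
  qed
  have op: "gopen C q A {x \<in> q ` C. h x \<in> U}" if U: "gopen C' q' A' U" for U
    unfolding gopen_def
  proof (intro conjI ballI impI)
    fix c assume c: "c \<in> C" "q c \<in> {x \<in> q ` C. h x \<in> U}"
    obtain e g0 \<Phi> where g0: "g0 \<in> A e" "g0 c \<noteq> 0" "\<forall>x\<in>C. g0 x \<noteq> 0 \<longrightarrow> \<Phi> x \<in> C' \<and> q' (\<Phi> x) = h (q x)"
      "pulls_back {x\<in>C. g0 x \<noteq> 0} A \<Phi> A'" using loc[OF c(1)] by (elim exE conjE) (rule that)
    have \<Phi>c: "\<Phi> c \<in> C'" "q' (\<Phi> c) \<in> U" using g0 c by auto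
    obtain d g where g: "g \<in> A' d" "g (\<Phi> c) \<noteq> 0" "\<forall>x\<in>C'. g x \<noteq> 0 \<longrightarrow> q' x \<in> U"
      using U \<Phi>c by (rule Y.gopenE)
    obtain m k k' l where k: "k \<in> A m" "k' \<in> A m" "\<forall>c\<in>{x\<in>C. g0 x \<noteq> 0}. l c \<noteq> 0"
      "\<forall>c\<in>{x\<in>C. g0 x \<noteq> 0}. k c = l c * g (\<Phi> c)" "\<forall>c\<in>{x\<in>C. g0 x \<noteq> 0}. k' c = l c * g (\<Phi> c)"
      using g0(4) g(1) g(1) by (rule pulls_backE)
    \<comment> \<open>The factor \<open>g0\<close> confines the open set to the region where the
      lift is valid.\<close>
    have "(\<lambda>x. k x * g0 x) \<in> A (m + e)" by (rule X.A_mult[OF k(1) g0(1)])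
    moreover have "k c * g0 c \<noteq> 0" using k c g0 g by auto
    moreover have "\<forall>x\<in>C. k x * g0 x \<noteq> 0 \<longrightarrow> q x \<in> {x \<in> q ` C. h x \<in> U}"
    proof (intro ballI impI)
      fix x assume x: "x \<in> C" "k x * g0 x \<noteq> 0"
      then have "\<Phi> x \<in> C'" "q' (\<Phi> x) = h (q x)" "g (\<Phi> x) \<noteq> 0" using g0(3) k(4) by auto
      with g(3) have "h (q x) \<in> U" by metis
      with x show "q x \<in> {x \<in> q ` C. h x \<in> U}" by simp
    qed
    ultimately show "\<exists>d. \<exists>g\<in>A d. g c \<noteq> 0 \<and> (\<forall>x\<in>C. g x \<noteq> 0 \<longrightarrow> q x \<in> {x \<in> q ` C. h x \<in> U})"
      by (rule_tac exI[of _ "m + e"], rule_tac bexI[of _ "\<lambda>x. k x * g0 x"]) (rule conjI)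
  qed auto
  show ?thesis
    unfolding morphism_def
  proof (intro conjI allI impI)
    show "continuous_map (fs_top GX) (fs_top GY) h"
      unfolding continuous_map X.points_gspace Y.points_gspace X.openin_gspace Y.openin_gspace
      using h op by auto
  next
    fix U \<phi> assume reg: "fs_reg GY U \<phi>"
    then have U: "gopen C' q' A' U" by (simp add: Y.reg_gspace)
    show "fs_reg GX {x \<in> points GX. h x \<in> U} (\<phi> \<circ> h)"
      unfolding X.points_gspace
    proof (rule X.regI[OF op[OF U]])
      fix c assume c: "c \<in> C" "q c \<in> {x \<in> q ` C. h x \<in> U}"
      obtain e g0 \<Phi> where g0: "g0 \<in> A e" "g0 c \<noteq> 0" "\<forall>x\<in>C. g0 x \<noteq> 0 \<longrightarrow> \<Phi> x \<in> C' \<and> q' (\<Phi> x) = h (q x)"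
        "pulls_back {x\<in>C. g0 x \<noteq> 0} A \<Phi> A'" using loc[OF c(1)] by (elim exE conjE) (rule that)
      have \<Phi>c: "\<Phi> c \<in> C'" "q' (\<Phi> c) \<in> U" using g0 c by auto
      obtain d f g where fg: "f \<in> A' d" "g \<in> A' d" "g (\<Phi> c) \<noteq> 0"
        "\<forall>x\<in>C'. q' x \<in> U \<longrightarrow> g x \<noteq> 0 \<longrightarrow> \<phi> (q' x) = f x / g x"
        using reg \<Phi>c by (rule Y.regE)
      obtain m F G l where k: "F \<in> A m" "G \<in> A m" "\<forall>c\<in>{x\<in>C. g0 x \<noteq> 0}. l c \<noteq> 0"
        "\<forall>c\<in>{x\<in>C. g0 x \<noteq> 0}. F c = l c * f (\<Phi> c)" "\<forall>c\<in>{x\<in>C. g0 x \<noteq> 0}. G c = l c * g (\<Phi> c)"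
        using g0(4) fg(1,2) by (rule pulls_backE)
      have "(\<lambda>x. F x * g0 x) \<in> A (m + e)" "(\<lambda>x. G x * g0 x) \<in> A (m + e)"
        by (auto intro!: X.A_mult k g0)
      moreover have "G c * g0 c \<noteq> 0" using k c g0 fg by auto
      moreover have "\<forall>x\<in>C. q x \<in> {x \<in> q ` C. h x \<in> U} \<longrightarrow> G x * g0 x \<noteq> 0 \<longrightarrow>
          (\<phi> \<circ> h) (q x) = F x * g0 x / (G x * g0 x)"
      proof (intro ballI impI)
        fix x assume x: "x \<in> C" "q x \<in> {x \<in> q ` C. h x \<in> U}" "G x * g0 x \<noteq> 0"
        then have "\<Phi> x \<in> C'" "q' (\<Phi> x) = h (q x)" "g (\<Phi> x) \<noteq> 0" "l x \<noteq> 0" "F x = l x * f (\<Phi> x)"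
          "G x = l x * g (\<Phi> x)" "h (q x) \<in> U" using g0(3) k by auto
        then have eq: "\<phi> (h (q x)) = f (\<Phi> x) / g (\<Phi> x)" using fg(4) by metis
        have "g0 x \<noteq> 0" using x(3) by auto
        with eq \<open>l x \<noteq> 0\<close> show "(\<phi> \<circ> h) (q x) = F x * g0 x / (G x * g0 x)"
          unfolding \<open>F x = l x * f (\<Phi> x)\<close> \<open>G x = l x * g (\<Phi> x)\<close> by simp
      qed
      ultimately show "\<exists>d f g. f \<in> A d \<and> g \<in> A d \<and> g c \<noteq> 0 \<and>
         (\<forall>x\<in>C. q x \<in> {x \<in> q ` C. h x \<in> U} \<longrightarrow> g x \<noteq> 0 \<longrightarrow> (\<phi> \<circ> h) (q x) = f x / g x)"
        by (rule_tac exI[of _ "m + e"], rule_tac exI[of _ "\<lambda>x. F x * g0 x"], rule_tac exI[of _ "\<lambda>x. G x * g0 x"]) (intro conjI)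
    qed
  qed
qed

lemma morphism_gspace_global:
  assumes "\<And>c. c \<in> C \<Longrightarrow> \<Phi> c \<in> C'" "\<And>c. c \<in> C \<Longrightarrow> q' (\<Phi> c) = h (q c)"
    and "pulls_back C A \<Phi> A'"
  shows "morphism GX GY h"
proof (rule morphism_gspace)
  fix c assume "c \<in> C"
  then obtain g where "g \<in> A 1" "g c \<noteq> 0" using X.A_nz by blast
  moreover have "pulls_back {x\<in>C. g x \<noteq> 0} A \<Phi> A'" for g
    unfolding pulls_back_def
  proof (intro allI ballI)
    fix d f' g' assume fg: "f' \<in> A' d" "g' \<in> A' d"
    obtain m f h l where "f \<in> A m" "h \<in> A m" "\<forall>c\<in>C. l c \<noteq> 0"
        "\<forall>c\<in>C. f c = l c * f' (\<Phi> c)" "\<forall>c\<in>C. h c = l c * g' (\<Phi> c)"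
      using assms(3) fg by (rule pulls_backE)
    then show "\<exists>m f h l. f \<in> A m \<and> h \<in> A m \<and> (\<forall>c\<in>{x \<in> C. g x \<noteq> 0}.
          l c \<noteq> 0 \<and> f c = l c * f' (\<Phi> c) \<and> h c = l c * g' (\<Phi> c))"
      by (rule_tac exI[of _ m], rule_tac exI[of _ f], rule_tac exI[of _ h], rule_tac exI[of _ l]) simp
  qed
  ultimately show "\<exists>e g0 \<Phi>. g0 \<in> A e \<and> g0 c \<noteq> 0 \<and>
     (\<forall>x\<in>C. g0 x \<noteq> 0 \<longrightarrow> \<Phi> x \<in> C' \<and> q' (\<Phi> x) = h (q x)) \<and> pulls_back {x\<in>C. g0 x \<noteq> 0} A \<Phi> A'"
    using assms(1,2)
    by (rule_tac exI[of _ 1], rule_tac exI[of _ g], rule_tac exI[of _ \<Phi>]) simp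
qed

text \<open>
  Separation makes the points a function of the graded rings, so that matching rings give an
  isomorphism as soon as the lift is surjective on points.
\<close>

lemma isomorphic_gspace:
  assumes lift: "\<And>c. c \<in> C \<Longrightarrow> \<Phi> c \<in> C'"
    and surj: "\<And>e. e \<in> C' \<Longrightarrow> \<exists>c\<in>C. q' (\<Phi> c) = q' e"
    and pull: "pulls_back C A \<Phi> A'"
    and push: "\<And>d f g. f \<in> A d \<Longrightarrow> g \<in> A d \<Longrightarrow> \<exists>m f' g' l. f' \<in> A' m \<and> g' \<in> A' m \<and>
        (\<forall>c\<in>C. l c \<noteq> 0 \<and> f' (\<Phi> c) = l c * f c \<and> g' (\<Phi> c) = l c * g c)"
    and sep: "gseparating C q A" "gseparating C' q' A'"
  shows "isomorphic GX GY" "isomorphic GY GX"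
proof -
  \<comment> \<open>By separation, equality of points on either side means equality of all ratios.
    The ratios match through \<open>pull\<close> and \<open>push\<close>, because the common factor
    \<open>l\<close> cancels.\<close>
  have ker: "q c = q x \<longleftrightarrow> q' (\<Phi> c) = q' (\<Phi> x)" if c: "c \<in> C" "x \<in> C" for c x
  proof
    assume eq: "q c = q x"
    have "f' (\<Phi> c) * g' (\<Phi> x) = f' (\<Phi> x) * g' (\<Phi> c)" if fg: "f' \<in> A' d" "g' \<in> A' d" for d f' g'
    proof -
      obtain m f h l where "f \<in> A m" "h \<in> A m" "\<forall>c\<in>C. l c \<noteq> 0"
        "\<forall>c\<in>C. f c = l c * f' (\<Phi> c)" "\<forall>c\<in>C. h c = l c * g' (\<Phi> c)"
        using pull fg by (rule pulls_backE)
      moreover from this have "f c * h x = f x * h c" using X.cross_eq[OF c eq] by blast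
      ultimately have "l c * l x * (f' (\<Phi> c) * g' (\<Phi> x)) = l c * l x * (f' (\<Phi> x) * g' (\<Phi> c))"
        "l c \<noteq> 0" "l x \<noteq> 0" using c by (simp_all add: algebra_simps)
      then show ?thesis by simp
    qed
    then show "q' (\<Phi> c) = q' (\<Phi> x)" by (rule gseparatingD[OF sep(2) lift[OF c(1)] lift[OF c(2)]])
  next
    assume eq: "q' (\<Phi> c) = q' (\<Phi> x)"
    have "f c * g x = f x * g c" if fg: "f \<in> A d" "g \<in> A d" for d f g
    proof -
      obtain m f' g' l where "f' \<in> A' m" "g' \<in> A' m"
        "\<forall>c\<in>C. l c \<noteq> 0 \<and> f' (\<Phi> c) = l c * f c \<and> g' (\<Phi> c) = l c * g c"
        using push[OF fg] by (elim exE conjE) (rule that)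
      moreover from this have "f' (\<Phi> c) * g' (\<Phi> x) = f' (\<Phi> x) * g' (\<Phi> c)"
        using Y.cross_eq[OF _ _ eq] lift c by blast
      ultimately have "l c * l x * (f c * g x) = l c * l x * (f x * g c)"
        "l c \<noteq> 0" "l x \<noteq> 0" using c by (simp_all add: algebra_simps)
      then show ?thesis by simp
    qed
    then show "q c = q x" by (rule gseparatingD[OF sep(1) c])
  qed
  define r where "r = (\<lambda>p. SOME c. c \<in> C \<and> q c = p)"
  have r: "r (q c) \<in> C \<and> q (r (q c)) = q c" if "c \<in> C" for c
    unfolding r_def by (rule someI[of _ c]) (use that in auto)
  define h where "h = (\<lambda>p. q' (\<Phi> (r p)))"
  have h: "h (q c) = q' (\<Phi> c)" if "c \<in> C" for c
    unfolding h_def using ker[of "r (q c)" c] r[OF that] that by blast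
  define s where "s = (\<lambda>p. SOME c. c \<in> C \<and> q' (\<Phi> c) = p)"
  have s: "s (q' e) \<in> C \<and> q' (\<Phi> (s (q' e))) = q' e" if "e \<in> C'" for e
    unfolding s_def by (rule someI_ex) (use surj[OF that] in blast)
  define k where "k = (\<lambda>p. q (s p))"
  have k: "k (q' (\<Phi> c)) = q c" if "c \<in> C" for c
    unfolding k_def using ker[of "s (q' (\<Phi> c))" c] s[OF lift[OF that]] that by blast
  have 1: "morphism GX GY h"
    by (rule morphism_gspace_global[OF lift _ pull]) (simp_all add: h)
  have op: "gopen C' q' A' {y \<in> q' ` C'. k y \<in> W}" if W: "gopen C q A W" for W
    unfolding gopen_def
  proof (intro conjI ballI impI)
    fix e assume e: "e \<in> C'" "q' e \<in> {y \<in> q' ` C'. k y \<in> W}"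
    obtain c where c: "c \<in> C" "q' (\<Phi> c) = q' e" using surj[OF e(1)] by blast
    then have "q c \<in> W" using e k[of c] by simp
    obtain d g where g: "g \<in> A d" "g c \<noteq> 0" "\<forall>x\<in>C. g x \<noteq> 0 \<longrightarrow> q x \<in> W"
      using W c(1) \<open>q c \<in> W\<close> by (rule X.gopenE)
    obtain m f' g' l where g': "f' \<in> A' m" "g' \<in> A' m"
        "\<forall>c\<in>C. l c \<noteq> 0 \<and> f' (\<Phi> c) = l c * g c \<and> g' (\<Phi> c) = l c * g c"
      using push[OF g(1) g(1)] by (elim exE conjE) (rule that)
    have "g' e \<noteq> 0" using Y.zero_iff[OF lift[OF c(1)] e(1) c(2) g'(2)] g'(3) c g(2) by auto
    moreover have "\<forall>x\<in>C'. g' x \<noteq> 0 \<longrightarrow> q' x \<in> {y \<in> q' ` C'. k y \<in> W}"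
    proof (intro ballI impI)
      fix x assume x: "x \<in> C'" "g' x \<noteq> 0"
      obtain y where y: "y \<in> C" "q' (\<Phi> y) = q' x" using surj[OF x(1)] by blast
      have "g' (\<Phi> y) \<noteq> 0" using Y.zero_iff[OF lift[OF y(1)] x(1) y(2) g'(2)] x(2) by blast
      then have "q y \<in> W" using g'(3) g(3) y(1) by auto
      then show "q' x \<in> {y \<in> q' ` C'. k y \<in> W}" using k[OF y(1)] y(2) x(1) by simp
    qed
    ultimately show "\<exists>d. \<exists>g\<in>A' d. g e \<noteq> 0 \<and> (\<forall>x\<in>C'. g x \<noteq> 0 \<longrightarrow> q' x \<in> {y \<in> q' ` C'. k y \<in> W})"
      using g'(2) by (rule_tac exI[of _ m], rule_tac bexI[of _ g']) (rule conjI)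
  qed auto
  have kC: "k (q' e) \<in> q ` C" if "e \<in> C'" for e
    using s[OF that] by (simp add: k_def)
  have 2: "morphism GY GX k"
    unfolding morphism_def
  proof (intro conjI allI impI)
    show "continuous_map (fs_top GY) (fs_top GX) k"
      unfolding continuous_map X.points_gspace Y.points_gspace X.openin_gspace Y.openin_gspace
      using kC op by auto
  next
    fix W \<phi> assume reg: "fs_reg GX W \<phi>"
    then have W: "gopen C q A W" by (simp add: X.reg_gspace)
    show "fs_reg GY {x \<in> points GY. k x \<in> W} (\<phi> \<circ> k)"
      unfolding Y.points_gspace
    proof (rule Y.regI[OF op[OF W]])
      fix e assume e: "e \<in> C'" "q' e \<in> {y \<in> q' ` C'. k y \<in> W}"
      obtain c where c: "c \<in> C" "q' (\<Phi> c) = q' e" using surj[OF e(1)] by blast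
      then have "q c \<in> W" using e k[of c] by simp
      obtain d f g where fg: "f \<in> A d" "g \<in> A d" "g c \<noteq> 0"
        "\<forall>x\<in>C. q x \<in> W \<longrightarrow> g x \<noteq> 0 \<longrightarrow> \<phi> (q x) = f x / g x"
        using reg c(1) \<open>q c \<in> W\<close> by (rule X.regE)
      obtain m f' g' l where g': "f' \<in> A' m" "g' \<in> A' m"
          "\<forall>c\<in>C. l c \<noteq> 0 \<and> f' (\<Phi> c) = l c * f c \<and> g' (\<Phi> c) = l c * g c"
        using push[OF fg(1,2)] by (elim exE conjE) (rule that)
      have "g' e \<noteq> 0" using Y.zero_iff[OF lift[OF c(1)] e(1) c(2) g'(2)] g'(3) c fg(3) by auto
      moreover have "\<forall>x\<in>C'. q' x \<in> {y \<in> q' ` C'. k y \<in> W} \<longrightarrow> g' x \<noteq> 0 \<longrightarrow>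
          (\<phi> \<circ> k) (q' x) = f' x / g' x"
      proof (intro ballI impI)
        fix x assume x: "x \<in> C'" "q' x \<in> {y \<in> q' ` C'. k y \<in> W}" "g' x \<noteq> 0"
        obtain y where y: "y \<in> C" "q' (\<Phi> y) = q' x" using surj[OF x(1)] by blast
        have nz: "g' (\<Phi> y) \<noteq> 0" using Y.zero_iff[OF lift[OF y(1)] x(1) y(2) g'(2)] x(3) by blast
        have ky: "k (q' x) = q y" using k[OF y(1)] y(2) by simp
        have "q y \<in> W" using x(2) ky by simp
        have "f' x / g' x = f' (\<Phi> y) / g' (\<Phi> y)"
          using Y.ratio_eq[OF lift[OF y(1)] x(1) y(2) g'(1,2)] by simp
        also have "\<dots> = f y / g y" using g'(3) y(1) by simp
        also have "\<dots> = \<phi> (q y)" using fg(4) y(1) \<open>q y \<in> W\<close> nz g'(3) by simp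
        finally show "(\<phi> \<circ> k) (q' x) = f' x / g' x" using ky by simp
      qed
      ultimately show "\<exists>d f g. f \<in> A' d \<and> g \<in> A' d \<and> g e \<noteq> 0 \<and>
         (\<forall>x\<in>C'. q' x \<in> {y \<in> q' ` C'. k y \<in> W} \<longrightarrow> g x \<noteq> 0 \<longrightarrow> (\<phi> \<circ> k) (q' x) = f x / g x)"
        using g'(1,2) by (rule_tac exI[of _ m], rule_tac exI[of _ f'], rule_tac exI[of _ g']) (intro conjI)
    qed
  qed
  have 3: "\<forall>x\<in>points GX. k (h x) = x" using h k by auto
  have 4: "\<forall>y\<in>points GY. h (k y) = y"
    using s by (auto simp: k_def h)
  show "isomorphic GX GY"
    unfolding isomorphic_def by (rule exI[of _ h], rule exI[of _ k]) (intro conjI 1 2 3 4)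
  show "isomorphic GY GX"
    unfolding isomorphic_def by (rule exI[of _ k], rule exI[of _ h]) (intro conjI 1 2 3 4)
qed

end

section \<open>Open subspaces, the diagonal, irreducibility and rational points\<close>

context graded
begin

text \<open>Restricting to a basic open set shrinks the cone and keeps the functions: since
  regularity is expressed by local fractions, no localised ring has to be formed.\<close>

lemma open_subspace_gspace:
  assumes g0: "g0 \<in> A e"
  shows "graded K {c \<in> C. g0 c \<noteq> 0} q A"
    "open_subspace (gspace C q A) (q ` {c \<in> C. g0 c \<noteq> 0}) = gspace {c \<in> C. g0 c \<noteq> 0} q A"
proof -
  let ?C = "{c \<in> C. g0 c \<noteq> 0}"
  show gr: "graded K ?C q A"
    by unfold_locales (use A_const A_add A_mult A_nz A_proj in auto)
  interpret D: graded K ?C q A by (rule gr)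
  have mem: "q x \<in> q ` ?C \<longleftrightarrow> g0 x \<noteq> 0" if "x \<in> C" for x using mem_D[OF that g0] .
  have op: "gopen ?C q A W \<longleftrightarrow> gopen C q A W \<and> W \<subseteq> q ` ?C" for W
  proof
    assume W: "gopen ?C q A W"
    then have WC: "W \<subseteq> q ` ?C" unfolding gopen_def by blast
    have "gopen C q A W" unfolding gopen_def
    proof (intro conjI ballI impI)
      show "W \<subseteq> q ` C" using WC by auto
      fix c assume c: "c \<in> C" "q c \<in> W"
      then have "g0 c \<noteq> 0" using mem[OF c(1)] WC by blast
      with c have "c \<in> ?C" by simp
      obtain d g where g: "g \<in> A d" "g c \<noteq> 0" "\<forall>x\<in>?C. g x \<noteq> 0 \<longrightarrow> q x \<in> W"
        using W \<open>c \<in> ?C\<close> c(2) by (rule D.gopenE)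
      show "\<exists>d. \<exists>g\<in>A d. g c \<noteq> 0 \<and> (\<forall>x\<in>C. g x \<noteq> 0 \<longrightarrow> q x \<in> W)"
        using A_mult[OF g(1) g0] g \<open>c \<in> ?C\<close>
        by (rule_tac exI[of _ "d + e"], rule_tac bexI[of _ "\<lambda>x. g x * g0 x"]) simp_all
    qed
    with WC show "gopen C q A W \<and> W \<subseteq> q ` ?C" by blast
  next
    assume W: "gopen C q A W \<and> W \<subseteq> q ` ?C"
    show "gopen ?C q A W" unfolding gopen_def
    proof (intro conjI ballI impI)
      show "W \<subseteq> q ` ?C" using W by blast
      fix c assume c: "c \<in> ?C" "q c \<in> W"
      then have "c \<in> C" by simp
      obtain d g where g: "g \<in> A d" "g c \<noteq> 0" "\<forall>x\<in>C. g x \<noteq> 0 \<longrightarrow> q x \<in> W"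
        using conjunct1[OF W] \<open>c \<in> C\<close> c(2) by (rule gopenE)
      then show "\<exists>d. \<exists>g\<in>A d. g c \<noteq> 0 \<and> (\<forall>x\<in>?C. g x \<noteq> 0 \<longrightarrow> q x \<in> W)"
        by (rule_tac exI[of _ d], rule_tac bexI[of _ g]) simp_all
    qed
  qed
  show "open_subspace (gspace C q A) (q ` ?C) = gspace ?C q A"
  proof (rule D.fspace_eqI)
    show "fs_top (open_subspace (gspace C q A) (q ` ?C)) = fs_top (gspace ?C q A)"
      unfolding topology_eq open_subspace_def fspace.simps openin_open_subtopology[of "fs_top (gspace C q A)", unfolded openin_gspace, OF gopen_D[OF g0]]
        D.openin_gspace op by simp
  next
    fix W \<phi> assume "fs_reg (open_subspace (gspace C q A) (q ` ?C)) W \<phi>"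
    then show "gopen ?C q A W" by (simp add: open_subspace_def op reg_gspace)
  next
    fix W \<phi> assume W: "gopen ?C q A W" and "fs_reg (open_subspace (gspace C q A) (q ` ?C)) W \<phi>"
    then have reg: "fs_reg (gspace C q A) W \<phi>" by (simp add: open_subspace_def)
    show "fs_reg (gspace ?C q A) W \<phi>"
    proof (rule D.regI[OF W])
      fix c assume c: "c \<in> ?C" "q c \<in> W"
      then have "c \<in> C" by simp
      obtain d f g where "f \<in> A d" "g \<in> A d" "g c \<noteq> 0"
        "\<forall>x\<in>C. q x \<in> W \<longrightarrow> g x \<noteq> 0 \<longrightarrow> \<phi> (q x) = f x / g x"
        using reg \<open>c \<in> C\<close> c(2) by (rule regE)
      then show "\<exists>d f g. f \<in> A d \<and> g \<in> A d \<and> g c \<noteq> 0 \<and>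
        (\<forall>x\<in>?C. q x \<in> W \<longrightarrow> g x \<noteq> 0 \<longrightarrow> \<phi> (q x) = f x / g x)"
        by (rule_tac exI[of _ d], rule_tac exI[of _ f], rule_tac exI[of _ g]) simp
    qed
  next
    fix W \<phi> assume reg: "fs_reg (gspace ?C q A) W \<phi>"
    then have W: "gopen ?C q A W" by (simp add: D.reg_gspace)
    then have W': "gopen C q A W" "W \<subseteq> q ` ?C" using op by auto
    have "fs_reg (gspace C q A) W \<phi>"
    proof (rule regI[OF W'(1)])
      fix c assume c: "c \<in> C" "q c \<in> W"
      then have "g0 c \<noteq> 0" using mem[OF c(1)] W' by blast
      with c have "c \<in> ?C" by simp
      obtain d f g where fg: "f \<in> A d" "g \<in> A d" "g c \<noteq> 0"
        "\<forall>x\<in>?C. q x \<in> W \<longrightarrow> g x \<noteq> 0 \<longrightarrow> \<phi> (q x) = f x / g x"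
        using reg \<open>c \<in> ?C\<close> c(2) by (rule D.regE)
      moreover have "g0 x \<noteq> 0" if "x \<in> C" "q x \<in> W" for x using mem[OF that(1)] W' that(2) by blast
      ultimately show "\<exists>d f g. f \<in> A d \<and> g \<in> A d \<and> g c \<noteq> 0 \<and>
        (\<forall>x\<in>C. q x \<in> W \<longrightarrow> g x \<noteq> 0 \<longrightarrow> \<phi> (q x) = f x / g x)"
        by (rule_tac exI[of _ d], rule_tac exI[of _ f], rule_tac exI[of _ g]) simp
    qed
    then show "fs_reg (open_subspace (gspace C q A) (q ` ?C)) W \<phi>"
      using W' by (simp add: open_subspace_def)
  qed
qed

text \<open>If the ratio of f and g distinguishes two points, then the antisymmetric function f(x)
  g(y) - g(x) f(y) vanishes on the diagonal and not at the given pair.\<close>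

lemma closedin_diagonal:
  assumes sep: "gseparating C q A"
  shows "closedin (fs_top (product (gspace C q A) (gspace C q A))) {(x, x) | x. x \<in> points (gspace C q A)}"
proof -
  interpret graded_pair K C q A C q A by unfold_locales
  have "\<exists>d. \<exists>g\<in>tens (A d) (A d). g p \<noteq> 0 \<and>
      (\<forall>x\<in>C \<times> C. map_prod q q x \<in> {(x, x) |x. x \<in> q ` C} \<longrightarrow> g x = 0)"
    if p: "p \<in> C \<times> C" "map_prod q q p \<notin> {(x, x) |x. x \<in> q ` C}" for p
  proof -
    obtain c x where cx: "p = (c, x)" "c \<in> C" "x \<in> C" using p(1) by blast
    then have "q c \<noteq> q x" using p(2) by auto
    with sep cx(2,3) obtain d f g where fg: "f \<in> A d" "g \<in> A d" "f c * g x \<noteq> f x * g c"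
      by (rule gseparatingE)
    have "(\<lambda>p. f (fst p) * g (snd p) - g (fst p) * f (snd p)) \<in> tens (A d) (A d)"
      by (intro XY.A_diff tens.prod fg)
    moreover have "f (fst p) * g (snd p) - g (fst p) * f (snd p) \<noteq> 0" using fg(3) cx by (simp add: mult.commute)
    moreover have "f (fst r) * g (snd r) - g (fst r) * f (snd r) = 0"
      if "r \<in> C \<times> C" "map_prod q q r \<in> {(x, x) |x. x \<in> q ` C}" for r
    proof -
      have "fst r \<in> C" "snd r \<in> C" "q (fst r) = q (snd r)" using that by auto
      from cross_eq[OF this fg(1,2)] show ?thesis by (simp add: mult.commute)
    qed
    ultimately show ?thesis
      by (rule_tac exI[of _ d],
          rule_tac bexI[of _ "\<lambda>p. f (fst p) * g (snd p) - g (fst p) * f (snd p)"]) simp_all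
  qed
  then show ?thesis
    unfolding product_gspace XY.closedin_gspace points_gspace by auto
qed

text \<open>A closed set that misses a point lies in the zero set of one homogeneous function not
  vanishing there, so primality has to be tested on pairs of homogeneous functions only.\<close>

lemma irreducible_in_gspace:
  assumes "B \<noteq> {}" "B \<subseteq> C"
    and prime: "\<And>d e f g. f \<in> A d \<Longrightarrow> g \<in> A e \<Longrightarrow> \<forall>c\<in>B. f c * g c = 0 \<Longrightarrow>
      (\<forall>c\<in>B. f c = 0) \<or> (\<forall>c\<in>B. g c = 0)"
  shows "irreducible_in (fs_top (gspace C q A)) (q ` B)"
  unfolding irreducible_in_def
proof (intro conjI allI impI)
  show "q ` B \<noteq> {}" "q ` B \<subseteq> points (gspace C q A)" using assms by auto
  fix S T assume S: "closedin (fs_top (gspace C q A)) S" and T: "closedin (fs_top (gspace C q A)) T"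
    and ST: "q ` B \<subseteq> S \<union> T"
  show "q ` B \<subseteq> S \<or> q ` B \<subseteq> T"
  proof (rule ccontr)
    assume "\<not> ?thesis"
    then obtain c x where cx: "c \<in> B" "q c \<notin> S" "x \<in> B" "q x \<notin> T" by blast
    then have "c \<in> C" "x \<in> C" using assms(2) by auto
    obtain d f where f: "f \<in> A d" "f c \<noteq> 0" "\<forall>x\<in>C. q x \<in> S \<longrightarrow> f x = 0"
      using S \<open>c \<in> C\<close> cx unfolding closedin_gspace by auto
    obtain e g where g: "g \<in> A e" "g x \<noteq> 0" "\<forall>x\<in>C. q x \<in> T \<longrightarrow> g x = 0"
      using T \<open>x \<in> C\<close> cx unfolding closedin_gspace by auto
    have "\<forall>c\<in>B. f c * g c = 0"
    proof
      fix y assume y: "y \<in> B"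
      then have "y \<in> C" "q y \<in> S \<or> q y \<in> T" using ST assms(2) by auto
      then show "f y * g y = 0" using f(3) g(3) by auto
    qed
    from prime[OF f(1) g(1) this] show False using f(2) g(2) cx by auto
  qed
qed

lemma irreducible_prime:
  assumes irr: "irreducible_in (fs_top (gspace C q A)) Z" and f: "f \<in> A d" and g: "g \<in> A e"
    and zero: "\<forall>c\<in>C. q c \<in> Z \<longrightarrow> f c * g c = 0"
  shows "(\<forall>c\<in>C. q c \<in> Z \<longrightarrow> f c = 0) \<or> (\<forall>c\<in>C. q c \<in> Z \<longrightarrow> g c = 0)"
proof -
  have Z: "Z \<subseteq> q ` C" using irr unfolding irreducible_in_def by simp
  have "Z \<subseteq> q ` {x \<in> C. f x = 0} \<union> q ` {x \<in> C. g x = 0}"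
  proof
    fix p assume "p \<in> Z"
    then obtain c where c: "c \<in> C" "p = q c" using Z by blast
    then have "f c = 0 \<or> g c = 0" using zero \<open>p \<in> Z\<close> by auto
    with c show "p \<in> q ` {x \<in> C. f x = 0} \<union> q ` {x \<in> C. g x = 0}" by auto
  qed
  then have alt: "Z \<subseteq> q ` {x \<in> C. f x = 0} \<or> Z \<subseteq> q ` {x \<in> C. g x = 0}"
    using irr closedin_zero_set[OF f] closedin_zero_set[OF g] unfolding irreducible_in_def by simp
  have zz: "\<forall>c\<in>C. q c \<in> Z \<longrightarrow> h c = 0" if "Z \<subseteq> q ` {x \<in> C. h x = 0}" "h \<in> A m" for h m
  proof (intro ballI impI)
    fix c assume c: "c \<in> C" "q c \<in> Z"
    then have "q c \<in> q ` {x \<in> C. h x = 0}" using that(1) by blast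
    then obtain x where x: "q c = q x" "x \<in> {x \<in> C. h x = 0}" by (rule imageE)
    then have "x \<in> C" "h x = 0" by simp_all
    then show "h c = 0" using zero_iff[OF c(1) \<open>x \<in> C\<close> x(1) that(2)] by simp
  qed
  from alt show ?thesis
  proof
    assume "Z \<subseteq> q ` {x \<in> C. f x = 0}"
    from zz[OF this f] show ?thesis by (rule disjI1)
  next
    assume "Z \<subseteq> q ` {x \<in> C. g x = 0}"
    from zz[OF this g] show ?thesis by (rule disjI2)
  qed
qed

text \<open>As the values at \<open>c\<close> lie in \<open>K\<close>, the function g(c) f - f(c) g
  is again defined over \<open>K\<close>. For a point that is not rational the closure may contain
  its conjugates.\<close>

lemma closedin_rational_point:
  assumes sep: "gseparating C q A" and c: "c \<in> C" "\<And>d f. f \<in> A d \<Longrightarrow> f c \<in> K"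
  shows "closedin (fs_top (gspace C q A)) {q c}"
  unfolding closedin_gspace
proof (intro conjI ballI impI)
  fix x assume x: "x \<in> C" "q x \<notin> {q c}"
  then have "q x \<noteq> q c" by simp
  with sep x(1) c(1) obtain d f g where fg: "f \<in> A d" "g \<in> A d" "f x * g c \<noteq> f c * g x"
    by (rule gseparatingE)
  have "(\<lambda>y. g c * f y - f c * g y) \<in> A d" using fg c by (intro A_diff A_smult) auto
  moreover have "g c * f x - f c * g x \<noteq> 0" using fg(3) by (simp add: mult.commute)
  moreover have "g c * f y - f c * g y = 0" if "y \<in> C" "q y \<in> {q c}" for y
    using cross_eq[OF that(1) c(1) _ fg(1,2)] that(2) by (simp add: mult.commute)
  ultimately show "\<exists>d. \<exists>g\<in>A d. g x \<noteq> 0 \<and> (\<forall>x\<in>C. q x \<in> {q c} \<longrightarrow> g x = 0)"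
    by (rule_tac exI[of _ d], rule_tac bexI[of _ "\<lambda>y. g c * f y - f c * g y"]) simp_all
qed (use c in auto)

lemma rational_pt_gspace:
  assumes "c \<in> C" "\<And>d f. f \<in> A d \<Longrightarrow> f c \<in> K"
  shows "rational_pt K (gspace C q A) (q c)"
  unfolding rational_pt_def
proof (intro conjI allI impI)
  fix U \<phi> assume U: "q c \<in> U" "fs_reg (gspace C q A) U \<phi>"
  obtain d f g where "f \<in> A d" "g \<in> A d" "g c \<noteq> 0"
    "\<forall>x\<in>C. q x \<in> U \<longrightarrow> g x \<noteq> 0 \<longrightarrow> \<phi> (q x) = f x / g x"
    using U(2) assms(1) U(1) by (rule regE)
  then show "\<phi> (q c) \<in> K" using assms U(1) by (auto intro: K_divide)
qed (use assms in simp)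

end

section \<open>Linear spans of functions\<close>

text \<open>The scalars are a parameter because two cases occur: \<open>K\<close> for normal forms,
  and all complex numbers for combinations of functions over \<open>K\<close> whose coefficients are
  values at a complex point.\<close>

inductive_set lspan :: "complex set \<Rightarrow> ('c \<Rightarrow> complex) set \<Rightarrow> ('c \<Rightarrow> complex) set"
  for S :: "complex set" and B :: "('c \<Rightarrow> complex) set" where
  zero: "(\<lambda>_. 0) \<in> lspan S B"
| base: "f \<in> B \<Longrightarrow> f \<in> lspan S B"
| add: "f \<in> lspan S B \<Longrightarrow> g \<in> lspan S B \<Longrightarrow> (\<lambda>x. f x + g x) \<in> lspan S B"
| smult: "k \<in> S \<Longrightarrow> f \<in> lspan S B \<Longrightarrow> (\<lambda>x. k * f x) \<in> lspan S B"

lemma lspan_mult: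
  assumes "f \<in> lspan S B" "g \<in> lspan S B'"
    and base: "\<And>b b'. b \<in> B \<Longrightarrow> b' \<in> B' \<Longrightarrow> (\<lambda>x. b x * b' x) \<in> lspan S B''"
  shows "(\<lambda>x. f x * g x) \<in> lspan S B''"
  using assms(1)
proof induction
  case (base b)
  from assms(2) show ?case
  proof induction
    case zero
    then show ?case using lspan.zero by simp
  next
    case (base b')
    then show ?case using assms(3) \<open>b \<in> B\<close> by blast
  next
    case (add f g)
    then show ?case using lspan.add[OF add(3,4)] by (simp add: distrib_left)
  next
    case (smult k f)
    then show ?case using lspan.smult[OF smult(1,3)] by (simp add: mult.left_commute)
  qed
next
  case zero
  then show ?case using lspan.zero by simp
next
  case (add f g)
  then show ?case using lspan.add[OF add(3,4)] by (simp add: distrib_right)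
next
  case (smult k f)
  then show ?case using lspan.smult[OF smult(1,3)] by (simp add: mult.assoc)
qed

lemma (in subfield) lspan_finite:
  assumes "finite B" "f \<in> lspan K B"
  shows "\<exists>k. (\<forall>b\<in>B. k b \<in> K) \<and> f = (\<lambda>x. \<Sum>b\<in>B. k b * b x)"
  using assms(2)
proof induction
  case zero
  then show ?case by (intro exI[of _ "\<lambda>_. 0"]) simp
next
  case (base f)
  have "(\<Sum>b\<in>B. (if b = f then 1 else 0) * b x) = f x" for x
  proof -
    have "(\<Sum>b\<in>B. (if b = f then 1 else 0) * b x) = (\<Sum>b\<in>B. if b = f then b x else 0)"
      by (rule sum.cong) auto
    then show ?thesis using assms(1) base by simp
  qed
  then show ?case by (intro exI[of _ "\<lambda>b. if b = f then 1 else 0"]) auto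
next
  case (add f g)
  then obtain k k' where "\<forall>b\<in>B. k b \<in> K" "f = (\<lambda>x. \<Sum>b\<in>B. k b * b x)"
    "\<forall>b\<in>B. k' b \<in> K" "g = (\<lambda>x. \<Sum>b\<in>B. k' b * b x)" by (elim exE conjE) (rule that)
  then show ?case by (intro exI[of _ "\<lambda>b. k b + k' b"]) (auto simp: distrib_right sum.distrib)
next
  case (smult c f)
  then obtain k where "\<forall>b\<in>B. k b \<in> K" "f = (\<lambda>x. \<Sum>b\<in>B. k b * b x)" by (elim exE conjE) (rule that)
  then show ?case using smult(1)
    by (intro exI[of _ "\<lambda>b. c * k b"]) (auto simp: sum_distrib_left mult.assoc)
qed

section \<open>Quotients by an involution\<close>

text \<open>Invariance is asked for on the cone only, since elements of \<open>A\<close> are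
  functions on the whole type and may differ from their translates elsewhere.\<close>

definition inv_funs :: "'c set \<Rightarrow> ('c \<Rightarrow> 'c) \<Rightarrow> (nat \<Rightarrow> ('c \<Rightarrow> complex) set) \<Rightarrow> nat \<Rightarrow> ('c \<Rightarrow> complex) set" where
  "inv_funs C t A d = {f \<in> A d. \<forall>c\<in>C. f (t c) = f c}"

text \<open>The involution \<open>s\<close> of the points is lifted to a map \<open>t\<close> of the
  cone. The condition \<open>inv_nz\<close> says that the invariants of degree one still have no
  base point, so that they satisfy the axioms of a graded ring themselves.\<close>

locale graded_invol = graded +
  fixes t :: "'c \<Rightarrow> 'c" and s :: "'b \<Rightarrow> 'b"
  assumes t_C: "c \<in> C \<Longrightarrow> t c \<in> C"
    and t_q: "c \<in> C \<Longrightarrow> q (t c) = s (q c)"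
    and t_A: "f \<in> A d \<Longrightarrow> (\<lambda>x. f (t x)) \<in> A d"
    and t_t: "f \<in> A d \<Longrightarrow> c \<in> C \<Longrightarrow> f (t (t c)) = f c"
    and s_s: "c \<in> C \<Longrightarrow> s (s (q c)) = q c"
    and inv_nz: "c \<in> C \<Longrightarrow> \<exists>g\<in>inv_funs C t A 1. g c \<noteq> 0"
begin

abbreviation "oq \<equiv> \<lambda>c. orbit_map s (q c)"
abbreviation "IA \<equiv> inv_funs C t A"

lemma orbit_t: "c \<in> C \<Longrightarrow> oq (t c) = oq c"
  unfolding orbit_map_def by (auto simp: t_q s_s)

lemma orbit_eq: "c \<in> C \<Longrightarrow> x \<in> C \<Longrightarrow> oq c = oq x \<longleftrightarrow> q c = q x \<or> q c = q (t x)"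
  unfolding orbit_map_def doubleton_eq_iff by (auto simp: t_q s_s)

lemma graded_inv: "graded K C oq IA"
proof unfold_locales
  fix c c' assume c: "c \<in> C" "c' \<in> C" "oq c = oq c'"
  then consider "q c = q c'" | "q c = q (t c')" using orbit_eq by blast
  then show "\<exists>l. l \<noteq> 0 \<and> (\<forall>d. \<forall>f\<in>IA d. f c' = l ^ d * f c)"
  proof cases
    case 1
    then obtain l where "l \<noteq> 0" "\<forall>d. \<forall>f\<in>A d. f c' = l ^ d * f c"
      using A_proj[OF c(1,2)] by (elim meta_impE exE conjE) auto
    then show ?thesis by (intro exI[of _ l]) (simp add: inv_funs_def)
  next
    case 2
    obtain l where "l \<noteq> 0" "\<forall>d. \<forall>f\<in>A d. f (t c') = l ^ d * f c"
      using A_proj[OF c(1) t_C[OF c(2)] 2] by (elim exE conjE) (rule that)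
    then show ?thesis using c(2) by (intro exI[of _ l]) (simp add: inv_funs_def)
  qed
next
  fix c assume "c \<in> C"
  then show "\<exists>g\<in>IA 1. g c \<noteq> 0" by (rule inv_nz)
qed (auto simp: inv_funs_def intro: A_const A_add A_mult)

text \<open>An open set that is a union of orbits contains a basic open set around both
  \<open>c\<close> and \<open>t c\<close> by avoidance. The product of its equation with the
  translate is invariant and still nonzero at \<open>c\<close>.\<close>

lemma gopen_quotient:
  "gopen C oq IA W \<longleftrightarrow> W \<subseteq> orbit_map s ` q ` C \<and> gopen C q A {x \<in> q ` C. orbit_map s x \<in> W}"
proof
  assume W: "gopen C oq IA W"
  have "gopen C q A {x \<in> q ` C. orbit_map s x \<in> W}"
    unfolding gopen_def
  proof (intro conjI ballI impI)
    fix c assume c: "c \<in> C" "q c \<in> {x \<in> q ` C. orbit_map s x \<in> W}"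
    then have "oq c \<in> W" by simp
    obtain d g where "g \<in> IA d" "g c \<noteq> 0" "\<forall>x\<in>C. g x \<noteq> 0 \<longrightarrow> oq x \<in> W"
      using W c(1) \<open>oq c \<in> W\<close> by (rule graded.gopenE[OF graded_inv])
    then show "\<exists>d. \<exists>g\<in>A d. g c \<noteq> 0 \<and> (\<forall>x\<in>C. g x \<noteq> 0 \<longrightarrow> q x \<in> {x \<in> q ` C. orbit_map s x \<in> W})"
      by (rule_tac exI[of _ d], rule_tac bexI[of _ g]) (simp_all add: inv_funs_def)
  qed auto
  moreover have "W \<subseteq> orbit_map s ` q ` C" using W unfolding gopen_def by (simp add: image_image)
  ultimately show "W \<subseteq> orbit_map s ` q ` C \<and> gopen C q A {x \<in> q ` C. orbit_map s x \<in> W}" by blast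
next
  assume W: "W \<subseteq> orbit_map s ` q ` C \<and> gopen C q A {x \<in> q ` C. orbit_map s x \<in> W}"
  show "gopen C oq IA W"
    unfolding gopen_def
  proof (intro conjI ballI impI)
    show "W \<subseteq> oq ` C" using W by (simp add: image_image)
    fix c assume c: "c \<in> C" "oq c \<in> W"
    have "\<exists>d\<ge>1. \<exists>g\<in>A d. (\<forall>c\<in>{c, t c}. g c \<noteq> 0) \<and>
       (\<forall>x\<in>C. g x \<noteq> 0 \<longrightarrow> q x \<in> {x \<in> q ` C. orbit_map s x \<in> W})"
    proof (rule gopen_avoid[OF conjunct2[OF W]])
      show "{c, t c} \<subseteq> C" using c t_C by simp
      show "q ` {c, t c} \<subseteq> {x \<in> q ` C. orbit_map s x \<in> W}" using c t_C orbit_t[OF c(1)] by simp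
    qed simp_all
    then obtain d g where g: "g \<in> A d" "g c \<noteq> 0" "g (t c) \<noteq> 0"
      "\<forall>x\<in>C. g x \<noteq> 0 \<longrightarrow> q x \<in> {x \<in> q ` C. orbit_map s x \<in> W}" by auto
    have "(\<lambda>x. g x * g (t x)) \<in> IA (d + d)"
      using A_mult[OF g(1) t_A[OF g(1)]] t_t[OF g(1)] by (simp add: inv_funs_def mult.commute)
    then show "\<exists>d. \<exists>g\<in>IA d. g c \<noteq> 0 \<and> (\<forall>x\<in>C. g x \<noteq> 0 \<longrightarrow> oq x \<in> W)"
      by (rule_tac exI[of _ "d + d"], rule_tac bexI[of _ "\<lambda>x. g x * g (t x)"]) (use g in auto)
  qed
qed

text \<open>The substance is that an invariant regular function is locally a fraction of invariants.
  A fraction f/g valid near \<open>c\<close> is turned into one whose denominator is nonzero at both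
  \<open>c\<close> and \<open>t c\<close>, and is then averaged with its translate.\<close>

lemma quotient_gspace: "quotient_by (gspace C q A) s = gspace C oq IA"
proof -
  interpret Q: graded K C oq IA by (rule graded_inv)
  show ?thesis
  proof (rule Q.fspace_eqI)
    show "fs_top (quotient_by (gspace C q A) s) = fs_top (gspace C oq IA)"
      unfolding topology_eq openin_quotient_by Q.openin_gspace gopen_quotient points_gspace
        openin_gspace by simp
  next
    fix W \<phi> assume "fs_reg (quotient_by (gspace C q A) s) W \<phi>"
    then show "gopen C oq IA W" unfolding gopen_quotient by (simp add: quotient_by_def reg_gspace)
  next
    fix W \<phi> assume "fs_reg (gspace C oq IA) W \<phi>"
    then have reg: "fs_reg (gspace C oq IA) W \<phi>" and W: "gopen C oq IA W" by (simp_all add: Q.reg_gspace)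
    have "fs_reg (gspace C q A) {x \<in> q ` C. orbit_map s x \<in> W} (\<phi> \<circ> orbit_map s)"
    proof (rule regI)
      show "gopen C q A {x \<in> q ` C. orbit_map s x \<in> W}" using W gopen_quotient by blast
      fix c assume c: "c \<in> C" "q c \<in> {x \<in> q ` C. orbit_map s x \<in> W}"
      then have "oq c \<in> W" by simp
      obtain d f g where "f \<in> IA d" "g \<in> IA d" "g c \<noteq> 0"
        "\<forall>x\<in>C. oq x \<in> W \<longrightarrow> g x \<noteq> 0 \<longrightarrow> \<phi> (oq x) = f x / g x"
        using reg c(1) \<open>oq c \<in> W\<close> by (rule Q.regE)
      then show "\<exists>d f g. f \<in> A d \<and> g \<in> A d \<and> g c \<noteq> 0 \<and>
        (\<forall>x\<in>C. q x \<in> {x \<in> q ` C. orbit_map s x \<in> W} \<longrightarrow> g x \<noteq> 0 \<longrightarrow> (\<phi> \<circ> orbit_map s) (q x) = f x / g x)"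
        by (rule_tac exI[of _ d], rule_tac exI[of _ f], rule_tac exI[of _ g]) (simp add: inv_funs_def)
    qed
    then show "fs_reg (quotient_by (gspace C q A) s) W \<phi>"
      using W gopen_quotient[of W] by (simp add: quotient_by_def)
  next
    fix W \<phi> assume W: "gopen C oq IA W" and "fs_reg (quotient_by (gspace C q A) s) W \<phi>"
    then have reg: "fs_reg (gspace C q A) {x \<in> q ` C. orbit_map s x \<in> W} (\<phi> \<circ> orbit_map s)"
      by (simp add: quotient_by_def)
    show "fs_reg (gspace C oq IA) W \<phi>"
    proof (rule Q.regI[OF W])
      fix c assume c: "c \<in> C" "oq c \<in> W"
      then have qc: "q c \<in> {x \<in> q ` C. orbit_map s x \<in> W}" by simp
      obtain d f g where fg: "f \<in> A d" "g \<in> A d" "g c \<noteq> 0"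
        "\<forall>x\<in>C. q x \<in> {x \<in> q ` C. orbit_map s x \<in> W} \<longrightarrow> g x \<noteq> 0 \<longrightarrow> (\<phi> \<circ> orbit_map s) (q x) = f x / g x"
        using reg c(1) qc by (rule regE)
      \<comment> \<open>After extending by \<open>g\<close>, the equation between \<open>f2\<close>
        and \<open>g2\<close> holds on the whole preimage of \<open>W\<close>: where
        \<open>g\<close> vanishes both sides are zero.\<close>
      define f2 g2 where "f2 = (\<lambda>x. f x * g x)" and "g2 = (\<lambda>x. g x * g x)"
      have A2: "f2 \<in> A (d + d)" "g2 \<in> A (d + d)" unfolding f2_def g2_def by (intro A_mult fg)+
      have \<phi>2: "\<phi> (oq x) * g2 x = f2 x" if "x \<in> C" "oq x \<in> W" for x
      proof (cases "g x = 0")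
        case False
        then have "\<phi> (oq x) = f x / g x" using fg(4) that by simp
        then show ?thesis using False by (simp add: f2_def g2_def)
      qed (simp add: f2_def g2_def)
      \<comment> \<open>The translate of \<open>g2\<close> is added exactly when \<open>g2\<close>
        vanishes at \<open>t c\<close>. In either case \<open>g3\<close> is nonzero at both points
        of the orbit.\<close>
      define k :: complex where "k = (if g2 (t c) = 0 then 1 else 0)"
      have kK: "k \<in> K" by (auto simp: k_def)
      define f3 g3 where "f3 = (\<lambda>x. f2 x + k * f2 (t x))" and "g3 = (\<lambda>x. g2 x + k * g2 (t x))"
      have A3: "f3 \<in> A (d + d)" "g3 \<in> A (d + d)" unfolding f3_def g3_def by (intro A_add A_smult t_A A2 kK)+
      have g3c: "g3 c \<noteq> 0" "g3 (t c) \<noteq> 0"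
        using fg(3) t_t[OF A2(2) c(1)] by (auto simp: g3_def k_def g2_def)
      have \<phi>3: "\<phi> (oq x) * g3 x = f3 x" if "x \<in> C" "oq x \<in> W" for x
      proof -
        have "\<phi> (oq x) * g2 (t x) = f2 (t x)" using \<phi>2[of "t x"] that t_C orbit_t by simp
        with \<phi>2[OF that] show ?thesis by (simp add: f3_def g3_def algebra_simps)
      qed
      \<comment> \<open>This is the average of f3/g3 and its translate, over the norm of
        \<open>g3\<close> as denominator.\<close>
      define N G where "N = (\<lambda>x. (1/2) * (f3 x * g3 (t x) + f3 (t x) * g3 x))" and "G = (\<lambda>x. g3 x * g3 (t x))"
      have "(1/2 :: complex) \<in> K" by (rule K_divide) auto
      have tt: "f3 (t (t x)) = f3 x" "g3 (t (t x)) = g3 x" if "x \<in> C" for x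
        using t_t[OF A3(1) that] t_t[OF A3(2) that] by auto
      have "N \<in> IA ((d + d) + (d + d))"
        unfolding inv_funs_def N_def
        by (intro CollectI conjI A_smult A_add A_mult t_A A3 \<open>1/2 \<in> K\<close>) (simp add: tt add.commute)
      moreover have "G \<in> IA ((d + d) + (d + d))"
        unfolding inv_funs_def G_def
        by (intro CollectI conjI A_mult t_A A3) (simp add: tt mult.commute)
      moreover have "G c \<noteq> 0" using g3c by (simp add: G_def)
      moreover have "\<phi> (oq x) = N x / G x" if x: "x \<in> C" "oq x \<in> W" "G x \<noteq> 0" for x
      proof -
        have 1: "f3 (t x) = \<phi> (oq x) * g3 (t x)" using \<phi>3[of "t x"] x t_C orbit_t by simp
        have 2: "f3 x = \<phi> (oq x) * g3 x" using \<phi>3[OF x(1,2)] by simp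
        have "N x = \<phi> (oq x) * G x" unfolding N_def G_def 1 2 by (simp add: algebra_simps)
        then show ?thesis using x(3) by simp
      qed
      ultimately show "\<exists>d f g. f \<in> IA d \<and> g \<in> IA d \<and> g c \<noteq> 0 \<and>
        (\<forall>x\<in>C. oq x \<in> W \<longrightarrow> g x \<noteq> 0 \<longrightarrow> \<phi> (oq x) = f x / g x)"
        by (rule_tac exI[of _ "(d + d) + (d + d)"], rule_tac exI[of _ N], rule_tac exI[of _ G]) simp
    qed
  qed
qed

lemma lspan_A_mult: "f \<in> lspan UNIV (A d) \<Longrightarrow> g \<in> lspan UNIV (A e) \<Longrightarrow> (\<lambda>x. f x * g x) \<in> lspan UNIV (A (d + e))"
  by (rule lspan_mult) (auto intro: lspan.base A_mult)

lemma lspan_A_power: "f \<in> lspan UNIV (A d) \<Longrightarrow> (\<lambda>x. f x ^ n) \<in> lspan UNIV (A (n * d))"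
proof (induction n)
  case 0
  show ?case using lspan.base[OF A_const[OF K_one]] by simp
next
  case (Suc n)
  then show ?case using lspan_A_mult[of f d "\<lambda>x. f x ^ n" "n * d"] by simp
qed

text \<open>For \<open>c\<close> and \<open>x\<close> in different orbits there is a complex
  combination \<open>F\<close> of functions over \<open>K\<close> that vanishes at \<open>c\<close>
  but at neither \<open>x\<close> nor \<open>t x\<close>. The product of \<open>F\<close> and its
  translate is invariant and separates the orbits. It lies in the complex span of the invariants
  over \<open>K\<close>, and this suffices because the condition on ratios is linear in each
  function.\<close>

lemma gseparating_quotient:
  assumes sep: "gseparating C q A"
  shows "gseparating C oq IA"
  unfolding gseparating_def
proof (intro ballI impI)
  fix c x assume cx: "c \<in> C" "x \<in> C" and eq: "\<forall>d. \<forall>f\<in>IA d. \<forall>g\<in>IA d. f c * g x = f x * g c"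
  show "oq c = oq x"
  proof (rule ccontr)
    assume "oq c \<noteq> oq x"
    then have ne: "q c \<noteq> q x" "q c \<noteq> q (t x)" using orbit_eq[OF cx] by auto
    have tx: "t x \<in> C" by (rule t_C[OF cx(2)])
    interpret Q: graded K C oq IA by (rule graded_inv)
    have *: "\<exists>d L. d \<ge> 1 \<and> L \<in> lspan UNIV (A d) \<and> L c = 0 \<and> L y \<noteq> 0" if y: "y \<in> C" "q c \<noteq> q y" for y
    proof -
      obtain d f g where fg: "f \<in> A d" "g \<in> A d" "f c * g y \<noteq> f y * g c"
        using sep cx(1) y by (rule gseparatingE)
      obtain w where w: "w \<in> A 1" "w y \<noteq> 0" using A_nz y(1) by blast
      \<comment> \<open>The coefficients are the values of f and g at \<open>c\<close>, hence
        complex. The factor \<open>w\<close> makes the degree positive.\<close>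
      define L where "L = (\<lambda>z. (f c * g z + (- g c) * f z) * w z)"
      have "L \<in> lspan UNIV (A (d + 1))" unfolding L_def
        by (intro lspan_A_mult lspan.add lspan.smult lspan.base fg w UNIV_I)
      moreover have "L c = 0" "L y \<noteq> 0" using fg(3) w(2) by (auto simp: L_def algebra_simps)
      ultimately show ?thesis by (rule_tac exI[of _ "d + 1"], rule_tac exI[of _ L]) simp
    qed
    obtain d1 L1 where L1: "d1 \<ge> 1" "L1 \<in> lspan UNIV (A d1)" "L1 c = 0" "L1 x \<noteq> 0"
      using *[OF cx(2) ne(1)] by (elim exE conjE) (rule that)
    obtain d2 L2 where L2: "d2 \<ge> 1" "L2 \<in> lspan UNIV (A d2)" "L2 c = 0" "L2 (t x) \<noteq> 0"
      using *[OF tx ne(2)] by (elim exE conjE) (rule that)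
    obtain k where k: "k \<in> K" "k \<notin> {- (L1 x ^ d2 / L2 x ^ d1), - (L1 (t x) ^ d2 / L2 (t x) ^ d1)}"
      using K_avoid[of "{- (L1 x ^ d2 / L2 x ^ d1), - (L1 (t x) ^ d2 / L2 (t x) ^ d1)}"] by auto
    obtain k where k: "k \<noteq> 0" "k \<notin> {- (L1 x ^ d2 / L2 x ^ d1), - (L1 (t x) ^ d2 / L2 (t x) ^ d1)}"
      using K_avoid[of "{0, - (L1 x ^ d2 / L2 x ^ d1), - (L1 (t x) ^ d2 / L2 (t x) ^ d1)}"] by auto
    define F where "F = (\<lambda>z. L1 z ^ d2 + k * L2 z ^ d1)"
    have F: "F \<in> lspan UNIV (A (d1 * d2))"
      unfolding F_def using lspan_A_power[OF L1(2), of d2] lspan_A_power[OF L2(2), of d1]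
      by (intro lspan.add lspan.smult) (simp_all add: mult.commute)
    have Fc: "F c = 0" using L1 L2 by (simp add: F_def power_0_left)
    have Fx: "F x \<noteq> 0"
    proof (cases "L2 x = 0")
      case False
      have "k \<noteq> - (L1 x ^ d2 / L2 x ^ d1)" using k by simp
      then show ?thesis using False by (simp add: F_def field_simps eq_neg_iff_add_eq_0)
    qed (use L1 L2 in \<open>simp add: F_def power_0_left\<close>)
    have Ftx: "F (t x) \<noteq> 0"
    proof -
      have "k \<noteq> - (L1 (t x) ^ d2 / L2 (t x) ^ d1)" using k by simp
      then show ?thesis using L2(4) by (simp add: F_def field_simps eq_neg_iff_add_eq_0)
    qed
    have Ft: "(\<lambda>z. f (t z)) \<in> lspan UNIV (A d)" if "f \<in> lspan UNIV (A d)" for f d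
      using that by induction (auto intro: lspan.intros t_A)
    have Ftt: "f (t (t z)) = f z" if "f \<in> lspan UNIV (A d)" "z \<in> C" for f d z
      using that(1) by induction (auto intro: t_t that(2))
    define D where "D = d1 * d2 + d1 * d2"
    have N: "(\<lambda>z. F z * F (t z)) \<in> lspan UNIV (A D)"
      unfolding D_def by (intro lspan_A_mult F Ft)
    \<comment> \<open>Averaging over the involution is linear, so it maps the complex span of
      \<open>A d\<close> to the complex span of the invariants.\<close>
    have sym: "\<exists>N'\<in>lspan UNIV (IA d). \<forall>z\<in>C. N' z = (1/2) * (N z + N (t z))" if "N \<in> lspan UNIV (A d)" for N d
      using that
    proof induction
      case zero
      show ?case by (rule bexI[OF _ lspan.zero]) simp
    next
      case (base f)
      have "(1/2 :: complex) \<in> K" by (rule K_divide) auto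
      then have "(\<lambda>z. (1/2) * (f z + f (t z))) \<in> IA d"
        unfolding inv_funs_def using t_t[OF base]
        by (intro CollectI conjI ballI A_smult A_add t_A base) (simp_all add: add.commute)
      then show ?case by (intro bexI[OF _ lspan.base]) auto
    next
      case (add f g)
      then obtain f' g' where "f' \<in> lspan UNIV (IA d)" "\<forall>z\<in>C. f' z = (1/2) * (f z + f (t z))"
        "g' \<in> lspan UNIV (IA d)" "\<forall>z\<in>C. g' z = (1/2) * (g z + g (t z))" by (elim bexE) (rule that)
      then show ?case by (intro bexI[OF _ lspan.add[of f' _ _ g']]) (simp_all add: algebra_simps)
    next
      case (smult k f)
      then obtain f' where "f' \<in> lspan UNIV (IA d)" "\<forall>z\<in>C. f' z = (1/2) * (f z + f (t z))"
        by (elim bexE) (rule that)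
      then show ?case by (intro bexI[OF _ lspan.smult[of k _ f']]) (simp_all add: algebra_simps)
    qed
    obtain N where N': "N \<in> lspan UNIV (IA D)" "\<forall>z\<in>C. N z = (1/2) * (F z * F (t z) + F (t z) * F (t (t z)))"
      using sym[OF N] by (elim bexE) (rule that)
    obtain w where w: "w \<in> IA D" "w c \<noteq> 0" using Q.A_nz_deg cx(1) by blast
    \<comment> \<open>Equality of ratios extends from invariants over \<open>K\<close> to their
      complex span, once the second function \<open>w\<close> is fixed.\<close>
    have "M c * w x = M x * w c" if "M \<in> lspan UNIV (IA D)" for M
      using that
    proof induction
      case (base f)
      then show ?case using eq w(1) by blast
    qed (auto simp: algebra_simps)
    moreover have "N c = (1/2) * (F c * F (t c) + F (t c) * F (t (t c)))" using N'(2) cx(1) by blast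
    then have "N c = 0" using Fc Ftt[OF F cx(1)] by simp
    ultimately have "N x * w c = 0" using N'(1) by (metis mult_zero_left)
    then have "N x = 0" using w(2) by simp
    moreover have "N x = (1/2) * (F x * F (t x) + F (t x) * F (t (t x)))" using N'(2) cx(2) by blast
    then have "N x = F x * F (t x)" using Ftt[OF F cx(2)] by simp
    ultimately show False using Fx Ftx by simp
  qed
qed

end

section \<open>Linear dependence and the dimension bound\<close>

text \<open>Gaussian elimination: a pivot \<open>p\<close> for the coordinate \<open>j\<close>
  clears this coordinate from the other vectors, a relation among the cleared vectors exists by
  induction, and the coefficient of the pivot is then forced. All divisions stay in
  \<open>K\<close>.\<close>

lemma (in subfield) K_dependent:
  assumes "finite J" "finite I" "card J < card I" "\<And>i j. i \<in> I \<Longrightarrow> j \<in> J \<Longrightarrow> m i j \<in> K"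
  shows "\<exists>u. (\<forall>i\<in>I. u i \<in> K) \<and> (\<exists>i\<in>I. u i \<noteq> 0) \<and> (\<forall>j\<in>J. (\<Sum>i\<in>I. u i * m i j) = 0)"
  using assms
proof (induction J arbitrary: I m rule: finite_induct)
  case empty
  then have "I \<noteq> {}" by auto
  then show ?case by (intro exI[of _ "\<lambda>_. 1"]) auto
next
  case (insert j J)
  show ?case
  proof (cases "\<forall>i\<in>I. m i j = 0")
    case True
    obtain u where "\<forall>i\<in>I. u i \<in> K" "\<exists>i\<in>I. u i \<noteq> 0" "\<forall>j\<in>J. (\<Sum>i\<in>I. u i * m i j) = 0"
      using insert.IH[of I m] insert.prems insert.hyps by (elim meta_impE exE conjE) auto
    with True show ?thesis by (intro exI[of _ u]) auto
  next
    case False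
    then obtain p where p: "p \<in> I" "m p j \<noteq> 0" by blast
    define I' m' where "I' = I - {p}" and "m' = (\<lambda>i k. m i k - m i j / m p j * m p k)"
    have "card J < card I'" "finite I'" using insert p by (auto simp: I'_def)
    moreover have "m' i k \<in> K" if "i \<in> I'" "k \<in> J" for i k
      unfolding m'_def using that p insert.prems(3) by (intro K_diff K_mult K_divide) (auto simp: I'_def)
    ultimately obtain u where u: "\<forall>i\<in>I'. u i \<in> K" "\<exists>i\<in>I'. u i \<noteq> 0" "\<forall>k\<in>J. (\<Sum>i\<in>I'. u i * m' i k) = 0"
      using insert.IH[of I' m'] by (elim meta_impE exE conjE) auto
    define v where "v = (\<lambda>i. if i = p then - (\<Sum>i\<in>I'. u i * m i j / m p j) else u i)"
    have sp: "(\<Sum>i\<in>I. v i * m i k) = v p * m p k + (\<Sum>i\<in>I'. u i * m i k)" for k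
    proof -
      have "(\<Sum>i\<in>I. v i * m i k) = v p * m p k + (\<Sum>i\<in>I'. v i * m i k)"
        unfolding I'_def by (rule sum.remove) (use p insert.prems in auto)
      also have "(\<Sum>i\<in>I'. v i * m i k) = (\<Sum>i\<in>I'. u i * m i k)"
        by (rule sum.cong) (auto simp: v_def I'_def)
      finally show ?thesis .
    qed
    have "\<forall>i\<in>I. v i \<in> K"
    proof
      fix i assume "i \<in> I"
      show "v i \<in> K"
      proof (cases "i = p")
        case True
        then show ?thesis using u(1) p insert.prems(3)
          by (auto simp: v_def I'_def intro!: K_uminus K_sum K_divide K_mult)
      next
        case False
        then show ?thesis using u(1) \<open>i \<in> I\<close> by (simp add: v_def I'_def)
      qed
    qed
    moreover have "\<exists>i\<in>I. v i \<noteq> 0" using u(2) by (auto simp: v_def I'_def)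
    moreover have "(\<Sum>i\<in>I. v i * m i k) = 0" if "k \<in> insert j J" for k
    proof (cases "k = j")
      case True
      have "v p * m p j = - (\<Sum>i\<in>I'. u i * m i j)"
        using p(2) by (simp add: v_def sum_divide_distrib[symmetric])
      then show ?thesis unfolding True sp by simp
    next
      case False
      then have "k \<in> J" using that by simp
      have "(\<Sum>i\<in>I'. u i * m' i k) = (\<Sum>i\<in>I'. u i * m i k) - (\<Sum>i\<in>I'. u i * m i j / m p j) * m p k"
        unfolding m'_def sum_distrib_right sum_subtractf[symmetric] by (rule sum.cong) (auto simp: algebra_simps)
      also have "\<dots> = v p * m p k + (\<Sum>i\<in>I'. u i * m i k)" by (simp add: v_def)
      finally show ?thesis unfolding sp using u(3) \<open>k \<in> J\<close> by simp
    qed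
    ultimately show ?thesis by (intro exI[of _ v]) auto
  qed
qed

context graded
begin

lemma A_sum:
  assumes "finite I" "I \<noteq> {}" "\<And>i. i \<in> I \<Longrightarrow> f i \<in> A d"
  shows "(\<lambda>x. \<Sum>i\<in>I. f i x) \<in> A d"
  using assms
proof (induction I rule: finite_ne_induct)
  case (insert i I)
  then have "(\<lambda>x. f i x + (\<Sum>i\<in>I. f i x)) \<in> A d" by (intro A_add) auto
  then show ?case using insert.hyps by simp
qed simp

text \<open>
  If a polynomial in G vanishes on the irreducible set Z, then its lowest coefficient vanishes
  wherever in Z the function G does.
\<close>

lemma lowest_coeff_vanishes:
  assumes irr: "irreducible_in (fs_top (gspace C q A)) Z" and G: "G \<in> A e"
    and nz: "c0 \<in> C" "q c0 \<in> Z" "G c0 \<noteq> 0"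
    and Z': "Z' \<subseteq> Z" "\<And>c. c \<in> C \<Longrightarrow> q c \<in> Z' \<Longrightarrow> G c = 0"
    and H: "\<And>i. i < M \<Longrightarrow> H i \<in> A (D - i * e)" and D: "M * e \<le> D"
    and j: "j < M" "\<And>i c. i < j \<Longrightarrow> c \<in> C \<Longrightarrow> H i c = 0"
    and sum: "\<And>c. c \<in> C \<Longrightarrow> q c \<in> Z \<Longrightarrow> (\<Sum>i<M. G c ^ i * H i c) = 0"
    and c: "c \<in> C" "q c \<in> Z'"
  shows "H j c = 0"
proof -
  define S where "S = (\<lambda>c. \<Sum>i\<in>{j..<M}. G c ^ (i - j) * H i c)"
  have S: "S \<in> A (D - j * e)"
    unfolding S_def
  proof (rule A_sum)
    fix i assume i: "i \<in> {j..<M}"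
    then have "i * e \<le> D" using D by (meson atLeastLessThan_iff le_trans less_imp_le mult_le_mono1)
    have "j * e \<le> i * e" using i by simp
    have "(i - j) * e + (D - i * e) = D - j * e"
      using \<open>i * e \<le> D\<close> \<open>j * e \<le> i * e\<close> by (simp add: diff_mult_distrib)
    with A_mult[OF A_power[OF G, of "i - j"] H[of i]] i
    show "(\<lambda>c. G c ^ (i - j) * H i c) \<in> A (D - j * e)" by simp
  qed (use j in auto)
  have GS: "(\<Sum>i<M. G c ^ i * H i c) = G c ^ j * S c" if "c \<in> C" for c
  proof -
    have "(\<Sum>i<M. G c ^ i * H i c) = (\<Sum>i\<in>{j..<M}. G c ^ i * H i c)"
      by (rule sum.mono_neutral_right) (use j(2) that in auto)
    also have "\<dots> = (\<Sum>i\<in>{j..<M}. G c ^ j * (G c ^ (i - j) * H i c))"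
      by (rule sum.cong) (auto simp: mult.assoc[symmetric] power_add[symmetric])
    finally show ?thesis by (simp add: S_def sum_distrib_left)
  qed
  have "(\<forall>c\<in>C. q c \<in> Z \<longrightarrow> G c ^ j = 0) \<or> (\<forall>c\<in>C. q c \<in> Z \<longrightarrow> S c = 0)"
    by (rule irreducible_prime[OF irr A_power[OF G] S]) (use GS sum in auto)
  then have "\<forall>c\<in>C. q c \<in> Z \<longrightarrow> S c = 0" using nz by auto
  then have "S c = 0" using c Z'(1) by auto
  moreover have "S c = G c ^ (j - j) * H j c"
  proof -
    have "S c = (\<Sum>i\<in>{j}. G c ^ (i - j) * H i c)" unfolding S_def
      by (rule sum.mono_neutral_right) (use Z'(2)[OF c] j(1) in auto)
    then show ?thesis by simp
  qed
  ultimately show ?thesis by simp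
qed

text \<open>
  A chain of length three provides four forms of equal degree with linearly independent monomials;
  there are too many of them for a ring that grows quadratically.
\<close>

lemma irreducible_chain_le_2:
  assumes span: "\<And>d. \<exists>B. finite B \<and> card B \<le> k * (d + 1)\<^sup>2 \<and> (\<forall>f\<in>A d. \<exists>g\<in>lspan K B. \<forall>c\<in>C. f c = g c)"
    and chain: "irreducible_chain (fs_top (gspace C q A)) m Z"
  shows "m \<le> 2"
proof (rule ccontr)
  assume "\<not> m \<le> 2"
  then have m: "m \<ge> 3" by simp
  have irr: "irreducible_in (fs_top (gspace C q A)) (Z i)" and cl: "closedin (fs_top (gspace C q A)) (Z i)"
    if "i \<le> 3" for i
    using chain m that unfolding irreducible_chain_def by auto
  have sub: "Z i \<subset> Z (Suc i)" if "i < 3" for i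
    using chain m that unfolding irreducible_chain_def by auto
  \<comment> \<open>A function that vanishes on one member of the chain but not on the next.
    Multiplying by a function of degree one makes its degree positive, so that its powers can be
    brought to any multiple of that degree.\<close>
  have step: "\<exists>e g c. e \<ge> 1 \<and> g \<in> A e \<and> (\<forall>c\<in>C. q c \<in> Z i \<longrightarrow> g c = 0) \<and> c \<in> C \<and> q c \<in> Z (Suc i) \<and> g c \<noteq> 0"
    if i: "i < 3" for i
  proof -
    obtain p where p: "p \<in> Z (Suc i)" "p \<notin> Z i" using sub[OF i] by blast
    moreover have "Z (Suc i) \<subseteq> q ` C" using cl[of "Suc i"] i by (simp add: closedin_gspace)
    ultimately obtain c where c: "c \<in> C" "p = q c" by blast
    have "\<exists>d. \<exists>g\<in>A d. g c \<noteq> 0 \<and> (\<forall>x\<in>C. q x \<in> Z i \<longrightarrow> g x = 0)"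
      using cl[of i] i c p by (simp add: closedin_gspace)
    then obtain d g where g: "g \<in> A d" "g c \<noteq> 0" "\<forall>x\<in>C. q x \<in> Z i \<longrightarrow> g x = 0"
      by (elim exE bexE conjE) (rule that)
    obtain w where w: "w \<in> A 1" "w c \<noteq> 0" using A_nz c(1) by blast
    show ?thesis using A_mult[OF g(1) w(1)] g w c p(1)
      by (rule_tac exI[of _ "d + 1"], rule_tac exI[of _ "\<lambda>x. g x * w x"], rule_tac exI[of _ c]) simp
  qed
  obtain e1 g1 c1 where g1: "e1 \<ge> 1" "g1 \<in> A e1" "\<forall>c\<in>C. q c \<in> Z 0 \<longrightarrow> g1 c = 0"
    "c1 \<in> C" "q c1 \<in> Z (Suc 0)" "g1 c1 \<noteq> 0" using step[of 0] by (elim meta_impE exE conjE) auto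
  obtain e2 g2 c2 where g2: "e2 \<ge> 1" "g2 \<in> A e2" "\<forall>c\<in>C. q c \<in> Z 1 \<longrightarrow> g2 c = 0"
    "c2 \<in> C" "q c2 \<in> Z (Suc 1)" "g2 c2 \<noteq> 0" using step[of 1] by (elim meta_impE exE conjE) auto
  obtain e3 g3 c3 where g3: "e3 \<ge> 1" "g3 \<in> A e3" "\<forall>c\<in>C. q c \<in> Z 2 \<longrightarrow> g3 c = 0"
    "c3 \<in> C" "q c3 \<in> Z (Suc 2)" "g3 c3 \<noteq> 0" using step[of 2] by (elim meta_impE exE conjE) auto
  obtain c0 where c0: "c0 \<in> C" "q c0 \<in> Z 0"
    using irr[of 0] cl[of 0] unfolding irreducible_in_def closedin_gspace by blast
  obtain g0 where g0: "g0 \<in> A 1" "g0 c0 \<noteq> 0" using A_nz c0 by blast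
  \<comment> \<open>Raising each of the four functions to a suitable power gives all of them the
    degree \<open>e\<close>.\<close>
  define e where "e = e1 * e2 * e3"
  define G0 G1 G2 G3 where "G0 = (\<lambda>x. g0 x ^ e)" and "G1 = (\<lambda>x. g1 x ^ (e2 * e3))"
    and "G2 = (\<lambda>x. g2 x ^ (e1 * e3))" and "G3 = (\<lambda>x. g3 x ^ (e1 * e2))"
  have G: "G0 \<in> A e" "G1 \<in> A e" "G2 \<in> A e" "G3 \<in> A e"
    using A_power[OF g0(1), of e] A_power[OF g1(2), of "e2 * e3"] A_power[OF g2(2), of "e1 * e3"]
      A_power[OF g3(2), of "e1 * e2"]
    unfolding e_def G0_def G1_def G2_def G3_def by (simp_all add: ac_simps)
  have Gz: "G1 c = 0" if "c \<in> C" "q c \<in> Z 0" for c using g1 g2 g3 that by (simp add: G1_def power_0_left)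
  have Gz2: "G2 c = 0" if "c \<in> C" "q c \<in> Z 1" for c using g1 g2 g3 that by (simp add: G2_def power_0_left)
  have Gz3: "G3 c = 0" if "c \<in> C" "q c \<in> Z 2" for c using g1 g2 g3 that by (simp add: G3_def power_0_left)
  \<comment> \<open>\<open>N\<close> is three times \<open>M\<close> so that the exponent of
    \<open>G0\<close> stays nonnegative. There are M^3 monomials against at most k (N e + 1)^2 <=
    M^2 k (3 e + 1)^2 functions in the spanning set, and \<open>M\<close> exceeds k (3 e + 1)^2 by
    one.\<close>
  define M N where "M = k * (3 * e + 1)\<^sup>2 + 1" and "N = 3 * M"
  define P where "P = (\<lambda>(i3, i2, i1) x. G3 x ^ i3 * (G2 x ^ i2 * (G1 x ^ i1 * G0 x ^ (N - i3 - i2 - i1))))"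
  define I where "I = {..<M} \<times> {..<M} \<times> {..<M}"
  have PA: "P i \<in> A (N * e)" if "i \<in> I" for i
  proof -
    obtain i3 i2 i1 where i: "i = (i3, i2, i1)" "i3 < M" "i2 < M" "i1 < M" using \<open>i \<in> I\<close> unfolding I_def by blast
    then have "i3 + i2 + i1 \<le> N" by (simp add: N_def)
    then have "i3 * e + (i2 * e + (i1 * e + (N - i3 - i2 - i1) * e)) = N * e"
      by (simp flip: add_mult_distrib)
    moreover have "P i \<in> A (i3 * e + (i2 * e + (i1 * e + (N - i3 - i2 - i1) * e)))"
      unfolding P_def i(1) prod.case by (intro A_mult A_power G)
    ultimately show ?thesis by simp
  qed
  obtain B where B: "finite B" "card B \<le> k * (N * e + 1)\<^sup>2" "\<forall>f\<in>A (N * e). \<exists>g\<in>lspan K B. \<forall>c\<in>C. f c = g c"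
    using span[of "N * e"] by (elim exE conjE) (rule that)
  have cardI: "card I = M * M * M" by (simp add: I_def)
  have "M \<ge> 1" by (simp add: M_def)
  have "N * e + 1 \<le> M * (3 * e + 1)" using \<open>M \<ge> 1\<close> by (simp add: N_def algebra_simps)
  then have "(N * e + 1)\<^sup>2 \<le> (M * (3 * e + 1))\<^sup>2" by (rule power_mono) simp
  then have "k * (N * e + 1)\<^sup>2 \<le> k * (M * (3 * e + 1))\<^sup>2" by (rule mult_le_mono2)
  also have "\<dots> = M * M * (k * (3 * e + 1)\<^sup>2)" by (simp only: power_mult_distrib power2_eq_square[of M] ac_simps)
  also have "\<dots> < M * M * M" using \<open>M \<ge> 1\<close> by (intro mult_strict_left_mono) (auto simp: M_def)
  finally have card: "card B < card I" using B(2) cardI by simp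
  have "\<exists>k. (\<forall>b\<in>B. k b \<in> K) \<and> (\<forall>c\<in>C. P i c = (\<Sum>b\<in>B. k b * b c))" if i: "i \<in> I" for i
  proof -
    obtain g where g: "g \<in> lspan K B" "\<forall>c\<in>C. P i c = g c" using B(3) PA[OF i] by blast
    obtain k where "\<forall>b\<in>B. k b \<in> K" "g = (\<lambda>x. \<Sum>b\<in>B. k b * b x)"
      using lspan_finite[OF B(1) g(1)] by (elim exE conjE) (rule that)
    then show ?thesis using g(2) by (intro exI[of _ k]) simp
  qed
  then have "\<forall>i\<in>I. \<exists>k. (\<forall>b\<in>B. k b \<in> K) \<and> (\<forall>c\<in>C. P i c = (\<Sum>b\<in>B. k b * b c))" by blast
  then obtain co where co: "\<forall>i\<in>I. (\<forall>b\<in>B. co i b \<in> K) \<and> (\<forall>c\<in>C. P i c = (\<Sum>b\<in>B. co i b * b c))"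
    by (rule bchoice[THEN exE])
  have "finite I" by (simp add: I_def)
  obtain u where u: "\<forall>i\<in>I. u i \<in> K" "\<exists>i\<in>I. u i \<noteq> 0" "\<forall>b\<in>B. (\<Sum>i\<in>I. u i * co i b) = 0"
    using K_dependent[OF B(1) \<open>finite I\<close> card, of co] co by (elim meta_impE exE conjE) auto
  have dep: "(\<Sum>i\<in>I. u i * P i c) = 0" if c: "c \<in> C" for c
  proof -
    have "(\<Sum>i\<in>I. u i * P i c) = (\<Sum>i\<in>I. \<Sum>b\<in>B. u i * co i b * b c)"
      by (rule sum.cong) (use co c in \<open>auto simp: sum_distrib_left mult.assoc\<close>)
    also have "\<dots> = (\<Sum>b\<in>B. \<Sum>i\<in>I. u i * co i b * b c)" by (rule sum.swap)
    also have "\<dots> = (\<Sum>b\<in>B. (\<Sum>i\<in>I. u i * co i b) * b c)" by (simp add: sum_distrib_right)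
    also have "\<dots> = 0" using u(3) by simp
    finally show ?thesis .
  qed
  \<comment> \<open>The relation is read as a polynomial in \<open>G3\<close> whose coefficients
    \<open>H3\<close> are polynomials in \<open>G2\<close>, with coefficients \<open>H2\<close> that
    are polynomials in \<open>G1\<close>.\<close>
  define H1 where "H1 = (\<lambda>i3 i2 i1 x. u (i3, i2, i1) * G0 x ^ (N - i3 - i2 - i1))"
  define H2 where "H2 = (\<lambda>i3 i2 x. \<Sum>i1<M. G1 x ^ i1 * H1 i3 i2 i1 x)"
  define H3 where "H3 = (\<lambda>i3 x. \<Sum>i2<M. G2 x ^ i2 * H2 i3 i2 x)"
  have H1A: "H1 i3 i2 i1 \<in> A ((N - i3 - i2) * e - i1 * e)" if "i3 < M" "i2 < M" "i1 < M" for i3 i2 i1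
    using A_smult[OF _ A_power[OF G(1)], of "u (i3, i2, i1)" "N - i3 - i2 - i1"] u(1) that
    by (simp add: H1_def I_def diff_mult_distrib add_mult_distrib)
  have ne: "{..<M} \<noteq> {}" using \<open>M \<ge> 1\<close> by (simp add: lessThan_empty_iff)
  have H2A: "H2 i3 i2 \<in> A ((N - i3) * e - i2 * e)" if i: "i3 < M" "i2 < M" for i3 i2
    unfolding H2_def
  proof (rule A_sum[OF _ ne])
    fix i1 assume "i1 \<in> {..<M}"
    then have i1: "i1 < M" by simp
    then have "i1 * e \<le> (N - i3 - i2) * e" using i by (intro mult_le_mono1) (simp add: N_def)
    then have "i1 * e + ((N - i3 - i2) * e - i1 * e) = (N - i3) * e - i2 * e"
      by (simp add: diff_mult_distrib add_mult_distrib)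
    with A_mult[OF A_power[OF G(2), of i1] H1A[OF i i1]]
    show "(\<lambda>x. G1 x ^ i1 * H1 i3 i2 i1 x) \<in> A ((N - i3) * e - i2 * e)" by simp
  qed simp
  have H3A: "H3 i3 \<in> A (N * e - i3 * e)" if i: "i3 < M" for i3
    unfolding H3_def
  proof (rule A_sum[OF _ ne])
    fix i2 assume "i2 \<in> {..<M}"
    then have i2: "i2 < M" by simp
    then have "i2 * e \<le> (N - i3) * e" using i by (intro mult_le_mono1) (simp add: N_def)
    then have "i2 * e + ((N - i3) * e - i2 * e) = N * e - i3 * e"
      by (simp add: diff_mult_distrib add_mult_distrib)
    with A_mult[OF A_power[OF G(3), of i2] H2A[OF i i2]]
    show "(\<lambda>x. G2 x ^ i2 * H2 i3 i2 x) \<in> A (N * e - i3 * e)" by simp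
  qed simp
  have total: "(\<Sum>i3<M. G3 c ^ i3 * H3 i3 c) = 0" if c: "c \<in> C" for c
  proof -
    have "(\<Sum>i3<M. G3 c ^ i3 * H3 i3 c) = (\<Sum>i3<M. \<Sum>i2<M. \<Sum>i1<M. u (i3, i2, i1) * P (i3, i2, i1) c)"
      unfolding H3_def H2_def H1_def P_def prod.case sum_distrib_left by (simp add: ac_simps)
    also have "\<dots> = (\<Sum>i\<in>I. u i * P i c)"
      unfolding I_def by (simp add: sum.cartesian_product)
    finally show ?thesis using dep[OF c] by simp
  qed
  \<comment> \<open>The triple (j3, j2, j1) is the lexicographically first one with a nonzero
    coefficient.\<close>
  define j3 where "j3 = (LEAST j. j < M \<and> (\<exists>i2<M. \<exists>i1<M. u (j, i2, i1) \<noteq> 0))"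
  have "\<exists>j. j < M \<and> (\<exists>i2<M. \<exists>i1<M. u (j, i2, i1) \<noteq> 0)" using u(2) unfolding I_def by auto
  then have j3: "j3 < M \<and> (\<exists>i2<M. \<exists>i1<M. u (j3, i2, i1) \<noteq> 0)" unfolding j3_def by (rule LeastI_ex)
  have j3z: "u (i, i2, i1) = 0" if "i < j3" "i2 < M" "i1 < M" for i i2 i1
    using not_less_Least[of i "\<lambda>j. j < M \<and> (\<exists>i2<M. \<exists>i1<M. u (j, i2, i1) \<noteq> 0)"] that j3 j3_def by auto
  define j2 where "j2 = (LEAST j. j < M \<and> (\<exists>i1<M. u (j3, j, i1) \<noteq> 0))"
  have "\<exists>j. j < M \<and> (\<exists>i1<M. u (j3, j, i1) \<noteq> 0)" using j3 by auto
  then have j2: "j2 < M \<and> (\<exists>i1<M. u (j3, j2, i1) \<noteq> 0)" unfolding j2_def by (rule LeastI_ex)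
  have j2z: "u (j3, i, i1) = 0" if "i < j2" "i1 < M" for i i1
    using not_less_Least[of i "\<lambda>j. j < M \<and> (\<exists>i1<M. u (j3, j, i1) \<noteq> 0)"] that j2 j2_def by auto
  define j1 where "j1 = (LEAST j. j < M \<and> u (j3, j2, j) \<noteq> 0)"
  have "\<exists>j. j < M \<and> u (j3, j2, j) \<noteq> 0" using j2 by auto
  then have j1: "j1 < M \<and> u (j3, j2, j1) \<noteq> 0" unfolding j1_def by (rule LeastI_ex)
  have j1z: "u (j3, j2, i) = 0" if "i < j1" for i
    using not_less_Least[of i "\<lambda>j. j < M \<and> u (j3, j2, j) \<noteq> 0"] that j1 j1_def by auto
  \<comment> \<open>Each application descends one step in the chain: the lowest coefficient of a
    polynomial vanishing on one member vanishes on the previous member. At the bottom a nonzero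
    multiple of a power of \<open>G0\<close> vanishes on \<open>Z 0\<close>, against the choice of
    \<open>g0\<close>.\<close>
  have 3: "H3 j3 c = 0" if "c \<in> C" "q c \<in> Z 2" for c
  proof (rule lowest_coeff_vanishes[where Z = "Z 3" and Z' = "Z 2" and G = G3 and e = e and H = H3 and M = M and D = "N * e"])
    show "M * e \<le> N * e" by (simp add: N_def)
    show "H3 i c = 0" if "i < j3" "c \<in> C" for i c
      unfolding H3_def H2_def H1_def using j3z that by simp
    show "q c3 \<in> Z 3" "G3 c3 \<noteq> 0" using g3 by (simp_all add: G3_def eval_nat_numeral)
    show "Z 2 \<subseteq> Z 3" using sub[of 2] by (simp add: eval_nat_numeral psubset_imp_subset)
  qed (use irr[of 3] G g3 Gz3 H3A j3 total that in auto)
  have 2: "H2 j3 j2 c = 0" if "c \<in> C" "q c \<in> Z 1" for c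
  proof (rule lowest_coeff_vanishes[where Z = "Z 2" and Z' = "Z 1" and G = G2 and e = e and H = "H2 j3" and M = M and D = "(N - j3) * e"])
    show "M * e \<le> (N - j3) * e" using conjunct1[OF j3] by (intro mult_le_mono1) (simp add: N_def)
    show "H2 j3 i c = 0" if "i < j2" "c \<in> C" for i c
      unfolding H2_def H1_def using j2z that by simp
    show "q c2 \<in> Z 2" "G2 c2 \<noteq> 0" using g2 by (simp_all add: G2_def eval_nat_numeral)
    show "Z 1 \<subseteq> Z 2" using sub[of 1] by (simp add: eval_nat_numeral psubset_imp_subset)
    show "(\<Sum>i<M. G2 c ^ i * H2 j3 i c) = 0" if "c \<in> C" "q c \<in> Z 2" for c
      using 3[OF that] by (simp add: H3_def)
  qed (use irr[of 2] G g2 Gz2 H2A j3 j2 that in auto)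
  have 1: "H1 j3 j2 j1 c = 0" if "c \<in> C" "q c \<in> Z 0" for c
  proof (rule lowest_coeff_vanishes[where Z = "Z 1" and Z' = "Z 0" and G = G1 and e = e and H = "H1 j3 j2" and M = M and D = "(N - j3 - j2) * e"])
    show "M * e \<le> (N - j3 - j2) * e" using conjunct1[OF j3] conjunct1[OF j2] by (intro mult_le_mono1) (simp add: N_def)
    show "H1 j3 j2 i c = 0" if "i < j1" "c \<in> C" for i c
      unfolding H1_def using j1z that by simp
    show "q c1 \<in> Z 1" "G1 c1 \<noteq> 0" using g1 by (simp_all add: G1_def)
    show "Z 0 \<subseteq> Z 1" using sub[of 0] by (simp add: psubset_imp_subset)
    show "(\<Sum>i<M. G1 c ^ i * H1 j3 j2 i c) = 0" if "c \<in> C" "q c \<in> Z 1" for c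
      using 2[OF that] by (simp add: H2_def)
  qed (use irr[of 1] G g1 Gz H1A j3 j2 j1 that in auto)
  from 1[OF c0] show False using j1 g0(2) by (simp add: H1_def G0_def)
qed

end

section \<open>The curve E\<close>

lemma complex_subfield_UNIV: "complex_subfield UNIV"
  by (simp add: complex_subfield_def)

interpretation UNIV: subfield UNIV
  by unfold_locales (rule complex_subfield_UNIV)

definition CE :: "(E_var \<Rightarrow> complex) set" where
  "CE = proj_cone {\<lambda>v. (v Ea)\<^sup>2 - ((v Ec)\<^sup>2 + (v Ed)\<^sup>2), \<lambda>v. (v Eb)\<^sup>2 - ((v Ec)\<^sup>2 - (v Ed)\<^sup>2)}"

definition evec :: "complex \<Rightarrow> complex \<Rightarrow> complex \<Rightarrow> complex \<Rightarrow> E_var \<Rightarrow> complex" where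
  "evec a b c d = (\<lambda>i. case i of Ea \<Rightarrow> a | Eb \<Rightarrow> b | Ec \<Rightarrow> c | Ed \<Rightarrow> d)"

lemma evec_simps [simp]: "evec a b c d Ea = a" "evec a b c d Eb = b" "evec a b c d Ec = c" "evec a b c d Ed = d"
  by (simp_all add: evec_def)

lemma all_E_var: "(\<forall>i. P i) \<longleftrightarrow> P Ea \<and> P Eb \<and> P Ec \<and> P Ed"
  using E_var.induct[of P] by blast

lemma evec_eq_iff: "u = v \<longleftrightarrow> u Ea = v Ea \<and> u Eb = v Eb \<and> u Ec = v Ec \<and> u Ed = v Ed"
  unfolding fun_eq_iff by (rule all_E_var)

text \<open>If c and d vanish, the two relations force a and b to vanish, so the pair (c, d) alone
  decides whether a vector is nonzero.\<close>

lemma CE_iff: "v \<in> CE \<longleftrightarrow> (v Ec \<noteq> 0 \<or> v Ed \<noteq> 0) \<and>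
    (v Ea)\<^sup>2 = (v Ec)\<^sup>2 + (v Ed)\<^sup>2 \<and> (v Eb)\<^sup>2 = (v Ec)\<^sup>2 - (v Ed)\<^sup>2"
proof -
  have "(\<exists>i. v i \<noteq> 0) \<longleftrightarrow> v Ea \<noteq> 0 \<or> v Eb \<noteq> 0 \<or> v Ec \<noteq> 0 \<or> v Ed \<noteq> 0"
    using all_E_var[of "\<lambda>i. v i = 0"] by blast
  then show ?thesis unfolding CE_def by auto
qed

text \<open>The relations give a^2 + b^2 = 2 c^2 and a^2 - b^2 = 2 d^2. As rho fixes a and b, their
  products with the corresponding coordinates of the second factor later provide invariant functions
  of degree one without base points.\<close>

lemma CE_ab: "v \<in> CE \<Longrightarrow> v Ea \<noteq> 0 \<or> v Eb \<noteq> 0"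
proof (rule ccontr)
  assume v: "v \<in> CE" and "\<not> (v Ea \<noteq> 0 \<or> v Eb \<noteq> 0)"
  then have "(v Ec)\<^sup>2 + (v Ed)\<^sup>2 = 0" "(v Ec)\<^sup>2 - (v Ed)\<^sup>2 = 0" by (auto simp: CE_iff)
  then have "(v Ec)\<^sup>2 = (v Ed)\<^sup>2" "2 * (v Ed)\<^sup>2 = 0" by simp_all
  with v show False by (simp add: CE_iff)
qed

lemma CE_scale: "v \<in> CE \<Longrightarrow> l \<noteq> 0 \<Longrightarrow> (\<lambda>i. l * v i) \<in> CE"
  by (auto simp: CE_iff power_mult_distrib distrib_left right_diff_distrib)

lemma proj_pt_evec: "v Ec \<noteq> 0 \<Longrightarrow> proj_pt v = proj_pt (evec (v Ea / v Ec) (v Eb / v Ec) 1 (v Ed / v Ec))"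
  unfolding proj_pt_eq_iff by (rule exI[of _ "1 / v Ec"]) (simp add: evec_eq_iff)

section \<open>Normal forms of functions on E\<close>

text \<open>Modulo the relations, the coordinate ring of E is spanned by 1, a, b and ab over the
  polynomials in c and d. This gives the linear growth 4 (n + 1), and hence quadratic growth on E x
  E.\<close>

definition emonos :: "nat \<Rightarrow> ((E_var \<Rightarrow> complex) \<Rightarrow> complex) set" where
  "emonos n = {\<lambda>v. v Ea ^ p * v Eb ^ q * v Ec ^ i * v Ed ^ j | p q i j. p \<le> 1 \<and> q \<le> 1 \<and> p + q + i + j = n}"

lemma monos_finite: "finite (emonos n)" "card (emonos n) \<le> 4 * (n + 1)"
proof -
  let ?S = "{..1::nat} \<times> {..1::nat} \<times> {..n}"
  have sub: "emonos n \<subseteq> (\<lambda>(p, q, i) v. v Ea ^ p * v Eb ^ q * v Ec ^ i * v Ed ^ (n - p - q - i)) ` ?S"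
  proof
    fix f assume "f \<in> emonos n"
    then obtain p q i j where "f = (\<lambda>v. v Ea ^ p * v Eb ^ q * v Ec ^ i * v Ed ^ j)" "p \<le> 1" "q \<le> 1" "p + q + i + j = n"
      unfolding emonos_def by blast
    moreover from this have "j = n - p - q - i" by simp
    ultimately show "f \<in> (\<lambda>(p, q, i) v. v Ea ^ p * v Eb ^ q * v Ec ^ i * v Ed ^ (n - p - q - i)) ` ?S"
      by (intro image_eqI[of _ _ "(p, q, i)"]) simp_all
  qed
  show "finite (emonos n)" by (rule finite_subset[OF sub]) simp
  have "card (emonos n) \<le> card ?S" by (rule surj_card_le[OF _ sub]) simp
  then show "card (emonos n) \<le> 4 * (n + 1)" by simp
qed

definition normal_forms :: "complex set \<Rightarrow> nat \<Rightarrow> ((E_var \<Rightarrow> complex) \<Rightarrow> complex) set" where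
  "normal_forms K n = {f. \<exists>g\<in>lspan K (emonos n). \<forall>v\<in>CE. f v = g v}"

context subfield
begin

lemma normal_forms_add: "f \<in> normal_forms K n \<Longrightarrow> g \<in> normal_forms K n \<Longrightarrow> (\<lambda>v. f v + g v) \<in> normal_forms K n"
proof -
  assume "f \<in> normal_forms K n" "g \<in> normal_forms K n"
  then obtain f' g' where "f' \<in> lspan K (emonos n)" "\<forall>v\<in>CE. f v = f' v"
    "g' \<in> lspan K (emonos n)" "\<forall>v\<in>CE. g v = g' v"
    unfolding normal_forms_def mem_Collect_eq by (elim bexE) (rule that)
  then show ?thesis unfolding normal_forms_def
    by (intro CollectI bexI[OF _ lspan.add[of f' _ _ g']]) simp_all
qed

lemma normal_forms_smult: "k \<in> K \<Longrightarrow> f \<in> normal_forms K n \<Longrightarrow> (\<lambda>v. k * f v) \<in> normal_forms K n"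
proof -
  assume k: "k \<in> K" and "f \<in> normal_forms K n"
  then obtain f' where "f' \<in> lspan K (emonos n)" "\<forall>v\<in>CE. f v = f' v"
    unfolding normal_forms_def mem_Collect_eq by (elim bexE) (rule that)
  then show ?thesis unfolding normal_forms_def
    by (intro CollectI bexI[OF _ lspan.smult[OF k, of f']]) simp_all
qed

lemma normal_forms_cong: "f \<in> normal_forms K n \<Longrightarrow> (\<And>v. v \<in> CE \<Longrightarrow> f v = g v) \<Longrightarrow> g \<in> normal_forms K n"
  unfolding normal_forms_def by auto

lemma normal_forms_mono:
  "p \<le> 1 \<Longrightarrow> q \<le> 1 \<Longrightarrow> p + q + i + j = n \<Longrightarrow> (\<lambda>v. v Ea ^ p * v Eb ^ q * v Ec ^ i * v Ed ^ j) \<in> normal_forms K n"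
  unfolding normal_forms_def emonos_def by (intro CollectI bexI[OF _ lspan.base]) auto

lemma normal_forms_zero: "(\<lambda>_. 0) \<in> normal_forms K n"
  unfolding normal_forms_def by (intro CollectI bexI[OF _ lspan.zero]) simp

text \<open>Only multiplying by a or b a monomial that already contains it leaves the normal form;
  then the square is replaced by c^2 + d^2 or c^2 - d^2. Multiplication of arbitrary normal forms is
  reduced to repeated use of this case.\<close>

lemma normal_forms_var:
  assumes "f \<in> normal_forms K n"
  shows "(\<lambda>v. v x * f v) \<in> normal_forms K (Suc n)"
proof -
  obtain g where g: "g \<in> lspan K (emonos n)" "\<forall>v\<in>CE. f v = g v"
    using assms unfolding normal_forms_def mem_Collect_eq by (elim bexE) (rule that)
  from g(1) have "(\<lambda>v. v x * g v) \<in> normal_forms K (Suc n)"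
  proof induction
    case zero
    show ?case using normal_forms_zero by simp
  next
    case (add f g)
    then show ?case using normal_forms_add[OF add(3,4)] by (simp add: distrib_left)
  next
    case (smult k f)
    then show ?case using normal_forms_smult[OF smult(1,3)] by (simp add: mult.left_commute)
  next
    case (base m)
    then obtain p q i j where m: "m = (\<lambda>v. v Ea ^ p * v Eb ^ q * v Ec ^ i * v Ed ^ j)" "p \<le> 1" "q \<le> 1" "p + q + i + j = n"
      unfolding emonos_def by blast
    show ?case
    proof (cases x)
      case Ea
      show ?thesis
      proof (cases "p = 0")
        case True
        then show ?thesis using normal_forms_mono[of 1 q i j "Suc n"] m Ea by (simp add: ac_simps)
      next
        case False
        then have "p = 1" using m by simp
        have "(\<lambda>v. v Ea ^ 0 * v Eb ^ q * v Ec ^ (i+2) * v Ed ^ j + v Ea ^ 0 * v Eb ^ q * v Ec ^ i * v Ed ^ (j+2)) \<in> normal_forms K (Suc n)"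
          by (intro normal_forms_add normal_forms_mono) (use m \<open>p = 1\<close> in simp_all)
        then show ?thesis
        proof (rule normal_forms_cong)
          fix v assume "v \<in> CE"
          then have "v Ea * v Ea = v Ec * v Ec + v Ed * v Ed" by (simp add: CE_iff power2_eq_square)
          then have "v Ea * v Ea * (v Eb ^ q * v Ec ^ i * v Ed ^ j) = (v Ec * v Ec + v Ed * v Ed) * (v Eb ^ q * v Ec ^ i * v Ed ^ j)" by simp
          then show "v Ea ^ 0 * v Eb ^ q * v Ec ^ (i+2) * v Ed ^ j + v Ea ^ 0 * v Eb ^ q * v Ec ^ i * v Ed ^ (j+2) = v x * m v"
            unfolding m(1) Ea \<open>p = 1\<close> by (simp add: power2_eq_square power_add algebra_simps)
        qed
      qed
    next
      case Eb
      show ?thesis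
      proof (cases "q = 0")
        case True
        then show ?thesis using normal_forms_mono[of p 1 i j "Suc n"] m Eb by (simp add: ac_simps)
      next
        case False
        then have "q = 1" using m by simp
        have "(\<lambda>v. v Ea ^ p * v Eb ^ 0 * v Ec ^ (i+2) * v Ed ^ j + (-1) * (v Ea ^ p * v Eb ^ 0 * v Ec ^ i * v Ed ^ (j+2))) \<in> normal_forms K (Suc n)"
          by (intro normal_forms_add normal_forms_smult normal_forms_mono K_uminus K_one) (use m \<open>q = 1\<close> in simp_all)
        then show ?thesis
        proof (rule normal_forms_cong)
          fix v assume "v \<in> CE"
          then have "v Eb * v Eb = v Ec * v Ec - v Ed * v Ed" by (simp add: CE_iff power2_eq_square)
          then have "v Eb * v Eb * (v Ea ^ p * v Ec ^ i * v Ed ^ j) = (v Ec * v Ec - v Ed * v Ed) * (v Ea ^ p * v Ec ^ i * v Ed ^ j)" by simp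
          then show "v Ea ^ p * v Eb ^ 0 * v Ec ^ (i+2) * v Ed ^ j + (-1) * (v Ea ^ p * v Eb ^ 0 * v Ec ^ i * v Ed ^ (j+2)) = v x * m v"
            unfolding m(1) Eb \<open>q = 1\<close> by (simp add: power2_eq_square power_add algebra_simps)
        qed
      qed
    next
      case Ec
      then show ?thesis using normal_forms_mono[of p q "Suc i" j "Suc n"] m by (simp add: ac_simps)
    next
      case Ed
      then show ?thesis using normal_forms_mono[of p q i "Suc j" "Suc n"] m by (simp add: ac_simps)
    qed
  qed
  then show ?thesis by (rule normal_forms_cong) (use g(2) in simp)
qed

lemma normal_forms_power: "f \<in> normal_forms K n \<Longrightarrow> (\<lambda>v. v x ^ k * f v) \<in> normal_forms K (k + n)"
proof (induction k)
  case (Suc k)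
  then show ?case using normal_forms_var[of "\<lambda>v. v x ^ k * f v" "k + n" x] by (simp add: mult.assoc)
qed simp

lemma normal_forms_mult:
  assumes f: "f \<in> normal_forms K n" and g: "g \<in> normal_forms K m"
  shows "(\<lambda>v. f v * g v) \<in> normal_forms K (n + m)"
proof -
  obtain h where h: "h \<in> lspan K (emonos n)" "\<forall>v\<in>CE. f v = h v"
    using f unfolding normal_forms_def mem_Collect_eq by (elim bexE) (rule that)
  from h(1) have "(\<lambda>v. h v * g v) \<in> normal_forms K (n + m)"
  proof induction
    case zero
    show ?case using normal_forms_zero by simp
  next
    case (add f g)
    then show ?case using normal_forms_add[OF add(3,4)] by (simp add: distrib_right)
  next
    case (smult k f)
    then show ?case using normal_forms_smult[OF smult(1,3)] by (simp add: mult.assoc)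
  next
    case (base b)
    then obtain p q i j where b: "b = (\<lambda>v. v Ea ^ p * v Eb ^ q * v Ec ^ i * v Ed ^ j)" "p + q + i + j = n"
      unfolding emonos_def by blast
    have "(\<lambda>v. v Ea ^ p * (v Eb ^ q * (v Ec ^ i * (v Ed ^ j * g v)))) \<in> normal_forms K (p + (q + (i + (j + m))))"
      by (intro normal_forms_power g)
    moreover have "n + m = p + (q + (i + (j + m)))" using b(2) by simp
    ultimately show ?case unfolding b(1) by (simp only: mult.assoc)
  qed
  then show ?thesis by (rule normal_forms_cong) (use h(2) in simp)
qed

lemma form_normal: "form K d f \<Longrightarrow> f \<in> normal_forms K d"
proof (induction rule: form.induct)
  case (const c)
  then show ?case using normal_forms_smult[OF const normal_forms_mono[of 0 0 0 0 0]] by simp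
next
  case (var x)
  show ?case using normal_forms_power[OF normal_forms_mono[of 0 0 0 0 0], of x 1] by simp
next
  case (add d f g)
  then show ?case by (intro normal_forms_add)
next
  case (mult d f e g)
  then show ?case by (intro normal_forms_mult)
qed

end

lemma form_UNIV: "form K d f \<Longrightarrow> form UNIV d f"
proof (induction rule: form.induct)
  case (const c)
  show ?case by (rule form.const) simp
qed (rule form.var form.add form.mult; assumption)+

lemma form_smult: "form UNIV d f \<Longrightarrow> form UNIV d (\<lambda>v. k * f v)"
  using form.mult[OF form.const[of k UNIV], of d f] by simp

section \<open>Zeros of forms on E, and irreducibility\<close>

text \<open>The order of vanishing at \<open>z\<close> would be even on the left and odd on the
  right.\<close>

lemma square_times_simple_root:
  fixes r s D' :: "complex poly"
  assumes eq: "r\<^sup>2 = [:-z, 1:] * D' * s\<^sup>2" and D': "poly D' z \<noteq> 0"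
  shows "s = 0"
proof (rule ccontr)
  assume s: "s \<noteq> 0"
  have "D' \<noteq> 0" using D' by auto
  then have nz: "[:-z, 1:] * D' * s\<^sup>2 \<noteq> 0" using s
    by (metis mult_eq_0_iff one_neq_zero pCons_eq_0_iff power_eq_0_iff)
  then have r: "r \<noteq> 0" using eq by auto
  have "order z (r\<^sup>2) = 2 * order z r" using r by (simp add: power2_eq_square order_mult)
  moreover have "order z ([:-z, 1:] * D' * s\<^sup>2) = 1 + 2 * order z s"
  proof -
    have "order z D' = 0" using D' by (simp add: order_root)
    moreover have "order z [:-z, 1:] = 1" using order_power_n_n[of z 1] by simp
    moreover have "order z (s\<^sup>2) = 2 * order z s" using s by (simp add: power2_eq_square order_mult)
    moreover have "order z ([:-z, 1:] * D' * s\<^sup>2) = order z ([:-z, 1:] * D') + order z (s\<^sup>2)"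
      by (rule order_mult[OF nz])
    moreover have "order z ([:-z, 1:] * D') = order z [:-z, 1:] + order z D'"
      by (rule order_mult) (use nz in auto)
    ultimately show ?thesis by (simp only:)
  qed
  ultimately have "2 * order z r = 1 + 2 * order z s" using eq by simp
  then show False by presburger
qed

text \<open>
  The norm from the function field of E to that of the projective line has trivial kernel, as
  none of 1 + x^2, 1 - x^2 and their product is a square.
\<close>

lemma norm_eq_0:
  fixes p0 p1 p2 p3 :: "complex poly"
  defines "D1 \<equiv> [:1, 0, 1:]" and "D2 \<equiv> [:1, 0, -1:]"
  assumes "(p0\<^sup>2 + D1 * p1\<^sup>2 - D2 * (p2\<^sup>2 + D1 * p3\<^sup>2))\<^sup>2 - D1 * (2 * (p0 * p1 - D2 * p2 * p3))\<^sup>2 = 0"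
  shows "p0 = 0 \<and> p1 = 0 \<and> p2 = 0 \<and> p3 = 0"
proof -
  have D1: "D1 = [:-\<i>, 1:] * [:\<i>, 1:]" unfolding D1_def by simp
  have D2: "D2 = [:-1, 1:] * [:-1, -1:]" unfolding D2_def by simp
  have sq1: "s = 0" if "r\<^sup>2 = D1 * s\<^sup>2" for r s
    by (rule square_times_simple_root[of r "\<i>" "[:\<i>, 1:]"]) (use that D1 in auto)
  have sq2: "s = 0" if "r\<^sup>2 = D2 * s\<^sup>2" for r s
    by (rule square_times_simple_root[of r 1 "[:-1, -1:]"]) (use that D2 in auto)
  have sq3: "s = 0" if "r\<^sup>2 = D1 * D2 * s\<^sup>2" for r s
  proof (rule square_times_simple_root[of r 1 "[:-1, -1:] * D1"])
    show "r\<^sup>2 = [:- 1, 1:] * ([:- 1, - 1:] * D1) * s\<^sup>2" using that unfolding D2 by (simp only: ac_simps)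
    show "poly ([:- 1, - 1:] * D1) 1 \<noteq> 0" by (simp add: D1_def)
  qed
  have D_nz: "D1 \<noteq> 0" "D2 \<noteq> 0" unfolding D1_def D2_def by simp_all
  have R1: "2 * (p0 * p1 - D2 * p2 * p3) = 0"
    by (rule sq1[of "p0\<^sup>2 + D1 * p1\<^sup>2 - D2 * (p2\<^sup>2 + D1 * p3\<^sup>2)"]) (use assms in simp)
  then have R0: "p0\<^sup>2 + D1 * p1\<^sup>2 - D2 * (p2\<^sup>2 + D1 * p3\<^sup>2) = 0" using assms(3) by simp
  have R1': "p0 * p1 = D2 * p2 * p3" using R1 by simp
  have R0': "p0\<^sup>2 + D1 * p1\<^sup>2 = D2 * (p2\<^sup>2 + D1 * p3\<^sup>2)" using R0 by simp
  \<comment> \<open>Put A = p0 + p1 w and B = p2 + p3 w with w^2 = D1. The two equations before say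
    A^2 = D2 B^2. Here \<open>n\<close> is the norm of B, and r + s w is A times the conjugate of B,
    so its square is D2 n^2; comparing coefficients gives the next two facts.\<close>
  define n r s where "n = p2\<^sup>2 - D1 * p3\<^sup>2" and "r = p0 * p2 - D1 * p1 * p3" and "s = p1 * p2 - p0 * p3"
  have "r * s = (p0 * p1) * (p2\<^sup>2 + D1 * p3\<^sup>2) - p2 * p3 * (p0\<^sup>2 + D1 * p1\<^sup>2)"
    unfolding r_def s_def by (simp add: power2_eq_square algebra_simps)
  also have "\<dots> = 0" unfolding R0' R1' by (simp add: algebra_simps)
  finally have "r * s = 0" .
  have "r\<^sup>2 + D1 * s\<^sup>2 = (p0\<^sup>2 + D1 * p1\<^sup>2) * (p2\<^sup>2 + D1 * p3\<^sup>2) - 4 * D1 * (p0 * p1) * (p2 * p3)"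
    unfolding r_def s_def by (simp add: power2_eq_square algebra_simps)
  also have "\<dots> = D2 * n\<^sup>2" unfolding R0' R1' n_def by (simp add: power2_eq_square algebra_simps)
  finally have rs: "r\<^sup>2 + D1 * s\<^sup>2 = D2 * n\<^sup>2" .
  have "n = 0"
  proof (cases "r = 0")
    case True
    then have "D1 * s\<^sup>2 = D2 * n\<^sup>2" using rs by simp
    then have "(D1 * s)\<^sup>2 = D1 * D2 * n\<^sup>2"
      by (simp only: power_mult_distrib power2_eq_square[of D1] mult.assoc)
    then show ?thesis by (rule sq3)
  next
    case False
    then have "s = 0" using \<open>r * s = 0\<close> by simp
    then have "r\<^sup>2 = D2 * n\<^sup>2" using rs by simp
    then show ?thesis by (rule sq2)
  qed
  then have "p2\<^sup>2 = D1 * p3\<^sup>2" by (simp add: n_def)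
  then have p3: "p3 = 0" by (rule sq1)
  then have p2: "p2 = 0" using \<open>p2\<^sup>2 = D1 * p3\<^sup>2\<close> by simp
  have "p0 * p1 = 0" using R1' p2 by simp
  moreover have "p0\<^sup>2 + D1 * p1\<^sup>2 = 0" using R0' p2 p3 by simp
  ultimately have "p0 = 0 \<and> p1 = 0" using D_nz by auto
  with p2 p3 show ?thesis by simp
qed

text \<open>Setting c = 1 turns a normal form into p0 + a p1 + b p2 + a b p3 with polynomials in d.
  The first conjunct records that nothing is lost: if the four polynomials vanish, the homogeneous
  function vanishes identically.\<close>

lemma lspan_monos_poly:
  assumes "f \<in> lspan UNIV (emonos n)"
  shows "\<exists>p0 p1 p2 p3 :: complex poly.
    (p0 = 0 \<and> p1 = 0 \<and> p2 = 0 \<and> p3 = 0 \<longrightarrow> (\<forall>v. f v = 0)) \<and>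
    (\<forall>v. v Ec = 1 \<longrightarrow> f v = poly p0 (v Ed) + v Ea * poly p1 (v Ed) + v Eb * poly p2 (v Ed) + v Ea * v Eb * poly p3 (v Ed))"
proof -
  \<comment> \<open>\<open>H m r\<close> homogenises the polynomial \<open>r\<close> to degree n -
    m, where \<open>m\<close> counts the factors a and b in front of it. Degrees up to
    \<open>n\<close> are allowed, which makes its value at c = 1 the value of
    \<open>r\<close>.\<close>
  define H where "H = (\<lambda>(m::nat) (r :: complex poly) (v :: E_var \<Rightarrow> complex).
    \<Sum>i\<le>n. coeff r i * v Ec ^ (n - m - i) * v Ed ^ i)"
  have H_add: "H m (r + s) v = H m r v + H m s v" for m r s v
    by (simp add: H_def distrib_right sum.distrib)
  have H_smult: "H m (Polynomial.smult k r) v = k * H m r v" for m r k v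
    by (simp add: H_def sum_distrib_left mult.assoc)
  have H_monom: "H m (monom 1 j) v = v Ec ^ (n - m - j) * v Ed ^ j" if "j \<le> n" for m j v
  proof -
    have "H m (monom 1 j) v = (\<Sum>i\<le>n. if i = j then v Ec ^ (n - m - i) * v Ed ^ i else 0)"
      unfolding H_def by (rule sum.cong) auto
    then show ?thesis using that by simp
  qed
  have H_0: "H m 0 v = 0" for m v by (simp add: H_def)
  from assms have "\<exists>p0 p1 p2 p3 :: complex poly. degree p0 \<le> n \<and> degree p1 \<le> n \<and> degree p2 \<le> n \<and> degree p3 \<le> n \<and>
    f = (\<lambda>v. H 0 p0 v + v Ea * H 1 p1 v + v Eb * H 1 p2 v + v Ea * v Eb * H 2 p3 v)"
  proof induction
    case zero
    show ?case by (rule exI[of _ 0])+ (simp add: H_0)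
  next
    case (base f)
    then obtain p q i j where f: "f = (\<lambda>v. v Ea ^ p * v Eb ^ q * v Ec ^ i * v Ed ^ j)" "p \<le> 1" "q \<le> 1" "p + q + i + j = n"
      unfolding emonos_def by blast
    then have j: "j \<le> n" and i: "i = n - (p + q) - j" by auto
    have dm: "degree (monom (1::complex) j) \<le> n" using j by (simp add: degree_monom_eq)
    consider "p = 0" "q = 0" | "p = 1" "q = 0" | "p = 0" "q = 1" | "p = 1" "q = 1" using f by linarith
    then show ?case
    proof cases
      case 1
      then show ?thesis using H_monom[OF j] dm f(1) i
        by (rule_tac exI[of _ "monom 1 j"], rule_tac exI[of _ 0], rule_tac exI[of _ 0], rule_tac exI[of _ 0]) (simp add: H_0)
    next
      case 2
      then show ?thesis using H_monom[OF j] dm f(1) i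
        by (rule_tac exI[of _ 0], rule_tac exI[of _ "monom 1 j"], rule_tac exI[of _ 0], rule_tac exI[of _ 0]) (simp add: H_0 mult.assoc)
    next
      case 3
      then show ?thesis using H_monom[OF j] dm f(1) i
        by (rule_tac exI[of _ 0], rule_tac exI[of _ 0], rule_tac exI[of _ "monom 1 j"], rule_tac exI[of _ 0]) (simp add: H_0 mult.assoc)
    next
      case 4
      then show ?thesis using H_monom[OF j] dm f(1) i
        by (rule_tac exI[of _ 0], rule_tac exI[of _ 0], rule_tac exI[of _ 0], rule_tac exI[of _ "monom 1 j"]) (simp add: H_0 mult.assoc)
    qed
  next
    case (add f g)
    obtain p0 p1 p2 p3 where p: "degree p0 \<le> n" "degree p1 \<le> n" "degree p2 \<le> n" "degree p3 \<le> n"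
      "f = (\<lambda>v. H 0 p0 v + v Ea * H 1 p1 v + v Eb * H 1 p2 v + v Ea * v Eb * H 2 p3 v)"
      using add(3) by (elim exE conjE) (rule that)
    obtain q0 q1 q2 q3 where q: "degree q0 \<le> n" "degree q1 \<le> n" "degree q2 \<le> n" "degree q3 \<le> n"
      "g = (\<lambda>v. H 0 q0 v + v Ea * H 1 q1 v + v Eb * H 1 q2 v + v Ea * v Eb * H 2 q3 v)"
      using add(4) by (elim exE conjE) (rule that)
    show ?case using p q
      by (rule_tac exI[of _ "p0 + q0"], rule_tac exI[of _ "p1 + q1"], rule_tac exI[of _ "p2 + q2"], rule_tac exI[of _ "p3 + q3"])
         (simp add: H_add degree_add_le algebra_simps)
  next
    case (smult k f)
    obtain p0 p1 p2 p3 where p: "degree p0 \<le> n" "degree p1 \<le> n" "degree p2 \<le> n" "degree p3 \<le> n"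
      "f = (\<lambda>v. H 0 p0 v + v Ea * H 1 p1 v + v Eb * H 1 p2 v + v Ea * v Eb * H 2 p3 v)"
      using smult(3) by (elim exE conjE) (rule that)
    show ?case using p degree_smult_le[of k p0] degree_smult_le[of k p1] degree_smult_le[of k p2] degree_smult_le[of k p3]
      by (rule_tac exI[of _ "Polynomial.smult k p0"], rule_tac exI[of _ "Polynomial.smult k p1"],
          rule_tac exI[of _ "Polynomial.smult k p2"], rule_tac exI[of _ "Polynomial.smult k p3"])
         (simp add: H_smult algebra_simps)
  qed
  then obtain p0 p1 p2 p3 where p: "degree p0 \<le> n" "degree p1 \<le> n" "degree p2 \<le> n" "degree p3 \<le> n"
    "f = (\<lambda>v. H 0 p0 v + v Ea * H 1 p1 v + v Eb * H 1 p2 v + v Ea * v Eb * H 2 p3 v)"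
    by (elim exE conjE) (rule that)
  have "H m r v = poly r (v Ed)" if "v Ec = 1" "degree r \<le> n" for m r v
  proof -
    have "poly r (v Ed) = (\<Sum>i\<le>degree r. coeff r i * v Ed ^ i)" by (rule poly_altdef)
    also have "\<dots> = (\<Sum>i\<le>n. coeff r i * v Ed ^ i)"
      by (rule sum.mono_neutral_left) (use that(2) in \<open>auto simp: coeff_eq_0\<close>)
    finally show ?thesis using that(1) by (simp add: H_def)
  qed
  with p show ?thesis
    by (rule_tac exI[of _ p0], rule_tac exI[of _ p1], rule_tac exI[of _ p2], rule_tac exI[of _ p3]) (simp add: H_0)
qed

lemma square_eq_cases: "x\<^sup>2 = y \<Longrightarrow> x = csqrt y \<or> x = - csqrt (y :: complex)"
  by (metis power2_csqrt power2_eq_iff)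

text \<open>The norm of the form down to polynomials in x = d/c vanishes at every zero with nonzero
  c. If the norm is a nonzero polynomial, finitely many x remain, with at most four points over
  each; if it is zero, so is the form on E.\<close>

lemma E_finite_zeros:
  assumes "form UNIV n f"
  shows "(\<forall>v\<in>CE. f v = 0) \<or> finite (proj_pt ` {v \<in> CE. f v = 0})"
proof -
  obtain g where g: "g \<in> lspan UNIV (emonos n)" "\<forall>v\<in>CE. f v = g v"
    using UNIV.form_normal[OF assms] unfolding normal_forms_def by blast
  obtain p0 p1 p2 p3 :: "complex poly" where
    p: "p0 = 0 \<and> p1 = 0 \<and> p2 = 0 \<and> p3 = 0 \<longrightarrow> (\<forall>v. g v = 0)"
    "\<forall>v. v Ec = 1 \<longrightarrow> g v = poly p0 (v Ed) + v Ea * poly p1 (v Ed) + v Eb * poly p2 (v Ed) + v Ea * v Eb * poly p3 (v Ed)"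
    using lspan_monos_poly[OF g(1)] by (elim exE conjE) (rule that)
  define D1 D2 :: "complex poly" where "D1 = [:1, 0, 1:]" and "D2 = [:1, 0, -1:]"
  define N where "N = (p0\<^sup>2 + D1 * p1\<^sup>2 - D2 * (p2\<^sup>2 + D1 * p3\<^sup>2))\<^sup>2 - D1 * (2 * (p0 * p1 - D2 * p2 * p3))\<^sup>2"
  show ?thesis
  proof (cases "N = 0")
    case True
    then have "\<forall>v. g v = 0" using norm_eq_0[of p0 p1 p2 p3] p(1) unfolding N_def D1_def D2_def by blast
    then show ?thesis using g(2) by simp
  next
    case False
    \<comment> \<open>Representatives of all candidates: the four sign choices of a and b over each
      root of the norm, and the four points with c = 0.\<close>
    define S where "S = (\<lambda>(x, s, t). evec (s * csqrt (1 + x\<^sup>2)) (t * csqrt (1 - x\<^sup>2)) 1 x) ` ({x. poly N x = 0} \<times> {1, -1} \<times> {1, -1}) \<union>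
      (\<lambda>(s, t). evec s (t * csqrt (-1)) 0 1) ` ({1, -1} \<times> {1, -1})"
    have "finite S" unfolding S_def using poly_roots_finite[OF False] by simp
    have "proj_pt v \<in> proj_pt ` S" if v: "v \<in> CE" "f v = 0" for v
    proof (cases "v Ec = 0")
      case True
      then have d: "v Ed \<noteq> 0" "(v Ea)\<^sup>2 = (v Ed)\<^sup>2" "(v Eb)\<^sup>2 = - (v Ed)\<^sup>2" using v by (auto simp: CE_iff)
      define s t where "s = v Ea / v Ed" and "t = v Eb / v Ed"
      have "s\<^sup>2 = 1" "t\<^sup>2 = -1" using d by (simp_all add: s_def t_def power_divide)
      then have "s = 1 \<or> s = -1" "t = csqrt (-1) \<or> t = - csqrt (-1)"
        by (simp_all only: square_eq_cases) (simp add: power2_eq_1_iff)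
      then have "evec s t 0 1 \<in> S" unfolding S_def by (auto simp: image_iff)
      moreover have "proj_pt v = proj_pt (evec s t 0 1)"
        unfolding proj_pt_eq_iff by (rule exI[of _ "1 / v Ed"]) (use d True in \<open>simp add: evec_eq_iff s_def t_def\<close>)
      ultimately show ?thesis by simp
    next
      case False
      define x s t where "x = v Ed / v Ec" and "s = v Ea / v Ec" and "t = v Eb / v Ec"
      let ?w = "evec s t 1 x"
      have w: "proj_pt v = proj_pt ?w" using proj_pt_evec[of v] False by (simp add: x_def s_def t_def)
      have st: "s\<^sup>2 = 1 + x\<^sup>2" "t\<^sup>2 = 1 - x\<^sup>2"
        using v False by (simp_all add: CE_iff s_def t_def x_def power_divide add_divide_distrib diff_divide_distrib)
      then have wC: "?w \<in> CE" by (simp add: CE_iff)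
      obtain l where "l \<noteq> 0" "?w = (\<lambda>i. l * v i)" using w unfolding proj_pt_eq_iff by blast
      then have "f ?w = 0" using form_scale[OF assms, of l v] v(2) by simp
      then have "g ?w = 0" using g(2) wC by simp
      then have eq: "poly p0 x + s * poly p1 x + t * poly p2 x + s * t * poly p3 x = 0" using p(2) by simp
      \<comment> \<open>The norm is formed in two stages: the value is multiplied by its conjugate
        under t -> -t, and the result by its conjugate under s -> -s.\<close>
      define a0 a1 a2 a3 where "a0 = poly p0 x" and "a1 = poly p1 x" and "a2 = poly p2 x" and "a3 = poly p3 x"
      have "(a0\<^sup>2 + s\<^sup>2 * a1\<^sup>2 - t\<^sup>2 * (a2\<^sup>2 + s\<^sup>2 * a3\<^sup>2)) + s * (2 * (a0 * a1 - t\<^sup>2 * a2 * a3)) =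
          (a0 + s * a1 + t * a2 + s * t * a3) * (a0 + s * a1 - t * a2 - s * t * a3)"
        by (simp add: power2_eq_square algebra_simps)
      also have "\<dots> = 0" using eq by (simp add: a0_def a1_def a2_def a3_def)
      finally have "(a0\<^sup>2 + s\<^sup>2 * a1\<^sup>2 - t\<^sup>2 * (a2\<^sup>2 + s\<^sup>2 * a3\<^sup>2)) = - (s * (2 * (a0 * a1 - t\<^sup>2 * a2 * a3)))"
        by (simp add: add_eq_0_iff2)
      then have "(a0\<^sup>2 + s\<^sup>2 * a1\<^sup>2 - t\<^sup>2 * (a2\<^sup>2 + s\<^sup>2 * a3\<^sup>2))\<^sup>2 - s\<^sup>2 * (2 * (a0 * a1 - t\<^sup>2 * a2 * a3))\<^sup>2 = 0"
        by (simp add: power_mult_distrib)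
      moreover have "poly N x = (a0\<^sup>2 + s\<^sup>2 * a1\<^sup>2 - t\<^sup>2 * (a2\<^sup>2 + s\<^sup>2 * a3\<^sup>2))\<^sup>2 - s\<^sup>2 * (2 * (a0 * a1 - t\<^sup>2 * a2 * a3))\<^sup>2"
      proof -
        have "poly D1 x = s\<^sup>2" "poly D2 x = t\<^sup>2" unfolding st by (simp_all add: D1_def D2_def power2_eq_square)
        then show ?thesis by (simp add: N_def a0_def a1_def a2_def a3_def)
      qed
      ultimately have "poly N x = 0" by simp
      moreover have "s = csqrt (1 + x\<^sup>2) \<or> s = - csqrt (1 + x\<^sup>2)" "t = csqrt (1 - x\<^sup>2) \<or> t = - csqrt (1 - x\<^sup>2)"
        using st by (simp_all only: square_eq_cases)
      ultimately have "?w \<in> S" unfolding S_def by (auto simp: image_iff)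
      then show ?thesis using w by simp
    qed
    then have "proj_pt ` {v \<in> CE. f v = 0} \<subseteq> proj_pt ` S" by blast
    then show ?thesis using \<open>finite S\<close> finite_subset by blast
  qed
qed

lemma evec_csqrt_CE: "evec (csqrt (1 + x\<^sup>2)) (csqrt (1 - x\<^sup>2)) 1 x \<in> CE"
  by (simp add: CE_iff)

lemma infinite_E: "infinite (proj_pt ` CE)"
proof -
  define w where "w = (\<lambda>n::nat. evec (csqrt (1 + (of_nat n)\<^sup>2)) (csqrt (1 - (of_nat n)\<^sup>2)) 1 (of_nat n))"
  have "inj (\<lambda>n. proj_pt (w n))"
  proof (rule injI)
    fix n m assume "proj_pt (w n) = proj_pt (w m)"
    then obtain l where "w m = (\<lambda>i. l * w n i)" unfolding proj_pt_eq_iff by blast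
    then have "w m Ec = l * w n Ec" "w m Ed = l * w n Ed" by simp_all
    then show "n = m" by (simp add: w_def)
  qed
  then have "infinite (range (\<lambda>n. proj_pt (w n)))" by (rule range_inj_infinite)
  moreover have "range (\<lambda>n. proj_pt (w n)) \<subseteq> proj_pt ` CE" unfolding w_def using evec_csqrt_CE by blast
  ultimately show ?thesis using finite_subset by blast
qed

text \<open>Two finite sets of zeros cannot cover the infinite curve. This is the irreducibility of
  E over the complex numbers, in the form in which generic points are chosen below.\<close>

lemma E_common_nonzero:
  assumes "form UNIV d f" "form UNIV e g" "u \<in> CE" "f u \<noteq> 0" "w \<in> CE" "g w \<noteq> 0"
  shows "\<exists>v\<in>CE. f v \<noteq> 0 \<and> g v \<noteq> 0"
proof (rule ccontr)
  assume "\<not> ?thesis"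
  then have "proj_pt ` CE \<subseteq> proj_pt ` {v \<in> CE. f v = 0} \<union> proj_pt ` {v \<in> CE. g v = 0}" by blast
  moreover have "finite (proj_pt ` {v \<in> CE. f v = 0})" "finite (proj_pt ` {v \<in> CE. g v = 0})"
    using E_finite_zeros[OF assms(1)] E_finite_zeros[OF assms(2)] assms(3-6) by blast+
  ultimately show False using infinite_E finite_subset by blast
qed

lemma tens_form_left: "f \<in> tens (forms K d) B \<Longrightarrow> form UNIV d (\<lambda>u. f (u, v))"
proof (induction rule: tens.induct)
  case (prod f g)
  then show ?case using form_smult[OF form_UNIV, of K d f "g v"] by (simp add: mult.commute)
qed (auto intro: form.add)

lemma tens_form_right: "f \<in> tens B (forms K d) \<Longrightarrow> form UNIV d (\<lambda>v. f (u, v))"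
proof (induction rule: tens.induct)
  case (prod f g)
  then show ?case using form_smult[OF form_UNIV, of K d g "f u"] by simp
qed (auto intro: form.add)

text \<open>First the second coordinate is moved to a point \<open>w\<close> good for both
  functions, then the first. The slices are forms with complex coefficients, because the fixed
  coordinate is a complex point; so the previous lemma is needed over the complex numbers.\<close>

lemma EE_prime:
  assumes f: "f \<in> tens (forms K d) (forms K d)" and g: "g \<in> tens (forms K e) (forms K e)"
    and zero: "\<forall>p\<in>CE \<times> CE. f p * g p = 0"
  shows "(\<forall>p\<in>CE \<times> CE. f p = 0) \<or> (\<forall>p\<in>CE \<times> CE. g p = 0)"
proof (rule ccontr)
  assume "\<not> ?thesis"
  then obtain u v u' v' where 1: "u \<in> CE" "v \<in> CE" "f (u, v) \<noteq> 0" "u' \<in> CE" "v' \<in> CE" "g (u', v') \<noteq> 0"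
    by auto
  obtain w where w: "w \<in> CE" "f (u, w) \<noteq> 0" "g (u', w) \<noteq> 0"
    using E_common_nonzero[OF tens_form_right[OF f, of u] tens_form_right[OF g, of u'] 1(2,3,5,6)] by auto
  obtain z where "z \<in> CE" "f (z, w) \<noteq> 0" "g (z, w) \<noteq> 0"
    using E_common_nonzero[OF tens_form_left[OF f, of w] tens_form_left[OF g, of w] 1(1) w(2) 1(4) w(3)] by auto
  then show False using zero w by auto
qed

section \<open>Elimination\<close>

text \<open>Linear factors of \<open>G\<close> are split off one at a time: a root of
  \<open>G\<close> is not a root of \<open>H\<close>, hence it is a root of
  \<open>Q\<close>.\<close>

lemma dvd_cancel_no_common_root:
  fixes G H Q :: "complex poly"
  assumes "G \<noteq> 0" "\<And>z. poly G z = 0 \<Longrightarrow> poly H z \<noteq> 0" "G dvd Q * H"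
  shows "G dvd Q"
  using assms
proof (induction "degree G" arbitrary: G Q)
  case 0
  then have "is_unit G" by (simp add: is_unit_iff_degree)
  then show ?case by (rule unit_imp_dvd)
next
  case (Suc n)
  then have "\<not> constant (poly G)" by (simp add: constant_degree)
  then obtain z where z: "poly G z = 0" using fundamental_theorem_of_algebra by blast
  then obtain G' where G': "G = [:-z, 1:] * G'" by (auto simp: poly_eq_0_iff_dvd)
  have "G' \<noteq> 0" using Suc.prems(1) G' by auto
  obtain k where "Q * H = G * k" using Suc.prems(3) by (rule dvdE)
  then have "poly (Q * H) z = 0" using z by simp
  then have "poly Q z = 0" using Suc.prems(2)[OF z] by simp
  then obtain Q' where Q': "Q = [:-z, 1:] * Q'" by (auto simp: poly_eq_0_iff_dvd)
  have "[:-z, 1:] * G' dvd [:-z, 1:] * (Q' * H)" using Suc.prems(3) unfolding G' Q' by (simp only: mult.assoc)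
  then have "G' dvd Q' * H" by (subst (asm) dvd_times_left_cancel_iff) simp
  moreover have "n = degree G'" using Suc.hyps(2) \<open>G' \<noteq> 0\<close> unfolding G' by (subst (asm) degree_mult_eq) auto
  moreover have "poly H w \<noteq> 0" if "poly G' w = 0" for w using Suc.prems(2)[of w] that unfolding G' by simp
  ultimately have "G' dvd Q'" using Suc.hyps(1)[of G' Q'] \<open>G' \<noteq> 0\<close> by blast
  then show ?case unfolding G' Q' by (rule mult_dvd_mono[OF dvd_refl])
qed

text \<open>The Sylvester matrix of two binary forms of the same degree n.\<close>

definition sylv_entry :: "nat \<Rightarrow> (nat \<Rightarrow> complex) \<Rightarrow> (nat \<Rightarrow> complex) \<Rightarrow> nat \<Rightarrow> nat \<Rightarrow> complex" where
  "sylv_entry n \<gamma> \<delta> i j =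
    (if i < n then (if i \<le> j \<and> j \<le> i + n then \<gamma> (j - i) else 0)
     else (if i - n \<le> j \<and> j \<le> i then \<delta> (j - (i - n)) else 0))"

definition sylv :: "nat \<Rightarrow> (nat \<Rightarrow> complex) \<Rightarrow> (nat \<Rightarrow> complex) \<Rightarrow> complex Matrix.mat" where
  "sylv n \<gamma> \<delta> = Matrix.mat (2 * n) (2 * n) (\<lambda>(i, j). sylv_entry n \<gamma> \<delta> i j)"

lemma sum_shift_window:
  fixes F :: "nat \<Rightarrow> complex"
  assumes "k < n"
  shows "(\<Sum>j<2 * n. (if k \<le> j \<and> j \<le> k + n then F j else 0)) = (\<Sum>l\<le>n. F (k + l))"
proof -
  have "(\<Sum>j<2 * n. (if k \<le> j \<and> j \<le> k + n then F j else 0)) = (\<Sum>j\<in>{k..k + n}. F j)"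
    by (rule sum.mono_neutral_cong_right) (use assms in auto)
  also have "\<dots> = (\<Sum>l\<in>{0..n}. F (l + k))"
    using sum.shift_bounds_cl_nat_ivl[of F 0 k n] by (simp add: add.commute)
  finally show ?thesis by (simp add: add.commute atLeast0AtMost)
qed

text \<open>Applied to the vector of all monomials of degree 2n - 1 in c and d, a row of the
  Sylvester matrix returns one of the two binary forms times a monomial of degree n - 1.\<close>

lemma sylv_row:
  assumes "i < 2 * n"
  shows "(\<Sum>j<2 * n. sylv_entry n \<gamma> \<delta> i j * (c ^ j * d ^ (2 * n - 1 - j))) =
    (if i < n then c ^ i * d ^ (n - 1 - i) * (\<Sum>l\<le>n. \<gamma> l * c ^ l * d ^ (n - l))
     else c ^ (i - n) * d ^ (n - 1 - (i - n)) * (\<Sum>l\<le>n. \<delta> l * c ^ l * d ^ (n - l)))"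
proof -
  have *: "(\<Sum>j<2 * n. (if k \<le> j \<and> j \<le> k + n then \<gamma> (j - k) else 0) * (c ^ j * d ^ (2 * n - 1 - j))) =
      c ^ k * d ^ (n - 1 - k) * (\<Sum>l\<le>n. \<gamma> l * c ^ l * d ^ (n - l))" if k: "k < n" for k \<gamma>
  proof -
    have "(\<Sum>j<2 * n. (if k \<le> j \<and> j \<le> k + n then \<gamma> (j - k) else 0) * (c ^ j * d ^ (2 * n - 1 - j))) =
      (\<Sum>j<2 * n. (if k \<le> j \<and> j \<le> k + n then \<gamma> (j - k) * (c ^ j * d ^ (2 * n - 1 - j)) else 0))"
      by (rule sum.cong) auto
    also have "\<dots> = (\<Sum>l\<le>n. \<gamma> (k + l - k) * (c ^ (k + l) * d ^ (2 * n - 1 - (k + l))))"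
      by (rule sum_shift_window[OF k])
    also have "\<dots> = (\<Sum>l\<le>n. c ^ k * d ^ (n - 1 - k) * (\<gamma> l * c ^ l * d ^ (n - l)))"
    proof (rule sum.cong)
      fix l assume "l \<in> {..n}"
      then have e: "2 * n - 1 - (k + l) = (n - 1 - k) + (n - l)" using k by auto
      show "\<gamma> (k + l - k) * (c ^ (k + l) * d ^ (2 * n - 1 - (k + l))) = c ^ k * d ^ (n - 1 - k) * (\<gamma> l * c ^ l * d ^ (n - l))"
        unfolding e by (simp add: power_add)
    qed simp
    finally show ?thesis by (simp add: sum_distrib_left)
  qed
  show ?thesis
  proof (cases "i < n")
    case True
    then show ?thesis using *[of i \<gamma>] by (simp add: sylv_entry_def)
  next
    case False
    then have "i - n < n" "i - n + n = i" using assms by auto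
    then show ?thesis using *[of "i - n" \<delta>] False by (simp add: sylv_entry_def)
  qed
qed

text \<open>At a common zero the vector of monomials lies in the kernel, and it is nonzero because
  it contains the pure powers of c and of d.\<close>

lemma det_sylv_eq_0:
  assumes n: "n \<ge> 1" and cd: "c \<noteq> 0 \<or> d \<noteq> 0"
    and zero: "(\<Sum>l\<le>n. \<gamma> l * c ^ l * d ^ (n - l)) = 0" "(\<Sum>l\<le>n. \<delta> l * c ^ l * d ^ (n - l)) = 0"
  shows "Determinant.det (sylv n \<gamma> \<delta>) = 0"
proof -
  have S: "sylv n \<gamma> \<delta> \<in> carrier_mat (2 * n) (2 * n)" by (simp add: sylv_def)
  define v where "v = Matrix.vec (2 * n) (\<lambda>j. c ^ j * d ^ (2 * n - 1 - j))"
  have "v \<in> carrier_vec (2 * n)" by (simp add: v_def)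
  moreover have "v \<noteq> 0\<^sub>v (2 * n)"
  proof
    assume v0: "v = 0\<^sub>v (2 * n)"
    have "vec_index v 0 = 0" "vec_index v (2 * n - 1) = 0" unfolding v0 using n by auto
    then have "d ^ (2 * n - 1) = 0" "c ^ (2 * n - 1) = 0" using n by (simp_all add: v_def)
    then show False using cd by simp
  qed
  moreover have "sylv n \<gamma> \<delta> *\<^sub>v v = 0\<^sub>v (2 * n)"
  proof (rule eq_vecI)
    fix i assume "i < dim_vec (0\<^sub>v (2 * n) :: complex Matrix.vec)"
    then have i: "i < 2 * n" by simp
    have "vec_index (sylv n \<gamma> \<delta> *\<^sub>v v) i = (\<Sum>j<2 * n. sylv_entry n \<gamma> \<delta> i j * (c ^ j * d ^ (2 * n - 1 - j)))"
      using i by (simp add: sylv_def v_def scalar_prod_def atLeast0LessThan)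
    also have "\<dots> = 0" unfolding sylv_row[OF i] using zero by simp
    finally show "vec_index (sylv n \<gamma> \<delta> *\<^sub>v v) i = vec_index (0\<^sub>v (2 * n)) i" using i by simp
  qed (simp add: sylv_def)
  ultimately show ?thesis using det_0_iff_vec_prod_zero[OF S] by blast
qed

text \<open>A vector in the kernel of the transpose is a pair of polynomials P, Q of degree less
  than n with P G + Q H = 0. As \<open>G\<close> has degree exactly n and no root in common with
  \<open>H\<close>, it divides \<open>Q\<close>, so both vanish. The condition on the leading
  coefficient excludes a common zero at infinity.\<close>

lemma det_sylv_neq_0:
  assumes lead: "\<gamma> n \<noteq> 0"
    and no_root: "\<And>t. (\<Sum>l\<le>n. \<gamma> l * t ^ l) = 0 \<Longrightarrow> (\<Sum>l\<le>n. \<delta> l * t ^ l) \<noteq> 0"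
  shows "Determinant.det (sylv n \<gamma> \<delta>) \<noteq> 0"
proof
  assume det0: "Determinant.det (sylv n \<gamma> \<delta>) = 0"
  have S: "sylv n \<gamma> \<delta> \<in> carrier_mat (2 * n) (2 * n)" by (simp add: sylv_def)
  have ST: "transpose_mat (sylv n \<gamma> \<delta>) \<in> carrier_mat (2 * n) (2 * n)" using S by simp
  have "Determinant.det (transpose_mat (sylv n \<gamma> \<delta>)) = 0" using det0 det_transpose[OF S] by simp
  then obtain v where v: "v \<in> carrier_vec (2 * n)" "v \<noteq> 0\<^sub>v (2 * n)" "transpose_mat (sylv n \<gamma> \<delta>) *\<^sub>v v = 0\<^sub>v (2 * n)"
    using det_0_iff_vec_prod_zero[OF ST] by blast
  define w where "w = (\<lambda>i. vec_index v i)"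
  have col: "(\<Sum>i<2 * n. w i * sylv_entry n \<gamma> \<delta> i j) = 0" if j: "j < 2 * n" for j
  proof -
    have dim: "dim_vec v = 2 * n" using v(1) by auto
    have "(\<Sum>i<2 * n. w i * sylv_entry n \<gamma> \<delta> i j) = (\<Sum>i<2 * n. sylv_entry n \<gamma> \<delta> i j * w i)"
      by (rule sum.cong) (simp_all add: mult.commute)
    also have "\<dots> = vec_index (transpose_mat (sylv n \<gamma> \<delta>) *\<^sub>v v) j"
      using j dim by (simp add: sylv_def w_def scalar_prod_def atLeast0LessThan)
    also have "\<dots> = 0" unfolding v(3) using j by simp
    finally show ?thesis .
  qed
  define P Q G H where "P = (\<Sum>i<n. monom (w i) i)" and "Q = (\<Sum>i<n. monom (w (n + i)) i)"
    and "G = (\<Sum>l\<le>n. monom (\<gamma> l) l)" and "H = (\<Sum>l\<le>n. monom (\<delta> l) l)"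
  have Gx: "poly G x = (\<Sum>l\<le>n. \<gamma> l * x ^ l)" for x by (simp add: G_def poly_sum poly_monom)
  have Hx: "poly H x = (\<Sum>l\<le>n. \<delta> l * x ^ l)" for x by (simp add: H_def poly_sum poly_monom)
  have "poly (P * G + Q * H) x = 0" for x
  proof -
    have "poly (P * G + Q * H) x = (\<Sum>i<n. w i * (x ^ i * (\<Sum>l\<le>n. \<gamma> l * x ^ l))) + (\<Sum>i<n. w (n + i) * (x ^ i * (\<Sum>l\<le>n. \<delta> l * x ^ l)))"
      by (simp add: Gx Hx P_def Q_def poly_sum poly_monom sum_distrib_right mult.assoc)
    also have "\<dots> = (\<Sum>i<n + n. w i * (\<Sum>j<2 * n. sylv_entry n \<gamma> \<delta> i j * x ^ j))"
    proof -
      have "x ^ i * (\<Sum>l\<le>n. \<gamma> l * x ^ l) = (\<Sum>j<2 * n. sylv_entry n \<gamma> \<delta> i j * x ^ j)" if "i < n" for i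
        using sylv_row[of i n \<gamma> \<delta> x 1] that by simp
      moreover have "x ^ i * (\<Sum>l\<le>n. \<delta> l * x ^ l) = (\<Sum>j<2 * n. sylv_entry n \<gamma> \<delta> (n + i) j * x ^ j)" if "i < n" for i
        using sylv_row[of "n + i" n \<gamma> \<delta> x 1] that by simp
      ultimately show ?thesis by (simp add: sum_lessThan_add)
    qed
    also have "\<dots> = (\<Sum>i<2 * n. \<Sum>j<2 * n. w i * sylv_entry n \<gamma> \<delta> i j * x ^ j)"
      by (simp add: sum_distrib_left mult.assoc mult_2)
    also have "\<dots> = (\<Sum>j<2 * n. \<Sum>i<2 * n. w i * sylv_entry n \<gamma> \<delta> i j * x ^ j)" by (rule sum.swap)
    also have "\<dots> = (\<Sum>j<2 * n. (\<Sum>i<2 * n. w i * sylv_entry n \<gamma> \<delta> i j) * x ^ j)" by (simp add: sum_distrib_right)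
    also have "\<dots> = 0" using col by simp
    finally show ?thesis .
  qed
  then have PGQH: "P * G + Q * H = 0" by (simp add: poly_all_0_iff_0[symmetric])
  have coeffG: "coeff G i = (if i \<le> n then \<gamma> i else 0)" for i
    by (simp add: G_def coeff_sum)
  have "degree G \<le> n" by (rule degree_le) (simp add: coeffG)
  moreover have "n \<le> degree G" by (rule le_degree) (simp add: coeffG lead)
  ultimately have dG: "degree G = n" by simp
  have G0: "G \<noteq> 0" using coeffG[of n] lead by auto
  have coeffQ: "coeff Q i = (if i < n then w (n + i) else 0)" "coeff P i = (if i < n then w i else 0)" for i
    by (simp_all add: Q_def P_def coeff_sum)
  have "Q * H = G * (- P)" using PGQH by (simp add: eq_neg_iff_add_eq_0 add.commute mult.commute)
  then have dvd: "G dvd Q * H" by simp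
  have "poly H z \<noteq> 0" if "poly G z = 0" for z
    using no_root[of z] that unfolding Gx Hx by simp
  then have "G dvd Q" by (rule dvd_cancel_no_common_root[OF G0 _ dvd])
  have "Q = 0"
  proof (rule ccontr)
    assume "Q \<noteq> 0"
    then have "n \<le> degree Q" using dvd_imp_degree_le[OF \<open>G dvd Q\<close>] dG by simp
    moreover have "coeff Q (degree Q) \<noteq> 0" using \<open>Q \<noteq> 0\<close> by simp
    ultimately show False using coeffQ(1)[of "degree Q"] by simp
  qed
  then have "P = 0" using PGQH G0 by simp
  have "w i = 0" if "i < 2 * n" for i
  proof (cases "i < n")
    case True
    then show ?thesis using coeffQ(2)[of i] \<open>P = 0\<close> by simp
  next
    case False
    then have "i - n < n" "n + (i - n) = i" using that by auto
    then show ?thesis using coeffQ(1)[of "i - n"] \<open>Q = 0\<close> by simp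
  qed
  then have "v = 0\<^sub>v (2 * n)" using v(1) by (intro eq_vecI) (auto simp: w_def)
  then show False using v(2) by simp
qed

context graded
begin

lemma A_prod: "(\<And>i. i \<in> {0..<m} \<Longrightarrow> f i \<in> A k) \<Longrightarrow> (\<lambda>x. \<Prod>i = 0..<m. f i x) \<in> A (m * k)"
proof (induction m)
  case 0
  show ?case using A_const[OF K_one] by simp
next
  case (Suc m)
  then have "(\<lambda>x. (\<Prod>i = 0..<m. f i x) * f m x) \<in> A (m * k + k)" by (intro A_mult) auto
  then show ?case by (simp add: add.commute)
qed

text \<open>By the expansion over permutations: each summand is a product of 2n entries of degree
  \<open>k\<close>, up to a sign, and the zero entries count as functions of degree \<open>k\<close>
  too.\<close>

lemma det_sylv_A:
  assumes "\<And>i. i \<le> n \<Longrightarrow> \<gamma> i \<in> A k" "\<And>i. i \<le> n \<Longrightarrow> \<delta> i \<in> A k"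
  shows "(\<lambda>y. Determinant.det (sylv n (\<lambda>i. \<gamma> i y) (\<lambda>i. \<delta> i y))) \<in> A (2 * n * k)"
proof -
  have z: "(\<lambda>_. 0) \<in> A k" using A_smult[OF K_zero assms(1)[of 0]] by simp
  have ent: "(\<lambda>y. sylv_entry n (\<lambda>i. \<gamma> i y) (\<lambda>i. \<delta> i y) i j) \<in> A k" for i j
  proof -
    consider "i < n" "i \<le> j" "j \<le> i + n" | "\<not> i < n" "i - n \<le> j" "j \<le> i"
      | "(i < n \<and> \<not> (i \<le> j \<and> j \<le> i + n)) \<or> (\<not> i < n \<and> \<not> (i - n \<le> j \<and> j \<le> i))" by blast
    then show ?thesis
    proof cases
      case 1
      then have "j - i \<le> n" by simp
      then show ?thesis using assms(1) 1 by (simp add: sylv_entry_def)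
    next
      case 2
      then have "j - (i - n) \<le> n" by simp
      then show ?thesis using assms(2) 2 by (simp add: sylv_entry_def)
    next
      case 3
      then have "(\<lambda>y. sylv_entry n (\<lambda>i. \<gamma> i y) (\<lambda>i. \<delta> i y) i j) = (\<lambda>_. 0)" by (auto simp: sylv_entry_def)
      then show ?thesis using z by simp
    qed
  qed
  have "(\<lambda>y. \<Sum>p\<in>{p. p permutes {0..<2 * n}}. signof p *
      (\<Prod>i = 0..<2 * n. sylv_entry n (\<lambda>i. \<gamma> i y) (\<lambda>i. \<delta> i y) i (p i))) \<in> A (2 * n * k)"
  proof (rule A_sum)
    show "finite {p. p permutes {0..<2 * n}}" by (rule finite_permutations) simp
    show "{p. p permutes {0..<2 * n}} \<noteq> {}" using permutes_id by blast
    fix p assume "p \<in> {p. p permutes {0..<2 * n}}"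
    have "signof p \<in> K" by (auto simp: sign_def)
    then show "(\<lambda>y. signof p * (\<Prod>i = 0..<2 * n. sylv_entry n (\<lambda>i. \<gamma> i y) (\<lambda>i. \<delta> i y) i (p i))) \<in> A (2 * n * k)"
      by (intro A_smult A_prod ent)
  qed
  also have "(\<lambda>y. \<Sum>p\<in>{p. p permutes {0..<2 * n}}. signof p *
      (\<Prod>i = 0..<2 * n. sylv_entry n (\<lambda>i. \<gamma> i y) (\<lambda>i. \<delta> i y) i (p i))) =
      (\<lambda>y. Determinant.det (sylv n (\<lambda>i. \<gamma> i y) (\<lambda>i. \<delta> i y)))"
  proof
    fix y
    have "Determinant.det (sylv n (\<lambda>i. \<gamma> i y) (\<lambda>i. \<delta> i y)) = (\<Sum>p\<in>{p. p permutes {0..<2 * n}}. signof p *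
      (\<Prod>i = 0..<2 * n. (sylv n (\<lambda>i. \<gamma> i y) (\<lambda>i. \<delta> i y)) $$ (i, p i)))"
      by (rule det_def') (simp add: sylv_def)
    also have "\<dots> = (\<Sum>p\<in>{p. p permutes {0..<2 * n}}. signof p *
      (\<Prod>i = 0..<2 * n. sylv_entry n (\<lambda>i. \<gamma> i y) (\<lambda>i. \<delta> i y) i (p i)))"
    proof (rule sum.cong[OF refl])
      fix p assume "p \<in> {p. p permutes {0..<2 * n}}"
      then have "p i < 2 * n" if "i < 2 * n" for i
        using that permutes_in_image[of p "{0..<2 * n}" i] by simp
      then show "signof p * (\<Prod>i = 0..<2 * n. (sylv n (\<lambda>i. \<gamma> i y) (\<lambda>i. \<delta> i y)) $$ (i, p i)) =
        signof p * (\<Prod>i = 0..<2 * n. sylv_entry n (\<lambda>i. \<gamma> i y) (\<lambda>i. \<delta> i y) i (p i))"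
        by (intro arg_cong2[of _ _ _ _ "(*)"] prod.cong refl) (simp add: sylv_def)
    qed
    finally show "(\<Sum>p\<in>{p. p permutes {0..<2 * n}}. signof p *
      (\<Prod>i = 0..<2 * n. sylv_entry n (\<lambda>i. \<gamma> i y) (\<lambda>i. \<delta> i y) i (p i))) = Determinant.det (sylv n (\<lambda>i. \<gamma> i y) (\<lambda>i. \<delta> i y))"
      by (rule sym)
  qed
  finally show ?thesis .
qed

end

section \<open>Norms from E to the line with coordinates c, d, and closed projections\<close>

lemma form_diag:
  assumes "form K d f" "\<And>i. \<epsilon> i \<in> K"
  shows "form K d (\<lambda>v. f (\<lambda>i. \<epsilon> i * v i))"
  using assms(1)
proof (induction rule: form.induct)
  case (const c)
  then show ?case by (rule form.const)
next
  case (var i)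
  show ?case using form.mult[OF form.const[OF assms(2)[of i]] form.var[of K i]] by simp
qed (rule form.add form.mult; assumption)+

text \<open>Together with \<open>sgn_b\<close> this generates the deck group of order four of the
  map from E to the line with coordinates [c, d].\<close>

definition sgn_a :: "(E_var \<Rightarrow> complex) \<Rightarrow> E_var \<Rightarrow> complex" where "sgn_a v = (\<lambda>i. evec (-1) 1 1 1 i * v i)"
definition sgn_b :: "(E_var \<Rightarrow> complex) \<Rightarrow> E_var \<Rightarrow> complex" where "sgn_b v = (\<lambda>i. evec 1 (-1) 1 1 i * v i)"

lemma sgn_simps [simp]: "sgn_a v Ea = - v Ea" "sgn_a v Eb = v Eb" "sgn_a v Ec = v Ec" "sgn_a v Ed = v Ed"
  "sgn_b v Ea = v Ea" "sgn_b v Eb = - v Eb" "sgn_b v Ec = v Ec" "sgn_b v Ed = v Ed"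
  by (simp_all add: sgn_a_def sgn_b_def)

lemma sgn_invol [simp]: "sgn_a (sgn_a v) = v" "sgn_b (sgn_b v) = v" "sgn_b (sgn_a v) = sgn_a (sgn_b v)"
  by (simp_all add: evec_eq_iff)

lemma sgn_CE: "v \<in> CE \<Longrightarrow> sgn_a v \<in> CE" "v \<in> CE \<Longrightarrow> sgn_b v \<in> CE"
  by (simp_all add: CE_iff)

lemma (in subfield) evec_K: "a \<in> K \<Longrightarrow> b \<in> K \<Longrightarrow> c \<in> K \<Longrightarrow> d \<in> K \<Longrightarrow> evec a b c d i \<in> K"
  by (cases i) simp_all

lemma (in subfield) form_sgn: "form K d f \<Longrightarrow> form K d (\<lambda>v. f (sgn_a v))" "form K d f \<Longrightarrow> form K d (\<lambda>v. f (sgn_b v))"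
  unfolding sgn_a_def sgn_b_def by (auto intro!: form_diag evec_K K_uminus)

definition sgn_avg :: "((E_var \<Rightarrow> complex) \<Rightarrow> complex) \<Rightarrow> (E_var \<Rightarrow> complex) \<Rightarrow> complex" where
  "sgn_avg f v = (f v + f (sgn_a v) + f (sgn_b v) + f (sgn_a (sgn_b v))) / 4"

text \<open>The average over the deck group annihilates every normal form monomial containing a or b
  and fixes the others, leaving a binary form in c and d.\<close>

lemma (in subfield) sgn_avg_form:
  assumes "form K n f"
  shows "\<exists>k. (\<forall>i. k i \<in> K) \<and> (\<forall>v\<in>CE. sgn_avg f v = (\<Sum>i\<le>n. k i * v Ec ^ i * v Ed ^ (n - i)))"
proof -
  obtain g where g: "g \<in> lspan K (emonos n)" "\<forall>v\<in>CE. f v = g v"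
    using form_normal[OF assms] unfolding normal_forms_def by blast
  have fg: "\<forall>v\<in>CE. sgn_avg f v = sgn_avg g v" using g(2) sgn_CE by (simp add: sgn_avg_def)
  from g(1) have "\<exists>k. (\<forall>i. k i \<in> K) \<and> (\<forall>v. sgn_avg g v = (\<Sum>i\<le>n. k i * v Ec ^ i * v Ed ^ (n - i)))"
  proof induction
    case zero
    show ?case by (rule exI[of _ "\<lambda>_. 0"]) (simp add: sgn_avg_def)
  next
    case (base f)
    then obtain p q i j where f: "f = (\<lambda>v. v Ea ^ p * v Eb ^ q * v Ec ^ i * v Ed ^ j)" "p \<le> 1" "q \<le> 1" "p + q + i + j = n"
      unfolding emonos_def by blast
    show ?case
    proof (cases "p = 0 \<and> q = 0")
      case True
      then have ij: "j = n - i" "i \<le> n" using f by auto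
      have "(\<Sum>l\<le>n. (if l = i then 1 else 0) * v Ec ^ l * v Ed ^ (n - l)) = v Ec ^ i * v Ed ^ (n - i)" for v :: "E_var \<Rightarrow> complex"
      proof -
        have "(\<Sum>l\<le>n. (if l = i then 1 else 0) * v Ec ^ l * v Ed ^ (n - l)) = (\<Sum>l\<le>n. if l = i then v Ec ^ l * v Ed ^ (n - l) else 0)"
          by (rule sum.cong) auto
        then show ?thesis using ij by simp
      qed
      moreover have "sgn_avg f v = v Ec ^ i * v Ed ^ (n - i)" for v using True ij by (simp add: sgn_avg_def f(1))
      ultimately show ?thesis by (intro exI[of _ "\<lambda>l. if l = i then 1 else 0"]) auto
    next
      case False
      then have "p = 1 \<or> q = 1" using f by auto
      moreover have "p = 0 \<or> p = 1" "q = 0 \<or> q = 1" using f by auto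
      ultimately have "sgn_avg f v = 0" for v by (auto simp: sgn_avg_def f(1))
      then show ?thesis by (intro exI[of _ "\<lambda>_. 0"]) simp
    qed
  next
    case (add f g)
    then obtain k k' where "\<forall>i. k i \<in> K" "\<forall>v. sgn_avg f v = (\<Sum>i\<le>n. k i * v Ec ^ i * v Ed ^ (n - i))"
      "\<forall>i. k' i \<in> K" "\<forall>v. sgn_avg g v = (\<Sum>i\<le>n. k' i * v Ec ^ i * v Ed ^ (n - i))" by (elim exE conjE) (rule that)
    moreover have "sgn_avg (\<lambda>v. f v + g v) v = sgn_avg f v + sgn_avg g v" for v
      by (simp add: sgn_avg_def add_divide_distrib)
    ultimately show ?case by (intro exI[of _ "\<lambda>i. k i + k' i"]) (auto simp: distrib_right sum.distrib)
  next
    case (smult c f)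
    then obtain k where "\<forall>i. k i \<in> K" "\<forall>v. sgn_avg f v = (\<Sum>i\<le>n. k i * v Ec ^ i * v Ed ^ (n - i))" by (elim exE conjE) (rule that)
    moreover have "sgn_avg (\<lambda>v. c * f v) v = c * sgn_avg f v" for v
      by (simp add: sgn_avg_def distrib_left)
    ultimately show ?case using smult(1) by (intro exI[of _ "\<lambda>i. c * k i"]) (auto simp: sum_distrib_left mult.assoc)
  qed
  then obtain k where "\<forall>i. k i \<in> K" "\<forall>v. sgn_avg g v = (\<Sum>i\<le>n. k i * v Ec ^ i * v Ed ^ (n - i))"
    by (elim exE conjE) (rule that)
  with fg show ?thesis by (intro exI[of _ k]) simp
qed

lemma (in subfield) graded_E: "graded K CE proj_pt (forms K)"
  unfolding CE_def by (rule graded_proj)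

text \<open>The second factor is an arbitrary space, so that projecting along E can be done twice:
  from E x (E x P) and then from E x P.\<close>

locale E_times = Y: graded K C q A for K and C :: "'c set" and q :: "'c \<Rightarrow> 'a" and A
begin

sublocale EY: graded_pair K CE proj_pt "forms K" C q A
proof -
  interpret E: graded K CE proj_pt "forms K" by (rule Y.graded_E)
  show "graded_pair K CE proj_pt (forms K) C q A" by unfold_locales
qed

abbreviation "T d \<equiv> tens (forms K d) (A d)"

text \<open>An invariant function equals its own average over the sign changes, and averaging turns
  the factor on E into a binary form while the other factor stays a coefficient.\<close>

lemma binary_coeffs:
  assumes h: "h \<in> T n"
    and inv: "\<And>e y. e \<in> CE \<Longrightarrow> y \<in> C \<Longrightarrow> h (sgn_a e, y) = h (e, y)" "\<And>e y. e \<in> CE \<Longrightarrow> y \<in> C \<Longrightarrow> h (sgn_b e, y) = h (e, y)"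
  shows "\<exists>\<gamma>. (\<forall>i. \<gamma> i \<in> A n) \<and> (\<forall>e\<in>CE. \<forall>y\<in>C. h (e, y) = (\<Sum>i\<le>n. \<gamma> i y * e Ec ^ i * e Ed ^ (n - i)))"
proof -
  have "\<exists>\<gamma>. (\<forall>i. \<gamma> i \<in> A n) \<and> (\<forall>e\<in>CE. \<forall>y\<in>C. sgn_avg (\<lambda>e. h (e, y)) e = (\<Sum>i\<le>n. \<gamma> i y * e Ec ^ i * e Ed ^ (n - i)))"
    using h
  proof induction
    case (prod f g)
    then have "form K n f" by simp
    obtain k where k: "\<forall>i. k i \<in> K" "\<forall>v\<in>CE. sgn_avg f v = (\<Sum>i\<le>n. k i * v Ec ^ i * v Ed ^ (n - i))"
      using Y.sgn_avg_form[OF \<open>form K n f\<close>] by (elim exE conjE) (rule that)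
    have eq: "sgn_avg (\<lambda>e. f (fst (e, y)) * g (snd (e, y))) e = sgn_avg f e * g y" for e y
      by (simp add: sgn_avg_def algebra_simps)
    have "sgn_avg (\<lambda>e. f (fst (e, y)) * g (snd (e, y))) e = (\<Sum>i\<le>n. k i * g y * e Ec ^ i * e Ed ^ (n - i))" if "e \<in> CE" for e y
    proof -
      have "sgn_avg (\<lambda>e. f (fst (e, y)) * g (snd (e, y))) e = (\<Sum>i\<le>n. k i * e Ec ^ i * e Ed ^ (n - i)) * g y"
        unfolding eq using k(2) that by simp
      also have "\<dots> = (\<Sum>i\<le>n. k i * g y * e Ec ^ i * e Ed ^ (n - i))"
        unfolding sum_distrib_right by (rule sum.cong) (simp_all add: ac_simps)
      finally show ?thesis .
    qed
    moreover have "(\<lambda>y. k i * g y) \<in> A n" for i using k(1) prod(2) by (intro Y.A_smult) auto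
    ultimately show ?case by (intro exI[of _ "\<lambda>i y. k i * g y"]) simp
  next
    case (add f g)
    then obtain \<gamma> \<delta> where \<gamma>: "\<forall>i. \<gamma> i \<in> A n" "\<forall>e\<in>CE. \<forall>y\<in>C. sgn_avg (\<lambda>e. f (e, y)) e = (\<Sum>i\<le>n. \<gamma> i y * e Ec ^ i * e Ed ^ (n - i))"
      "\<forall>i. \<delta> i \<in> A n" "\<forall>e\<in>CE. \<forall>y\<in>C. sgn_avg (\<lambda>e. g (e, y)) e = (\<Sum>i\<le>n. \<delta> i y * e Ec ^ i * e Ed ^ (n - i))"
      by (elim exE conjE) (rule that)
    have "sgn_avg (\<lambda>e. f (e, y) + g (e, y)) e = sgn_avg (\<lambda>e. f (e, y)) e + sgn_avg (\<lambda>e. g (e, y)) e" for e y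
      by (simp add: sgn_avg_def add_divide_distrib)
    then show ?case using \<gamma>
      by (intro exI[of _ "\<lambda>i y. \<gamma> i y + \<delta> i y"]) (auto intro: Y.A_add simp: sum.distrib distrib_right)
  qed
  then obtain \<gamma> where "\<forall>i. \<gamma> i \<in> A n"
    "\<forall>e\<in>CE. \<forall>y\<in>C. sgn_avg (\<lambda>e. h (e, y)) e = (\<Sum>i\<le>n. \<gamma> i y * e Ec ^ i * e Ed ^ (n - i))"
    by (elim exE conjE) (rule that)
  moreover have "sgn_avg (\<lambda>e. h (e, y)) e = h (e, y)" if "e \<in> CE" "y \<in> C" for e y
    using inv that sgn_CE by (simp add: sgn_avg_def)
  ultimately show ?thesis by (intro exI[of _ \<gamma>]) simp
qed

text \<open>The norm along the map of degree four from E to the line, with the point of the second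
  factor kept fixed. It is invariant, hence a binary form in c and d whose coefficients are
  functions on the second factor.\<close>

definition enorm :: "((E_var \<Rightarrow> complex) \<times> 'c \<Rightarrow> complex) \<Rightarrow> (E_var \<Rightarrow> complex) \<times> 'c \<Rightarrow> complex" where
  "enorm g p = g p * g (sgn_a (fst p), snd p) * (g (sgn_b (fst p), snd p) * g (sgn_a (sgn_b (fst p)), snd p))"

lemma enorm_coeffs:
  assumes "g \<in> T n"
  shows "\<exists>\<gamma>. (\<forall>i. \<gamma> i \<in> A (4 * n)) \<and> (\<forall>e\<in>CE. \<forall>y\<in>C. enorm g (e, y) = (\<Sum>i\<le>4 * n. \<gamma> i y * e Ec ^ i * e Ed ^ (4 * n - i)))"
proof (rule binary_coeffs)
  have s: "(\<lambda>p. g (sgn_a (fst p), snd p)) \<in> T n" if "g \<in> T n" for g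
    using tens_map[OF that, of sgn_a "forms K n" "\<lambda>y. y" "A n"] Y.form_sgn by (simp add: map_prod_def case_prod_unfold)
  have s': "(\<lambda>p. g (sgn_b (fst p), snd p)) \<in> T n" if "g \<in> T n" for g
    using tens_map[OF that, of sgn_b "forms K n" "\<lambda>y. y" "A n"] Y.form_sgn by (simp add: map_prod_def case_prod_unfold)
  have "(\<lambda>p. g (sgn_a (sgn_b (fst p)), snd p)) \<in> T n" using s'[OF s[OF assms]] by simp
  then have "(\<lambda>p. g p * g (sgn_a (fst p), snd p) * (g (sgn_b (fst p), snd p) * g (sgn_a (sgn_b (fst p)), snd p))) \<in> T ((n + n) + (n + n))"
    by (intro EY.XY.A_mult s s' assms)
  moreover have "(n + n) + (n + n) = 4 * n" by simp
  ultimately show "enorm g \<in> T (4 * n)" unfolding enorm_def[abs_def] by (simp only:)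
qed (simp_all add: enorm_def ac_simps)

text \<open>Over a point \<open>y\<close> outside the image, two functions \<open>g\<close> and
  \<open>h\<close> vanishing on \<open>Z\<close> are found whose norms have no common zero over
  \<open>y\<close>. The resultant of the norms is then nonzero at \<open>y\<close>, and it vanishes
  on the whole image since a point of \<open>Z\<close> is a common zero.\<close>

lemma closedin_snd:
  assumes Z: "closedin (fs_top (gspace (CE \<times> C) (map_prod proj_pt q) T)) Z"
  shows "closedin (fs_top (gspace C q A)) (snd ` Z)"
  unfolding Y.closedin_gspace
proof (intro conjI ballI impI)
  have Zs: "Z \<subseteq> map_prod proj_pt q ` (CE \<times> C)" using Z unfolding EY.XY.closedin_gspace by (rule conjunct1)
  then show "snd ` Z \<subseteq> q ` C" by auto
  fix y assume y: "y \<in> C" "q y \<notin> snd ` Z"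
  define W where "W = map_prod proj_pt q ` (CE \<times> C) - Z"
  have W: "gopen (CE \<times> C) (map_prod proj_pt q) T W"
    using Z unfolding closedin_def EY.XY.points_gspace EY.XY.openin_gspace W_def by (rule conjunct2)
  have yW: "map_prod proj_pt q (e, y) \<in> W" if "e \<in> CE" for e
    using that y unfolding W_def by (force simp: image_iff)
  \<comment> \<open>The four points of E with d = 0. If \<open>g\<close> is nonzero at all of them,
    the leading coefficient of its norm over \<open>y\<close> is nonzero.\<close>
  define F0 where "F0 = (\<lambda>(s, t). (evec s t 1 0, y)) ` ({1, -1} \<times> {1, -1})"
  have F0: "finite F0" "F0 \<noteq> {}" "F0 \<subseteq> CE \<times> C" unfolding F0_def using y by (auto simp: CE_iff)
  have avoid: "\<exists>d\<ge>1. \<exists>g\<in>T d. (\<forall>c\<in>F. g c \<noteq> 0) \<and> (\<forall>x\<in>CE \<times> C. map_prod proj_pt q x \<in> Z \<longrightarrow> g x = 0)"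
    if F: "finite F" "F \<noteq> {}" "F \<subseteq> CE \<times> {y}" for F
  proof -
    have "\<exists>d\<ge>1. \<exists>g\<in>T d. (\<forall>c\<in>F. g c \<noteq> 0) \<and> (\<forall>x\<in>CE \<times> C. g x \<noteq> 0 \<longrightarrow> map_prod proj_pt q x \<in> W)"
      by (rule EY.XY.gopen_avoid[OF W]) (use F y yW in auto)
    then obtain d g where dg: "d \<ge> 1" "g \<in> T d" "\<forall>c\<in>F. g c \<noteq> 0" "\<forall>x\<in>CE \<times> C. g x \<noteq> 0 \<longrightarrow> map_prod proj_pt q x \<in> W"
      by (elim exE bexE conjE) (rule that)
    from dg(4) have zz: "\<forall>x\<in>CE \<times> C. map_prod proj_pt q x \<in> Z \<longrightarrow> g x = 0" unfolding W_def by auto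
    show ?thesis
      by (rule exI[of _ d], rule conjI, rule dg(1), rule bexI[of _ g], rule conjI, rule dg(3), rule zz, rule dg(2))
  qed
  have F0y: "F0 \<subseteq> CE \<times> {y}" using F0(3) unfolding F0_def by auto
  obtain d g where g: "d \<ge> 1" "g \<in> T d" "\<forall>c\<in>F0. g c \<noteq> 0" "\<forall>x\<in>CE \<times> C. map_prod proj_pt q x \<in> Z \<longrightarrow> g x = 0"
    using avoid[OF F0(1,2) F0y] by (elim exE bexE conjE) (rule that)
  obtain \<gamma>0 where \<gamma>0: "\<forall>e\<in>CE. \<forall>y\<in>C. enorm g (e, y) = (\<Sum>i\<le>4 * d. \<gamma>0 i y * e Ec ^ i * e Ed ^ (4 * d - i))"
    using enorm_coeffs[OF g(2)] by (elim exE conjE) (rule that)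
  have lead: "(\<Sum>i\<le>n. c i * 1 ^ i * (0::complex) ^ (n - i)) = c n" for c :: "nat \<Rightarrow> complex" and n
  proof -
    have "(\<Sum>i\<le>n. c i * 1 ^ i * (0::complex) ^ (n - i)) = (\<Sum>i\<in>{n}. c i * 1 ^ i * (0::complex) ^ (n - i))"
      by (rule sum.mono_neutral_right) auto
    then show ?thesis by simp
  qed
  have e1: "evec 1 1 1 0 \<in> CE" by (simp add: CE_iff)
  have sg: "sgn_a (evec a b c d) = evec (-a) b c d" "sgn_b (evec a b c d) = evec a (-b) c d" for a b c d
    by (simp_all add: evec_eq_iff)
  have g_e1: "enorm g (evec 1 1 1 0, y) \<noteq> 0" using g(3) by (simp add: enorm_def sg F0_def)
  define G where "G = (\<Sum>l\<le>4 * d. monom (\<gamma>0 l y) l)"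
  have Gx: "poly G x = (\<Sum>l\<le>4 * d. \<gamma>0 l y * x ^ l)" for x by (simp add: G_def poly_sum poly_monom)
  have "\<gamma>0 (4 * d) y \<noteq> 0" using g_e1 \<gamma>0 e1 y(1) lead[of "\<lambda>i. \<gamma>0 i y" "4 * d"] by simp
  then have "coeff G (4 * d) \<noteq> 0" by (simp add: G_def coeff_sum)
  then have "G \<noteq> 0" by auto
  \<comment> \<open>All points of E over the roots of the norm of \<open>g\<close> at
    \<open>y\<close>. There \<open>h\<close> must not vanish, so that the two norms share no
    root.\<close>
  define F1 where "F1 = (\<lambda>(x, s, t). (evec (s * csqrt (x\<^sup>2 + 1)) (t * csqrt (x\<^sup>2 - 1)) x 1, y)) ` ({x. poly G x = 0} \<times> {1, -1} \<times> {1, -1})"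
  have F1: "finite F1" unfolding F1_def using poly_roots_finite[OF \<open>G \<noteq> 0\<close>] by simp
  have F1y: "F1 \<subseteq> CE \<times> {y}" unfolding F1_def by (auto simp: CE_iff)
  have FF: "finite (F0 \<union> F1)" "F0 \<union> F1 \<noteq> {}" "F0 \<union> F1 \<subseteq> CE \<times> {y}" using F0(1,2) F1 F0y F1y by auto
  obtain d' h where h: "d' \<ge> 1" "h \<in> T d'" "\<forall>c\<in>F0 \<union> F1. h c \<noteq> 0" "\<forall>x\<in>CE \<times> C. map_prod proj_pt q x \<in> Z \<longrightarrow> h x = 0"
    using avoid[OF FF] by (elim exE bexE conjE) (rule that)
  \<comment> \<open>Powers bring \<open>g\<close> and \<open>h\<close> to equal degree, as the
    Sylvester matrix is set up for forms of one degree; the zeros do not change.\<close>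
  define g' h' D where "g' = (\<lambda>x. g x ^ d')" and "h' = (\<lambda>x. h x ^ d)" and "D = d' * d"
  have gh: "g' \<in> T D" "h' \<in> T D"
    unfolding g'_def h'_def D_def using EY.XY.A_power[OF g(2), of d'] EY.XY.A_power[OF h(2), of d] by (simp_all add: mult.commute)
  have D: "D \<ge> 1" using g(1) h(1) by (simp add: D_def)
  obtain \<gamma> where \<gamma>: "\<forall>i. \<gamma> i \<in> A (4 * D)" "\<forall>e\<in>CE. \<forall>y\<in>C. enorm g' (e, y) = (\<Sum>i\<le>4 * D. \<gamma> i y * e Ec ^ i * e Ed ^ (4 * D - i))"
    using enorm_coeffs[OF gh(1)] by (elim exE conjE) (rule that)
  obtain \<delta> where \<delta>: "\<forall>i. \<delta> i \<in> A (4 * D)" "\<forall>e\<in>CE. \<forall>y\<in>C. enorm h' (e, y) = (\<Sum>i\<le>4 * D. \<delta> i y * e Ec ^ i * e Ed ^ (4 * D - i))"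
    using enorm_coeffs[OF gh(2)] by (elim exE conjE) (rule that)
  define R where "R = (\<lambda>y. Determinant.det (sylv (4 * D) (\<lambda>i. \<gamma> i y) (\<lambda>i. \<delta> i y)))"
  have "R \<in> A (2 * (4 * D) * (4 * D))" unfolding R_def by (rule Y.det_sylv_A) (use \<gamma> \<delta> in simp_all)
  moreover have "R y \<noteq> 0"
    unfolding R_def
  proof (rule det_sylv_neq_0)
    have "enorm g' (evec 1 1 1 0, y) \<noteq> 0" using g_e1 by (simp add: enorm_def g'_def)
    then show "\<gamma> (4 * D) y \<noteq> 0" using \<gamma>(2) e1 y(1) lead[of "\<lambda>i. \<gamma> i y" "4 * D"] by simp
    fix x assume x: "(\<Sum>l\<le>4 * D. \<gamma> l y * x ^ l) = 0"
    define e where "e = evec (csqrt (x\<^sup>2 + 1)) (csqrt (x\<^sup>2 - 1)) x 1"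
    have e: "e \<in> CE" "e Ec = x" "e Ed = 1" by (simp_all add: e_def CE_iff)
    have "enorm g' (e, y) = 0" using \<gamma>(2) e y(1) x by simp
    then have "enorm g (e, y) = 0" by (auto simp: enorm_def g'_def)
    then have "poly G x = 0" using \<gamma>0 e y(1) by (simp add: Gx)
    then have "(evec (s * csqrt (x\<^sup>2 + 1)) (t * csqrt (x\<^sup>2 - 1)) x 1, y) \<in> F1" if "s \<in> {1, -1}" "t \<in> {1, -1}" for s t
      unfolding F1_def by (intro image_eqI[of _ _ "(x, s, t)"]) (use that in auto)
    from this[of 1 1] this[of 1 "-1"] this[of "-1" 1] this[of "-1" "-1"]
    have "h (e, y) \<noteq> 0" "h (sgn_a e, y) \<noteq> 0" "h (sgn_b e, y) \<noteq> 0" "h (sgn_a (sgn_b e), y) \<noteq> 0"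
      using h(3) by (simp_all add: e_def sg)
    then have "enorm h' (e, y) \<noteq> 0" by (simp add: enorm_def h'_def)
    then show "(\<Sum>l\<le>4 * D. \<delta> l y * x ^ l) \<noteq> 0" using \<delta>(2) e y(1) by simp
  qed
  moreover have "R x = 0" if x: "x \<in> C" "q x \<in> snd ` Z" for x
  proof -
    obtain p where p: "(p, q x) \<in> Z" using x(2) by auto
    then obtain e where e: "e \<in> CE" "p = proj_pt e" using Zs by auto
    have "g (e, x) = 0" "h (e, x) = 0" using g(4) h(4) e x(1) p by auto
    then have "enorm g' (e, x) = 0" "enorm h' (e, x) = 0" using g(1) h(1) by (simp_all add: enorm_def g'_def h'_def)
    then have "(\<Sum>i\<le>4 * D. \<gamma> i x * e Ec ^ i * e Ed ^ (4 * D - i)) = 0" "(\<Sum>i\<le>4 * D. \<delta> i x * e Ec ^ i * e Ed ^ (4 * D - i)) = 0"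
      using \<gamma>(2) \<delta>(2) e x(1) by simp_all
    then show "R x = 0" unfolding R_def using D e(1) by (intro det_sylv_eq_0) (auto simp: CE_iff)
  qed
  ultimately show "\<exists>d. \<exists>g\<in>A d. g y \<noteq> 0 \<and> (\<forall>x\<in>C. q x \<in> snd ` Z \<longrightarrow> g x = 0)"
    by (rule_tac exI[of _ "2 * (4 * D) * (4 * D)"], rule_tac bexI[of _ R]) simp_all
qed

end

section \<open>The group law of E\<close>

text \<open>
  In the coordinates (S, C, D, T) = (d, b, a, c) the curve is the Jacobi intersection
  S^2 + C^2 = T^2, D^2 - S^2 = T^2, and the following are the two classical forms of the addition
  theorem for sn, cn, dn.  The first fails for pairs whose difference has T = 0, the second for
  those whose difference has S = 0, hence at least one of them is always defined.
\<close>

lemma CE_rel: "v \<in> CE \<Longrightarrow> (v Ea)\<^sup>2 = (v Ec)\<^sup>2 + (v Ed)\<^sup>2" "v \<in> CE \<Longrightarrow> (v Eb)\<^sup>2 = (v Ec)\<^sup>2 - (v Ed)\<^sup>2"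
  by (simp_all add: CE_iff)

definition add1 :: "(E_var \<Rightarrow> complex) \<Rightarrow> (E_var \<Rightarrow> complex) \<Rightarrow> E_var \<Rightarrow> complex" where
  "add1 u v = evec
     (u Ea * u Ec * (v Ea * v Ec) + u Ed * u Eb * (v Ed * v Eb))
     (u Eb * u Ec * (v Eb * v Ec) - u Ed * u Ea * (v Ed * v Ea))
     (u Ec * u Ec * (v Ec * v Ec) + u Ed * u Ed * (v Ed * v Ed))
     (u Ed * u Ec * (v Eb * v Ea) + u Eb * u Ea * (v Ed * v Ec))"

definition add2 :: "(E_var \<Rightarrow> complex) \<Rightarrow> (E_var \<Rightarrow> complex) \<Rightarrow> E_var \<Rightarrow> complex" where
  "add2 u v = evec
     (u Ed * u Ea * (v Ec * v Eb) - u Ec * u Eb * (v Ed * v Ea))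
     (u Ed * u Eb * (v Ec * v Ea) - u Ec * u Ea * (v Ed * v Eb))
     (u Ed * u Ec * (v Eb * v Ea) - u Eb * u Ea * (v Ed * v Ec))
     (u Ed * u Ed * (v Ec * v Ec) - u Ec * u Ec * (v Ed * v Ed))"

definition add_laws :: "((E_var \<Rightarrow> complex) \<Rightarrow> (E_var \<Rightarrow> complex) \<Rightarrow> E_var \<Rightarrow> complex) set" where
  "add_laws = {add1, add2}"

lemma add_law_relations:
  assumes "F \<in> add_laws" "u \<in> CE" "v \<in> CE"
  shows "(F u v Ea)\<^sup>2 = (F u v Ec)\<^sup>2 + (F u v Ed)\<^sup>2" "(F u v Eb)\<^sup>2 = (F u v Ec)\<^sup>2 - (F u v Ed)\<^sup>2"
proof -
  have "(add1 u v Ea)\<^sup>2 = (add1 u v Ec)\<^sup>2 + (add1 u v Ed)\<^sup>2"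
    using CE_rel[OF assms(2)] CE_rel[OF assms(3)] unfolding add1_def evec_simps by Groebner_Basis.algebra
  moreover have "(add1 u v Eb)\<^sup>2 = (add1 u v Ec)\<^sup>2 - (add1 u v Ed)\<^sup>2"
    using CE_rel[OF assms(2)] CE_rel[OF assms(3)] unfolding add1_def evec_simps by Groebner_Basis.algebra
  moreover have "(add2 u v Ea)\<^sup>2 = (add2 u v Ec)\<^sup>2 + (add2 u v Ed)\<^sup>2"
    using CE_rel[OF assms(2)] CE_rel[OF assms(3)] unfolding add2_def evec_simps by Groebner_Basis.algebra
  moreover have "(add2 u v Eb)\<^sup>2 = (add2 u v Ec)\<^sup>2 - (add2 u v Ed)\<^sup>2"
    using CE_rel[OF assms(2)] CE_rel[OF assms(3)] unfolding add2_def evec_simps by Groebner_Basis.algebra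
  ultimately show "(F u v Ea)\<^sup>2 = (F u v Ec)\<^sup>2 + (F u v Ed)\<^sup>2" "(F u v Eb)\<^sup>2 = (F u v Ec)\<^sup>2 - (F u v Ed)\<^sup>2"
    using assms(1) by (auto simp: add_laws_def)
qed

lemma add_law_CE_iff:
  assumes "F \<in> add_laws" "u \<in> CE" "v \<in> CE"
  shows "F u v \<in> CE \<longleftrightarrow> F u v Ec \<noteq> 0 \<or> F u v Ed \<noteq> 0"
  using add_law_relations[OF assms] by (simp add: CE_iff)

text \<open>The defining relations hold for the output of a law at every pair of points of E, so a
  law can fail only by returning the zero vector, never a vector off the curve.\<close>

lemma add_law_zero:
  assumes "F \<in> add_laws" "u \<in> CE" "v \<in> CE" "F u v \<notin> CE"
  shows "F u v i = 0"
proof -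
  have "F u v Ec = 0" "F u v Ed = 0" using add_law_CE_iff[OF assms(1-3)] assms(4) by auto
  moreover from this have "F u v Ea = 0" "F u v Eb = 0" using add_law_relations[OF assms(1-3)] by simp_all
  ultimately show ?thesis by (cases i) simp_all
qed

lemma add_laws_agree:
  assumes "u \<in> CE" "v \<in> CE"
  shows "add1 u v i * add2 u v j = add1 u v j * add2 u v i"
proof -
  have "add1 u v Ea * add2 u v Eb = add1 u v Eb * add2 u v Ea"
    "add1 u v Ea * add2 u v Ec = add1 u v Ec * add2 u v Ea"
    "add1 u v Ea * add2 u v Ed = add1 u v Ed * add2 u v Ea"
    "add1 u v Eb * add2 u v Ec = add1 u v Ec * add2 u v Eb"
    "add1 u v Eb * add2 u v Ed = add1 u v Ed * add2 u v Eb"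
    "add1 u v Ec * add2 u v Ed = add1 u v Ed * add2 u v Ec"
    using CE_rel[OF assms(1)] CE_rel[OF assms(2)] unfolding add1_def add2_def evec_simps by Groebner_Basis.algebra+
  then show ?thesis by (cases i; cases j) simp_all
qed

text \<open>Write c, d and a', b', c', d' for the coordinates of \<open>u\<close> and
  \<open>v\<close>. If both laws vanish and c, d, c', d' are all nonzero, equations 3 and 4 give a'
  b' = 0, hence c'^4 = d'^4, while equations 1 and 2 give c'^4 = - d'^4. If one of the four is zero,
  equations 1 and 2 already contradict that (c, d) and (c', d') are nonzero.\<close>

lemma add_laws_cover:
  assumes u: "u \<in> CE" and v: "v \<in> CE"
  shows "add1 u v \<in> CE \<or> add2 u v \<in> CE"
proof (rule ccontr)
  assume "\<not> ?thesis"
  then have n: "add1 u v \<notin> CE" "add2 u v \<notin> CE" by auto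
  have z: "add1 u v i = 0" "add2 u v i = 0" for i
    using add_law_zero[of add1 u v i] add_law_zero[of add2 u v i] u v n by (auto simp: add_laws_def)
  have 1: "u Ec * u Ec * (v Ec * v Ec) + u Ed * u Ed * (v Ed * v Ed) = 0"
    using z(1)[of Ec] by (simp add: add1_def)
  have 2: "u Ed * u Ed * (v Ec * v Ec) - u Ec * u Ec * (v Ed * v Ed) = 0"
    using z(2)[of Ed] by (simp add: add2_def)
  have 3: "u Ed * u Ec * (v Eb * v Ea) + u Eb * u Ea * (v Ed * v Ec) = 0"
    using z(1)[of Ed] by (simp add: add1_def)
  have 4: "u Ed * u Ec * (v Eb * v Ea) - u Eb * u Ea * (v Ed * v Ec) = 0"
    using z(2)[of Ec] by (simp add: add2_def)
  have "X + Y = 0 \<Longrightarrow> X - Y = 0 \<Longrightarrow> X = 0" for X Y :: complex by Groebner_Basis.algebra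
  from this[OF 3 4] have 34: "u Ed * u Ec * (v Eb * v Ea) = 0" .
  have ab: "(v Eb * v Ea)\<^sup>2 = (v Ec)^4 - (v Ed)^4" using CE_rel[OF v] by Groebner_Basis.algebra
  have 5: "(u Ec)^4 * (v Ec)\<^sup>2 + (u Ed)^4 * (v Ec)\<^sup>2 = 0" using 1 2 by Groebner_Basis.algebra
  have 6: "(v Ec)^4 * (u Ec)\<^sup>2 + (v Ed)^4 * (u Ec)\<^sup>2 = 0" using 1 2 by Groebner_Basis.algebra
  show False
  proof (cases "u Ec = 0 \<or> u Ed = 0 \<or> v Ec = 0 \<or> v Ed = 0")
    case True
    with 1 2 u v show False by (auto simp: CE_iff)
  next
    case False
    then have "(v Ec)^4 - (v Ed)^4 = 0" "(v Ec)^4 + (v Ed)^4 = 0" using 34 ab 6 by (auto simp flip: distrib_right)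
    then have "2 * (v Ec)^4 = 0" by Groebner_Basis.algebra
    with False show False by simp
  qed
qed

lemma proj_pt_minors:
  assumes "u i0 \<noteq> 0" "v j0 \<noteq> 0" "\<And>i j. u i * v j = u j * v i"
  shows "proj_pt u = proj_pt v"
proof -
  have "u i0 * v j0 = u j0 * v i0" by (rule assms(3))
  then have uj: "u j0 \<noteq> 0" using assms(1,2) by auto
  have "v = (\<lambda>i. v j0 / u j0 * u i)"
  proof
    fix i show "v i = v j0 / u j0 * u i" using assms(3)[of j0 i] uj by (simp add: field_simps)
  qed
  then show ?thesis unfolding proj_pt_eq_iff using assms(2) uj by (intro exI[of _ "v j0 / u j0"]) simp
qed

lemma CE_minors:
  assumes "u \<in> CE" "v \<in> CE" "\<And>i j. u i * v j = u j * v i"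
  shows "proj_pt u = proj_pt v"
proof -
  obtain i where "u i \<noteq> 0" using assms(1) by (auto simp: CE_iff)
  moreover obtain j where "v j \<noteq> 0" using assms(2) by (auto simp: CE_iff)
  ultimately show ?thesis by (rule proj_pt_minors) (rule assms(3))
qed

lemma minors_proj_pt: "proj_pt u = proj_pt v \<Longrightarrow> u i * v j = u j * v (i::'v)"
  unfolding proj_pt_eq_iff by auto

section \<open>Addition as an operation on points\<close>

text \<open>The preference for \<open>add1\<close> is arbitrary: where both laws are defined their
  results are proportional. Only the class of the result in projective space is meaningful.\<close>

definition add_vec :: "(E_var \<Rightarrow> complex) \<Rightarrow> (E_var \<Rightarrow> complex) \<Rightarrow> E_var \<Rightarrow> complex" where
  "add_vec u v = (if add1 u v \<in> CE then add1 u v else add2 u v)"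

lemma add_vec_CE: "u \<in> CE \<Longrightarrow> v \<in> CE \<Longrightarrow> add_vec u v \<in> CE"
  using add_laws_cover by (auto simp: add_vec_def)

lemma add_vec_law:
  assumes "u \<in> CE" "v \<in> CE"
  shows "\<exists>F\<in>add_laws. F u v \<in> CE"
  using add_laws_cover[OF assms] by (auto simp: add_laws_def)

lemma proj_add_vec:
  assumes F: "F \<in> add_laws" and u: "u \<in> CE" and v: "v \<in> CE" and FC: "F u v \<in> CE"
  shows "proj_pt (add_vec u v) = proj_pt (F u v)"
proof (cases "F = add1")
  case True
  then show ?thesis using FC by (simp add: add_vec_def)
next
  case False
  then have "F = add2" using F by (simp add: add_laws_def)
  moreover have "proj_pt (add1 u v) = proj_pt (add2 u v)" if "add1 u v \<in> CE" "add2 u v \<in> CE"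
    by (rule CE_minors[OF that]) (rule add_laws_agree[OF u v])
  ultimately show ?thesis using FC by (auto simp: add_vec_def)
qed

lemma add_law_scale:
  assumes "F \<in> add_laws"
  shows "F (\<lambda>i. l * u i) (\<lambda>i. m * v i) = (\<lambda>i. l\<^sup>2 * m\<^sup>2 * F u v i)"
  using assms unfolding add_laws_def
  by (auto simp: add1_def add2_def evec_eq_iff power2_eq_square algebra_simps)

lemma proj_add_vec_cong:
  assumes "u \<in> CE" "v \<in> CE" "u' \<in> CE" "v' \<in> CE" "proj_pt u = proj_pt u'" "proj_pt v = proj_pt v'"
  shows "proj_pt (add_vec u v) = proj_pt (add_vec u' v')"
proof -
  obtain l where l: "l \<noteq> 0" "u' = (\<lambda>i. l * u i)" using assms(5) proj_pt_eq_iff by blast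
  obtain m where m: "m \<noteq> 0" "v' = (\<lambda>i. m * v i)" using assms(6) proj_pt_eq_iff by blast
  obtain F where F: "F \<in> add_laws" "F u v \<in> CE" using add_vec_law[OF assms(1,2)] by blast
  have sc: "F u' v' = (\<lambda>i. l\<^sup>2 * m\<^sup>2 * F u v i)" unfolding l m by (rule add_law_scale[OF F(1)])
  then have "F u' v' \<in> CE" using CE_scale[OF F(2), of "l\<^sup>2 * m\<^sup>2"] l m by simp
  then have "proj_pt (add_vec u' v') = proj_pt (F u' v')" by (intro proj_add_vec F assms)
  also have "\<dots> = proj_pt (F u v)" unfolding sc by (rule proj_pt_scale) (use l m in simp)
  also have "\<dots> = proj_pt (add_vec u v)" by (intro proj_add_vec[symmetric] F assms)
  finally show ?thesis by simp
qed

definition E_rep :: "(E_var \<Rightarrow> complex) set \<Rightarrow> E_var \<Rightarrow> complex" where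
  "E_rep p = (SOME v. v \<in> CE \<and> proj_pt v = p)"

definition E_add :: "(E_var \<Rightarrow> complex) set \<Rightarrow> (E_var \<Rightarrow> complex) set \<Rightarrow> (E_var \<Rightarrow> complex) set" where
  "E_add p q = proj_pt (add_vec (E_rep p) (E_rep q))"

lemma E_rep: "v \<in> CE \<Longrightarrow> E_rep (proj_pt v) \<in> CE \<and> proj_pt (E_rep (proj_pt v)) = proj_pt v"
  unfolding E_rep_def by (rule someI[of _ v]) simp

lemma E_add: "u \<in> CE \<Longrightarrow> v \<in> CE \<Longrightarrow> E_add (proj_pt u) (proj_pt v) = proj_pt (add_vec u v)"
  unfolding E_add_def by (rule proj_add_vec_cong) (simp_all add: E_rep)

lemma E_add_law: "F \<in> add_laws \<Longrightarrow> u \<in> CE \<Longrightarrow> v \<in> CE \<Longrightarrow> F u v \<in> CE \<Longrightarrow>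
    E_add (proj_pt u) (proj_pt v) = proj_pt (F u v)"
  by (simp add: E_add proj_add_vec)

abbreviation "EP \<equiv> proj_pt ` CE"

lemma E_add_closed: "p \<in> EP \<Longrightarrow> r \<in> EP \<Longrightarrow> E_add p r \<in> EP"
  by (auto simp: E_add add_vec_CE)

section \<open>Regular maps to E\<close>

lemma form_compose:
  assumes "form K d f" "\<And>i. form K k (\<lambda>x. P x i)"
  shows "form K (d * k) (\<lambda>x. f (P x))"
  using assms(1)
proof (induction rule: form.induct)
  case (const c)
  then show ?case using form.const by simp
next
  case (var i)
  show ?case using assms(2) by simp
next
  case (add d f g)
  then show ?case by (intro form.add)
next
  case (mult d f e g)
  then show ?case using form.mult[of K "d * k" "\<lambda>x. f (P x)" "e * k" "\<lambda>x. g (P x)"] by (simp add: add_mult_distrib)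
qed

lemma form_var2: "form K 2 (\<lambda>v. v i * v j)"
  using form.mult[OF form.var form.var, of K i j] by (simp add: numeral_2_eq_2)

lemma (in subfield) add_law_tens:
  assumes "F \<in> add_laws"
  shows "(\<lambda>p. F (fst p) (snd p) i) \<in> tens (forms K 2) (forms K 2)"
proof -
  have f: "(\<lambda>v. v x * v y) \<in> forms K 2" "(\<lambda>v. (-1) * (v x * v y)) \<in> forms K 2" for x y :: E_var
    using form.mult[OF form.const[of "-1" K] form_var2[of K x y]] K_uminus[OF K_one] form_var2[of K x y]
    by (simp_all add: numeral_2_eq_2)
  have m: "(\<lambda>p. fst p x * fst p y * (snd p z * snd p w)) \<in> tens (forms K 2) (forms K 2)" for x y z w :: E_var
    using tens.prod[OF f(1) f(1), of x y z w] by simp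
  have m': "(\<lambda>p. - (fst p x * fst p y * (snd p z * snd p w))) \<in> tens (forms K 2) (forms K 2)" for x y z w :: E_var
    using tens.prod[OF f(2) f(1), of x y z w] by simp
  have "(\<lambda>p. add1 (fst p) (snd p) i) \<in> tens (forms K 2) (forms K 2)"
    using tens.add[OF m m] tens.add[OF m m'] unfolding add1_def by (cases i) simp_all
  moreover have "(\<lambda>p. add2 (fst p) (snd p) i) \<in> tens (forms K 2) (forms K 2)"
    using tens.add[OF m m] tens.add[OF m m'] unfolding add2_def by (cases i) simp_all
  ultimately show ?thesis using assms by (auto simp: add_laws_def)
qed

lemma add_law_form:
  assumes "F \<in> add_laws"
  shows "form UNIV 2 (\<lambda>u. F u v i)" "form UNIV 2 (\<lambda>v. F u v i)"
  using tens_form_left[OF UNIV.add_law_tens[OF assms, of i], of v] tens_form_right[OF UNIV.add_law_tens[OF assms, of i], of u]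
  by simp_all

text \<open>
  Maps to E that are locally given by forms; two of them that agree at infinitely many points
  agree everywhere.
\<close>

definition Ereg :: "((E_var \<Rightarrow> complex) \<Rightarrow> (E_var \<Rightarrow> complex) set) \<Rightarrow> bool" where
  "Ereg h \<longleftrightarrow> (\<forall>x0\<in>CE. \<exists>k P. (\<forall>i. form UNIV k (\<lambda>x. P x i)) \<and> P x0 \<in> CE \<and>
     (\<forall>x\<in>CE. P x \<in> CE \<longrightarrow> h x = proj_pt (P x)) \<and> (\<forall>x\<in>CE. P x \<notin> CE \<longrightarrow> (\<forall>i. P x i = 0)))"

lemma EregE:
  assumes "Ereg h" "x0 \<in> CE"
  obtains k P where "\<forall>i. form UNIV k (\<lambda>x. P x i)" "P x0 \<in> CE"
     "\<forall>x\<in>CE. P x \<in> CE \<longrightarrow> h x = proj_pt (P x)" "\<forall>x\<in>CE. P x \<notin> CE \<longrightarrow> (\<forall>i. P x i = 0)"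
  using bspec[OF assms(1)[unfolded Ereg_def] assms(2)] by (elim exE conjE) (rule that)

lemma Ereg_id: "Ereg proj_pt"
  unfolding Ereg_def
  by (intro ballI exI[of _ 1] exI[of _ "\<lambda>x. x"] conjI allI impI form.var) auto

text \<open>Left and right addition of a fixed point are two instances of one statement about a
  family \<F> of maps of degree two representing an operation \<open>op\<close>, namely the addition
  laws with one argument frozen.\<close>

lemma Ereg_add:
  assumes h: "Ereg h" and w: "w \<in> CE"
  shows "Ereg (\<lambda>x. E_add (h x) (proj_pt w))" "Ereg (\<lambda>x. E_add (proj_pt w) (h x))"
proof -
  have *: "\<exists>k P. (\<forall>i. form UNIV k (\<lambda>x. P x i)) \<and> P x0 \<in> CE \<and>
     (\<forall>x\<in>CE. P x \<in> CE \<longrightarrow> op (h x) = proj_pt (P x)) \<and> (\<forall>x\<in>CE. P x \<notin> CE \<longrightarrow> (\<forall>i. P x i = 0))"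
    if x0: "x0 \<in> CE" and op: "\<And>v. v \<in> CE \<Longrightarrow> \<exists>F\<in>\<F>. F v \<in> CE"
      "\<And>F v. F \<in> \<F> \<Longrightarrow> v \<in> CE \<Longrightarrow> F v \<in> CE \<Longrightarrow> op (proj_pt v) = proj_pt (F v)"
      "\<And>F v i. F \<in> \<F> \<Longrightarrow> v \<in> CE \<Longrightarrow> F v \<notin> CE \<Longrightarrow> F v i = 0"
      "\<And>F i. F \<in> \<F> \<Longrightarrow> form UNIV 2 (\<lambda>v. F v i)" for x0 op \<F>
  proof -
    obtain k P where P: "\<forall>i. form UNIV k (\<lambda>x. P x i)" "P x0 \<in> CE"
     "\<forall>x\<in>CE. P x \<in> CE \<longrightarrow> h x = proj_pt (P x)" "\<forall>x\<in>CE. P x \<notin> CE \<longrightarrow> (\<forall>i. P x i = 0)"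
      using h x0 by (rule EregE)
    obtain F where F: "F \<in> \<F>" "F (P x0) \<in> CE" using op(1)[OF P(2)] by blast
    \<comment> \<open>A form of positive degree vanishes at the zero vector. Thus F (P x) can be a
      cone point only if P x already is one, and the failures of the two representations do not
      interfere.\<close>
    have F0: "F v i = 0" if "\<forall>i. v i = 0" for v i
    proof -
      have "v = (\<lambda>i. 0 * v i)" using that by auto
      then have "F v i = 0 ^ 2 * F v i" using form_scale[OF op(4)[OF F(1), of i], where c = 0 and v = v] by simp
      then show ?thesis by simp
    qed
    have PC: "P x \<in> CE" if x: "x \<in> CE" "F (P x) \<in> CE" for x
    proof (rule ccontr)
      assume "P x \<notin> CE"
      then have "\<forall>i. P x i = 0" using P(4) x(1) by blast
      from F0[OF this, of Ec] F0[OF this, of Ed] show False using x(2) by (simp add: CE_iff)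
    qed
    have "form UNIV (2 * k) (\<lambda>x. F (P x) i)" for i
      by (rule form_compose[OF op(4)[OF F(1)]]) (use P(1) in simp)
    moreover have "op (h x) = proj_pt (F (P x))" if x: "x \<in> CE" "F (P x) \<in> CE" for x
    proof -
      have "h x = proj_pt (P x)" using P(3) PC[OF x] x(1) by blast
      then show ?thesis using op(2)[OF F(1) PC[OF x] x(2)] by simp
    qed
    moreover have "F (P x) i = 0" if x: "x \<in> CE" "F (P x) \<notin> CE" for x i
    proof (cases "P x \<in> CE")
      case True
      then show ?thesis by (rule op(3)[OF F(1) _ x(2)])
    next
      case False
      then have "\<forall>i. P x i = 0" using P(4) x(1) by blast
      then show ?thesis by (rule F0)
    qed
    ultimately show ?thesis using F(2)
      by (rule_tac exI[of _ "2 * k"], rule_tac exI[of _ "\<lambda>x. F (P x)"]) simp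
  qed
  show "Ereg (\<lambda>x. E_add (h x) (proj_pt w))"
    unfolding Ereg_def
  proof
    fix x0 assume "x0 \<in> CE"
    then show "\<exists>k P. (\<forall>i. form UNIV k (\<lambda>x. P x i)) \<and> P x0 \<in> CE \<and>
      (\<forall>x\<in>CE. P x \<in> CE \<longrightarrow> E_add (h x) (proj_pt w) = proj_pt (P x)) \<and> (\<forall>x\<in>CE. P x \<notin> CE \<longrightarrow> (\<forall>i. P x i = 0))"
      by (rule *[of x0 "(\<lambda>F v. F v w) ` add_laws" "\<lambda>p. E_add p (proj_pt w)"])
         (use w add_vec_law E_add_law add_law_zero add_law_form in \<open>auto simp: image_iff\<close>)
  qed
  show "Ereg (\<lambda>x. E_add (proj_pt w) (h x))"
    unfolding Ereg_def
  proof
    fix x0 assume "x0 \<in> CE"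
    then show "\<exists>k P. (\<forall>i. form UNIV k (\<lambda>x. P x i)) \<and> P x0 \<in> CE \<and>
      (\<forall>x\<in>CE. P x \<in> CE \<longrightarrow> E_add (proj_pt w) (h x) = proj_pt (P x)) \<and> (\<forall>x\<in>CE. P x \<notin> CE \<longrightarrow> (\<forall>i. P x i = 0))"
      by (rule *[of x0 "(\<lambda>F v. F w v) ` add_laws" "\<lambda>p. E_add (proj_pt w) p"])
         (use w add_vec_law E_add_law add_law_zero add_law_form in \<open>auto simp: image_iff\<close>)
  qed
qed

text \<open>If the maps differ at \<open>z\<close>, some minor of local representations near
  \<open>z\<close> is a form that is nonzero at \<open>z\<close>. By irreducibility it is nonzero at
  a point where \<open>g\<close> is nonzero as well, but there the maps agree.\<close>

lemma Ereg_eq: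
  assumes h: "Ereg \<phi>" "Ereg \<psi>" and g: "form UNIV m g" "a \<in> CE" "g a \<noteq> 0"
    and eq: "\<And>x. x \<in> CE \<Longrightarrow> g x \<noteq> 0 \<Longrightarrow> \<phi> x = \<psi> x" and z: "z \<in> CE"
  shows "\<phi> z = \<psi> z"
proof (rule ccontr)
  assume ne: "\<phi> z \<noteq> \<psi> z"
  obtain k P where P: "\<forall>i. form UNIV k (\<lambda>x. P x i)" "P z \<in> CE"
     "\<forall>x\<in>CE. P x \<in> CE \<longrightarrow> \<phi> x = proj_pt (P x)" "\<forall>x\<in>CE. P x \<notin> CE \<longrightarrow> (\<forall>i. P x i = 0)"
    using h(1) z by (rule EregE)
  obtain l Q where Q: "\<forall>i. form UNIV l (\<lambda>x. Q x i)" "Q z \<in> CE"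
     "\<forall>x\<in>CE. Q x \<in> CE \<longrightarrow> \<psi> x = proj_pt (Q x)" "\<forall>x\<in>CE. Q x \<notin> CE \<longrightarrow> (\<forall>i. Q x i = 0)"
    using h(2) z by (rule EregE)
  have "proj_pt (P z) \<noteq> proj_pt (Q z)" using ne P Q z by simp
  then obtain i j where ij: "P z i * Q z j \<noteq> P z j * Q z i"
    using CE_minors[OF P(2) Q(2)] by blast
  define f where "f = (\<lambda>x. P x i * Q x j + (-1) * (P x j * Q x i))"
  have f: "form UNIV (k + l) f" unfolding f_def
    by (intro form.add form.mult form_smult) (use P(1) Q(1) in auto)
  have "f z \<noteq> 0" using ij by (simp add: f_def)
  then obtain x where x: "x \<in> CE" "g x \<noteq> 0" "f x \<noteq> 0"
    using E_common_nonzero[OF g(1) f g(2,3) z] by blast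
  have "P x \<in> CE" using P(4) x by (auto simp: f_def)
  moreover have "Q x \<in> CE" using Q(4) x by (auto simp: f_def)
  ultimately have "proj_pt (P x) = proj_pt (Q x)" using P(3) Q(3) x eq by auto
  then have "P x i * Q x j = P x j * Q x i" by (rule minors_proj_pt)
  then show False using x(3) by (simp add: f_def)
qed

section \<open>Associativity\<close>

abbreviation "vO \<equiv> evec 1 1 1 0"

lemma vO_CE: "vO \<in> CE" by (simp add: CE_iff)

definition neg_vec :: "(E_var \<Rightarrow> complex) \<Rightarrow> E_var \<Rightarrow> complex" where
  "neg_vec v = evec (v Ea) (v Eb) (v Ec) (- v Ed)"

lemma neg_vec_CE: "v \<in> CE \<Longrightarrow> neg_vec v \<in> CE"
  by (simp add: CE_iff neg_vec_def)

text \<open>Comparison with the c coordinate alone gives proportionality wherever both c coordinates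
  are nonzero, which is the only place where it is applied. This keeps the number of large
  polynomial identities at three.\<close>

lemma add1_assoc_minors:
  assumes u: "u \<in> CE" and v: "v \<in> CE" and w: "w \<in> CE"
  shows "add1 (add1 u v) w i * add1 u (add1 v w) Ec = add1 (add1 u v) w Ec * add1 u (add1 v w) i"
proof -
  let ?L = "add1 (add1 u v) w" and ?R = "add1 u (add1 v w)"
  note rel = CE_rel[OF u] CE_rel[OF v] CE_rel[OF w]
  have "?L Ea * ?R Ec = ?L Ec * ?R Ea" using rel unfolding add1_def evec_simps by Groebner_Basis.algebra
  moreover have "?L Eb * ?R Ec = ?L Ec * ?R Eb" using rel unfolding add1_def evec_simps by Groebner_Basis.algebra
  moreover have "?L Ed * ?R Ec = ?L Ec * ?R Ed" using rel unfolding add1_def evec_simps by Groebner_Basis.algebra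
  ultimately show ?thesis by (cases i) simp_all
qed

lemma E_add_assoc_generic:
  assumes u: "u \<in> CE" and v: "v \<in> CE" and w: "w \<in> CE" and "add1 u v Ec \<noteq> 0" "add1 v w Ec \<noteq> 0"
    "add1 (add1 u v) w Ec \<noteq> 0" "add1 u (add1 v w) Ec \<noteq> 0"
  shows "E_add (E_add (proj_pt u) (proj_pt v)) (proj_pt w) = E_add (proj_pt u) (E_add (proj_pt v) (proj_pt w))"
proof -
  have F: "add1 \<in> add_laws" by (simp add: add_laws_def)
  have 1: "add1 u v \<in> CE" "add1 v w \<in> CE" using add_law_CE_iff[OF F] assms by auto
  then have 2: "add1 (add1 u v) w \<in> CE" "add1 u (add1 v w) \<in> CE" using add_law_CE_iff[OF F] assms by auto
  have "proj_pt (add1 (add1 u v) w) = proj_pt (add1 u (add1 v w))"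
    unfolding proj_pt_eq_iff
  proof (rule exI[of _ "add1 u (add1 v w) Ec / add1 (add1 u v) w Ec"], intro conjI ext)
    show "add1 u (add1 v w) Ec / add1 (add1 u v) w Ec \<noteq> 0" using assms by simp
    show "add1 u (add1 v w) i = add1 u (add1 v w) Ec / add1 (add1 u v) w Ec * add1 (add1 u v) w i" for i
      using add1_assoc_minors[OF u v w, of i] assms(6) by (simp add: field_simps)
  qed
  then show ?thesis using E_add_law[OF F] u v w 1 2 by simp
qed

text \<open>The generic identity is extended in one variable at a time, first \<open>w\<close>, then
  \<open>v\<close>, then \<open>u\<close>. Each extension needs a point where the genericity
  conditions hold; those on the variables still to be freed are carried as hypotheses of
  \<open>B\<close> and \<open>C\<close>.\<close>

lemma E_add_assoc_aux:
  assumes u: "u \<in> CE" and v: "v \<in> CE" and w: "w \<in> CE"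
  shows "E_add (E_add (proj_pt u) (proj_pt v)) (proj_pt w) = E_add (proj_pt u) (E_add (proj_pt v) (proj_pt w))"
proof -
  have F: "add1 \<in> add_laws" by (simp add: add_laws_def)
  have f4: "form UNIV 4 (\<lambda>v. (v Ec)^4 + (v Ed)^4)"
  proof -
    have "form UNIV (2 + 2) (\<lambda>v::E_var \<Rightarrow> complex. (v Ec * v Ec) * (v Ec * v Ec) + (v Ed * v Ed) * (v Ed * v Ed))"
      by (intro form.add form.mult form_var2)
    then show ?thesis by (simp add: power4_eq_xxxx mult.assoc)
  qed
  have B: "E_add (E_add (proj_pt u) (proj_pt v)) (proj_pt w) = E_add (proj_pt u) (E_add (proj_pt v) (proj_pt w))"
    if u: "u \<in> CE" "u Ec \<noteq> 0" and v: "v \<in> CE" "v Ec \<noteq> 0" "(v Ec)^4 + (v Ed)^4 \<noteq> 0" "add1 u v Ec \<noteq> 0" and w: "w \<in> CE" for u v w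
  proof -
    have uv: "add1 u v \<in> CE" using add_law_CE_iff[OF F u(1) v(1)] v by simp
    have g1: "form UNIV 2 (\<lambda>w. add1 v w Ec)" by (rule add_law_form[OF F])
    have g2: "form UNIV 2 (\<lambda>w. add1 (add1 u v) w Ec)" by (rule add_law_form[OF F])
    have g3: "form UNIV (2 * 2) (\<lambda>w. add1 u (add1 v w) Ec)"
      by (rule form_compose[OF add_law_form(2)[OF F] add_law_form(2)[OF F]])
    \<comment> \<open>Taking the third summand to be the origin satisfies two of the conditions: the
      c coordinates are squares of nonzero numbers.\<close>
    have "add1 v vO Ec \<noteq> 0" "add1 (add1 u v) vO Ec \<noteq> 0" using v by (simp_all add: add1_def[of v vO] add1_def[of "add1 u v" vO])
    then obtain x where x: "x \<in> CE" "add1 v x Ec \<noteq> 0" "add1 (add1 u v) x Ec \<noteq> 0" using vO_CE by blast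
    \<comment> \<open>For the remaining condition the third summand is taken to be -v, so that the
      inner sum is a multiple of the origin. The factor c^4 + d^4 explains the extra hypothesis on
      \<open>v\<close>.\<close>
    have "add1 v (neg_vec v) Ec = (v Ec)^4 + (v Ed)^4" "add1 v (neg_vec v) Ed = 0"
      by (simp_all add: add1_def neg_vec_def power4_eq_xxxx)
    then have "add1 u (add1 v (neg_vec v)) Ec \<noteq> 0" using u(2) v(3) by (simp add: add1_def[of u])
    then obtain y where y: "y \<in> CE" "add1 v y Ec * add1 (add1 u v) y Ec \<noteq> 0" "add1 u (add1 v y) Ec \<noteq> 0"
      using E_common_nonzero[OF form.mult[OF g1 g2] g3 x(1) _ neg_vec_CE[OF v(1)]] x by auto
    show ?thesis
    proof (rule Ereg_eq[where z = w and \<phi> = "\<lambda>x. E_add (E_add (proj_pt u) (proj_pt v)) (proj_pt x)"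
          and \<psi> = "\<lambda>x. E_add (proj_pt u) (E_add (proj_pt v) (proj_pt x))", OF _ _ form.mult[OF form.mult[OF g1 g2] g3] y(1)])
      have "Ereg (\<lambda>x. E_add (proj_pt (add_vec u v)) (proj_pt x))"
        by (rule Ereg_add(2)[OF Ereg_id add_vec_CE[OF u(1) v(1)]])
      then show "Ereg (\<lambda>x. E_add (E_add (proj_pt u) (proj_pt v)) (proj_pt x))" by (simp add: E_add u v)
      show "Ereg (\<lambda>x. E_add (proj_pt u) (E_add (proj_pt v) (proj_pt x)))"
        by (intro Ereg_add(2) Ereg_id u v)
      show "add1 v y Ec * add1 (add1 u v) y Ec * add1 u (add1 v y) Ec \<noteq> 0" using y by simp
      show "w \<in> CE" by (rule w)
      show "E_add (E_add (proj_pt u) (proj_pt v)) (proj_pt x) = E_add (proj_pt u) (E_add (proj_pt v) (proj_pt x))"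
        if x: "x \<in> CE" "add1 v x Ec * add1 (add1 u v) x Ec * add1 u (add1 v x) Ec \<noteq> 0" for x
        by (rule E_add_assoc_generic[OF u(1) v(1) x(1) v(4)]) (use x(2) in auto)
    qed
  qed
  have C: "E_add (E_add (proj_pt u) (proj_pt v)) (proj_pt w) = E_add (proj_pt u) (E_add (proj_pt v) (proj_pt w))"
    if u: "u \<in> CE" "u Ec \<noteq> 0" and v: "v \<in> CE" and w: "w \<in> CE" for u v w
  proof (rule Ereg_eq[where z = v and \<phi> = "\<lambda>x. E_add (E_add (proj_pt u) (proj_pt x)) (proj_pt w)"
        and \<psi> = "\<lambda>x. E_add (proj_pt u) (E_add (proj_pt x) (proj_pt w))", OF _ _ _ vO_CE])
    show "form UNIV (1 + 4 + 2) (\<lambda>v. v Ec * ((v Ec)^4 + (v Ed)^4) * add1 u v Ec)"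
      by (intro form.mult form.var f4 add_law_form(2)[OF F])
    \<comment> \<open>All conditions on the middle summand hold at the origin.\<close>
    show "vO Ec * ((vO Ec)^4 + (vO Ed)^4) * add1 u vO Ec \<noteq> 0" using u by (simp add: add1_def)
    show "Ereg (\<lambda>x. E_add (E_add (proj_pt u) (proj_pt x)) (proj_pt w))" by (intro Ereg_add Ereg_id u w)
    show "Ereg (\<lambda>x. E_add (proj_pt u) (E_add (proj_pt x) (proj_pt w)))" by (intro Ereg_add Ereg_id u w)
    show "v \<in> CE" by (rule v)
    show "E_add (E_add (proj_pt u) (proj_pt x)) (proj_pt w) = E_add (proj_pt u) (E_add (proj_pt x) (proj_pt w))"
      if x: "x \<in> CE" "x Ec * ((x Ec)^4 + (x Ed)^4) * add1 u x Ec \<noteq> 0" for x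
      by (rule B[OF u x(1) _ _ _ w]) (use x(2) in auto)
  qed
  show ?thesis
  proof (rule Ereg_eq[where z = u and \<phi> = "\<lambda>x. E_add (E_add (proj_pt x) (proj_pt v)) (proj_pt w)"
        and \<psi> = "\<lambda>x. E_add (proj_pt x) (E_add (proj_pt v) (proj_pt w))", OF _ _ form.var[of _ Ec] vO_CE])
    show "Ereg (\<lambda>x. E_add (E_add (proj_pt x) (proj_pt v)) (proj_pt w))" by (intro Ereg_add Ereg_id v w)
    have "Ereg (\<lambda>x. E_add (proj_pt x) (proj_pt (add_vec v w)))" by (intro Ereg_add Ereg_id add_vec_CE v w)
    then show "Ereg (\<lambda>x. E_add (proj_pt x) (E_add (proj_pt v) (proj_pt w)))" by (simp add: E_add v w)
    show "vO Ec \<noteq> 0" by simp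
    show "u \<in> CE" by (rule u)
    show "E_add (E_add (proj_pt x) (proj_pt v)) (proj_pt w) = E_add (proj_pt x) (E_add (proj_pt v) (proj_pt w))"
      if x: "x \<in> CE" "x Ec \<noteq> 0" for x by (rule C[OF x v w])
  qed
qed

lemma E_add_assoc: "p \<in> EP \<Longrightarrow> q \<in> EP \<Longrightarrow> r \<in> EP \<Longrightarrow> E_add (E_add p q) r = E_add p (E_add q r)"
  using E_add_assoc_aux by blast

section \<open>Neutral element, inverses and special translations\<close>

text \<open>Whichever law is defined returns a nonzero multiple of \<open>x\<close>. The factors
  \<open>k\<close> and \<open>l\<close> may vanish individually, so no case distinction on the
  defined law is needed in the applications.\<close>

lemma E_add_eqI:
  assumes "u \<in> CE" "v \<in> CE" "x \<in> CE"
    and "add1 u v = (\<lambda>i. k * x i)" "add2 u v = (\<lambda>i. l * x i)"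
  shows "E_add (proj_pt u) (proj_pt v) = proj_pt x"
proof -
  obtain F where F: "F \<in> add_laws" "F u v \<in> CE" using add_vec_law[OF assms(1,2)] by blast
  obtain k where k: "F u v = (\<lambda>i. k * x i)" using F(1) assms(4,5) unfolding add_laws_def by auto
  then have "k \<noteq> 0" using F(2) by (auto simp: CE_iff)
  have "E_add (proj_pt u) (proj_pt v) = proj_pt (F u v)" by (rule E_add_law[OF F(1) assms(1,2) F(2)])
  also have "\<dots> = proj_pt x" unfolding k by (rule proj_pt_scale[OF \<open>k \<noteq> 0\<close>])
  finally show ?thesis .
qed

lemma E_add_comm: "p \<in> EP \<Longrightarrow> q \<in> EP \<Longrightarrow> E_add p q = E_add q p"
proof -
  have "E_add (proj_pt u) (proj_pt v) = E_add (proj_pt v) (proj_pt u)" if u: "u \<in> CE" and v: "v \<in> CE" for u v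
  proof -
    obtain F where F: "F \<in> add_laws" "F v u \<in> CE" using add_vec_law[OF v u] by blast
    have c: "add1 u v = add1 v u" "add2 u v = (\<lambda>i. (-1) * add2 v u i)"
      by (simp_all add: add1_def add2_def evec_eq_iff algebra_simps)
    have "F u v \<in> CE \<and> proj_pt (F u v) = proj_pt (F v u)"
    proof (cases "F = add1")
      case True
      show ?thesis using F(2) unfolding True c(1) by simp
    next
      case False
      then have F2: "F = add2" using F(1) by (simp add: add_laws_def)
      show ?thesis using CE_scale[OF F(2), of "-1"] proj_pt_scale[of "-1" "F v u"] unfolding F2 c(2) by simp
    qed
    with F show ?thesis using E_add_law[OF F(1) u v] E_add_law[OF F(1) v u] by simp
  qed
  then show "p \<in> EP \<Longrightarrow> q \<in> EP \<Longrightarrow> E_add p q = E_add q p" by blast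
qed

lemma E_add_zero: "v \<in> CE \<Longrightarrow> E_add (proj_pt v) (proj_pt vO) = proj_pt v"
proof (rule E_add_eqI)
  assume v: "v \<in> CE"
  show "add1 v vO = (\<lambda>i. v Ec * v i)" and "add2 v vO = (\<lambda>i. v Ed * v i)"
    by (simp_all add: add1_def add2_def evec_eq_iff)
qed (simp_all add: vO_CE)

lemma E_add_neg: "v \<in> CE \<Longrightarrow> E_add (proj_pt v) (proj_pt (neg_vec v)) = proj_pt vO"
proof (rule E_add_eqI)
  assume v: "v \<in> CE"
  show "add1 v (neg_vec v) = (\<lambda>i. ((v Ec)^4 + (v Ed)^4) * vO i)"
    unfolding evec_eq_iff add1_def neg_vec_def evec_simps by (intro conjI; use CE_rel[OF v] in \<open>(simp add: power4_eq_xxxx algebra_simps; fail) | Groebner_Basis.algebra\<close>)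
  show "add2 v (neg_vec v) = (\<lambda>i. (2 * v Ea * v Eb * v Ec * v Ed) * vO i)"
    unfolding evec_eq_iff add2_def neg_vec_def evec_simps by (intro conjI; use CE_rel[OF v] in \<open>(simp add: power4_eq_xxxx algebra_simps; fail) | Groebner_Basis.algebra\<close>)
qed (simp_all add: vO_CE neg_vec_CE)

text \<open>Translation by the point [sqrt 2, 0, 1, -1] is linear.\<close>

definition theta :: "(E_var \<Rightarrow> complex) \<Rightarrow> E_var \<Rightarrow> complex" where
  "theta v = evec (complex_of_real (sqrt 2) * v Ec) (complex_of_real (sqrt 2) * v Ed) (v Ea) (- v Eb)"

definition tau_vec :: "(E_var \<Rightarrow> complex) \<Rightarrow> E_var \<Rightarrow> complex" where
  "tau_vec v = evec (v Ea) (- v Eb) (v Ec) (v Ed)"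

definition rho_vec :: "(E_var \<Rightarrow> complex) \<Rightarrow> E_var \<Rightarrow> complex" where
  "rho_vec v = evec (v Ea) (v Eb) (- v Ec) (- v Ed)"

lemma vec_simps [simp]:
  "neg_vec v Ea = v Ea" "neg_vec v Eb = v Eb" "neg_vec v Ec = v Ec" "neg_vec v Ed = - v Ed"
  "tau_vec v Ea = v Ea" "tau_vec v Eb = - v Eb" "tau_vec v Ec = v Ec" "tau_vec v Ed = v Ed"
  "rho_vec v Ea = v Ea" "rho_vec v Eb = v Eb" "rho_vec v Ec = - v Ec" "rho_vec v Ed = - v Ed"
  "theta v Ea = complex_of_real (sqrt 2) * v Ec" "theta v Eb = complex_of_real (sqrt 2) * v Ed"
  "theta v Ec = v Ea" "theta v Ed = - v Eb"
  by (simp_all add: neg_vec_def tau_vec_def rho_vec_def theta_def)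

lemma sqrt2_sq: "complex_of_real (sqrt 2) * complex_of_real (sqrt 2) = 2"
  by (metis of_real_mult of_real_numeral real_sqrt_mult_self abs_numeral)

lemma theta_CE:
  assumes "v \<in> CE"
  shows "theta v \<in> CE"
proof -
  define s where "s = complex_of_real (sqrt 2)"
  have s: "s * s = 2" using sqrt2_sq by (simp add: s_def)
  have ss: "(s * x)\<^sup>2 = 2 * x\<^sup>2" for x by (simp add: power_mult_distrib power2_eq_square[of s] s)
  show ?thesis
    using CE_ab[OF assms] CE_rel[OF assms] unfolding CE_iff[of "theta v"] vec_simps s_def[symmetric] ss by simp
qed

lemma tau_vec_CE: "v \<in> CE \<Longrightarrow> tau_vec v \<in> CE" and rho_vec_CE: "v \<in> CE \<Longrightarrow> rho_vec v \<in> CE"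
  by (simp_all add: CE_iff)

abbreviation "vo \<equiv> evec (complex_of_real (sqrt 2)) 0 1 1"

lemma vo_CE: "vo \<in> CE"
  using sqrt2_sq by (simp add: CE_iff power2_eq_square)

lemma E_add_theta: "v \<in> CE \<Longrightarrow> E_add (proj_pt v) (proj_pt (theta vO)) = proj_pt (theta v)"
proof (rule E_add_eqI)
  assume v: "v \<in> CE"
  show "add1 v (theta vO) = (\<lambda>i. v Ea * theta v i)"
    unfolding evec_eq_iff add1_def vec_simps evec_simps by (intro conjI; use CE_rel[OF v] in \<open>(simp add: power4_eq_xxxx algebra_simps; fail) | Groebner_Basis.algebra\<close>)
  show "add2 v (theta vO) = (\<lambda>i. v Eb * theta v i)"
    unfolding evec_eq_iff add2_def vec_simps evec_simps by (intro conjI; use CE_rel[OF v] in \<open>(simp add: power4_eq_xxxx algebra_simps; fail) | Groebner_Basis.algebra\<close>)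
qed (simp_all add: vO_CE theta_CE)

text \<open>The translation sends the stated origin to [1, 1, 1, 0]: the translating point is its
  negative, so the shifted group law has the stated origin as neutral element.\<close>

lemma theta_vo: "proj_pt (theta vo) = proj_pt vO"
proof -
  have "theta vo = (\<lambda>i. complex_of_real (sqrt 2) * vO i)" by (simp add: evec_eq_iff)
  then show ?thesis using proj_pt_scale[of "complex_of_real (sqrt 2)" vO] by simp
qed

text \<open>This constancy is what makes tau a negation after a change of origin. The constant is a
  point of order two, not the neutral element of \<open>E_add\<close>; the translation
  \<open>theta\<close> sends it to the stated origin.\<close>

lemma E_add_tau: "v \<in> CE \<Longrightarrow> E_add (proj_pt v) (proj_pt (tau_vec v)) = proj_pt (evec 1 (-1) 1 0)"
proof (rule E_add_eqI)
  assume v: "v \<in> CE"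
  show "add1 v (tau_vec v) = (\<lambda>i. ((v Ec)^4 + (v Ed)^4) * evec 1 (-1) 1 0 i)"
    unfolding evec_eq_iff add1_def vec_simps evec_simps by (intro conjI; use CE_rel[OF v] in \<open>(simp add: power4_eq_xxxx algebra_simps; fail) | Groebner_Basis.algebra\<close>)
  show "add2 v (tau_vec v) = (\<lambda>i. (- 2 * v Ea * v Eb * v Ec * v Ed) * evec 1 (-1) 1 0 i)"
    unfolding evec_eq_iff add2_def vec_simps evec_simps by (intro conjI; use CE_rel[OF v] in \<open>(simp add: power4_eq_xxxx algebra_simps; fail) | Groebner_Basis.algebra\<close>)
qed (simp_all add: CE_iff)

lemma theta_tau: "theta (evec 1 (-1) 1 0) = vo"
  by (simp add: evec_eq_iff)

lemma add_law_rho: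
  assumes "F \<in> add_laws"
  shows "F (rho_vec u) v = (\<lambda>i. (-1) * rho_vec (F u v) i)" "F u (rho_vec v) = (\<lambda>i. (-1) * rho_vec (F u v) i)"
  using assms unfolding add_laws_def by (auto simp: evec_eq_iff add1_def add2_def)

section \<open>The surface X\<close>

lemma image_proj_pt:
  assumes "\<And>c v. f (\<lambda>i. c * v i) = (\<lambda>i. c * g v i)"
  shows "f ` proj_pt v = proj_pt (g v)"
proof (intro equalityI subsetI)
  fix w assume "w \<in> f ` proj_pt v"
  then obtain c where "c \<noteq> 0" "w = f (\<lambda>i. c * v i)" unfolding proj_pt_def by auto
  then show "w \<in> proj_pt (g v)" unfolding proj_pt_def assms by blast
next
  fix w assume "w \<in> proj_pt (g v)"
  then obtain c where "c \<noteq> 0" "w = f (\<lambda>i. c * v i)" unfolding proj_pt_def assms by auto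
  then show "w \<in> f ` proj_pt v" unfolding proj_pt_def by blast
qed

lemma E_rho_proj: "E_rho (proj_pt v) = proj_pt (rho_vec v)"
  unfolding E_rho_def by (rule image_proj_pt) (simp add: evec_eq_iff)

lemma E_tau_proj: "E_tau (proj_pt v) = proj_pt (tau_vec v)"
  unfolding E_tau_def by (rule image_proj_pt) (simp add: evec_eq_iff)

lemma vec_invol [simp]: "rho_vec (rho_vec v) = v" "tau_vec (tau_vec v) = v" "neg_vec (neg_vec v) = v"
  by (simp_all add: evec_eq_iff)

lemma rho_tau_commute: "rho_vec (tau_vec v) = tau_vec (rho_vec v)" "rho_vec (neg_vec v) = neg_vec (rho_vec v)"
  by (simp_all add: evec_eq_iff)

lemma vec_diag: "rho_vec v = (\<lambda>i. evec 1 1 (-1) (-1) i * v i)" "tau_vec v = (\<lambda>i. evec 1 (-1) 1 1 i * v i)"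
  "neg_vec v = (\<lambda>i. evec 1 1 1 (-1) i * v i)"
  by (simp_all add: evec_eq_iff)

abbreviation "EE \<equiv> CE \<times> CE"
abbreviation "EEq \<equiv> map_prod proj_pt proj_pt :: (E_var \<Rightarrow> complex) \<times> (E_var \<Rightarrow> complex) \<Rightarrow> _"
abbreviation "EEA K \<equiv> \<lambda>d. tens (forms K d) (forms K d :: ((E_var \<Rightarrow> complex) \<Rightarrow> complex) set)"
abbreviation "rr \<equiv> map_prod rho_vec rho_vec"
abbreviation "Xq \<equiv> \<lambda>c. orbit_map (map_prod E_rho E_rho) (EEq c)"
abbreviation "XA K \<equiv> inv_funs EE rr (EEA K)"

lemma (in graded) A_nz2:
  assumes "c \<in> C" "x \<in> C"
  shows "\<exists>w\<in>A d. w c \<noteq> 0 \<and> w x \<noteq> 0"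
proof -
  obtain w where w: "w \<in> A d" "w c \<noteq> 0" using A_nz_deg assms(1) by blast
  obtain w' where w': "w' \<in> A d" "w' x \<noteq> 0" using A_nz_deg assms(2) by blast
  show ?thesis
  proof (cases "w x \<noteq> 0 \<or> w' c \<noteq> 0")
    case True
    then show ?thesis using w w' by auto
  next
    case False
    then show ?thesis using w w' by (intro bexI[OF _ A_add[OF w(1) w'(1)]]) simp
  qed
qed

text \<open>Only functions of equal degree on both factors are available, so a test function on one
  factor is multiplied by a function on the other that is nonzero at both points and
  cancels.\<close>

lemma (in graded_pair) gseparating_tens:
  assumes "gseparating C q A" "gseparating C' q' A'"
  shows "gseparating (C \<times> C') (map_prod q q') (\<lambda>d. tens (A d) (A' d))"
  unfolding gseparating_def
proof (intro ballI impI)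
  fix p r assume p: "p \<in> C \<times> C'" "r \<in> C \<times> C'"
    and eq: "\<forall>d. \<forall>f\<in>tens (A d) (A' d). \<forall>g\<in>tens (A d) (A' d). f p * g r = f r * g p"
  have C: "fst p \<in> C" "fst r \<in> C" "snd p \<in> C'" "snd r \<in> C'" using p by auto
  have "q (fst p) = q (fst r)"
  proof (rule gseparatingD[OF assms(1) C(1,2)])
    fix d f g assume fg: "f \<in> A d" "g \<in> A d"
    obtain w where w: "w \<in> A' d" "w (snd p) \<noteq> 0" "w (snd r) \<noteq> 0" using Y.A_nz2[OF C(3,4)] by blast
    have "f (fst p) * w (snd p) * (g (fst r) * w (snd r)) = f (fst r) * w (snd r) * (g (fst p) * w (snd p))"
      using bspec[OF bspec[OF spec[OF eq, of d] tens.prod[OF fg(1) w(1)]] tens.prod[OF fg(2) w(1)]] by simp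
    then have "w (snd p) * w (snd r) * (f (fst p) * g (fst r)) = w (snd p) * w (snd r) * (f (fst r) * g (fst p))"
      by (simp add: ac_simps)
    then show "f (fst p) * g (fst r) = f (fst r) * g (fst p)" using w by simp
  qed
  moreover have "q' (snd p) = q' (snd r)"
  proof (rule gseparatingD[OF assms(2) C(3,4)])
    fix d f g assume fg: "f \<in> A' d" "g \<in> A' d"
    obtain w where w: "w \<in> A d" "w (fst p) \<noteq> 0" "w (fst r) \<noteq> 0" using X.A_nz2[OF C(1,2)] by blast
    have "w (fst p) * f (snd p) * (w (fst r) * g (snd r)) = w (fst r) * f (snd r) * (w (fst p) * g (snd p))"
      using bspec[OF bspec[OF spec[OF eq, of d] tens.prod[OF w(1) fg(1)]] tens.prod[OF w(1) fg(2)]] by simp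
    then have "w (fst p) * w (fst r) * (f (snd p) * g (snd r)) = w (fst p) * w (fst r) * (f (snd r) * g (snd p))"
      by (simp add: ac_simps)
    then show "f (snd p) * g (snd r) = f (snd r) * g (snd p)" using w by simp
  qed
  ultimately show "map_prod q q' p = map_prod q q' r" by (simp add: prod_eq_iff)
qed

context subfield
begin

lemma E_curve_gspace: "E_curve K = gspace CE proj_pt (forms K)"
  unfolding E_curve_def CE_def by (rule proj_var_gspace)

lemma EE_pair: "graded_pair K CE proj_pt (forms K) CE proj_pt (forms K)"
proof -
  interpret E: graded K CE proj_pt "forms K" by (rule graded_E)
  show ?thesis by unfold_locales
qed

lemma graded_EE: "graded K EE EEq (EEA K)"
  by (rule graded_tens[OF graded_E graded_E])

lemma form_rho: "form K d f \<Longrightarrow> form K d (\<lambda>v. f (rho_vec v))"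
  and form_tau: "form K d f \<Longrightarrow> form K d (\<lambda>v. f (tau_vec v))"
  and form_neg: "form K d f \<Longrightarrow> form K d (\<lambda>v. f (neg_vec v))"
  unfolding vec_diag by (auto intro!: form_diag evec_K K_uminus)

lemma gseparating_E: "gseparating CE proj_pt (forms K)"
  unfolding gseparating_def
proof (intro ballI impI)
  fix u v assume uv: "u \<in> CE" "v \<in> CE" and eq: "\<forall>d. \<forall>f\<in>forms K d. \<forall>g\<in>forms K d. f u * g v = f v * g u"
  show "proj_pt u = proj_pt v"
  proof (rule CE_minors[OF uv])
    fix i j :: E_var
    have "(\<lambda>v. v i) \<in> forms K 1" "(\<lambda>v. v j) \<in> forms K 1" using form.var[of K] by simp_all
    from bspec[OF bspec[OF spec[OF eq, of 1] this(1)] this(2)]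
    show "u i * v j = u j * v i" by (simp add: mult.commute)
  qed
qed

lemma bilinear_XA:
  assumes "\<And>v. rho_vec v x = \<epsilon> * v x" "\<And>v. rho_vec v y = \<epsilon> * v y" "\<epsilon> * \<epsilon> = 1"
  shows "(\<lambda>p. fst p x * snd p y) \<in> XA K 1"
proof -
  have "(\<lambda>p. fst p x * snd p y) \<in> EEA K 1"
    using tens.prod[of "\<lambda>v. v x" "forms K 1" "\<lambda>v. v y" "forms K 1"] form.var[of K x] form.var[of K y] by simp
  moreover have "\<epsilon> * a * (\<epsilon> * b) = \<epsilon> * \<epsilon> * (a * b)" for a b by simp
  ultimately show ?thesis using assms by (simp add: inv_funs_def)
qed

lemma bilinear_ab: "x \<in> {Ea, Eb} \<Longrightarrow> y \<in> {Ea, Eb} \<Longrightarrow> (\<lambda>p. fst p x * snd p y) \<in> XA K 1"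
  by (rule bilinear_XA[where \<epsilon> = 1]) auto

lemma bilinear_cd: "x \<in> {Ec, Ed} \<Longrightarrow> y \<in> {Ec, Ed} \<Longrightarrow> (\<lambda>p. fst p x * snd p y) \<in> XA K 1"
  by (rule bilinear_XA[where \<epsilon> = "-1"]) auto

text \<open>Products of the coordinates a or b of both factors are fixed by rho, and by
  \<open>CE_ab\<close> one of them is nonzero at any given point; this is the condition
  \<open>inv_nz\<close>.\<close>

lemma X_invol: "graded_invol K EE EEq (EEA K) rr (map_prod E_rho E_rho)"
proof -
  interpret EE: graded K EE EEq "EEA K" by (rule graded_EE)
  show ?thesis
  proof unfold_locales
    fix c assume c: "c \<in> EE"
    show "rr c \<in> EE" using c rho_vec_CE by auto
    show "EEq (rr c) = map_prod E_rho E_rho (EEq c)" by (cases c) (simp add: E_rho_proj)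
    show "map_prod E_rho E_rho (map_prod E_rho E_rho (EEq c)) = EEq c" by (cases c) (simp add: E_rho_proj)
    have c': "fst c \<in> CE" "snd c \<in> CE" using c by auto
    obtain x where x: "x \<in> {Ea, Eb}" "fst c x \<noteq> 0" using CE_ab[OF c'(1)] by blast
    obtain y where y: "y \<in> {Ea, Eb}" "snd c y \<noteq> 0" using CE_ab[OF c'(2)] by blast
    show "\<exists>g\<in>XA K 1. g c \<noteq> 0" by (rule bexI[OF _ bilinear_ab[OF x(1) y(1)]]) (use x y in simp)
  next
    fix f :: "(E_var \<Rightarrow> complex) \<times> (E_var \<Rightarrow> complex) \<Rightarrow> complex" and d
    assume "f \<in> EEA K d"
    then show "(\<lambda>x. f (rr x)) \<in> EEA K d" by (rule tens_map) (simp_all add: form_rho)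
  next
    fix f :: "(E_var \<Rightarrow> complex) \<times> (E_var \<Rightarrow> complex) \<Rightarrow> complex" and d c
    show "f (rr (rr c)) = f c" by (cases c) simp
  qed
qed

lemma graded_X: "graded K EE Xq (XA K)"
  by (rule graded_invol.graded_inv[OF X_invol])

lemma X_surface_gspace: "X_surface K = gspace EE Xq (XA K)"
  unfolding X_surface_def E_curve_gspace graded_pair.product_gspace[OF EE_pair]
  by (rule graded_invol.quotient_gspace[OF X_invol])

lemma gseparating_X: "gseparating EE Xq (XA K)"
  by (rule graded_invol.gseparating_quotient[OF X_invol])
     (rule graded_pair.gseparating_tens[OF EE_pair gseparating_E gseparating_E])

lemma points_X: "points (X_surface K) = Xq ` EE"
  unfolding X_surface_gspace by (rule graded.points_gspace[OF graded_X])

end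

lemma Xq_eq_iff:
  assumes "c \<in> EE" "x \<in> EE"
  shows "Xq c = Xq x \<longleftrightarrow> EEq c = EEq x \<or> EEq c = EEq (rr x)"
  using graded_invol.orbit_eq[OF UNIV.X_invol assms] .

subsection \<open>Completeness\<close>

lemma tens_assoc:
  assumes "h \<in> tens (tens A B) D"
  shows "(\<lambda>p. h ((fst p, fst (snd p)), snd (snd p))) \<in> tens A (tens B D)"
  using assms
proof induction
  case (prod f g)
  from prod(1) show ?case
  proof induction
    case (prod a b)
    show ?case using tens.prod[OF prod(1) tens.prod[OF prod(2) \<open>g \<in> D\<close>]] by (simp add: mult.assoc)
  next
    case (add a b)
    then show ?case using tens.add[OF add(3,4)] by (simp add: distrib_right)
  qed
next
  case (add f g)
  then show ?case using tens.add[OF add(3,4)] by simp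
qed

lemma tens_mono: "f \<in> tens A B \<Longrightarrow> A \<subseteq> A' \<Longrightarrow> f \<in> tens A' B"
  by (induction rule: tens.induct) (auto intro: tens.intros)

text \<open>A closed set in X x P is pulled back to E x (E x P) and then projected twice along E.
  Since E x E maps onto X, the result is the projection of the original set.\<close>

lemma (in subfield) complete_X: "complete_var K (X_surface K)"
  unfolding complete_var_def
proof (intro allI impI)
  fix n and R :: "((nat \<Rightarrow> complex) \<Rightarrow> complex) set"
  let ?P = "affine_pts n R" and ?B = "\<lambda>_::nat. polys K {..<n}" and ?id = "\<lambda>x::nat \<Rightarrow> complex. x"
  interpret X: graded K EE Xq "XA K" by (rule graded_X)
  interpret P: graded K ?P ?id ?B by (rule graded_affine)
  interpret XP: graded_pair K EE Xq "XA K" ?P ?id ?B by unfold_locales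
  interpret E1: E_times K ?P ?id ?B by unfold_locales
  interpret E2: E_times K "CE \<times> ?P" "map_prod proj_pt ?id" "\<lambda>d. tens (forms K d) (?B d)"
    unfolding E_times_def by (rule graded_tens[OF graded_E graded_affine])
  show "closed_map (fs_top (product (X_surface K) (affine_var K n R))) (fs_top (affine_var K n R)) snd"
    unfolding X_surface_gspace affine_var_gspace XP.product_gspace closed_map_def
  proof (intro allI impI)
    fix Z assume Z: "closedin (fs_top (gspace (EE \<times> ?P) (map_prod Xq ?id) (\<lambda>d. tens (XA K d) (?B d)))) Z"
    define Z1 where "Z1 = {(proj_pt u, (proj_pt v, y)) | u v y. u \<in> CE \<and> v \<in> CE \<and> y \<in> ?P \<and> (Xq (u, v), y) \<in> Z}"
    have Zs: "Z \<subseteq> map_prod Xq ?id ` (EE \<times> ?P)" using Z unfolding XP.XY.closedin_gspace by (rule conjunct1)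
    have mem: "(proj_pt u, (proj_pt v, y)) \<in> Z1 \<longleftrightarrow> (Xq (u, v), y) \<in> Z" if "u \<in> CE" "v \<in> CE" "y \<in> ?P" for u v y
      unfolding Z1_def using that by auto
    have "closedin (fs_top (gspace (CE \<times> (CE \<times> ?P)) (map_prod proj_pt (map_prod proj_pt ?id)) (\<lambda>d. tens (forms K d) (tens (forms K d) (?B d))))) Z1"
      unfolding E2.EY.XY.closedin_gspace
    proof (intro conjI ballI impI)
      show "Z1 \<subseteq> map_prod proj_pt (map_prod proj_pt ?id) ` (CE \<times> (CE \<times> ?P))"
      proof
        fix z assume "z \<in> Z1"
        then have "\<exists>u v y. z = (proj_pt u, (proj_pt v, y)) \<and> u \<in> CE \<and> v \<in> CE \<and> y \<in> ?P \<and> (Xq (u, v), y) \<in> Z"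
          unfolding Z1_def by (rule CollectD)
        then obtain u v y where "z = (proj_pt u, (proj_pt v, y))" "u \<in> CE" "v \<in> CE" "y \<in> ?P"
          by (elim exE conjE) (rule that)
        then show "z \<in> map_prod proj_pt (map_prod proj_pt ?id) ` (CE \<times> (CE \<times> ?P))"
          by (intro image_eqI[of _ _ "(u, (v, y))"]) simp_all
      qed
      fix c assume c: "c \<in> CE \<times> (CE \<times> ?P)" "map_prod proj_pt (map_prod proj_pt ?id) c \<notin> Z1"
      obtain u r where ur: "c = (u, r)" "u \<in> CE" "r \<in> CE \<times> ?P" using c(1) by (rule SigmaE)
      obtain v y where "r = (v, y)" "v \<in> CE" "y \<in> ?P" using ur(3) by (rule SigmaE)
      with ur have uvy: "c = (u, (v, y))" "u \<in> CE" "v \<in> CE" "y \<in> ?P" by simp_all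
      then have "(Xq (u, v), y) \<notin> Z" using c(2) mem by simp
      then have "map_prod Xq ?id ((u, v), y) \<notin> Z" by simp
      moreover have uvyP: "((u, v), y) \<in> EE \<times> ?P" using uvy by simp
      ultimately have "\<exists>d. \<exists>g\<in>tens (XA K d) (?B d). g ((u, v), y) \<noteq> 0 \<and> (\<forall>x\<in>EE \<times> ?P. map_prod Xq ?id x \<in> Z \<longrightarrow> g x = 0)"
        using bspec[OF conjunct2[OF Z[unfolded XP.XY.closedin_gspace]] uvyP] by (rule_tac mp)
      then obtain d g where g: "g \<in> tens (XA K d) (?B d)" "g ((u, v), y) \<noteq> 0" "\<forall>x\<in>EE \<times> ?P. map_prod Xq ?id x \<in> Z \<longrightarrow> g x = 0"
        by (elim exE bexE conjE) (rule that)
      have "g \<in> tens (EEA K d) (?B d)" using g(1) by (rule tens_mono) (auto simp: inv_funs_def)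
      then have "(\<lambda>p. g ((fst p, fst (snd p)), snd (snd p))) \<in> tens (forms K d) (tens (forms K d) (?B d))"
        by (rule tens_assoc)
      moreover have "\<forall>x\<in>CE \<times> (CE \<times> ?P). map_prod proj_pt (map_prod proj_pt ?id) x \<in> Z1 \<longrightarrow> g ((fst x, fst (snd x)), snd (snd x)) = 0"
      proof (intro ballI impI)
        fix x assume x: "x \<in> CE \<times> (CE \<times> ?P)" "map_prod proj_pt (map_prod proj_pt ?id) x \<in> Z1"
        obtain u r where ur: "x = (u, r)" "u \<in> CE" "r \<in> CE \<times> ?P" using x(1) by (rule SigmaE)
        obtain v y where "r = (v, y)" "v \<in> CE" "y \<in> ?P" using ur(3) by (rule SigmaE)
        with ur have uvy: "x = (u, (v, y))" "u \<in> CE" "v \<in> CE" "y \<in> ?P" by simp_all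
        then have "map_prod Xq ?id ((u, v), y) \<in> Z" using x(2) mem[of u v y] by simp
        then show "g ((fst x, fst (snd x)), snd (snd x)) = 0"
          using bspec[OF g(3), of "((u, v), y)"] uvy by simp
      qed
      ultimately show "\<exists>d. \<exists>g\<in>tens (forms K d) (tens (forms K d) (?B d)). g c \<noteq> 0 \<and>
          (\<forall>x\<in>CE \<times> (CE \<times> ?P). map_prod proj_pt (map_prod proj_pt ?id) x \<in> Z1 \<longrightarrow> g x = 0)"
        using g(2) uvy(1)
        by (rule_tac exI[of _ d], rule_tac bexI[of _ "\<lambda>p. g ((fst p, fst (snd p)), snd (snd p))"]) simp_all
    qed
    then have "closedin (fs_top (gspace ?P ?id ?B)) (snd ` snd ` Z1)"
      by (intro E1.closedin_snd E2.closedin_snd)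
    moreover have "snd ` snd ` Z1 = snd ` Z"
    proof (intro equalityI subsetI)
      fix y assume "y \<in> snd ` snd ` Z1"
      then obtain z where z: "z \<in> Z1" "y = snd (snd z)" by (elim imageE) simp
      from z(1) have "\<exists>u v y. z = (proj_pt u, (proj_pt v, y)) \<and> u \<in> CE \<and> v \<in> CE \<and> y \<in> ?P \<and> (Xq (u, v), y) \<in> Z"
        unfolding Z1_def by (rule CollectD)
      then obtain u v y' where "z = (proj_pt u, (proj_pt v, y'))" "(Xq (u, v), y') \<in> Z"
        by (elim exE conjE) (rule that)
      then show "y \<in> snd ` Z" using z(2) by (intro image_eqI[of _ _ "(Xq (u, v), y)"]) simp_all
    next
      fix y assume "y \<in> snd ` Z"
      then obtain z where z: "z \<in> Z" "y = snd z" by blast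
      obtain x where x: "z = map_prod Xq ?id x" "x \<in> EE \<times> ?P" using subsetD[OF Zs z(1)] by (rule imageE)
      obtain c where c: "x = (c, snd x)" "c \<in> EE" "snd x \<in> ?P" using x(2) by auto
      obtain u v where uv: "c = (u, v)" "u \<in> CE" "v \<in> CE" using c(2) by (rule SigmaE)
      have "snd x = y" using x(1) z(2) by simp
      have "(Xq (u, v), y) \<in> Z" using z(1) unfolding x(1) by (subst (asm) c(1)) (simp add: uv \<open>snd x = y\<close>)
      then have "(proj_pt u, (proj_pt v, y)) \<in> Z1" using mem uv(2,3) c(3) \<open>snd x = y\<close> by blast
      then show "y \<in> snd ` snd ` Z1"
        by (intro image_eqI[of _ _ "(proj_pt v, y)"] image_eqI[of _ _ "(proj_pt u, (proj_pt v, y))"]) simp_all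
    qed
    ultimately show "closedin (fs_top (gspace ?P ?id ?B)) (snd ` Z)" by simp
  qed
qed

subsection \<open>Dimension\<close>

lemma (in subfield) irreducible_EE_sub:
  assumes "B \<noteq> {}" "B \<subseteq> EE"
    and "\<And>d e f g. f \<in> EEA K d \<Longrightarrow> g \<in> EEA K e \<Longrightarrow> \<forall>c\<in>B. f c * g c = 0 \<Longrightarrow> (\<forall>c\<in>B. f c = 0) \<or> (\<forall>c\<in>B. g c = 0)"
  shows "irreducible_in (fs_top (X_surface K)) (Xq ` B)"
  unfolding X_surface_gspace
proof (rule graded.irreducible_in_gspace[OF graded_X assms(1,2)])
  fix d e f g assume "f \<in> XA K d" "g \<in> XA K e" "\<forall>c\<in>B. f c * g c = 0"
  then show "(\<forall>c\<in>B. f c = 0) \<or> (\<forall>c\<in>B. g c = 0)"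
    using assms(3)[of f d g e] by (simp add: inv_funs_def)
qed

lemma (in subfield) irreducible_X: "irreducible_in (fs_top (X_surface K)) (points (X_surface K))"
  unfolding points_X
  by (rule irreducible_EE_sub) (use vO_CE EE_prime in auto)

lemma (in subfield) form_K_value: "form K d f \<Longrightarrow> (\<And>i. v i \<in> K) \<Longrightarrow> f v \<in> K"
  by (induction rule: form.induct) auto

lemma (in subfield) EEA_K_value: "f \<in> EEA K d \<Longrightarrow> (\<And>i. u i \<in> K) \<Longrightarrow> (\<And>i. v i \<in> K) \<Longrightarrow> f (u, v) \<in> K"
  by (induction rule: tens.induct) (auto intro: form_K_value)

lemma (in subfield) EEA_span:
  assumes "f \<in> EEA K d"
  shows "\<exists>g\<in>lspan K ((\<lambda>(b, b') p. b (fst p) * b' (snd p)) ` (emonos d \<times> emonos d)). \<forall>p\<in>EE. f p = g p"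
  using assms
proof induction
  case (prod f g)
  obtain f' where f': "f' \<in> lspan K (emonos d)" "\<forall>v\<in>CE. f v = f' v"
    using form_normal prod(1) unfolding normal_forms_def by blast
  obtain g' where g': "g' \<in> lspan K (emonos d)" "\<forall>v\<in>CE. g v = g' v"
    using form_normal prod(2) unfolding normal_forms_def by blast
  let ?B = "(\<lambda>(b, b') p. b (fst p) * b' (snd p)) ` (emonos d \<times> emonos d)"
  have "(\<lambda>p. f' (fst p) * g' (snd p)) \<in> lspan K ?B"
    using f'(1)
  proof induction
    case zero
    show ?case using lspan.zero by simp
  next
    case (add a b)
    then show ?case using lspan.add[OF add(3,4)] by (simp add: distrib_right)
  next
    case (smult k a)
    then show ?case using lspan.smult[OF smult(1,3)] by (simp add: mult.assoc)
  next
    case (base b)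
    from g'(1) show ?case
    proof induction
      case zero
      show ?case using lspan.zero by simp
    next
      case (add a b)
      then show ?case using lspan.add[OF add(3,4)] by (simp add: distrib_left)
    next
      case (smult k a)
      then show ?case using lspan.smult[OF smult(1,3)] by (simp add: mult.left_commute)
    next
      case (base b')
      show ?case by (rule lspan.base, rule image_eqI[of _ _ "(b, b')"]) (use base \<open>b \<in> emonos d\<close> in auto)
    qed
  qed
  then show ?case using f'(2) g'(2) by (rule_tac bexI) auto
next
  case (add f g)
  then obtain f' g' where "f' \<in> lspan K ((\<lambda>(b, b') p. b (fst p) * b' (snd p)) ` (emonos d \<times> emonos d))" "\<forall>p\<in>EE. f p = f' p"
    "g' \<in> lspan K ((\<lambda>(b, b') p. b (fst p) * b' (snd p)) ` (emonos d \<times> emonos d))" "\<forall>p\<in>EE. g p = g' p"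
    by (elim bexE) (rule that)
  then show ?case by (intro bexI[OF _ lspan.add[of f' _ _ g']]) simp_all
qed

text \<open>The chain consists of the origin, the image of E x O and X itself. The upper bound comes
  from the span of products of normal form monomials; the constant 16 is the square of the 4 for a
  single factor.\<close>

lemma (in subfield) has_dimension_X: "has_dimension (X_surface K) 2"
  unfolding has_dimension_def
proof (intro conjI allI impI)
  interpret X: graded K EE Xq "XA K" by (rule graded_X)
  fix m Z assume "irreducible_chain (fs_top (X_surface K)) m Z"
  then have chain: "irreducible_chain (fs_top (gspace EE Xq (XA K))) m Z" by (simp add: X_surface_gspace)
  show "m \<le> 2"
  proof (rule X.irreducible_chain_le_2[OF _ chain])
    fix d
    let ?B = "(\<lambda>(b, b') p. b (fst p) * b' (snd p)) ` (emonos d \<times> emonos d) :: ((E_var \<Rightarrow> complex) \<times> (E_var \<Rightarrow> complex) \<Rightarrow> complex) set"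
    have "finite ?B" using monos_finite by simp
    moreover have "card ?B \<le> 16 * (d + 1)\<^sup>2"
    proof -
      have "card ?B \<le> card (emonos d \<times> emonos d)" by (rule card_image_le) (simp add: monos_finite)
      also have "\<dots> = card (emonos d) * card (emonos d)" by (rule card_cartesian_product)
      also have "\<dots> \<le> (4 * (d + 1)) * (4 * (d + 1))" by (intro mult_le_mono monos_finite)
      finally show ?thesis by (simp add: power2_eq_square algebra_simps)
    qed
    moreover have "\<forall>f\<in>XA K d. \<exists>g\<in>lspan K ?B. \<forall>c\<in>EE. f c = g c"
      using EEA_span by (simp add: inv_funs_def)
    ultimately show "\<exists>B. finite B \<and> card B \<le> 16 * (d + 1)\<^sup>2 \<and> (\<forall>f\<in>XA K d. \<exists>g\<in>lspan K B. \<forall>c\<in>EE. f c = g c)"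
      by (intro exI[of _ ?B] conjI)
  qed
next
  interpret X: graded K EE Xq "XA K" by (rule graded_X)
  let ?T = "fs_top (X_surface K)"
  define Z where "Z = (\<lambda>i::nat. if i = 0 then Xq ` {(vO, vO)} else if i = 1 then Xq ` (CE \<times> {vO}) else Xq ` EE)"
  have vOK: "vO i \<in> K" for i by (rule evec_K) auto
  have "closedin ?T {Xq (vO, vO)}"
    unfolding X_surface_gspace
  proof (rule X.closedin_rational_point[OF gseparating_X])
    fix d f assume "f \<in> XA K d"
    then have "f \<in> EEA K d" by (simp add: inv_funs_def)
    then show "f (vO, vO) \<in> K" by (rule EEA_K_value) (rule vOK)+
  qed (use vO_CE in simp)
  then have cl0: "closedin ?T (Z 0)" by (simp add: Z_def)
  have irr0: "irreducible_in ?T (Z 0)" unfolding Z_def by (simp, rule irreducible_EE_sub[of "{(vO, vO)}", simplified]) (use vO_CE in auto)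
  \<comment> \<open>Over the curve \<open>Z 1\<close> the second coordinate is the origin or its
    image under rho. These two points satisfy d = 0 and a = b, which provides the equations used for
    closedness.\<close>
  have key: "v Ed = 0 \<and> v Ea = v Eb" if x: "(u, v) \<in> EE" "Xq (u, v) \<in> Z 1" for u v
  proof -
    obtain w where w: "w \<in> CE" "Xq (u, v) = Xq (w, vO)" using x(2) by (auto simp: Z_def)
    then have "EEq (u, v) = EEq (w, vO) \<or> EEq (u, v) = EEq (rr (w, vO))"
      using Xq_eq_iff[of "(u, v)" "(w, vO)"] x(1) vO_CE by simp
    then have "proj_pt vO = proj_pt v \<or> proj_pt (rho_vec vO) = proj_pt v" by auto
    then show ?thesis unfolding proj_pt_eq_iff by auto
  qed
  have Z0: "Z 0 = Xq ` {(vO, vO)}" and Z1: "Z 1 = Xq ` (CE \<times> {vO})" and Z2: "Z 2 = Xq ` EE"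
    by (simp_all add: Z_def)
  have cl1: "closedin ?T (Z 1)"
    unfolding X_surface_gspace X.closedin_gspace
  proof (intro conjI ballI impI)
    show "Z 1 \<subseteq> Xq ` EE" unfolding Z_def using vO_CE by auto
    fix c assume c: "c \<in> EE" "Xq c \<notin> Z 1"
    obtain u v where uv: "c = (u, v)" "u \<in> CE" "v \<in> CE" using c(1) by blast
    show "\<exists>d. \<exists>g\<in>XA K d. g c \<noteq> 0 \<and> (\<forall>x\<in>EE. Xq x \<in> Z 1 \<longrightarrow> g x = 0)"
    proof (cases "v Ed = 0")
      case False
      obtain x where x: "x \<in> {Ec, Ed}" "u x \<noteq> 0" using uv(2) by (auto simp: CE_iff)
      have "(\<lambda>p. fst p x * snd p Ed) \<in> XA K 1" by (rule bilinear_cd) (use x in auto)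
      moreover have "fst c x * snd c Ed \<noteq> 0" using x False uv by simp
      moreover have "\<forall>p\<in>EE. Xq p \<in> Z 1 \<longrightarrow> fst p x * snd p Ed = 0" using key by auto
      ultimately show ?thesis by (rule_tac exI[of _ 1], rule_tac bexI[of _ "\<lambda>p. fst p x * snd p Ed"]) (rule conjI)
    next
      case True
      \<comment> \<open>The points with d = 0 are [1, 1, 1, 0] up to signs, and a = b leaves only
        the origin and its image under rho, both over \<open>Z 1\<close>.\<close>
      have "v Ea \<noteq> v Eb"
      proof
        assume ab: "v Ea = v Eb"
        have nz: "v Ec \<noteq> 0" "v Ea \<noteq> 0" using uv(3) True by (auto simp: CE_iff)
        have "(v Ec)\<^sup>2 = (v Ea)\<^sup>2" using uv(3) True by (simp add: CE_iff)
        then have "v Ec = v Ea \<or> v Ec = - v Ea" by (simp add: power2_eq_iff)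
        then show False
        proof
          assume e: "v Ec = v Ea"
          have "proj_pt vO = proj_pt v" unfolding proj_pt_eq_iff
            by (rule exI[of _ "v Ea"]) (use nz ab True e in \<open>simp add: evec_eq_iff\<close>)
          then have "Xq c = Xq (u, vO)" using Xq_eq_iff[of c "(u, vO)"] uv vO_CE by simp
          moreover have "Xq (u, vO) \<in> Z 1" unfolding Z1 using uv(2) by (intro imageI) simp
          ultimately have "Xq c \<in> Z 1" by simp
          then show False using c(2) by simp
        next
          assume e: "v Ec = - v Ea"
          have "proj_pt (rho_vec vO) = proj_pt v" unfolding proj_pt_eq_iff
            by (rule exI[of _ "v Ea"]) (use nz ab True e in \<open>simp add: evec_eq_iff\<close>)
          then have "Xq c = Xq (rho_vec u, vO)" using Xq_eq_iff[of c "(rho_vec u, vO)"] uv vO_CE rho_vec_CE by simp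
          moreover have "Xq (rho_vec u, vO) \<in> Z 1" unfolding Z1 using uv(2) rho_vec_CE by (intro imageI) simp
          ultimately have "Xq c \<in> Z 1" by simp
          then show False using c(2) by simp
        qed
      qed
      obtain x where x: "x \<in> {Ea, Eb}" "u x \<noteq> 0" using CE_ab[OF uv(2)] by auto
      have "(\<lambda>p. fst p x * snd p Ea - fst p x * snd p Eb) \<in> XA K 1"
        by (intro X.A_diff bilinear_ab) (use x in auto)
      moreover have "fst c x * snd c Ea - fst c x * snd c Eb \<noteq> 0" using x \<open>v Ea \<noteq> v Eb\<close> uv by simp
      moreover have "\<forall>p\<in>EE. Xq p \<in> Z 1 \<longrightarrow> fst p x * snd p Ea - fst p x * snd p Eb = 0" using key by auto
      ultimately show ?thesis
        by (rule_tac exI[of _ 1], rule_tac bexI[of _ "\<lambda>p. fst p x * snd p Ea - fst p x * snd p Eb"]) (rule conjI)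
    qed
  qed
  have irr1: "irreducible_in ?T (Z 1)"
  proof -
    have "irreducible_in ?T (Xq ` (CE \<times> {vO}))"
    proof (rule irreducible_EE_sub)
      fix d e f g assume fg: "f \<in> EEA K d" "g \<in> EEA K e" "\<forall>c\<in>CE \<times> {vO}. f c * g c = 0"
      show "(\<forall>c\<in>CE \<times> {vO}. f c = 0) \<or> (\<forall>c\<in>CE \<times> {vO}. g c = 0)"
      proof (rule ccontr)
        assume "\<not> ?thesis"
        then obtain u w where "u \<in> CE" "f (u, vO) \<noteq> 0" "w \<in> CE" "g (w, vO) \<noteq> 0" by auto
        from E_common_nonzero[OF tens_form_left[OF fg(1)] tens_form_left[OF fg(2)] this]
        show False using fg(3) by auto
      qed
    qed (use vO_CE in auto)
    then show ?thesis by (simp add: Z_def)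
  qed
  have irr2: "irreducible_in ?T (Z 2)" using irreducible_X by (simp add: Z_def points_X)
  have cl2: "closedin ?T (Z 2)" using closedin_topspace[of ?T] unfolding points_X by (simp add: Z_def)
  have s1: "Z 0 \<subset> Z 1"
  proof
    show "Z 0 \<subseteq> Z 1" unfolding Z0 Z1 by (rule image_mono) (use vO_CE in auto)
    have "Xq (rho_vec vO, vO) \<notin> Z 0"
    proof
      assume "Xq (rho_vec vO, vO) \<in> Z 0"
      then have "Xq (rho_vec vO, vO) = Xq (vO, vO)" by (simp add: Z_def)
      then have "proj_pt vO = proj_pt (rho_vec vO)"
        using Xq_eq_iff[of "(rho_vec vO, vO)" "(vO, vO)"] vO_CE rho_vec_CE by auto
      then show False unfolding proj_pt_eq_iff by (auto simp: evec_eq_iff)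
    qed
    moreover have "Xq (rho_vec vO, vO) \<in> Z 1" unfolding Z1 by (rule imageI) (use vO_CE rho_vec_CE in auto)
    ultimately show "Z 0 \<noteq> Z 1" by blast
  qed
  have s2: "Z 1 \<subset> Z 2"
  proof
    show "Z 1 \<subseteq> Z 2" unfolding Z1 Z2 by (rule image_mono) (use vO_CE in auto)
    have "Xq (vO, vo) \<notin> Z 1" using key[of vO vo] vO_CE vo_CE by auto
    moreover have "Xq (vO, vo) \<in> Z 2" unfolding Z2 by (rule imageI) (use vO_CE vo_CE in auto)
    ultimately show "Z 1 \<noteq> Z 2" by blast
  qed
  show "\<exists>Z. irreducible_chain ?T 2 Z"
    unfolding irreducible_chain_def
  proof (intro exI[of _ Z] conjI allI impI)
    fix i :: nat assume "i \<le> 2"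
    then have i: "i = 0 \<or> i = 1 \<or> i = 2" by auto
    show "closedin ?T (Z i)" using i cl0 cl1 cl2 by (elim disjE) simp_all
    show "irreducible_in ?T (Z i)" using i irr0 irr1 irr2 by (elim disjE) simp_all
  next
    fix i :: nat assume "i < 2"
    then have "i = 0 \<or> i = 1" by auto
    then show "Z i \<subset> Z (Suc i)"
    proof
      assume "i = 0" then show ?thesis using s1 by simp
    next
      assume "i = 1" then show ?thesis using s2 by (simp add: numeral_2_eq_2)
    qed
  qed
qed

subsection \<open>Affine charts\<close>

text \<open>A nonzero diagonal entry has a complex square root s, and a row through it divided by s
  is the vector. If the diagonal is zero, the minors make all entries zero. A nonzero vector is
  unique up to sign, and the sign is the ambiguity of the quotient.\<close>

lemma rank_one_symmetric:
  fixes M :: "nat \<Rightarrow> nat \<Rightarrow> complex"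
  assumes minors: "\<And>k l m n. k < N \<Longrightarrow> l < N \<Longrightarrow> m < N \<Longrightarrow> n < N \<Longrightarrow> M k l * M m n = M k n * M m l"
    and sym: "\<And>k l. k < N \<Longrightarrow> l < N \<Longrightarrow> M k l = M l k"
  shows "\<exists>z. \<forall>k<N. \<forall>l<N. M k l = z k * z l"
proof (cases "\<exists>k<N. M k k \<noteq> 0")
  case True
  then obtain k where k: "k < N" "M k k \<noteq> 0" by blast
  define s where "s = csqrt (M k k)"
  have s: "s * s = M k k" by (simp add: s_def flip: power2_eq_square)
  have "M l m = M k l / s * (M k m / s)" if "l < N" "m < N" for l m
  proof -
    have "M k l * M k m = M l k * M k m" using sym[OF k(1) that(1)] by simp
    also have "\<dots> = M l m * M k k" by (rule minors) (use that k in auto)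
    finally show ?thesis using s k(2) by (auto simp: field_simps)
  qed
  then show ?thesis by (intro exI[of _ "\<lambda>l. M k l / s"]) simp
next
  case False
  have "M k l = 0" if "k < N" "l < N" for k l
  proof -
    have "M k l * M l k = M k k * M l l" by (rule minors) (use that in auto)
    then show ?thesis using False sym[OF that] that by simp
  qed
  then show ?thesis by (intro exI[of _ "\<lambda>_. 0"]) simp
qed

text \<open>
  On the chart where the i-th coordinate of the first and the j-th coordinate of the second factor
  do not vanish, the involution changes the signs of the four functions zc, and the invariants are
  generated by the two remaining coordinates and by the products of two of the zc.
\<close>

definition oth :: "E_var \<Rightarrow> E_var" where "oth i = (if i = Ec then Ed else Ec)"

definition zc :: "E_var \<Rightarrow> E_var \<Rightarrow> (E_var \<Rightarrow> complex) \<times> (E_var \<Rightarrow> complex) \<Rightarrow> nat \<Rightarrow> complex" where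
  "zc i j p k = (if k = 0 then fst p Ea / fst p i else if k = 1 then fst p Eb / fst p i
     else if k = 2 then snd p Ea / snd p j else snd p Eb / snd p j)"

text \<open>Two coordinates are ratios d/c or c/d of the factors. The other sixteen are the products
  of \<open>zc\<close> k and \<open>zc\<close> l at index 2 + 4 k + l, kept in both orders so that
  they form a full matrix.\<close>

definition chart :: "E_var \<Rightarrow> E_var \<Rightarrow> (E_var \<Rightarrow> complex) \<times> (E_var \<Rightarrow> complex) \<Rightarrow> nat \<Rightarrow> complex" where
  "chart i j p = (\<lambda>n\<in>{..<18}. if n = 0 then fst p (oth i) / fst p i else if n = 1 then snd p (oth j) / snd p j
     else zc i j p ((n - 2) div 4) * zc i j p ((n - 2) mod 4))"

definition chart_dom :: "E_var \<Rightarrow> E_var \<Rightarrow> ((E_var \<Rightarrow> complex) \<times> (E_var \<Rightarrow> complex)) set" where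
  "chart_dom i j = {p \<in> EE. fst p i * snd p j \<noteq> 0}"

lemma chart_simps:
  "chart i j p 0 = fst p (oth i) / fst p i" "chart i j p 1 = snd p (oth j) / snd p j"
  "k < 4 \<Longrightarrow> l < 4 \<Longrightarrow> chart i j p (2 + 4 * k + l) = zc i j p k * zc i j p l"
  by (simp_all add: chart_def)

lemma chart_ext: "chart i j p \<in> {..<18} \<rightarrow>\<^sub>E UNIV"
  by (simp add: chart_def)

context subfield
begin

abbreviation "P18 \<equiv> polys K {..<18::nat}"

lemma P18_diff: "f \<in> P18 \<Longrightarrow> g \<in> P18 \<Longrightarrow> (\<lambda>e. f e - g e) \<in> P18"
  using polys.add[OF _ polys.mult[OF polys.const[of "-1" K]], of f "{..<18}" g] K_uminus[OF K_one] by simp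

lemma P18_sum: "(\<And>k. k \<in> I \<Longrightarrow> f k \<in> P18) \<Longrightarrow> (\<lambda>e. \<Sum>k\<in>I. f k e) \<in> P18"
proof (induction I rule: infinite_finite_induct)
  case (insert k I)
  then have "(\<lambda>e. f k e + (\<Sum>k\<in>I. f k e)) \<in> P18" by (intro polys.add) auto
  then show ?case using insert.hyps by simp
qed (simp_all add: polys.const)

lemma P18_M: "k < 4 \<Longrightarrow> l < 4 \<Longrightarrow> (\<lambda>e. e (2 + 4 * k + l)) \<in> P18"
  by (rule polys.var) simp

lemma P18_pow2: "f \<in> P18 \<Longrightarrow> (\<lambda>e. (f e)\<^sup>2) \<in> P18"
  using polys.mult[of f K "{..<18}" f] by (simp add: power2_eq_square)

text \<open>All polynomials over \<open>K\<close> vanishing on the image are taken, so no generators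
  of an ideal have to be found; what must be shown is that the image fills their common
  zeros.\<close>

definition chart_rels :: "E_var \<Rightarrow> E_var \<Rightarrow> ((nat \<Rightarrow> complex) \<Rightarrow> complex) set" where
  "chart_rels i j = {r \<in> P18. \<forall>p\<in>chart_dom i j. r (chart i j p) = 0}"

text \<open>Among the relations are these: the sixteen products form a symmetric matrix with
  vanishing 2 x 2 minors, and its diagonal consists of the values of a^2 and b^2 prescribed by E.
  The vector \<open>z\<close> whose products are the entries therefore supplies the coordinates a
  and b of a point on each factor.\<close>

lemma chart_surj:
  assumes i: "i \<in> {Ec, Ed}" and j: "j \<in> {Ec, Ed}" and e: "e \<in> affine_pts 18 (chart_rels i j)"
  shows "\<exists>p\<in>chart_dom i j. chart i j p = e"
proof -
  have rel: "r e = 0" if "r \<in> P18" "\<And>p. p \<in> chart_dom i j \<Longrightarrow> r (chart i j p) = 0" for r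
    using e that unfolding chart_rels_def by blast
  define M where "M = (\<lambda>k l. e (2 + 4 * k + l))"
  \<comment> \<open>The equation for b reads b^2 = 1 - x^2 where c is normalised to 1, and b^2 = x^2
    - 1 where d is.\<close>
  define \<sigma> :: "E_var \<Rightarrow> complex" where "\<sigma> = (\<lambda>i. if i = Ec then 1 else -1)"
  have \<sigma>K: "\<sigma> i \<in> K" for i by (auto simp: \<sigma>_def)
  have minors: "M k l * M m n = M k n * M m l" if "k < 4" "l < 4" "m < 4" "n < 4" for k l m n
  proof -
    have "(\<lambda>e. e (2 + 4 * k + l) * e (2 + 4 * m + n) - e (2 + 4 * k + n) * e (2 + 4 * m + l)) \<in> P18"
      by (intro P18_diff polys.mult P18_M that)
    moreover have "chart i j p (2 + 4 * k + l) * chart i j p (2 + 4 * m + n)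
        - chart i j p (2 + 4 * k + n) * chart i j p (2 + 4 * m + l) = 0" for p
      unfolding chart_simps(3)[OF that(1,2)] chart_simps(3)[OF that(3,4)] chart_simps(3)[OF that(1,4)]
        chart_simps(3)[OF that(3,2)] by (simp add: ac_simps)
    ultimately have "e (2 + 4 * k + l) * e (2 + 4 * m + n) - e (2 + 4 * k + n) * e (2 + 4 * m + l) = 0"
      by (rule rel)
    then show ?thesis unfolding M_def by simp
  qed
  have sym: "M k l = M l k" if "k < 4" "l < 4" for k l
  proof -
    have "(\<lambda>e. e (2 + 4 * k + l) - e (2 + 4 * l + k)) \<in> P18" by (intro P18_diff P18_M that)
    moreover have "chart i j p (2 + 4 * k + l) - chart i j p (2 + 4 * l + k) = 0" for p
      unfolding chart_simps(3)[OF that] chart_simps(3)[OF that(2,1)] by (simp add: ac_simps)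
    ultimately have "e (2 + 4 * k + l) - e (2 + 4 * l + k) = 0" by (rule rel)
    then show ?thesis unfolding M_def by simp
  qed
  have "\<exists>z. \<forall>k<4. \<forall>l<4. M k l = z k * z l"
    by (rule rank_one_symmetric) (rule minors sym; assumption)+
  then obtain z where z: "\<forall>k<4. \<forall>l<4. M k l = z k * z l" by (elim exE) (rule that)
  have x0: "(\<lambda>e. e (0::nat)) \<in> P18" "(\<lambda>e. e (1::nat)) \<in> P18" by (auto intro: polys.var)
  have nz: "fst p i \<noteq> 0" "snd p j \<noteq> 0" "fst p \<in> CE" "snd p \<in> CE" if "p \<in> chart_dom i j" for p
    using that by (auto simp: chart_dom_def)
  have sq: "v Ea / v i * (v Ea / v i) = 1 + (v (oth i) / v i)\<^sup>2 \<and> v Eb / v i * (v Eb / v i) = \<sigma> i * (1 - (v (oth i) / v i)\<^sup>2)"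
    if "v \<in> CE" "v i \<noteq> 0" "i \<in> {Ec, Ed}" for v i
    using CE_rel[OF that(1)] that(2,3)
    by (auto simp: oth_def \<sigma>_def power_divide field_simps power2_eq_square)
  have "z 0 * z 0 = 1 + (e 0)\<^sup>2"
  proof -
    have "(\<lambda>e. e (2 + 4 * 0 + 0) - (1 + (e 0)\<^sup>2)) \<in> P18"
      by (intro P18_diff P18_M polys.add polys.const P18_pow2 x0 K_one) simp_all
    from rel[OF this] have "M 0 0 - (1 + (e 0)\<^sup>2) = 0" unfolding M_def
      using sq[OF nz(3) nz(1) i] chart_simps(3)[of 0 0 i j] by (simp add: chart_simps(1) zc_def)
    then show ?thesis using z by simp
  qed
  moreover have "z 1 * z 1 = \<sigma> i * (1 - (e 0)\<^sup>2)"
  proof -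
    have "(\<lambda>e. e (2 + 4 * 1 + 1) - \<sigma> i * (1 - (e 0)\<^sup>2)) \<in> P18"
      by (intro P18_diff P18_M polys.mult polys.const P18_pow2 x0 K_one \<sigma>K) simp_all
    from rel[OF this] have "M 1 1 - \<sigma> i * (1 - (e 0)\<^sup>2) = 0" unfolding M_def
      using sq[OF nz(3) nz(1) i] chart_simps(3)[of 1 1 i j] by (simp add: chart_simps(1) zc_def)
    then show ?thesis using z by simp
  qed
  moreover have "z 2 * z 2 = 1 + (e 1)\<^sup>2"
  proof -
    have "(\<lambda>e. e (2 + 4 * 2 + 2) - (1 + (e 1)\<^sup>2)) \<in> P18"
      by (intro P18_diff P18_M polys.add polys.const P18_pow2 x0 K_one) simp_all
    from rel[OF this] have "M 2 2 - (1 + (e 1)\<^sup>2) = 0" unfolding M_def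
      using sq[OF nz(4) nz(2) j] chart_simps(3)[of 2 2 i j] chart_simps(2)[of i j] by (simp add: zc_def)
    then show ?thesis using z by simp
  qed
  moreover have "z 3 * z 3 = \<sigma> j * (1 - (e 1)\<^sup>2)"
  proof -
    have "(\<lambda>e. e (2 + 4 * 3 + 3) - \<sigma> j * (1 - (e 1)\<^sup>2)) \<in> P18"
      by (intro P18_diff P18_M polys.mult polys.const P18_pow2 x0 K_one \<sigma>K) simp_all
    from rel[OF this] have "M 3 3 - \<sigma> j * (1 - (e 1)\<^sup>2) = 0" unfolding M_def
      using sq[OF nz(4) nz(2) j] chart_simps(3)[of 3 3 i j] chart_simps(2)[of i j] by (simp add: zc_def)
    then show ?thesis using z by simp
  qed
  moreover define u where "u = (\<lambda>i x a b. if i = Ec then evec a b 1 x else evec a b x 1)"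
  have uC: "u i x a b \<in> CE \<and> u i x a b i = 1 \<and> u i x a b (oth i) = x \<and> u i x a b Ea = a \<and> u i x a b Eb = b"
    if "a * a = 1 + x\<^sup>2" "b * b = \<sigma> i * (1 - x\<^sup>2)" "i \<in> {Ec, Ed}" for a b x i
    using that by (auto simp: u_def oth_def \<sigma>_def CE_iff power2_eq_square)
  ultimately have
    U: "u i (e 0) (z 0) (z 1) \<in> CE \<and> u i (e 0) (z 0) (z 1) i = 1 \<and> u i (e 0) (z 0) (z 1) (oth i) = e 0 \<and>
        u i (e 0) (z 0) (z 1) Ea = z 0 \<and> u i (e 0) (z 0) (z 1) Eb = z 1" and
    V: "u j (e 1) (z 2) (z 3) \<in> CE \<and> u j (e 1) (z 2) (z 3) j = 1 \<and> u j (e 1) (z 2) (z 3) (oth j) = e 1 \<and>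
        u j (e 1) (z 2) (z 3) Ea = z 2 \<and> u j (e 1) (z 2) (z 3) Eb = z 3"
    using i j by blast+
  define p where "p = (u i (e 0) (z 0) (z 1), u j (e 1) (z 2) (z 3))"
  have p: "p \<in> chart_dom i j" using U V by (simp add: p_def chart_dom_def)
  have zp: "zc i j p k = z k" if "k < 4" for k
  proof -
    have "k = 0 \<or> k = 1 \<or> k = 2 \<or> k = 3" using that by auto
    then show ?thesis using U V by (auto simp: zc_def p_def)
  qed
  have "chart i j p n = e n" for n
  proof (cases "n < 18")
    case True
    show ?thesis
    proof (cases "n < 2")
      case True
      then have "n = 0 \<or> n = 1" by auto
      then show ?thesis using chart_simps(1,2)[of i j p] U V by (auto simp: p_def)
    next
      case False
      define k l where "k = (n - 2) div 4" and "l = (n - 2) mod 4"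
      have kl: "k < 4" "l < 4" "n = 2 + 4 * k + l" using False True by (auto simp: k_def l_def)
      have "chart i j p n = z k * z l" unfolding kl(3) using chart_simps(3)[OF kl(1,2)] zp kl by simp
      also have "\<dots> = M k l" using z kl by simp
      finally show ?thesis by (simp add: M_def kl(3))
    qed
  next
    case False
    then show ?thesis using e by (auto simp: chart_def PiE_def extensional_def)
  qed
  then show ?thesis using p by (intro bexI[OF _ p] ext)
qed

text \<open>Clearing denominators by a power of the invariant function that defines the
  chart.\<close>

lemma chart_pull:
  assumes i: "i \<in> {Ec, Ed}" and j: "j \<in> {Ec, Ed}" and r: "r \<in> P18"
  shows "\<exists>m. \<exists>f\<in>XA K m. \<forall>p\<in>chart_dom i j. f p = (fst p i * snd p j) ^ m * r (chart i j p)"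
  using r
proof induction
  case (const c)
  interpret X: graded K EE Xq "XA K" by (rule graded_X)
  show ?case by (rule exI[of _ 0], rule bexI[OF _ X.A_const[OF const]]) simp
next
  case (add f g)
  interpret X: graded K EE Xq "XA K" by (rule graded_X)
  obtain m F where F: "F \<in> XA K m" "\<forall>p\<in>chart_dom i j. F p = (fst p i * snd p j) ^ m * f (chart i j p)"
    using add(3) by (elim exE bexE) (rule that)
  obtain n G where G: "G \<in> XA K n" "\<forall>p\<in>chart_dom i j. G p = (fst p i * snd p j) ^ n * g (chart i j p)"
    using add(4) by (elim exE bexE) (rule that)
  have b: "(\<lambda>p. fst p i * snd p j) \<in> XA K 1" by (rule bilinear_cd[OF i j])
  have "(\<lambda>p. (fst p i * snd p j) ^ n * F p) \<in> XA K (m + n)"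
    using X.A_mult[OF X.A_power[OF b, of n] F(1)] by (simp add: add.commute)
  moreover have "(\<lambda>p. (fst p i * snd p j) ^ m * G p) \<in> XA K (m + n)"
    using X.A_mult[OF X.A_power[OF b, of m] G(1)] by simp
  ultimately have "(\<lambda>p. (fst p i * snd p j) ^ n * F p + (fst p i * snd p j) ^ m * G p) \<in> XA K (m + n)"
    by (rule X.A_add)
  moreover have "\<forall>p\<in>chart_dom i j. (fst p i * snd p j) ^ n * F p + (fst p i * snd p j) ^ m * G p =
      (fst p i * snd p j) ^ (m + n) * (f (chart i j p) + g (chart i j p))"
    using F(2) G(2) by (simp add: power_add algebra_simps)
  ultimately show ?case
    by (rule_tac exI[of _ "m + n"], rule_tac bexI[of _ "\<lambda>p. (fst p i * snd p j) ^ n * F p + (fst p i * snd p j) ^ m * G p"])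
next
  case (mult f g)
  interpret X: graded K EE Xq "XA K" by (rule graded_X)
  obtain m F where F: "F \<in> XA K m" "\<forall>p\<in>chart_dom i j. F p = (fst p i * snd p j) ^ m * f (chart i j p)"
    using mult(3) by (elim exE bexE) (rule that)
  obtain n G where G: "G \<in> XA K n" "\<forall>p\<in>chart_dom i j. G p = (fst p i * snd p j) ^ n * g (chart i j p)"
    using mult(4) by (elim exE bexE) (rule that)
  have "(\<lambda>p. F p * G p) \<in> XA K (m + n)" by (rule X.A_mult[OF F(1) G(1)])
  moreover have "\<forall>p\<in>chart_dom i j. F p * G p = (fst p i * snd p j) ^ (m + n) * (f (chart i j p) * g (chart i j p))"
    using F(2) G(2) by (simp add: power_add algebra_simps)
  ultimately show ?case by (rule_tac exI[of _ "m + n"], rule_tac bexI[of _ "\<lambda>p. F p * G p"])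
next
  case (var n)
  interpret X: graded K EE Xq "XA K" by (rule graded_X)
  interpret EE: graded K EE EEq "EEA K" by (rule graded_EE)
  have nz: "fst p i \<noteq> 0" "snd p j \<noteq> 0" if "p \<in> chart_dom i j" for p
    using that by (auto simp: chart_dom_def)
  have o: "oth i \<in> {Ec, Ed}" "oth j \<in> {Ec, Ed}" by (auto simp: oth_def)
  consider "n = 0" | "n = 1" | "n \<ge> 2" by linarith
  then show ?case
  proof cases
    case 1
    have "\<forall>p\<in>chart_dom i j. fst p (oth i) * snd p j = (fst p i * snd p j) ^ 1 * chart i j p n"
      using nz 1 by (simp add: chart_simps)
    then show ?thesis by (intro exI[of _ 1] bexI[OF _ bilinear_cd[OF o(1) j]])
  next
    case 2
    have "\<forall>p\<in>chart_dom i j. fst p i * snd p (oth j) = (fst p i * snd p j) ^ 1 * chart i j p n"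
      using nz 2 chart_simps(2) by simp
    then show ?thesis by (intro exI[of _ 1] bexI[OF _ bilinear_cd[OF i o(2)]])
  next
    case 3
    \<comment> \<open>\<open>Y\<close> k is the function \<open>zc\<close> k times the equation of
      the chart. Each is odd under rho, so only products of two of them are invariant, of degree
      two.\<close>
    define Y where "Y = (\<lambda>k (p :: (E_var \<Rightarrow> complex) \<times> (E_var \<Rightarrow> complex)). if k = 0 then fst p Ea * snd p j else if k = 1 then fst p Eb * snd p j
       else if k = (2::nat) then fst p i * snd p Ea else fst p i * snd p (Eb::E_var))"
    have b: "(\<lambda>p. fst p x * snd p y) \<in> EEA K 1" for x y :: E_var
      using tens.prod[of "\<lambda>v. v x" "forms K 1" "\<lambda>v. v y" "forms K 1"] form.var[of K x] form.var[of K y] by simp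
    have YA: "Y k \<in> EEA K 1" for k
    proof -
      consider "k = 0" | "k = 1" | "k = 2" | "k > 2" by linarith
      then show ?thesis
      proof cases
        case 1 show ?thesis unfolding Y_def 1 using b[of Ea j] by (simp only: if_True refl)
      next
        case 2 show ?thesis unfolding Y_def 2 using b[of Eb j] by simp
      next
        case 3 show ?thesis unfolding Y_def 3 using b[of i Ea] by simp
      next
        case 4 then show ?thesis unfolding Y_def using b[of i Eb] by simp
      qed
    qed
    have Yr: "Y k (rr p) = - Y k p" for k p using i j by (auto simp: Y_def)
    have Yz: "Y k p = (fst p i * snd p j) * zc i j p k" if "p \<in> chart_dom i j" for k p
      using nz[OF that] by (simp add: Y_def zc_def)
    define k l where "k = (n - 2) div 4" and "l = (n - 2) mod 4"
    have kl: "k < 4" "l < 4" "n = 2 + 4 * k + l" using 3 var by (auto simp: k_def l_def)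
    have "(\<lambda>p. Y k p * Y l p) \<in> EEA K (1 + 1)" by (intro EE.A_mult YA)
    moreover have "Y k (rr p) * Y l (rr p) = Y k p * Y l p" for p unfolding Yr by simp
    ultimately have "(\<lambda>p. Y k p * Y l p) \<in> XA K 2"
      unfolding inv_funs_def one_add_one by (intro CollectI conjI ballI) assumption+
    moreover have "\<forall>p\<in>chart_dom i j. Y k p * Y l p = (fst p i * snd p j) ^ 2 * chart i j p n"
      unfolding kl(3) using chart_simps(3)[OF kl(1,2)] Yz by (simp add: power2_eq_square)
    ultimately show ?thesis by (rule_tac exI[of _ 2], rule_tac bexI[of _ "\<lambda>p. Y k p * Y l p"])
  qed
qed

text \<open>Decomposition of the functions on the chart in E x E by their sign under rho: an even
  part and an odd part linear in the \<open>zc\<close>, with coefficients in the coordinates of the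
  chart. It is stable under products because a product of two \<open>zc\<close> is itself a
  coordinate.\<close>

definition even_odd :: "E_var \<Rightarrow> E_var \<Rightarrow> ((E_var \<Rightarrow> complex) \<times> (E_var \<Rightarrow> complex) \<Rightarrow> complex) \<Rightarrow> bool" where
  "even_odd i j F \<longleftrightarrow> (\<exists>E\<in>P18. \<exists>Od. (\<forall>k<4. Od k \<in> P18) \<and>
     (\<forall>p\<in>chart_dom i j. F p = E (chart i j p) + (\<Sum>k<4. zc i j p k * Od k (chart i j p))))"

lemma even_oddE:
  assumes "even_odd i j F"
  obtains E Od where "E \<in> P18" "\<forall>k<4. Od k \<in> P18"
     "\<forall>p\<in>chart_dom i j. F p = E (chart i j p) + (\<Sum>k<4. zc i j p k * Od k (chart i j p))"
  using assms unfolding even_odd_def by (elim bexE exE conjE) (rule that)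

lemma even_oddI:
  assumes "E \<in> P18" "\<And>k. k < 4 \<Longrightarrow> Od k \<in> P18"
     "\<And>p. p \<in> chart_dom i j \<Longrightarrow> F p = E (chart i j p) + (\<Sum>k<4. zc i j p k * Od k (chart i j p))"
  shows "even_odd i j F"
  unfolding even_odd_def using assms by (intro bexI[of _ E] exI[of _ Od]) auto

lemma P18_zero: "(\<lambda>_. 0) \<in> P18" by (rule polys.const) simp

lemma even_odd_even: "E \<in> P18 \<Longrightarrow> (\<And>p. p \<in> chart_dom i j \<Longrightarrow> F p = E (chart i j p)) \<Longrightarrow> even_odd i j F"
  by (rule even_oddI[of E "\<lambda>_ _. 0"]) (auto intro: P18_zero)

lemma even_odd_zc:
  assumes "k < 4" "\<And>p. p \<in> chart_dom i j \<Longrightarrow> F p = zc i j p k"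
  shows "even_odd i j F"
proof (rule even_oddI[of "\<lambda>_. 0" "\<lambda>l _. if l = k then 1 else 0"])
  fix p assume "p \<in> chart_dom i j"
  have "(\<Sum>l<4. zc i j p l * (if l = k then 1 else 0)) = (\<Sum>l<4. if l = k then zc i j p l else 0)"
    by (rule sum.cong) auto
  then show "F p = 0 + (\<Sum>l<4. zc i j p l * (if l = k then 1 else 0))"
    using assms \<open>p \<in> chart_dom i j\<close> by simp
qed (auto intro: polys.const)

lemma even_odd_add:
  assumes "even_odd i j F" "even_odd i j G"
  shows "even_odd i j (\<lambda>p. F p + G p)"
proof -
  obtain E Od where F: "E \<in> P18" "\<forall>k<4. Od k \<in> P18"
     "\<forall>p\<in>chart_dom i j. F p = E (chart i j p) + (\<Sum>k<4. zc i j p k * Od k (chart i j p))"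
    using assms(1) by (rule even_oddE)
  obtain E' Od' where G: "E' \<in> P18" "\<forall>k<4. Od' k \<in> P18"
     "\<forall>p\<in>chart_dom i j. G p = E' (chart i j p) + (\<Sum>k<4. zc i j p k * Od' k (chart i j p))"
    using assms(2) by (rule even_oddE)
  show ?thesis
    by (rule even_oddI[of "\<lambda>e. E e + E' e" "\<lambda>k e. Od k e + Od' k e"])
       (use F G in \<open>auto intro: polys.add simp: distrib_left sum.distrib\<close>)
qed

lemma even_odd_mult:
  assumes "even_odd i j F" "even_odd i j G"
  shows "even_odd i j (\<lambda>p. F p * G p)"
proof -
  obtain E Od where F: "E \<in> P18" "\<forall>k<4. Od k \<in> P18"
     "\<forall>p\<in>chart_dom i j. F p = E (chart i j p) + (\<Sum>k<4. zc i j p k * Od k (chart i j p))"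
    using assms(1) by (rule even_oddE)
  obtain E' Od' where G: "E' \<in> P18" "\<forall>k<4. Od' k \<in> P18"
     "\<forall>p\<in>chart_dom i j. G p = E' (chart i j p) + (\<Sum>k<4. zc i j p k * Od' k (chart i j p))"
    using assms(2) by (rule even_oddE)
  show ?thesis
  proof (rule even_oddI[of "\<lambda>e. E e * E' e + (\<Sum>k<4. \<Sum>l<4. e (2 + 4 * k + l) * (Od k e * Od' l e))"
        "\<lambda>k e. Od k e * E' e + E e * Od' k e"])
    show "(\<lambda>e. E e * E' e + (\<Sum>k<4. \<Sum>l<4. e (2 + 4 * k + l) * (Od k e * Od' l e))) \<in> P18"
      by (intro polys.add polys.mult P18_sum P18_M) (use F G in auto)
    show "(\<lambda>e. Od k e * E' e + E e * Od' k e) \<in> P18" if "k < 4" for k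
      by (intro polys.add polys.mult) (use F G that in auto)
    fix p assume p: "p \<in> chart_dom i j"
    let ?e = "chart i j p" and ?z = "zc i j p"
    have "(\<Sum>k<4. ?z k * Od k ?e) * (\<Sum>l<4. ?z l * Od' l ?e) = (\<Sum>k<4. \<Sum>l<4. ?e (2 + 4 * k + l) * (Od k ?e * Od' l ?e))"
      unfolding sum_product
    proof (intro sum.cong refl)
      fix k l :: nat assume "k \<in> {..<4}" "l \<in> {..<4}"
      then have "?e (2 + 4 * k + l) = ?z k * ?z l" by (intro chart_simps) auto
      then show "?z k * Od k ?e * (?z l * Od' l ?e) = ?e (2 + 4 * k + l) * (Od k ?e * Od' l ?e)" by (simp only: ac_simps)
    qed
    moreover have "(\<Sum>k<4. ?z k * (Od k ?e * E' ?e + E ?e * Od' k ?e)) = (\<Sum>k<4. ?z k * Od k ?e) * E' ?e + E ?e * (\<Sum>k<4. ?z k * Od' k ?e)"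
      by (simp add: sum_distrib_left sum_distrib_right distrib_left sum.distrib ac_simps)
    ultimately show "F p * G p = E ?e * E' ?e + (\<Sum>k<4. \<Sum>l<4. ?e (2 + 4 * k + l) * (Od k ?e * Od' l ?e)) +
        (\<Sum>k<4. ?z k * (Od k ?e * E' ?e + E ?e * Od' k ?e))"
      using F(3) G(3) p by (simp only: distrib_left distrib_right) (simp add: algebra_simps)
  qed
qed

lemma even_odd_form_fst:
  assumes i: "i \<in> {Ec, Ed}" and "form K d f"
  shows "even_odd i j (\<lambda>p. f (fst p) / fst p i ^ d)"
  using assms(2)
proof (induction rule: form.induct)
  case (const c)
  show ?case by (rule even_odd_even[of "\<lambda>_. c"]) (auto intro: polys.const const)
next
  case (var x)
  have nz: "fst p i \<noteq> 0" if "p \<in> chart_dom i j" for p using that by (auto simp: chart_dom_def)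
  consider "x = Ea" | "x = Eb" | "x = i" | "x = oth i" using i by (cases x) (auto simp: oth_def)
  then show ?case
  proof cases
    case 1 then show ?thesis by (intro even_odd_zc[of 0]) (simp_all add: zc_def)
  next
    case 2 then show ?thesis by (intro even_odd_zc[of 1]) (simp_all add: zc_def)
  next
    case 3 then show ?thesis by (intro even_odd_even[of "\<lambda>_. 1"]) (auto intro: polys.const simp: nz)
  next
    case 4 then show ?thesis by (intro even_odd_even[of "\<lambda>e. e 0"]) (auto intro: polys.var simp: chart_simps)
  qed
next
  case (add d f g)
  show ?case using even_odd_add[OF add(3,4)] by (simp add: add_divide_distrib)
next
  case (mult d f e g)
  show ?case using even_odd_mult[OF mult(3,4)] by (simp add: power_add)
qed

lemma even_odd_form_snd:
  assumes j: "j \<in> {Ec, Ed}" and "form K d f"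
  shows "even_odd i j (\<lambda>p. f (snd p) / snd p j ^ d)"
  using assms(2)
proof (induction rule: form.induct)
  case (const c)
  show ?case by (rule even_odd_even[of "\<lambda>_. c"]) (auto intro: polys.const const)
next
  case (var x)
  have nz: "snd p j \<noteq> 0" if "p \<in> chart_dom i j" for p using that by (auto simp: chart_dom_def)
  consider "x = Ea" | "x = Eb" | "x = j" | "x = oth j" using j by (cases x) (auto simp: oth_def)
  then show ?case
  proof cases
    case 1 then show ?thesis by (intro even_odd_zc[of 2]) (simp_all add: zc_def)
  next
    case 2 then show ?thesis by (intro even_odd_zc[of 3]) (simp_all add: zc_def)
  next
    case 3 then show ?thesis by (intro even_odd_even[of "\<lambda>_. 1"]) (auto intro: polys.const simp: nz)
  next
    case 4 then show ?thesis using chart_simps(2)[of i j] by (intro even_odd_even[of "\<lambda>e. e 1"]) (auto intro: polys.var)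
  qed
next
  case (add d f g)
  show ?case using even_odd_add[OF add(3,4)] by (simp add: add_divide_distrib)
next
  case (mult d f e g)
  show ?case using even_odd_mult[OF mult(3,4)] by (simp add: power_add)
qed

text \<open>Comparing the values at a point and at its image under rho, which have the same chart
  coordinates and opposite \<open>zc\<close>, shows that the odd part of an invariant function
  vanishes.\<close>

lemma chart_push:
  assumes i: "i \<in> {Ec, Ed}" and j: "j \<in> {Ec, Ed}" and f: "f \<in> XA K d"
  shows "\<exists>r\<in>P18. \<forall>p\<in>chart_dom i j. r (chart i j p) = f p / (fst p i * snd p j) ^ d"
proof -
  have "f \<in> EEA K d" and inv: "\<forall>c\<in>EE. f (rr c) = f c" using f by (auto simp: inv_funs_def)
  from this(1) have "even_odd i j (\<lambda>p. f p / (fst p i * snd p j) ^ d)"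
  proof induction
    case (prod f g)
    then show ?case using even_odd_mult[OF even_odd_form_fst[OF i] even_odd_form_snd[OF j], of d f d g]
      by (simp add: power_mult_distrib)
  next
    case (add f g)
    show ?case using even_odd_add[OF add(3,4)] by (simp add: add_divide_distrib)
  qed
  then obtain E Od where E: "E \<in> P18" "\<forall>p\<in>chart_dom i j. f p / (fst p i * snd p j) ^ d = E (chart i j p) + (\<Sum>k<4. zc i j p k * Od k (chart i j p))"
    by (rule even_oddE)
  have "E (chart i j p) = f p / (fst p i * snd p j) ^ d" if p: "p \<in> chart_dom i j" for p
  proof -
    have ij: "rho_vec v i = - v i" "rho_vec v j = - v j" "rho_vec v (oth i) = - v (oth i)" "rho_vec v (oth j) = - v (oth j)" for v
      using i j by (auto simp: oth_def)
    have pE: "p \<in> EE" using p by (simp add: chart_dom_def)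
    have rp: "rr p \<in> chart_dom i j" using p rho_vec_CE by (auto simp: chart_dom_def ij)
    have z: "zc i j (rr p) k = - zc i j p k" for k by (simp add: zc_def ij)
    have c: "chart i j (rr p) = chart i j p" unfolding chart_def z by (auto simp: ij fun_eq_iff)
    have "f (rr p) / (fst (rr p) i * snd (rr p) j) ^ d = f p / (fst p i * snd p j) ^ d"
      using bspec[OF inv pE] by (simp add: ij)
    then have "E (chart i j p) + (\<Sum>k<4. zc i j p k * Od k (chart i j p)) = E (chart i j p) - (\<Sum>k<4. zc i j p k * Od k (chart i j p))"
      using bspec[OF E(2) p] bspec[OF E(2) rp] unfolding z c by (simp add: sum_negf)
    then have "(\<Sum>k<4. zc i j p k * Od k (chart i j p)) = 0" by simp
    then show ?thesis using bspec[OF E(2) p] by simp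
  qed
  then show ?thesis by (intro bexI[OF _ E(1)] ballI)
qed

lemma chart_isomorphic:
  assumes i: "i \<in> {Ec, Ed}" and j: "j \<in> {Ec, Ed}"
  shows "gopen EE Xq (XA K) (Xq ` chart_dom i j)"
    "isomorphic (open_subspace (X_surface K) (Xq ` chart_dom i j)) (affine_var K 18 (chart_rels i j))"
proof -
  interpret X: graded K EE Xq "XA K" by (rule graded_X)
  let ?g = "\<lambda>p :: (E_var \<Rightarrow> complex) \<times> (E_var \<Rightarrow> complex). fst p i * snd p j"
  have g: "?g \<in> XA K 1" by (rule bilinear_cd[OF i j])
  have dom: "{p \<in> EE. ?g p \<noteq> 0} = chart_dom i j" by (simp add: chart_dom_def)
  note sub = X.open_subspace_gspace[OF g, unfolded dom]
  show "gopen EE Xq (XA K) (Xq ` chart_dom i j)" using X.gopen_D[OF g] unfolding dom .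
  let ?P = "affine_pts 18 (chart_rels i j)"
  interpret D: graded K "chart_dom i j" Xq "XA K" by (rule sub(1))
  interpret P: graded K ?P "\<lambda>x. x" "\<lambda>_. P18" by (rule graded_affine)
  interpret DP: graded_pair K "chart_dom i j" Xq "XA K" ?P "\<lambda>x. x" "\<lambda>_. P18" by unfold_locales
  have nz: "?g p \<noteq> 0" if "p \<in> chart_dom i j" for p using that by (simp add: chart_dom_def)
  have "isomorphic DP.GX DP.GY"
  proof (rule DP.isomorphic_gspace(1)[where \<Phi> = "chart i j"])
    show "chart i j c \<in> ?P" if "c \<in> chart_dom i j" for c
      using that chart_ext[of i j c] by (simp add: chart_rels_def)
    show "\<exists>c\<in>chart_dom i j. chart i j c = e" if "e \<in> ?P" for e by (rule chart_surj[OF i j that])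
    show "gseparating (chart_dom i j) Xq (XA K)"
      unfolding gseparating_def
    proof (intro ballI impI)
      fix c x assume "c \<in> chart_dom i j" "x \<in> chart_dom i j" "\<forall>d. \<forall>f\<in>XA K d. \<forall>g\<in>XA K d. f c * g x = f x * g c"
      then show "Xq c = Xq x" by (intro gseparatingD[OF gseparating_X]) (auto simp: chart_dom_def)
    qed
    show "gseparating ?P (\<lambda>x. x) (\<lambda>_. P18)"
      unfolding gseparating_def
    proof (intro ballI impI)
      fix c x assume c: "c \<in> ?P" "x \<in> ?P" and eq: "\<forall>d::nat. \<forall>f\<in>P18. \<forall>g\<in>P18. f c * g x = f x * g c"
      have "c n = x n" for n
      proof (cases "n < 18")
        case True
        then have m: "(\<lambda>e. e n) \<in> P18" "(\<lambda>_. 1) \<in> P18" by (auto intro: polys.var polys.const)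
        have "c n * 1 = x n * 1" using bspec[OF bspec[OF spec[OF eq] m(1)] m(2)] by simp
        then show ?thesis by simp
      next
        case False
        then show ?thesis using c by (auto simp: PiE_def extensional_def)
      qed
      then show "c = x" by (intro ext)
    qed
    show "pulls_back (chart_dom i j) (XA K) (chart i j) (\<lambda>_. P18)"
      unfolding pulls_back_def
    proof (intro allI ballI)
      fix f' g' assume fg: "f' \<in> P18" "g' \<in> P18"
      obtain m f where f: "f \<in> XA K m" "\<forall>p\<in>chart_dom i j. f p = ?g p ^ m * f' (chart i j p)"
        using chart_pull[OF i j fg(1)] by (elim exE bexE) (rule that)
      obtain n h where h: "h \<in> XA K n" "\<forall>p\<in>chart_dom i j. h p = ?g p ^ n * g' (chart i j p)"
        using chart_pull[OF i j fg(2)] by (elim exE bexE) (rule that)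
      have 1: "(\<lambda>p. ?g p ^ n * f p) \<in> XA K (m + n)" "(\<lambda>p. ?g p ^ m * h p) \<in> XA K (m + n)"
        using X.A_mult[OF X.A_power[OF g, of n] f(1)] X.A_mult[OF X.A_power[OF g, of m] h(1)] by (simp_all add: add.commute)
      have "\<forall>c\<in>chart_dom i j. ?g c ^ (m + n) \<noteq> 0 \<and> ?g c ^ n * f c = ?g c ^ (m + n) * f' (chart i j c) \<and>
          ?g c ^ m * h c = ?g c ^ (m + n) * g' (chart i j c)"
        using f(2) h(2) nz by (simp add: power_add)
      then show "\<exists>m f g l. f \<in> XA K m \<and> g \<in> XA K m \<and>
          (\<forall>c\<in>chart_dom i j. l c \<noteq> 0 \<and> f c = l c * f' (chart i j c) \<and> g c = l c * g' (chart i j c))"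
        by (rule_tac exI[of _ "m + n"], rule_tac exI[of _ "\<lambda>p. ?g p ^ n * f p"], rule_tac exI[of _ "\<lambda>p. ?g p ^ m * h p"],
            rule_tac exI[of _ "\<lambda>p. ?g p ^ (m + n)"]) (intro conjI 1)
    qed
    show "\<exists>(m::nat) f' g' l. f' \<in> P18 \<and> g' \<in> P18 \<and> (\<forall>c\<in>chart_dom i j. l c \<noteq> 0 \<and> f' (chart i j c) = l c * f c \<and> g' (chart i j c) = l c * h c)"
      if fh: "f \<in> XA K d" "h \<in> XA K d" for d f h
    proof -
      obtain r where r: "r \<in> P18" "\<forall>p\<in>chart_dom i j. r (chart i j p) = f p / ?g p ^ d" using chart_push[OF i j fh(1)] by (elim bexE) (rule that)
      obtain s where s: "s \<in> P18" "\<forall>p\<in>chart_dom i j. s (chart i j p) = h p / ?g p ^ d" using chart_push[OF i j fh(2)] by (elim bexE) (rule that)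
      have "\<forall>c\<in>chart_dom i j. 1 / ?g c ^ d \<noteq> 0 \<and> r (chart i j c) = 1 / ?g c ^ d * f c \<and> s (chart i j c) = 1 / ?g c ^ d * h c"
        using r(2) s(2) nz by simp
      then show ?thesis using r(1) s(1)
        by (rule_tac exI[of _ "0::nat"], rule_tac exI[of _ r], rule_tac exI[of _ s], rule_tac exI[of _ "\<lambda>c. 1 / ?g c ^ d"]) (intro conjI)
    qed
  qed
  then show "isomorphic (open_subspace (X_surface K) (Xq ` chart_dom i j)) (affine_var K 18 (chart_rels i j))"
    unfolding X_surface_gspace affine_var_gspace sub(2) .
qed

lemma variety_X: "variety K (X_surface K)"
  unfolding variety_def
proof (intro conjI)
  interpret X: graded K EE Xq "XA K" by (rule graded_X)
  show "function_space (X_surface K)" unfolding X_surface_gspace by (rule X.function_space_gspace)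
  show "closedin (fs_top (product (X_surface K) (X_surface K))) {(x, x) |x. x \<in> points (X_surface K)}"
    unfolding X_surface_gspace by (rule X.closedin_diagonal[OF gseparating_X])
  let ?U = "(\<lambda>(i, j). Xq ` chart_dom i j) ` ({Ec, Ed} \<times> {Ec, Ed})"
  have "\<Union> ?U = points (X_surface K)"
    unfolding points_X
  proof (intro equalityI subsetI)
    fix x assume "x \<in> Xq ` EE"
    then obtain p where p: "p \<in> EE" "x = Xq p" by blast
    have C: "fst p \<in> CE" "snd p \<in> CE" using p by auto
    obtain i where i: "i \<in> {Ec, Ed}" "fst p i \<noteq> 0" using C(1) unfolding CE_iff by blast
    obtain j where j: "j \<in> {Ec, Ed}" "snd p j \<noteq> 0" using C(2) unfolding CE_iff by blast
    have "p \<in> chart_dom i j" using p i j by (simp add: chart_dom_def)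
    then have "x \<in> Xq ` chart_dom i j" unfolding p(2) by (rule imageI)
    then show "x \<in> \<Union> ?U" using i(1) j(1) by (intro UnionI[of "Xq ` chart_dom i j"] image_eqI[of _ _ "(i, j)"]) auto
  next
    fix x assume "x \<in> \<Union> ?U"
    then show "x \<in> Xq ` EE" by (auto simp: chart_dom_def)
  qed
  moreover have "openin (fs_top (X_surface K)) U \<and> (\<exists>n R. R \<subseteq> polys K {..<n} \<and> isomorphic (open_subspace (X_surface K) U) (affine_var K n R))"
    if U: "U \<in> ?U" for U
  proof -
    obtain i j where ij: "U = Xq ` chart_dom i j" "i \<in> {Ec, Ed}" "j \<in> {Ec, Ed}" using U by auto
    have "openin (fs_top (X_surface K)) U" unfolding ij(1) X_surface_gspace X.openin_gspace by (rule chart_isomorphic(1)[OF ij(2,3)])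
    moreover have "chart_rels i j \<subseteq> P18" by (auto simp: chart_rels_def)
    ultimately show ?thesis using chart_isomorphic(2)[OF ij(2,3)] unfolding ij(1) by blast
  qed
  ultimately show "\<exists>\<U>. finite \<U> \<and> \<Union> \<U> = points (X_surface K) \<and> (\<forall>U\<in>\<U>. openin (fs_top (X_surface K)) U \<and>
           (\<exists>n R. R \<subseteq> polys K {..<n} \<and> isomorphic (open_subspace (X_surface K) U) (affine_var K n R)))"
    by (intro exI[of _ ?U] conjI ballI) auto
qed

end

subsection \<open>The group law\<close>

lemma EP_rho: "p \<in> EP \<Longrightarrow> E_rho p \<in> EP"
  by (auto simp: E_rho_proj intro: rho_vec_CE)

lemma E_rho_rho: "p \<in> EP \<Longrightarrow> E_rho (E_rho p) = p"
  by (auto simp: E_rho_proj)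

lemma E_add_rho:
  assumes "p \<in> EP" "r \<in> EP"
  shows "E_add (E_rho p) r = E_rho (E_add p r)" "E_add p (E_rho r) = E_rho (E_add p r)"
proof -
  have *: "E_add (E_rho p) r = E_rho (E_add p r)" if pr: "p \<in> EP" "r \<in> EP" for p r
  proof -
    obtain u where u: "p = proj_pt u" "u \<in> CE" using pr(1) by (rule imageE)
    obtain v where v: "r = proj_pt v" "v \<in> CE" using pr(2) by (rule imageE)
    obtain F where F: "F \<in> add_laws" "F u v \<in> CE" using add_vec_law[OF u(2) v(2)] by (elim bexE) (rule that)
    have F': "F (rho_vec u) v \<in> CE"
      unfolding add_law_rho[OF F(1)] by (rule CE_scale[OF rho_vec_CE[OF F(2)]]) simp
    have "E_add (proj_pt (rho_vec u)) (proj_pt v) = proj_pt (F (rho_vec u) v)"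
      by (rule E_add_law[OF F(1) rho_vec_CE[OF u(2)] v(2) F'])
    also have "\<dots> = proj_pt (rho_vec (F u v))" unfolding add_law_rho[OF F(1)] by (rule proj_pt_scale) simp
    finally show ?thesis unfolding u(1) v(1) E_rho_proj E_add_law[OF F(1) u(2) v(2) F(2)] .
  qed
  show "E_add (E_rho p) r = E_rho (E_add p r)" by (rule *[OF assms])
  show "E_add p (E_rho r) = E_rho (E_add p r)"
    using *[OF assms(2,1)] E_add_comm[OF assms(1) EP_rho[OF assms(2)]] E_add_comm[OF assms] by simp
qed

abbreviation "OX \<equiv> orbit_map (map_prod E_rho E_rho)"

lemma (in subfield) add_law_compose:
  assumes "form K d f" "\<And>i. (\<lambda>p. F (fst p) (snd p) i) \<in> tens (forms K 2) (forms K 2)"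
  shows "(\<lambda>p. f (F (fst p) (snd p))) \<in> tens (forms K (2 * d)) (forms K (2 * d))"
  using assms(1)
proof induction
  case (const c)
  from tens.prod[of "\<lambda>_. c" "forms K 0" "\<lambda>_. 1" "forms K 0"] form.const[OF const] form.const[OF K_one]
  show ?case by simp
next
  case (var i)
  show ?case using assms(2) by simp
next
  case (add d f g)
  show ?case by (rule tens.add[OF add(3,4)])
next
  case (mult d f e g)
  show ?case by (rule tens_mult[OF mult(3,4)]) (auto simp: distrib_left intro: form.mult)
qed

text \<open>Interchange of the two middle factors: the group law pairs corresponding components of
  two points of E x E, while functions on X x X are grouped by the points.\<close>

lemma tens_rearrange:
  assumes "a \<in> tens A B" "b \<in> tens A' B'"
  shows "(\<lambda>x. a (fst (fst x), fst (snd x)) * b (snd (fst x), snd (snd x))) \<in> tens (tens A A') (tens B B')"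
  using assms(1)
proof induction
  case (prod f g)
  note fg = prod
  from assms(2) show ?case
  proof induction
    case (prod f' g')
    have "(\<lambda>x. (f (fst (fst x)) * f' (snd (fst x))) * (g (fst (snd x)) * g' (snd (snd x)))) \<in> tens (tens A A') (tens B B')"
      by (rule tens.prod[OF tens.prod[OF fg(1) prod(1)] tens.prod[OF fg(2) prod(2)]])
    then show ?case by (simp add: ac_simps)
  next
    case (add b b')
    from tens.add[OF add(3,4)] show ?case by (simp add: distrib_left)
  qed
next
  case (add a a')
  from tens.add[OF add(3,4)] show ?case by (simp add: distrib_right)
qed

lemma tens_form_scale:
  assumes "f \<in> tens (forms K d) (forms K d)"
  shows "f (\<lambda>i. c * u i, \<lambda>i. c * v i) = c ^ (2 * d) * f (u, v)"
proof -
  have "c ^ (2 * d) = c ^ d * c ^ d" by (simp add: mult_2 power_add)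
  moreover from assms have "f (\<lambda>i. c * u i, \<lambda>i. c * v i) = c ^ d * c ^ d * f (u, v)"
    by induction (auto simp: form_scale distrib_left)
  ultimately show ?thesis by simp
qed

context subfield
begin

lemma average_XA:
  assumes "f \<in> EEA K d"
  shows "(\<lambda>p. (f p + f (rr p)) / 2) \<in> XA K d"
proof -
  interpret EE: graded K EE EEq "EEA K" by (rule graded_EE)
  have "(\<lambda>p. f (rr p)) \<in> EEA K d" using assms by (rule tens_map) (simp_all add: form_rho)
  from EE.A_smult[OF K_inverse[OF K_numeral[of "num.Bit0 num.One"]] EE.A_add[OF assms this]]
  show ?thesis by (auto simp: inv_funs_def field_simps)
qed

lemma XA_compose:
  assumes "f \<in> XA K d" "\<And>d f. form K d f \<Longrightarrow> form K d (\<lambda>v. f (\<iota> v))"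
    and "\<And>v. v \<in> CE \<Longrightarrow> \<iota> v \<in> CE" "\<And>v. \<iota> (rho_vec v) = rho_vec (\<iota> v)"
  shows "(\<lambda>p. f (map_prod \<iota> \<iota> p)) \<in> XA K d"
proof -
  have f: "f \<in> EEA K d" "\<forall>c\<in>EE. f (rr c) = f c" using assms(1) by (auto simp: inv_funs_def)
  have "(\<lambda>p. f (map_prod \<iota> \<iota> p)) \<in> EEA K d" by (rule tens_map[OF f(1)]) (simp_all add: assms(2))
  moreover have "f (map_prod \<iota> \<iota> (rr c)) = f (map_prod \<iota> \<iota> c)" if "c \<in> EE" for c
  proof -
    have "map_prod \<iota> \<iota> c \<in> EE" using that assms(3) by auto
    from bspec[OF f(2) this] show ?thesis by (simp add: map_prod_def case_prod_beta assms(4))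
  qed
  ultimately show ?thesis unfolding inv_funs_def by (intro CollectI conjI ballI)
qed

text \<open>Average over rho acting separately on the two points of E x E. It takes place factor by
  factor in each product, so the result is a sum of products of invariants.\<close>

lemma average_tens:
  assumes "h \<in> tens (EEA K d) (EEA K d)"
  shows "\<exists>h'\<in>tens (XA K d) (XA K d). \<forall>x. h' x =
    (h x + h (rr (fst x), snd x) + (h (fst x, rr (snd x)) + h (rr (fst x), rr (snd x)))) / 4"
  using assms
proof induction
  case (prod f g)
  show ?case
    by (rule bexI[OF _ tens.prod[OF average_XA[OF prod(1)] average_XA[OF prod(2)]]]) (simp add: field_simps)
next
  case (add f g)
  obtain f' where f': "f' \<in> tens (XA K d) (XA K d)" "\<forall>x. f' x =
    (f x + f (rr (fst x), snd x) + (f (fst x, rr (snd x)) + f (rr (fst x), rr (snd x)))) / 4"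
    using add(3) by (elim bexE) (rule that)
  obtain g' where g': "g' \<in> tens (XA K d) (XA K d)" "\<forall>x. g' x =
    (g x + g (rr (fst x), snd x) + (g (fst x, rr (snd x)) + g (rr (fst x), rr (snd x)))) / 4"
    using add(4) by (elim bexE) (rule that)
  show ?case
    by (rule bexI[OF _ tens.add[OF f'(1) g'(1)]])
       (simp only: f'(2)[rule_format] g'(2)[rule_format] add_divide_distrib[symmetric] ac_simps simp_thms all_simps)
qed

lemma law_compose:
  assumes "f \<in> EEA K d" and F: "F \<in> add_laws" "F' \<in> add_laws"
  shows "(\<lambda>x. f (F (fst (fst x)) (fst (snd x)), F' (snd (fst x)) (snd (snd x)))) \<in> tens (EEA K (2 * d)) (EEA K (2 * d))"
  using assms(1)
proof induction
  case (prod f g)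
  have "(\<lambda>p. f (F (fst p) (snd p))) \<in> tens (forms K (2 * d)) (forms K (2 * d))"
    "(\<lambda>p. g (F' (fst p) (snd p))) \<in> tens (forms K (2 * d)) (forms K (2 * d))"
    using prod add_law_compose add_law_tens F by blast+
  from tens_rearrange[OF this] show ?case by simp
next
  case (add f g)
  show ?case using tens.add[OF add(3,4)] by simp
qed

end

text \<open>
  The group law of E with origin o' is (u, v) \<open>\<mapsto>\<close> u + v + n, where + has the origin [1,1,1,0] and
  translation by n is the linear map Th.
\<close>

locale E_group = subfield K for K +
  fixes Th \<iota> :: "(E_var \<Rightarrow> complex) \<Rightarrow> E_var \<Rightarrow> complex" and o' :: "E_var \<Rightarrow> complex"
  assumes Th_CE: "v \<in> CE \<Longrightarrow> Th v \<in> CE"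
    and Th_form: "form K d f \<Longrightarrow> form K d (\<lambda>v. f (Th v))"
    and Th_scale: "Th (\<lambda>i. c * v i) = (\<lambda>i. c * Th v i)"
    and Th_rho: "\<exists>e. e\<^sup>2 = 1 \<and> (\<forall>v. Th (rho_vec v) = (\<lambda>i. e * rho_vec (Th v) i))"
    and Th_trans: "v \<in> CE \<Longrightarrow> E_add (proj_pt v) (proj_pt (Th vO)) = proj_pt (Th v)"
    and o_CE: "o' \<in> CE" and o_K: "o' i \<in> K"
    and Th_o: "proj_pt (Th o') = proj_pt vO"
    and i_CE: "v \<in> CE \<Longrightarrow> \<iota> v \<in> CE"
    and i_form: "form K d f \<Longrightarrow> form K d (\<lambda>v. f (\<iota> v))"
    and i_rho: "\<iota> (rho_vec v) = rho_vec (\<iota> v)"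
    and i_inv: "v \<in> CE \<Longrightarrow> E_add (E_add (proj_pt v) (proj_pt (\<iota> v))) (proj_pt (Th vO)) = proj_pt o'"
begin

abbreviation "n0 \<equiv> proj_pt (Th vO)"

lemma n0: "n0 \<in> EP" using Th_CE vO_CE by blast

definition E_op :: "(E_var \<Rightarrow> complex) set \<Rightarrow> (E_var \<Rightarrow> complex) set \<Rightarrow> (E_var \<Rightarrow> complex) set" where
  "E_op p r = E_add (E_add p r) n0"

lemma E_op_closed: "p \<in> EP \<Longrightarrow> r \<in> EP \<Longrightarrow> E_op p r \<in> EP"
  unfolding E_op_def by (intro E_add_closed n0)

lemma E_op_assoc:
  assumes "p \<in> EP" "q \<in> EP" "r \<in> EP"
  shows "E_op (E_op p q) r = E_op p (E_op q r)"
proof -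
  have c: "E_add p q \<in> EP" "E_add q r \<in> EP" using assms by (auto intro: E_add_closed)
  have "E_add (E_add (E_add p q) n0) r = E_add (E_add p q) (E_add n0 r)" by (rule E_add_assoc[OF c(1) n0 assms(3)])
  also have "\<dots> = E_add (E_add p q) (E_add r n0)" by (simp only: E_add_comm[OF n0 assms(3)])
  also have "\<dots> = E_add p (E_add q (E_add r n0))" by (rule E_add_assoc[OF assms(1,2) E_add_closed[OF assms(3) n0]])
  also have "\<dots> = E_add p (E_add (E_add q r) n0)" by (simp only: E_add_assoc[OF assms(2,3) n0])
  finally show ?thesis unfolding E_op_def by (rule arg_cong)
qed

lemma E_op_comm: "p \<in> EP \<Longrightarrow> r \<in> EP \<Longrightarrow> E_op p r = E_op r p"
  unfolding E_op_def by (simp only: E_add_comm)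

lemma E_op_one:
  assumes "v \<in> CE"
  shows "E_op (proj_pt v) (proj_pt o') = proj_pt v"
proof -
  have "E_add (E_add (proj_pt v) (proj_pt o')) n0 = E_add (proj_pt v) (E_add (proj_pt o') n0)"
    by (rule E_add_assoc) (use assms o_CE n0 in auto)
  also have "\<dots> = E_add (proj_pt v) (proj_pt vO)" by (simp only: Th_trans[OF o_CE] Th_o)
  also have "\<dots> = proj_pt v" by (rule E_add_zero[OF assms])
  finally show ?thesis unfolding E_op_def .
qed

lemma E_op_inv: "v \<in> CE \<Longrightarrow> E_op (proj_pt v) (proj_pt (\<iota> v)) = proj_pt o'"
  unfolding E_op_def by (rule i_inv)

lemma E_op_rho:
  assumes "p \<in> EP" "r \<in> EP"
  shows "E_op (E_rho p) r = E_rho (E_op p r)" "E_op p (E_rho r) = E_rho (E_op p r)"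
  unfolding E_op_def using E_add_rho[OF assms] E_add_rho[OF E_add_closed[OF assms] n0] by simp_all

lemma E_op_law:
  assumes "F \<in> add_laws" "u \<in> CE" "v \<in> CE" "F u v \<in> CE"
  shows "E_op (proj_pt u) (proj_pt v) = proj_pt (Th (F u v))"
  unfolding E_op_def E_add_law[OF assms] by (rule Th_trans[OF assms(4)])

text \<open>All four products of representatives are collected. They form a single orbit because
  \<open>E_op\<close> commutes with rho in each argument.\<close>

definition X_op :: "X_point \<Rightarrow> X_point \<Rightarrow> X_point" where
  "X_op x y = (\<lambda>((p, p'), (r, r')). (E_op p r, E_op p' r')) ` (x \<times> y)"

definition XG :: "X_point monoid" where
  "XG = \<lparr>carrier = points (X_surface K), mult = X_op, one = OX (proj_pt o', proj_pt o')\<rparr>"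

lemma X_op:
  assumes "p \<in> EP" "p' \<in> EP" "r \<in> EP" "r' \<in> EP"
  shows "X_op (OX (p, p')) (OX (r, r')) = OX (E_op p r, E_op p' r')"
  unfolding X_op_def orbit_map_def
  by (auto simp: E_op_rho E_rho_rho E_op_closed EP_rho assms)

lemma XG_carrier: "x \<in> carrier XG \<longleftrightarrow> (\<exists>p\<in>EP. \<exists>p'\<in>EP. x = OX (p, p'))"
proof -
  have "Xq ` EE = (\<lambda>(p, p'). OX (p, p')) ` (EP \<times> EP)"
    by (force simp: image_iff)
  then show ?thesis by (auto simp: XG_def points_X)
qed

lemma XG_carrierE:
  assumes "x \<in> carrier XG"
  obtains u v where "u \<in> CE" "v \<in> CE" "x = OX (proj_pt u, proj_pt v)"
  using assms unfolding XG_carrier by auto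

lemma group_XG: "group XG"
proof (rule groupI)
  show "\<one>\<^bsub>XG\<^esub> \<in> carrier XG" unfolding XG_carrier using o_CE by (auto simp: XG_def)
  fix x assume x: "x \<in> carrier XG"
  obtain u v where uv: "u \<in> CE" "v \<in> CE" "x = OX (proj_pt u, proj_pt v)" using x by (rule XG_carrierE)
  have uvP: "proj_pt u \<in> EP" "proj_pt v \<in> EP" "proj_pt o' \<in> EP" using uv o_CE by auto
  show "\<one>\<^bsub>XG\<^esub> \<otimes>\<^bsub>XG\<^esub> x = x"
    using uvP E_op_one[OF uv(1)] E_op_one[OF uv(2)] E_op_comm[OF uvP(1,3)] E_op_comm[OF uvP(2,3)]
    by (simp add: XG_def uv(3) X_op)
  have i: "proj_pt (\<iota> u) \<in> EP" "proj_pt (\<iota> v) \<in> EP" using uv i_CE by auto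
  have "OX (proj_pt (\<iota> u), proj_pt (\<iota> v)) \<otimes>\<^bsub>XG\<^esub> x = \<one>\<^bsub>XG\<^esub>"
    using i uvP E_op_inv[OF uv(1)] E_op_inv[OF uv(2)] E_op_comm[OF uvP(1) i(1)] E_op_comm[OF uvP(2) i(2)]
    by (simp add: XG_def uv(3) X_op)
  moreover have "OX (proj_pt (\<iota> u), proj_pt (\<iota> v)) \<in> carrier XG" unfolding XG_carrier using i by blast
  ultimately show "\<exists>y\<in>carrier XG. y \<otimes>\<^bsub>XG\<^esub> x = \<one>\<^bsub>XG\<^esub>" by (rule bexI)
  fix y assume "y \<in> carrier XG"
  then obtain p p' where p: "p \<in> EP" "p' \<in> EP" "y = OX (p, p')" unfolding XG_carrier by (elim bexE) (rule that)
  have "OX (E_op (proj_pt u) p, E_op (proj_pt v) p') \<in> carrier XG"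
    unfolding XG_carrier using E_op_closed[OF uvP(1) p(1)] E_op_closed[OF uvP(2) p(2)] by blast
  then show "x \<otimes>\<^bsub>XG\<^esub> y \<in> carrier XG"
    using X_op[OF uvP(1,2) p(1,2)] by (simp add: XG_def uv(3) p(3))
  fix z assume "z \<in> carrier XG"
  then obtain r r' where r: "r \<in> EP" "r' \<in> EP" "z = OX (r, r')" unfolding XG_carrier by (elim bexE) (rule that)
  show "x \<otimes>\<^bsub>XG\<^esub> y \<otimes>\<^bsub>XG\<^esub> z = x \<otimes>\<^bsub>XG\<^esub> (y \<otimes>\<^bsub>XG\<^esub> z)"
    using uvP(1,2) p(1,2) r(1,2) by (simp add: XG_def uv(3) p(3) r(3) X_op E_op_closed E_op_assoc)
qed

lemma XG_inv:
  assumes "u \<in> CE" "v \<in> CE"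
  shows "inv\<^bsub>XG\<^esub> (OX (proj_pt u, proj_pt v)) = OX (proj_pt (\<iota> u), proj_pt (\<iota> v))"
proof (rule group.inv_equality[OF group_XG])
  have c: "proj_pt u \<in> EP" "proj_pt v \<in> EP" "proj_pt (\<iota> u) \<in> EP" "proj_pt (\<iota> v) \<in> EP" using assms i_CE by auto
  show "OX (proj_pt (\<iota> u), proj_pt (\<iota> v)) \<otimes>\<^bsub>XG\<^esub> OX (proj_pt u, proj_pt v) = \<one>\<^bsub>XG\<^esub>"
    using c E_op_inv[OF assms(1)] E_op_inv[OF assms(2)] E_op_comm[OF c(1,3)] E_op_comm[OF c(2,4)]
    by (simp add: XG_def X_op)
  show "OX (proj_pt u, proj_pt v) \<in> carrier XG" "OX (proj_pt (\<iota> u), proj_pt (\<iota> v)) \<in> carrier XG"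
    unfolding XG_carrier using c by blast+
qed

lemma morphism_inv: "morphism (X_surface K) (X_surface K) (\<lambda>x. inv\<^bsub>XG\<^esub> x)"
  unfolding X_surface_gspace
proof -
  interpret X: graded K EE Xq "XA K" by (rule graded_X)
  interpret XX: graded_pair K EE Xq "XA K" EE Xq "XA K" by unfold_locales
  show "morphism (gspace EE Xq (XA K)) (gspace EE Xq (XA K)) (\<lambda>x. inv\<^bsub>XG\<^esub> x)"
  proof (rule XX.morphism_gspace_global[where \<Phi> = "map_prod \<iota> \<iota>"])
    fix c assume c: "c \<in> EE"
    show "map_prod \<iota> \<iota> c \<in> EE" using c i_CE by auto
    show "Xq (map_prod \<iota> \<iota> c) = inv\<^bsub>XG\<^esub> (Xq c)" using c XG_inv by (cases c) simp
  next
    show "pulls_back EE (XA K) (map_prod \<iota> \<iota>) (XA K)"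
    proof (rule pulls_back_direct[where k = 1])
      fix d f' assume "f' \<in> XA K d"
      then have "(\<lambda>c. f' (map_prod \<iota> \<iota> c)) \<in> XA K d"
        by (rule XA_compose) (rule i_form i_CE i_rho; assumption?)+
      then show "\<exists>f\<in>XA K (1 * d). \<forall>c\<in>EE. f c = f' (map_prod \<iota> \<iota> c)"
        by (simp only: mult_1) (rule bexI, rule ballI, rule refl)
    qed
  qed
qed

lemma Th_fun:
  assumes "f \<in> EEA K d"
  shows "(\<lambda>p. f (map_prod Th Th p)) \<in> EEA K d"
  by (rule tens_map[OF assms]) (simp_all add: Th_form)

text \<open>The law contributes the sign -1 and the translation the sign e. On functions of bidegree
  (d, d) they act through the power 2d and disappear.\<close>

lemma Th_fun_inv:
  assumes "f \<in> XA K d" "(u, v) \<in> EE"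
  shows "f (Th (\<lambda>i. (-1) * rho_vec u i), Th (\<lambda>i. (-1) * rho_vec v i)) = f (Th u, Th v)"
proof -
  have f: "f \<in> EEA K d" "\<forall>c\<in>EE. f (rr c) = f c" using assms by (auto simp: inv_funs_def)
  obtain e where e: "e\<^sup>2 = 1" "\<forall>v. Th (rho_vec v) = (\<lambda>i. e * rho_vec (Th v) i)" using Th_rho by (elim exE conjE) (rule that)
  have T: "Th (\<lambda>i. (-1) * rho_vec v i) = (\<lambda>i. (-e) * rho_vec (Th v) i)" for v
    unfolding Th_scale using e(2) by simp
  have "(- e) ^ (2 * d) = 1" using e(1) by (simp add: power_mult)
  moreover have "f (rr (Th u, Th v)) = f (Th u, Th v)" using bspec[OF f(2), of "(Th u, Th v)"] assms(2) Th_CE by simp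
  ultimately show ?thesis unfolding T tens_form_scale[OF f(1)] by simp
qed

text \<open>The composite with the laws is invariant under rho in each argument only at pairs where
  the laws are defined, so it is replaced by its average. The average lies in the ring of the
  product and has the same values at those pairs.\<close>

lemma X_op_pull:
  assumes f: "f \<in> XA K d" and F: "F \<in> add_laws" "F' \<in> add_laws"
  shows "\<exists>h\<in>tens (XA K (2 * d)) (XA K (2 * d)). \<forall>u\<in>CE. \<forall>u'\<in>CE. \<forall>v\<in>CE. \<forall>v'\<in>CE. F u v \<in> CE \<longrightarrow> F' u' v' \<in> CE \<longrightarrow>
    h ((u, u'), (v, v')) = f (Th (F u v), Th (F' u' v'))"
proof -
  let ?h = "\<lambda>x. f (map_prod Th Th (F (fst (fst x)) (fst (snd x)), F' (snd (fst x)) (snd (snd x))))"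
  have "f \<in> EEA K d" using f by (simp add: inv_funs_def)
  then have "?h \<in> tens (EEA K (2 * d)) (EEA K (2 * d))" by (rule law_compose[OF Th_fun F])
  then obtain h where h: "h \<in> tens (XA K (2 * d)) (XA K (2 * d))" "\<forall>x. h x =
    (?h x + ?h (rr (fst x), snd x) + (?h (fst x, rr (snd x)) + ?h (rr (fst x), rr (snd x)))) / 4"
    by (drule_tac average_tens) (elim bexE, rule that)
  have "h ((u, u'), (v, v')) = f (Th (F u v), Th (F' u' v'))"
    if "F u v \<in> CE" "F' u' v' \<in> CE" for u u' v v'
  proof -
    have "(F u v, F' u' v') \<in> EE" using that by simp
    moreover have "(\<lambda>i. - rho_vec (\<lambda>i. - rho_vec w i) i) = w" for w by (simp add: evec_eq_iff)
    ultimately show ?thesis using Th_fun_inv[OF f]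
      h(2)[rule_format, of "((u, u'), (v, v'))"] by (simp add: add_law_rho[OF F(1)] add_law_rho[OF F(2)])
  qed
  then show ?thesis by (intro bexI[OF _ h(1)]) blast
qed

text \<open>Near a given pair of points an addition law is chosen for each of the two components of
  E x E independently. The function \<open>g\<close> marks the region where both chosen laws are
  defined.\<close>

lemma morphism_mult: "morphism (product (X_surface K) (X_surface K)) (X_surface K) (\<lambda>(x, y). x \<otimes>\<^bsub>XG\<^esub> y)"
proof -
  interpret X: graded K EE Xq "XA K" by (rule graded_X)
  interpret XX: graded_pair K EE Xq "XA K" EE Xq "XA K" by unfold_locales
  interpret XXX: graded_pair K "EE \<times> EE" "map_prod Xq Xq" "\<lambda>d. tens (XA K d) (XA K d)" EE Xq "XA K" by unfold_locales
  show ?thesis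
    unfolding X_surface_gspace XX.product_gspace
  proof (rule XXX.morphism_gspace)
    fix c assume "c \<in> EE \<times> EE"
    then obtain u u' v v' where c: "c = ((u, u'), (v, v'))" "u \<in> CE" "u' \<in> CE" "v \<in> CE" "v' \<in> CE" by blast
    obtain F where F: "F \<in> add_laws" "F u v \<in> CE" using add_vec_law[OF c(2,4)] by (elim bexE) (rule that)
    obtain F' where F': "F' \<in> add_laws" "F' u' v' \<in> CE" using add_vec_law[OF c(3,5)] by (elim bexE) (rule that)
    define \<Phi> where "\<Phi> = (\<lambda>x. (Th (F (fst (fst x)) (fst (snd x))), Th (F' (snd (fst x)) (snd (snd x)))))"
    \<comment> \<open>A coordinate fixed by rho is chosen, so that the two signs from
      \<open>add_law_rho\<close> cancel in the product \<open>?s\<close>.\<close>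
    obtain i where i: "i \<in> {Ea, Eb}" "F u v i \<noteq> 0" using CE_ab[OF F(2)] by blast
    obtain j where j: "j \<in> {Ea, Eb}" "F' u' v' j \<noteq> 0" using CE_ab[OF F'(2)] by blast
    let ?s = "\<lambda>x. F (fst (fst x)) (fst (snd x)) i * F' (snd (fst x)) (snd (snd x)) j"
    have "(\<lambda>p. fst p i * snd p j) \<in> EEA K 1" using bilinear_ab[OF i(1) j(1)] by (simp add: inv_funs_def)
    from law_compose[OF this F(1) F'(1)] have "?s \<in> tens (EEA K 2) (EEA K 2)" by simp
    then obtain g where g: "g \<in> tens (XA K 2) (XA K 2)" "\<forall>x. g x =
      (?s x + ?s (rr (fst x), snd x) + (?s (fst x, rr (snd x)) + ?s (rr (fst x), rr (snd x)))) / 4"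
      by (drule_tac average_tens) (elim bexE, rule that)
    have rho: "rho_vec w i = w i" "rho_vec w j = w j" for w using i(1) j(1) by auto
    \<comment> \<open>All four terms of the average coincide, so nonvanishing of \<open>g\<close> is
      nonvanishing of a coordinate of both sums.\<close>
    have gs: "g x = ?s x" for x
      using spec[OF g(2), of x] by (simp add: add_law_rho[OF F(1)] add_law_rho[OF F'(1)] rho)
    have gCE: "F x y \<in> CE \<and> F' x' y' \<in> CE" if "x \<in> CE" "x' \<in> CE" "y \<in> CE" "y' \<in> CE" "g ((x, x'), (y, y')) \<noteq> 0" for x x' y y'
      using that(5) add_law_zero[OF F(1) that(1,3), of i] add_law_zero[OF F'(1) that(2,4), of j] by (auto simp: gs)
    have "\<Phi> x \<in> EE \<and> Xq (\<Phi> x) = (\<lambda>(x, y). x \<otimes>\<^bsub>XG\<^esub> y) (map_prod Xq Xq x)" if x: "x \<in> EE \<times> EE" "g x \<noteq> 0" for x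
    proof -
      obtain w w' z z' where w: "x = ((w, w'), (z, z'))" "w \<in> CE" "w' \<in> CE" "z \<in> CE" "z' \<in> CE" using x(1) by blast
      have FC: "F w z \<in> CE" "F' w' z' \<in> CE" using gCE[OF w(2-5)] x(2) w(1) by auto
      have P: "proj_pt w \<in> EP" "proj_pt w' \<in> EP" "proj_pt z \<in> EP" "proj_pt z' \<in> EP" using w by auto
      have "OX (proj_pt w, proj_pt w') \<otimes>\<^bsub>XG\<^esub> OX (proj_pt z, proj_pt z') = OX (proj_pt (Th (F w z)), proj_pt (Th (F' w' z')))"
        using X_op[OF P] unfolding E_op_law[OF F(1) w(2,4) FC(1)] E_op_law[OF F'(1) w(3,5) FC(2)] by (simp add: XG_def)
      then show ?thesis using FC Th_CE by (simp add: \<Phi>_def w(1))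
    qed
    moreover have "pulls_back {x \<in> EE \<times> EE. g x \<noteq> 0} (\<lambda>d. tens (XA K d) (XA K d)) \<Phi> (XA K)"
    proof (rule pulls_back_direct[where k = 2])
      fix d f' assume "f' \<in> XA K d"
      from X_op_pull[OF this F(1) F'(1)] obtain h where h: "h \<in> tens (XA K (2 * d)) (XA K (2 * d))"
        "\<forall>u\<in>CE. \<forall>u'\<in>CE. \<forall>v\<in>CE. \<forall>v'\<in>CE. F u v \<in> CE \<longrightarrow> F' u' v' \<in> CE \<longrightarrow>
            h ((u, u'), (v, v')) = f' (Th (F u v), Th (F' u' v'))" by (elim bexE) (rule that)
      have "h x = f' (\<Phi> x)" if x: "x \<in> {x \<in> EE \<times> EE. g x \<noteq> 0}" for x
      proof -
        obtain w w' z z' where w: "x = ((w, w'), (z, z'))" "w \<in> CE" "w' \<in> CE" "z \<in> CE" "z' \<in> CE" using x by blast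
        have FC: "F w z \<in> CE" "F' w' z' \<in> CE" using gCE[OF w(2-5)] x w(1) by auto
        show ?thesis
          using h(2)[rule_format, OF w(2,3,4,5) FC] by (simp add: \<Phi>_def w(1))
      qed
      then show "\<exists>f\<in>tens (XA K (2 * d)) (XA K (2 * d)). \<forall>c\<in>{x \<in> EE \<times> EE. g x \<noteq> 0}. f c = f' (\<Phi> c)"
        by (intro bexI[OF _ h(1)] ballI)
    qed
    moreover have "g c \<noteq> 0" using i(2) j(2) by (simp add: gs c(1))
    ultimately show "\<exists>e g0 \<Phi>. g0 \<in> tens (XA K e) (XA K e) \<and> g0 c \<noteq> 0 \<and>
        (\<forall>x\<in>EE \<times> EE. g0 x \<noteq> 0 \<longrightarrow> \<Phi> x \<in> EE \<and> Xq (\<Phi> x) = (\<lambda>(x, y). x \<otimes>\<^bsub>XG\<^esub> y) (map_prod Xq Xq x)) \<and>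
        pulls_back {x \<in> EE \<times> EE. g0 x \<noteq> 0} (\<lambda>d. tens (XA K d) (XA K d)) \<Phi> (XA K)"
      using g(1)
      by (rule_tac exI[of _ 2], rule_tac exI[of _ g], rule_tac exI[of _ \<Phi>]) (intro conjI ballI impI; simp)
  qed
qed

lemma abelian_surface_XG: "abelian_surface K (X_surface K) XG"
  unfolding abelian_surface_def abelian_variety_def
proof (intro conjI)
  show "rational_pt K (X_surface K) \<one>\<^bsub>XG\<^esub>"
  proof -
    have "f (o', o') \<in> K" if "f \<in> XA K d" for d f
    proof (rule EEA_K_value)
      show "f \<in> EEA K d" using that by (simp add: inv_funs_def)
    qed (rule o_K)+
    then have "rational_pt K (gspace EE Xq (XA K)) (Xq (o', o'))"
      by (intro graded.rational_pt_gspace[OF graded_X]) (simp add: o_CE)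
    then show ?thesis by (simp add: X_surface_gspace XG_def)
  qed
  show "carrier XG = points (X_surface K)" by (simp add: XG_def)
qed (rule variety_X irreducible_X complete_X group_XG morphism_mult morphism_inv has_dimension_X)+

end

subsection \<open>The two origins\<close>

lemma subfield_Rats: "subfield \<rat>"
  by unfold_locales (auto simp: complex_subfield_def)

lemma subfield_Q_zeta8: "subfield Q_zeta8"
proof
  have "complex_subfield (\<Inter>\<F>)" if "\<forall>L\<in>\<F>. complex_subfield L" for \<F>
    using that unfolding complex_subfield_def by blast
  then show "complex_subfield Q_zeta8"
    unfolding Q_zeta8_def by (rule hull_in)
qed

lemma sqrt2_Q_zeta8: "complex_of_real (sqrt 2) \<in> Q_zeta8"
  unfolding Q_zeta8_def by (rule hull_inc) simp

text \<open>With [1, 1, 1, 0] as origin the translation is the identity, and the laws, the inverse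
  and the origin are all rational.\<close>

lemma E_group_Rats: "E_group \<rat> (\<lambda>v. v) neg_vec vO"
proof -
  interpret subfield \<rat> by (rule subfield_Rats)
  show ?thesis
  proof unfold_locales
    fix v assume v: "v \<in> CE"
    show "E_add (proj_pt v) (proj_pt vO) = proj_pt v" by (rule E_add_zero[OF v])
    show "E_add (E_add (proj_pt v) (proj_pt (neg_vec v))) (proj_pt vO) = proj_pt vO"
      unfolding E_add_neg[OF v] by (rule E_add_zero[OF vO_CE])
  next
    show "\<exists>e::complex. e\<^sup>2 = 1 \<and> (\<forall>v. rho_vec v = (\<lambda>i. e * rho_vec v i))" by (rule exI[of _ 1]) simp
    show "vO i \<in> \<rat>" for i by (rule evec_K) auto
  qed (auto simp: vO_CE neg_vec_CE form_neg rho_tau_commute)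
qed

text \<open>By \<open>E_add_tau\<close> the sum of v and tau v is [1, -1, 1, 0], and
  \<open>theta\<close> sends this to the stated origin; hence tau is the inverse for the shifted
  law.\<close>

lemma E_group_Q_zeta8: "E_group Q_zeta8 theta tau_vec vo"
proof -
  interpret subfield Q_zeta8 by (rule subfield_Q_zeta8)
  show ?thesis
  proof unfold_locales
    fix v assume v: "v \<in> CE"
    show "E_add (proj_pt v) (proj_pt (theta vO)) = proj_pt (theta v)" by (rule E_add_theta[OF v])
    have e: "evec 1 (-1) 1 0 \<in> CE" by (simp add: CE_iff)
    show "E_add (E_add (proj_pt v) (proj_pt (tau_vec v))) (proj_pt (theta vO)) = proj_pt vo"
      unfolding E_add_tau[OF v] E_add_theta[OF e] theta_tau by (rule refl)
  next
    show "\<exists>e. e\<^sup>2 = 1 \<and> (\<forall>v. theta (rho_vec v) = (\<lambda>i. e * rho_vec (theta v) i))"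
      \<comment> \<open>The sign is -1 because \<open>theta\<close> interchanges the pair (a, b),
        fixed by rho, with the pair (c, d), negated by rho.\<close>
      by (rule exI[of _ "-1"]) (simp add: evec_eq_iff)
    show "vo i \<in> Q_zeta8" for i by (rule evec_K) (auto simp: sqrt2_Q_zeta8)
    fix d and f :: "(E_var \<Rightarrow> complex) \<Rightarrow> complex" assume f: "form Q_zeta8 d f"
    have "form Q_zeta8 1 (\<lambda>v. theta v i)" for i
    proof -
      have c: "form Q_zeta8 1 (\<lambda>v. k * v x)" if "k \<in> Q_zeta8" for k and x :: E_var
        using form.mult[OF form.const[OF that] form.var[of Q_zeta8 x]] by simp
      show ?thesis
        using c[OF sqrt2_Q_zeta8] c[OF K_one, of Ea] c[OF K_uminus[OF K_one], of Eb] by (cases i) simp_all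
    qed
    from form_compose[OF f this] show "form Q_zeta8 d (\<lambda>v. f (theta v))" by simp
  next
    show "proj_pt (theta vo) = proj_pt vO" by (rule theta_vo)
    show "theta (\<lambda>i. c * v i) = (\<lambda>i. c * theta v i)" for c v by (simp add: evec_eq_iff)
  qed (auto simp: vo_CE theta_CE tau_vec_CE form_tau rho_tau_commute)
qed

lemma X_tau_OX: "X_tau (OX (proj_pt u, proj_pt v)) = OX (proj_pt (tau_vec u), proj_pt (tau_vec v))"
  by (simp add: X_tau_def orbit_map_def E_tau_proj E_rho_proj rho_tau_commute)

section \<open>The box variety\<close>

abbreviation "box_rels \<equiv> {\<lambda>v. (v W1)\<^sup>2 + (v W2)\<^sup>2 - (v Z3)\<^sup>2,
  \<lambda>v. (v W1)\<^sup>2 + (v W3)\<^sup>2 - (v Z2)\<^sup>2,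
  \<lambda>v. (v W2)\<^sup>2 + (v W3)\<^sup>2 - (v Z1)\<^sup>2,
  \<lambda>v. (v W1)\<^sup>2 + (v W2)\<^sup>2 + (v W3)\<^sup>2 - (v Cc)\<^sup>2 :: complex}"

definition BC :: "(box_var \<Rightarrow> complex) set" where "BC = proj_cone box_rels"

lemma all_box_var: "(\<forall>i. P i) \<longleftrightarrow> P Z1 \<and> P Z2 \<and> P Z3 \<and> P W1 \<and> P W2 \<and> P W3 \<and> P Cc"
  using box_var.induct[of P] by blast

text \<open>If Z1, Z2, W1 and W2 vanish, the relations force the other three coordinates to vanish.
  So there are coordinates fixed by sigma without a common zero.\<close>

lemma BC_iff: "v \<in> BC \<longleftrightarrow> (v Z1 \<noteq> 0 \<or> v Z2 \<noteq> 0 \<or> v W1 \<noteq> 0 \<or> v W2 \<noteq> 0) \<and>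
    (v W1)\<^sup>2 + (v W2)\<^sup>2 = (v Z3)\<^sup>2 \<and> (v W1)\<^sup>2 + (v W3)\<^sup>2 = (v Z2)\<^sup>2 \<and> (v W2)\<^sup>2 + (v W3)\<^sup>2 = (v Z1)\<^sup>2 \<and>
    (v W1)\<^sup>2 + (v W2)\<^sup>2 + (v W3)\<^sup>2 = (v Cc)\<^sup>2"
proof -
  have "(\<exists>i. v i \<noteq> 0) \<longleftrightarrow> \<not> (v Z1 = 0 \<and> v Z2 = 0 \<and> v Z3 = 0 \<and> v W1 = 0 \<and> v W2 = 0 \<and> v W3 = 0 \<and> v Cc = 0)"
    using all_box_var[of "\<lambda>i. v i = 0"] by blast
  then show ?thesis unfolding BC_def by auto
qed

definition box_neg :: "(box_var \<Rightarrow> complex) \<Rightarrow> box_var \<Rightarrow> complex" where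
  "box_neg v = v(Z3 := - v Z3)"

lemma box_neg_simps [simp]: "box_neg v Z3 = - v Z3" "i \<noteq> Z3 \<Longrightarrow> box_neg v i = v i" "box_neg (box_neg v) = v"
  by (simp_all add: box_neg_def)

lemma box_neg_BC: "box_neg v \<in> BC \<longleftrightarrow> v \<in> BC"
  unfolding BC_iff by (simp only: box_neg_simps box_var.distinct not_False_eq_True power2_minus)

lemma box_neg_diag: "box_neg v = (\<lambda>i. (if i = Z3 then - 1 else 1) * v i)"
  by (auto simp: box_neg_def)

lemma box_sigma_proj: "box_sigma (proj_pt v) = proj_pt (box_neg v)"
  unfolding box_sigma_def box_neg_def by (rule image_proj_pt) auto

abbreviation "tt \<equiv> map_prod tau_vec tau_vec"
abbreviation "KA K \<equiv> inv_funs EE tt (XA K)"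

text \<open>
  The square root is not a regular function, but its sign is invisible in the quotient by sigma.
\<close>

definition box_map :: "(E_var \<Rightarrow> complex) \<times> (E_var \<Rightarrow> complex) \<Rightarrow> box_var \<Rightarrow> complex" where
  "box_map p = (\<lambda>i. case i of
     Z1 \<Rightarrow> fst p Ec * snd p Ec + fst p Ed * snd p Ed | Z2 \<Rightarrow> fst p Ec * snd p Ec - fst p Ed * snd p Ed
   | W1 \<Rightarrow> fst p Ec * snd p Ed - fst p Ed * snd p Ec | W2 \<Rightarrow> fst p Ec * snd p Ed + fst p Ed * snd p Ec
   | W3 \<Rightarrow> fst p Eb * snd p Eb | Cc \<Rightarrow> fst p Ea * snd p Ea
   | Z3 \<Rightarrow> csqrt ((fst p Ec * snd p Ed - fst p Ed * snd p Ec)\<^sup>2 + (fst p Ec * snd p Ed + fst p Ed * snd p Ec)\<^sup>2))"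

lemma box_map_simps:
  "box_map p Z1 = fst p Ec * snd p Ec + fst p Ed * snd p Ed" "box_map p Z2 = fst p Ec * snd p Ec - fst p Ed * snd p Ed"
  "box_map p W1 = fst p Ec * snd p Ed - fst p Ed * snd p Ec" "box_map p W2 = fst p Ec * snd p Ed + fst p Ed * snd p Ec"
  "box_map p W3 = fst p Eb * snd p Eb" "box_map p Cc = fst p Ea * snd p Ea"
  "(box_map p Z3)\<^sup>2 = (box_map p W1)\<^sup>2 + (box_map p W2)\<^sup>2"
  by (simp_all add: box_map_def)

lemma box_map_BC:
  assumes "p \<in> EE"
  shows "box_map p \<in> BC"
proof -
  have p: "fst p \<in> CE" "snd p \<in> CE" using assms by auto
  note r = CE_rel[OF p(1)] CE_rel[OF p(2)]
  have sq: "(fst p Ea)\<^sup>2 = (fst p Ec)\<^sup>2 + (fst p Ed)\<^sup>2" "(fst p Eb)\<^sup>2 = (fst p Ec)\<^sup>2 - (fst p Ed)\<^sup>2"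
     "(snd p Ea)\<^sup>2 = (snd p Ec)\<^sup>2 + (snd p Ed)\<^sup>2" "(snd p Eb)\<^sup>2 = (snd p Ec)\<^sup>2 - (snd p Ed)\<^sup>2"
    and nz: "fst p Ec \<noteq> 0 \<or> fst p Ed \<noteq> 0" "snd p Ec \<noteq> 0 \<or> snd p Ed \<noteq> 0"
    using p by (simp_all add: CE_iff)
  have "fst p Ec * snd p Ec = 0 \<and> fst p Ed * snd p Ed = 0 \<and> fst p Ec * snd p Ed = 0 \<and> fst p Ed * snd p Ec = 0"
    if "box_map p Z1 = 0" "box_map p Z2 = 0" "box_map p W1 = 0" "box_map p W2 = 0"
    using that unfolding box_map_simps by auto
  then have 0: "box_map p Z1 \<noteq> 0 \<or> box_map p Z2 \<noteq> 0 \<or> box_map p W1 \<noteq> 0 \<or> box_map p W2 \<noteq> 0"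
    using nz by auto
  have 1: "(box_map p W1)\<^sup>2 + (box_map p W3)\<^sup>2 = (box_map p Z2)\<^sup>2"
    and 2: "(box_map p W2)\<^sup>2 + (box_map p W3)\<^sup>2 = (box_map p Z1)\<^sup>2"
    and 3: "(box_map p W1)\<^sup>2 + (box_map p W2)\<^sup>2 + (box_map p W3)\<^sup>2 = (box_map p Cc)\<^sup>2"
    unfolding box_map_simps power_mult_distrib sq by (simp_all add: power2_eq_square algebra_simps)
  show ?thesis unfolding BC_iff using 0 1 2 3 box_map_simps(7)[of p] by simp
qed

text \<open>One root is chosen freely and the other is forced by the product \<open>m\<close>, so
  even the sign of the product is as prescribed.\<close>

lemma sqrt_factors:
  fixes A A' m :: complex
  assumes "A * A' = m\<^sup>2"
  shows "\<exists>a a'. a\<^sup>2 = A \<and> a'\<^sup>2 = A' \<and> a * a' = m"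
proof (cases "A = 0")
  case True
  then show ?thesis using assms by (intro exI[of _ 0] exI[of _ "csqrt A'"]) simp
next
  case False
  then have "csqrt A \<noteq> 0" by simp
  moreover have "(m / csqrt A)\<^sup>2 = A'" using False assms by (simp add: power_divide flip: assms)
  ultimately show ?thesis by (intro exI[of _ "csqrt A"] exI[of _ "m / csqrt A"]) simp
qed

text \<open>A nonzero 2 x 2 matrix with zero determinant is the product of a nonzero column and a
  nonzero row.\<close>

lemma rank_one_factors:
  fixes p q r s :: complex
  assumes "p * s = q * r" "\<not> (p = 0 \<and> q = 0 \<and> r = 0 \<and> s = 0)"
  shows "\<exists>c d c' d'. c * c' = p \<and> c * d' = q \<and> d * c' = r \<and> d * d' = s \<and> (c \<noteq> 0 \<or> d \<noteq> 0) \<and> (c' \<noteq> 0 \<or> d' \<noteq> 0)"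
proof -
  consider "p \<noteq> 0" | "q \<noteq> 0" | "p = 0" "q = 0" by blast
  then show ?thesis
  proof cases
    case 1
    then show ?thesis using assms(1)
      by (intro exI[of _ 1] exI[of _ "r / p"] exI[of _ p] exI[of _ q]) (simp add: field_simps)
  next
    case 2
    then show ?thesis using assms(1)
      by (intro exI[of _ 1] exI[of _ "s / q"] exI[of _ p] exI[of _ q]) (simp add: field_simps)
  next
    case 3
    then show ?thesis using assms(2)
      by (intro exI[of _ 0] exI[of _ 1] exI[of _ r] exI[of _ s]) auto
  qed
qed

text \<open>The values of cc', cd', dc' and dd' are linear in Z1, Z2, W1, W2, and the relations make
  them a matrix of rank one. After splitting it, the remaining relations say that Cc and W3 are
  square roots of a^2 a'^2 and b^2 b'^2. Only the sign of Z3 is left open, which is the action of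
  sigma.\<close>

lemma box_map_surj:
  assumes e: "e \<in> BC"
  shows "\<exists>p\<in>EE. box_map p = e \<or> box_map p = box_neg e"
proof -
  have rel: "(e W1)\<^sup>2 + (e W2)\<^sup>2 = (e Z3)\<^sup>2" "(e W1)\<^sup>2 + (e W3)\<^sup>2 = (e Z2)\<^sup>2" "(e W2)\<^sup>2 + (e W3)\<^sup>2 = (e Z1)\<^sup>2"
    "(e W1)\<^sup>2 + (e W2)\<^sup>2 + (e W3)\<^sup>2 = (e Cc)\<^sup>2"
    and nz: "e Z1 \<noteq> 0 \<or> e Z2 \<noteq> 0 \<or> e W1 \<noteq> 0 \<or> e W2 \<noteq> 0"
    using iffD1[OF BC_iff e] by blast+
  \<comment> \<open>The intended values of cc', dd', cd' and dc', obtained by solving the formulas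
    for Z1, Z2, W1 and W2.\<close>
  define P S Q R where "P = (e Z1 + e Z2) / 2" and "S = (e Z1 - e Z2) / 2"
    and "Q = (e W1 + e W2) / 2" and "R = (e W2 - e W1) / 2"
  note defs = P_def S_def Q_def R_def
  have Z: "e Z1 = P + S" "e Z2 = P - S" "e W1 = Q - R" "e W2 = Q + R" by (simp_all add: defs field_simps)
  have "4 * (P * S) = (e Z1)\<^sup>2 - (e Z2)\<^sup>2" "4 * (Q * R) = (e W2)\<^sup>2 - (e W1)\<^sup>2"
    by (simp_all add: Z power2_eq_square algebra_simps)
  moreover have "(e Z1)\<^sup>2 - (e Z2)\<^sup>2 = (e W2)\<^sup>2 - (e W1)\<^sup>2" unfolding rel(2,3)[symmetric] by simp
  ultimately have "4 * (P * S) = 4 * (Q * R)" by (simp only:)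
  then have "P * S = Q * R" by simp
  moreover have "\<not> (P = 0 \<and> Q = 0 \<and> R = 0 \<and> S = 0)" using nz unfolding Z by auto
  ultimately have "\<exists>c d c' d'. c * c' = P \<and> c * d' = Q \<and> d * c' = R \<and> d * d' = S \<and>
      (c \<noteq> 0 \<or> d \<noteq> 0) \<and> (c' \<noteq> 0 \<or> d' \<noteq> 0)"
    by (rule rank_one_factors)
  then obtain c d c' d' where cd: "c * c' = P" "c * d' = Q" "d * c' = R" "d * d' = S"
    "c \<noteq> 0 \<or> d \<noteq> 0" "c' \<noteq> 0 \<or> d' \<noteq> 0" by (elim exE conjE) (rule that)
  have s: "P\<^sup>2 + S\<^sup>2 = ((e Z1)\<^sup>2 + (e Z2)\<^sup>2) / 2" "Q\<^sup>2 + R\<^sup>2 = ((e W1)\<^sup>2 + (e W2)\<^sup>2) / 2"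
    by (simp_all add: Z power2_eq_square field_simps)
  have "(c\<^sup>2 + d\<^sup>2) * (c'\<^sup>2 + d'\<^sup>2) = (P\<^sup>2 + S\<^sup>2) + (Q\<^sup>2 + R\<^sup>2)"
    unfolding cd(1-4)[symmetric] by (simp add: power2_eq_square algebra_simps)
  also have "\<dots> = (e Cc)\<^sup>2" unfolding s rel(4)[symmetric] rel(2,3)[symmetric] by (simp add: field_simps)
  finally have "\<exists>a a'. a\<^sup>2 = c\<^sup>2 + d\<^sup>2 \<and> a'\<^sup>2 = c'\<^sup>2 + d'\<^sup>2 \<and> a * a' = e Cc" by (rule sqrt_factors)
  then obtain a a' where a: "a\<^sup>2 = c\<^sup>2 + d\<^sup>2" "a'\<^sup>2 = c'\<^sup>2 + d'\<^sup>2" "a * a' = e Cc"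
    by (elim exE conjE) (rule that)
  have "(c\<^sup>2 - d\<^sup>2) * (c'\<^sup>2 - d'\<^sup>2) = (P\<^sup>2 + S\<^sup>2) - (Q\<^sup>2 + R\<^sup>2)"
    unfolding cd(1-4)[symmetric] by (simp add: power2_eq_square algebra_simps)
  also have "\<dots> = (e W3)\<^sup>2" unfolding s rel(2,3)[symmetric] by (simp add: field_simps)
  finally have "\<exists>b b'. b\<^sup>2 = c\<^sup>2 - d\<^sup>2 \<and> b'\<^sup>2 = c'\<^sup>2 - d'\<^sup>2 \<and> b * b' = e W3" by (rule sqrt_factors)
  then obtain b b' where b: "b\<^sup>2 = c\<^sup>2 - d\<^sup>2" "b'\<^sup>2 = c'\<^sup>2 - d'\<^sup>2" "b * b' = e W3"
    by (elim exE conjE) (rule that)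
  define p where "p = (evec a b c d, evec a' b' c' d')"
  have p: "p \<in> EE" using a(1,2) b(1,2) cd(5,6) by (simp add: p_def CE_iff)
  have m: "box_map p Z1 = e Z1" "box_map p Z2 = e Z2" "box_map p W1 = e W1" "box_map p W2 = e W2"
      "box_map p W3 = e W3" "box_map p Cc = e Cc"
    by (simp_all add: box_map_simps p_def cd(1-4) a(3) b(3) Z)
  have "(box_map p Z3)\<^sup>2 = (e Z3)\<^sup>2" using box_map_simps(7)[of p] rel(1) by (simp add: m)
  then have "box_map p Z3 = e Z3 \<or> box_map p Z3 = - e Z3" by (simp add: power2_eq_iff)
  then have "box_map p = e \<or> box_map p = box_neg e" unfolding fun_eq_iff all_box_var using m by auto
  then show ?thesis using p by (intro bexI)
qed

section \<open>Comparison of the two invariant rings\<close>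

context subfield
begin

lemma box_gspace: "box_variety K = gspace BC proj_pt (forms K)"
  unfolding box_variety_def BC_def by (rule proj_var_gspace)

lemma graded_BC: "graded K BC proj_pt (forms K)"
  unfolding BC_def by (rule graded_proj)

lemma gseparating_BC: "gseparating BC proj_pt (forms K)"
  unfolding gseparating_def
proof (intro ballI impI)
  fix u v assume uv: "u \<in> BC" "v \<in> BC" and eq: "\<forall>d. \<forall>f\<in>forms K d. \<forall>g\<in>forms K d. f u * g v = f v * g u"
  obtain i0 where "u i0 \<noteq> 0" using uv(1) unfolding BC_def by blast
  moreover obtain j0 where "v j0 \<noteq> 0" using uv(2) unfolding BC_def by blast
  ultimately show "proj_pt u = proj_pt v"
  proof (rule proj_pt_minors)
    fix i j :: box_var
    have "(\<lambda>v. v i) \<in> forms K 1" "(\<lambda>v. v j) \<in> forms K 1" using form.var[of K] by simp_all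
    from bspec[OF bspec[OF spec[OF eq, of 1] this(1)] this(2)]
    show "u i * v j = u j * v i" by (simp add: mult.commute)
  qed
qed

lemma box_invol: "graded_invol K BC proj_pt (forms K) box_neg box_sigma"
proof -
  interpret B: graded K BC proj_pt "forms K" by (rule graded_BC)
  show ?thesis
  proof unfold_locales
    fix c assume c: "c \<in> BC"
    show "box_neg c \<in> BC" using c by (simp only: box_neg_BC)
    show "proj_pt (box_neg c) = box_sigma (proj_pt c)" by (rule box_sigma_proj[symmetric])
    show "box_sigma (box_sigma (proj_pt c)) = proj_pt c" by (simp add: box_sigma_proj)
    obtain i where i: "c i \<noteq> 0" "i \<noteq> Z3" using c unfolding BC_iff by (metis box_var.distinct)
    then have "(\<lambda>v. v i) \<in> inv_funs BC box_neg (forms K) 1" using form.var[of K i] by (simp add: inv_funs_def)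
    then show "\<exists>g\<in>inv_funs BC box_neg (forms K) 1. g c \<noteq> 0" by (rule rev_bexI) (rule i(1))
  next
    fix f :: "(box_var \<Rightarrow> complex) \<Rightarrow> complex" and d
    assume "f \<in> forms K d"
    then show "(\<lambda>x. f (box_neg x)) \<in> forms K d"
      unfolding box_neg_diag by (auto intro!: form_diag K_uminus)
  next
    fix f :: "(box_var \<Rightarrow> complex) \<Rightarrow> complex" and c
    show "f (box_neg (box_neg c)) = f c" by simp
  qed
qed

lemma box_quotient_gspace:
  "quotient_by (box_variety K) box_sigma = gspace BC (\<lambda>c. orbit_map box_sigma (proj_pt c)) (inv_funs BC box_neg (forms K))"
  unfolding box_gspace by (rule graded_invol.quotient_gspace[OF box_invol])

text \<open>The involution on points is a parameter because the same lift \<open>tau_vec\<close> is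
  used both for \<open>X_tau\<close> and for the inverse map of a group on X.\<close>

lemma kummer_invol:
  assumes s: "\<And>u v. u \<in> CE \<Longrightarrow> v \<in> CE \<Longrightarrow> s (OX (proj_pt u, proj_pt v)) = OX (proj_pt (tau_vec u), proj_pt (tau_vec v))"
  shows "graded_invol K EE Xq (XA K) tt s"
proof -
  interpret X: graded K EE Xq "XA K" by (rule graded_X)
  show ?thesis
  proof unfold_locales
    fix c assume c: "c \<in> EE"
    then obtain u v where uv: "c = (u, v)" "u \<in> CE" "v \<in> CE" by (rule SigmaE)
    have t: "tau_vec u \<in> CE" "tau_vec v \<in> CE" using uv tau_vec_CE by auto
    show "tt c \<in> EE" using t by (simp add: uv(1))
    show "Xq (tt c) = s (Xq c)" using s[OF uv(2,3)] by (simp add: uv(1))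
    show "s (s (Xq c)) = Xq c" using s[OF uv(2,3)] s[OF t] by (simp add: uv(1))
    obtain i where i: "i \<in> {Ec, Ed}" "u i \<noteq> 0" using uv(2) unfolding CE_iff by blast
    obtain j where j: "j \<in> {Ec, Ed}" "v j \<noteq> 0" using uv(3) unfolding CE_iff by blast
    have "tau_vec w i = w i" "tau_vec w j = w j" for w using i(1) j(1) by auto
    then have "(\<lambda>p. fst p i * snd p j) \<in> KA K 1" using bilinear_cd[OF i(1) j(1)] by (simp add: inv_funs_def[of EE tt])
    then show "\<exists>g\<in>KA K 1. g c \<noteq> 0" by (rule rev_bexI) (simp add: uv(1) i(2) j(2))
  next
    fix f :: "(E_var \<Rightarrow> complex) \<times> (E_var \<Rightarrow> complex) \<Rightarrow> complex" and d
    assume "f \<in> XA K d"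
    then show "(\<lambda>x. f (tt x)) \<in> XA K d" by (rule XA_compose) (simp_all add: form_tau tau_vec_CE rho_tau_commute)
  next
    fix f :: "(E_var \<Rightarrow> complex) \<times> (E_var \<Rightarrow> complex) \<Rightarrow> complex" and c
    show "f (tt (tt c)) = f c" by (cases c) simp
  qed
qed

lemma graded_KA: "graded K EE (\<lambda>c. orbit_map X_tau (Xq c)) (KA K)"
  by (rule graded_invol.graded_inv[OF kummer_invol]) (rule X_tau_OX)

lemma KA_bilinear:
  assumes "(x, y) \<in> {(Ea, Ea), (Eb, Eb)} \<union> {Ec, Ed} \<times> {Ec, Ed}"
  shows "(\<lambda>p. fst p x * snd p y) \<in> KA K 1"
proof -
  have "(\<lambda>p. fst p x * snd p y) \<in> XA K 1"
    using assms bilinear_ab[of x y] bilinear_cd[of x y] by auto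
  then show ?thesis using assms by (auto simp: inv_funs_def[of EE tt])
qed

lemma box_map_KA:
  assumes "i \<noteq> Z3"
  shows "(\<lambda>p. box_map p i) \<in> KA K 1"
proof -
  interpret A: graded K EE "\<lambda>c. orbit_map X_tau (Xq c)" "KA K" by (rule graded_KA)
  have "(\<lambda>p. fst p x * snd p y + fst p x' * snd p y') \<in> KA K 1" "(\<lambda>p. fst p x * snd p y - fst p x' * snd p y') \<in> KA K 1"
    if "{x, y, x', y'} \<subseteq> {Ec, Ed}" for x y x' y'
  proof -
    have "(\<lambda>p. fst p x * snd p y) \<in> KA K 1" "(\<lambda>p. fst p x' * snd p y') \<in> KA K 1"
      by (rule KA_bilinear, rule UnI2, use that in blast)+
    then show "(\<lambda>p. fst p x * snd p y + fst p x' * snd p y') \<in> KA K 1" "(\<lambda>p. fst p x * snd p y - fst p x' * snd p y') \<in> KA K 1"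
      by (rule A.A_add, rule A.A_diff)
  qed
  then show ?thesis using assms KA_bilinear[of Ea Ea] KA_bilinear[of Eb Eb]
    by (cases i) (simp_all add: box_map_simps)
qed

text \<open>Z3 has degree one, so its coefficient in a form of degree d has degree d - 1, and is 0 for d = 0.\<close>

definition KA_odd :: "nat \<Rightarrow> ((E_var \<Rightarrow> complex) \<times> (E_var \<Rightarrow> complex) \<Rightarrow> complex) set" where
  "KA_odd d = (case d of 0 \<Rightarrow> {\<lambda>_. 0} | Suc n \<Rightarrow> KA K n)"

lemma KA_odd_add: "f \<in> KA_odd d \<Longrightarrow> g \<in> KA_odd d \<Longrightarrow> (\<lambda>p. f p + g p) \<in> KA_odd d"
proof -
  interpret A: graded K EE "\<lambda>c. orbit_map X_tau (Xq c)" "KA K" by (rule graded_KA)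
  assume "f \<in> KA_odd d" "g \<in> KA_odd d"
  then show ?thesis unfolding KA_odd_def by (cases d) (simp_all add: A.A_add)
qed

text \<open>Modulo Z3^2 = W1^2 + W2^2 a form is f + Z3 g with \<open>f\<close> and \<open>g\<close>
  free of Z3, hence bihomogeneous and invariant. The value at the sigma-conjugate is carried along
  so that the odd part can be eliminated for invariant forms.\<close>

lemma box_form_pull:
  assumes "form K d F"
  shows "\<exists>f\<in>KA K d. \<exists>g\<in>KA_odd d. \<forall>p\<in>EE. F (box_map p) = f p + box_map p Z3 * g p \<and>
    F (box_neg (box_map p)) = f p - box_map p Z3 * g p"
  using assms
proof (induction rule: form.induct)
  case (const c)
  interpret A: graded K EE "\<lambda>c. orbit_map X_tau (Xq c)" "KA K" by (rule graded_KA)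
  show ?case by (intro bexI[OF _ A.A_const[OF const]] bexI[of _ "\<lambda>_. 0"]) (simp_all add: KA_odd_def)
next
  case (var i)
  interpret A: graded K EE "\<lambda>c. orbit_map X_tau (Xq c)" "KA K" by (rule graded_KA)
  have zero: "(\<lambda>_. 0) \<in> KA K n" for n
  proof -
    obtain w where "w \<in> KA K n" using A.A_nz_deg[of "(vO, vO)" n] vO_CE by auto
    from A.A_smult[OF K_zero this] show ?thesis by simp
  qed
  show ?case
  proof (cases "i = Z3")
    case True
    have "(\<lambda>_. 1) \<in> KA_odd 1" using A.A_const[OF K_one] by (simp add: KA_odd_def)
    then show ?thesis using True by (intro bexI[OF _ zero] bexI[of _ "\<lambda>_. 1"]) simp_all
  next
    case False
    have "(\<lambda>_. 0) \<in> KA_odd 1" using zero by (simp add: KA_odd_def)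
    then show ?thesis using False by (intro bexI[OF _ box_map_KA[OF False]] bexI[of _ "\<lambda>_. 0"]) simp_all
  qed
next
  case (add d F G)
  interpret A: graded K EE "\<lambda>c. orbit_map X_tau (Xq c)" "KA K" by (rule graded_KA)
  obtain f g where fg: "f \<in> KA K d" "g \<in> KA_odd d" "\<forall>p\<in>EE. F (box_map p) = f p + box_map p Z3 * g p \<and>
    F (box_neg (box_map p)) = f p - box_map p Z3 * g p" using add(3) by (elim bexE) (rule that)
  obtain f' g' where fg': "f' \<in> KA K d" "g' \<in> KA_odd d" "\<forall>p\<in>EE. G (box_map p) = f' p + box_map p Z3 * g' p \<and>
    G (box_neg (box_map p)) = f' p - box_map p Z3 * g' p" using add(4) by (elim bexE) (rule that)
  have "(\<lambda>p. g p + g' p) \<in> KA_odd d"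
    using fg(2) fg'(2) by (rule KA_odd_add)
  moreover have "(\<lambda>p. f p + f' p) \<in> KA K d" by (rule A.A_add[OF fg(1) fg'(1)])
  moreover have "F (box_map p) + G (box_map p) = f p + f' p + box_map p Z3 * (g p + g' p) \<and>
     F (box_neg (box_map p)) + G (box_neg (box_map p)) = f p + f' p - box_map p Z3 * (g p + g' p)"
    if "p \<in> EE" for p
    using bspec[OF fg(3) that] bspec[OF fg'(3) that] by (simp add: distrib_left)
  ultimately show ?case
    by (rule_tac bexI[of _ "\<lambda>p. f p + f' p"], rule_tac bexI[of _ "\<lambda>p. g p + g' p"]) simp_all
next
  case (mult d F e G)
  interpret A: graded K EE "\<lambda>c. orbit_map X_tau (Xq c)" "KA K" by (rule graded_KA)
  obtain f g where fg: "f \<in> KA K d" "g \<in> KA_odd d" "\<forall>p\<in>EE. F (box_map p) = f p + box_map p Z3 * g p \<and>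
    F (box_neg (box_map p)) = f p - box_map p Z3 * g p" using mult(3) by (elim bexE) (rule that)
  obtain f' g' where fg': "f' \<in> KA K e" "g' \<in> KA_odd e" "\<forall>p\<in>EE. G (box_map p) = f' p + box_map p Z3 * g' p \<and>
    G (box_neg (box_map p)) = f' p - box_map p Z3 * g' p" using mult(4) by (elim bexE) (rule that)
  define w where "w = (\<lambda>p. (box_map p W1)\<^sup>2 + (box_map p W2)\<^sup>2)"
  have w: "w \<in> KA K (1 + 1)" unfolding w_def power2_eq_square
    by (intro A.A_add A.A_mult box_map_KA) simp_all
  have ww: "box_map p Z3 * box_map p Z3 = w p" for p
    using box_map_simps(7)[of p] by (simp add: w_def power2_eq_square)
  have odd: "(\<lambda>p. f p * g p) \<in> KA_odd (m + n)" if "f \<in> KA K m" "g \<in> KA_odd n" for f g m n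
  proof (cases n)
    case 0
    show ?thesis
    proof (cases m)
      case 0
      then show ?thesis using that \<open>n = 0\<close> by (simp add: KA_odd_def)
    next
      case (Suc k)
      obtain z where "z \<in> KA K k" using A.A_nz_deg[of "(vO, vO)" k] vO_CE by auto
      from A.A_smult[OF K_zero this] have "(\<lambda>_. 0) \<in> KA K k" by simp
      then show ?thesis using that \<open>n = 0\<close> Suc by (simp add: KA_odd_def)
    qed
  next
    case (Suc k)
    then show ?thesis using A.A_mult[OF that(1), of g k] that(2) by (simp add: KA_odd_def)
  qed
  have odd2: "(\<lambda>p. w p * (g p * g' p)) \<in> KA K (d + e)"
  proof (cases "d = 0 \<or> e = 0")
    case True
    have "(\<lambda>p. w p * (g p * g' p)) = (\<lambda>_. 0)"
      using True fg(2) fg'(2) by (auto simp: KA_odd_def)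
    moreover obtain z where "z \<in> KA K (d + e)" using A.A_nz_deg[of "(vO, vO)" "d + e"] vO_CE by auto
    ultimately show ?thesis using A.A_smult[OF K_zero, of z "d + e"] by simp
  next
    case False
    then obtain m n where mn: "d = Suc m" "e = Suc n" by (metis not0_implies_Suc)
    then have "g \<in> KA K m" "g' \<in> KA K n" using fg(2) fg'(2) by (simp_all add: KA_odd_def)
    from A.A_mult[OF w A.A_mult[OF this]] show ?thesis by (simp add: mn)
  qed
  have "(\<lambda>p. f p * f' p + w p * (g p * g' p)) \<in> KA K (d + e)"
    by (rule A.A_add[OF A.A_mult[OF fg(1) fg'(1)] odd2])
  moreover have "(\<lambda>p. f p * g' p + f' p * g p) \<in> KA_odd (d + e)"
  proof -
    have "(\<lambda>p. f p * g' p) \<in> KA_odd (d + e)" "(\<lambda>p. f' p * g p) \<in> KA_odd (d + e)"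
      using odd[OF fg(1) fg'(2)] odd[OF fg'(1) fg(2)] by (simp_all add: add.commute)
    then show ?thesis by (rule KA_odd_add)
  qed
  moreover have "F (box_map p) * G (box_map p) = f p * f' p + w p * (g p * g' p) + box_map p Z3 * (f p * g' p + f' p * g p) \<and>
     F (box_neg (box_map p)) * G (box_neg (box_map p)) = f p * f' p + w p * (g p * g' p) - box_map p Z3 * (f p * g' p + f' p * g p)"
    if "p \<in> EE" for p
    unfolding conjunct1[OF bspec[OF fg(3) that]] conjunct2[OF bspec[OF fg(3) that]]
      conjunct1[OF bspec[OF fg'(3) that]] conjunct2[OF bspec[OF fg'(3) that]] ww[symmetric]
    by (simp add: algebra_simps)
  ultimately show ?case
    by (rule_tac bexI[of _ "\<lambda>p. f p * f' p + w p * (g p * g' p)"], rule_tac bexI[of _ "\<lambda>p. f p * g' p + f' p * g p"]) simp_all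
qed

text \<open>Functions on E x E that come from sigma-invariant forms on the box variety. That all
  invariants of rho and tau are of this kind is the surjective half of the comparison of
  rings.\<close>

definition box_funs :: "nat \<Rightarrow> ((E_var \<Rightarrow> complex) \<times> (E_var \<Rightarrow> complex) \<Rightarrow> complex) set" where
  "box_funs d = {f. \<exists>F\<in>inv_funs BC box_neg (forms K) d. \<forall>p\<in>EE. f p = F (box_map p)}"

lemma graded_box_quotient: "graded K BC (\<lambda>c. orbit_map box_sigma (proj_pt c)) (inv_funs BC box_neg (forms K))"
  by (rule graded_invol.graded_inv[OF box_invol])

lemma box_funs_const: "c \<in> K \<Longrightarrow> (\<lambda>_. c) \<in> box_funs 0"
proof -
  interpret B: graded K BC "\<lambda>c. orbit_map box_sigma (proj_pt c)" "inv_funs BC box_neg (forms K)" by (rule graded_box_quotient)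
  assume "c \<in> K"
  from B.A_const[OF this] show ?thesis unfolding box_funs_def by (intro CollectI bexI) simp_all
qed

lemma box_funsE:
  assumes "f \<in> box_funs d"
  obtains F where "F \<in> inv_funs BC box_neg (forms K) d" "\<forall>p\<in>EE. f p = F (box_map p)"
  using assms unfolding box_funs_def mem_Collect_eq by (elim bexE) (rule that)

lemma box_funs_add: "f \<in> box_funs d \<Longrightarrow> g \<in> box_funs d \<Longrightarrow> (\<lambda>p. f p + g p) \<in> box_funs d"
proof -
  interpret B: graded K BC "\<lambda>c. orbit_map box_sigma (proj_pt c)" "inv_funs BC box_neg (forms K)" by (rule graded_box_quotient)
  assume f: "f \<in> box_funs d" and g: "g \<in> box_funs d"
  obtain F where F: "F \<in> inv_funs BC box_neg (forms K) d" "\<forall>p\<in>EE. f p = F (box_map p)" using f by (rule box_funsE)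
  obtain G where G: "G \<in> inv_funs BC box_neg (forms K) d" "\<forall>p\<in>EE. g p = G (box_map p)" using g by (rule box_funsE)
  show ?thesis unfolding box_funs_def
    by (intro CollectI bexI[OF _ B.A_add[OF F(1) G(1)]]) (use F(2) G(2) in simp)
qed

lemma box_funs_mult: "f \<in> box_funs d \<Longrightarrow> g \<in> box_funs e \<Longrightarrow> (\<lambda>p. f p * g p) \<in> box_funs (d + e)"
proof -
  interpret B: graded K BC "\<lambda>c. orbit_map box_sigma (proj_pt c)" "inv_funs BC box_neg (forms K)" by (rule graded_box_quotient)
  assume f: "f \<in> box_funs d" and g: "g \<in> box_funs e"
  obtain F where F: "F \<in> inv_funs BC box_neg (forms K) d" "\<forall>p\<in>EE. f p = F (box_map p)" using f by (rule box_funsE)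
  obtain G where G: "G \<in> inv_funs BC box_neg (forms K) e" "\<forall>p\<in>EE. g p = G (box_map p)" using g by (rule box_funsE)
  show ?thesis unfolding box_funs_def
    by (intro CollectI bexI[OF _ B.A_mult[OF F(1) G(1)]]) (use F(2) G(2) in simp)
qed

lemma box_funs_smult: "k \<in> K \<Longrightarrow> f \<in> box_funs d \<Longrightarrow> (\<lambda>p. k * f p) \<in> box_funs d"
  using box_funs_mult[OF box_funs_const, of k f d] by simp

lemma box_funs_zero: "(\<lambda>_. 0) \<in> box_funs d"
proof -
  interpret B: graded K BC "\<lambda>c. orbit_map box_sigma (proj_pt c)" "inv_funs BC box_neg (forms K)" by (rule graded_box_quotient)
  obtain z where "z \<in> inv_funs BC box_neg (forms K) d"
    using B.A_nz_deg[of "box_map (vO, vO)" d] box_map_BC[of "(vO, vO)"] vO_CE by auto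
  from B.A_smult[OF K_zero this] show ?thesis unfolding box_funs_def by (intro CollectI bexI) simp_all
qed

lemma box_funs_coord: "i \<noteq> Z3 \<Longrightarrow> (\<lambda>p. box_map p i) \<in> box_funs 1"
  unfolding box_funs_def using form.var[of K i] by (intro CollectI bexI[of _ "\<lambda>v. v i"]) (simp_all add: inv_funs_def)

text \<open>The formulas for Z1, Z2, W1 and W2 are inverted, which requires 1/2 in
  \<open>K\<close>.\<close>

lemma box_funs_bilinear:
  assumes "(x, y) \<in> {(Ea, Ea), (Eb, Eb)} \<union> {Ec, Ed} \<times> {Ec, Ed}"
  shows "(\<lambda>p. fst p x * snd p y) \<in> box_funs 1"
proof -
  have half: "inverse 2 \<in> K" "- inverse 2 \<in> K" by (auto intro: K_inverse)
  have *: "(\<lambda>p. k * box_map p i + l * box_map p j) \<in> box_funs 1" if "i \<noteq> Z3" "j \<noteq> Z3" "k \<in> K" "l \<in> K" for i j k l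
    using that by (intro box_funs_add box_funs_smult box_funs_coord)
  consider "x = Ea" "y = Ea" | "x = Eb" "y = Eb" | "x = Ec" "y = Ec" | "x = Ed" "y = Ed" | "x = Ec" "y = Ed" | "x = Ed" "y = Ec"
    using assms by auto
  then show ?thesis
  proof cases
    case 1 then show ?thesis using box_funs_coord[of Cc] by (simp add: box_map_simps)
  next
    case 2 then show ?thesis using box_funs_coord[of W3] by (simp add: box_map_simps)
  next
    case 3 then show ?thesis using *[of Z1 Z2 "inverse 2" "inverse 2"] half by (simp add: box_map_simps field_simps)
  next
    case 4 then show ?thesis using *[of Z1 Z2 "inverse 2" "- inverse 2"] half by (simp add: box_map_simps field_simps)
  next
    case 5 then show ?thesis using *[of W1 W2 "inverse 2" "inverse 2"] half by (simp add: box_map_simps field_simps)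
  next
    case 6 then show ?thesis using *[of W1 W2 "- inverse 2" "inverse 2"] half by (simp add: box_map_simps field_simps)
  qed
qed

text \<open>As the degrees on the two factors are equal, variables of the first factor can be paired
  with variables of the second in any order, and each pair is a bilinear function of the previous
  lemma.\<close>

lemma box_funs_cd:
  "i + j = k + l \<Longrightarrow> (\<lambda>p. fst p Ec ^ i * fst p Ed ^ j * (snd p Ec ^ k * snd p Ed ^ l)) \<in> box_funs (i + j)"
proof (induction "i + j" arbitrary: i j k l)
  case 0
  then show ?case using box_funs_const[OF K_one] by simp
next
  case (Suc n)
  obtain x i' j' where x: "x \<in> {Ec, Ed}" "n = i' + j'" "\<And>v. v Ec ^ i * v Ed ^ j = v x * (v Ec ^ i' * v Ed ^ j' :: complex)"
  proof (cases i)
    case 0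
    then obtain m where "j = Suc m" "n = m" using Suc(2) by (cases j) auto
    then show thesis using 0 by (intro that[of Ed 0 m]) simp_all
  next
    case i: (Suc m)
    then show thesis using Suc(2) by (intro that[of Ec m j]) (simp_all add: mult.assoc)
  qed
  obtain y k' l' where y: "y \<in> {Ec, Ed}" "n = k' + l'" "\<And>v. v Ec ^ k * v Ed ^ l = v y * (v Ec ^ k' * v Ed ^ l' :: complex)"
  proof (cases k)
    case 0
    then obtain m where "l = Suc m" "n = m" using Suc(2,3) by (cases l) auto
    then show thesis using 0 by (intro that[of Ed 0 m]) simp_all
  next
    case k: (Suc m)
    then show thesis using Suc(2,3) by (intro that[of Ec m l]) (simp_all add: mult.assoc)
  qed
  have ij: "i' + j' = k' + l'" using x(2) y(2) by (rule trans[OF sym])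
  have "(\<lambda>p. fst p Ec ^ i' * fst p Ed ^ j' * (snd p Ec ^ k' * snd p Ed ^ l')) \<in> box_funs (i' + j')"
    by (rule Suc(1)[OF x(2) ij])
  moreover have "(\<lambda>p. fst p x * snd p y) \<in> box_funs 1"
    by (rule box_funs_bilinear, rule UnI2) (use x(1) y(1) in blast)
  ultimately have "(\<lambda>p. fst p x * snd p y * (fst p Ec ^ i' * fst p Ed ^ j' * (snd p Ec ^ k' * snd p Ed ^ l'))) \<in> box_funs (1 + (i' + j'))"
    by (rule_tac box_funs_mult)
  then show ?case unfolding x(3) y(3) Suc(2)[symmetric] x(2) by (simp add: ac_simps)
qed

text \<open>Every product of normal form monomials is an eigenfunction of rho and tau with signs as
  eigenvalues, so the average is either zero or the product itself. In the latter case the exponents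
  of b agree by parity, then those of a, and then the degrees in c and d.\<close>

lemma box_funs_average:
  assumes "f \<in> lspan K ((\<lambda>(b, b') p. b (fst p) * b' (snd p)) ` (emonos d \<times> emonos d))"
  shows "(\<lambda>p. (f p + f (rr p) + (f (tt p) + f (rr (tt p)))) / 4) \<in> box_funs d"
  using assms
proof induction
  case zero
  show ?case using box_funs_zero by simp
next
  case (add f g)
  from box_funs_add[OF add(3,4)] show ?case by (simp add: add_divide_distrib ac_simps)
next
  case (smult k f)
  from box_funs_smult[OF smult(1,3)] show ?case by (simp add: distrib_left)
next
  case (base f)
  then obtain b b' where b: "b \<in> emonos d" "b' \<in> emonos d" "f = (\<lambda>p. b (fst p) * b' (snd p))" by auto
  obtain p q i j where m: "b = (\<lambda>v. v Ea ^ p * v Eb ^ q * v Ec ^ i * v Ed ^ j)" "p \<le> 1" "q \<le> 1" "p + q + i + j = d"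
    using b(1) unfolding emonos_def by blast
  obtain p' q' i' j' where m': "b' = (\<lambda>v. v Ea ^ p' * v Eb ^ q' * v Ec ^ i' * v Ed ^ j')" "p' \<le> 1" "q' \<le> 1" "p' + q' + i' + j' = d"
    using b(2) unfolding emonos_def by blast
  define \<rho> \<tau> :: complex where "\<rho> = (-1) ^ (i + j + i' + j')" and "\<tau> = (-1) ^ (q + q')"
  have neg: "(- x) ^ n = (-1) ^ n * (x :: complex) ^ n" for x n by (rule power_minus)
  have fr: "f (rr c) = \<rho> * f c" for c
    unfolding b(3) m(1) m'(1) \<rho>_def by (simp add: neg[of "fst c _"] neg[of "snd c _"] power_add ac_simps)
  have ft: "f (tt c) = \<tau> * f c" for c
    unfolding b(3) m(1) m'(1) \<tau>_def by (simp add: neg[of "fst c _"] neg[of "snd c _"] power_add ac_simps)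
  have avg: "(f c + f (rr c) + (f (tt c) + f (rr (tt c)))) / 4 = (1 + \<rho>) * (1 + \<tau>) / 4 * f c" for c
    unfolding fr ft by (simp add: algebra_simps)
  show ?case
  proof (cases "even (i + j + i' + j') \<and> even (q + q')")
    case False
    then have "\<rho> = -1 \<or> \<tau> = -1" unfolding \<rho>_def \<tau>_def using neg_one_odd_power by blast
    then have zero: "(1 + \<rho>) * (1 + \<tau>) = 0" by auto
    show ?thesis unfolding avg zero using box_funs_zero by simp
  next
    case True
    then have "\<rho> = 1" "\<tau> = 1" unfolding \<rho>_def \<tau>_def by (auto intro: neg_one_even_power)
    then have one: "(1 + \<rho>) * (1 + \<tau>) / 4 = 1" by simp
    have qq: "q' = q" using True m(3) m'(3) by presburger
    have pp: "p' = p"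
    proof -
      \<comment> \<open>The total degree of the two monomials is 2d, and the exponents of b, c and d
        together are even.\<close>
      have "even (p + p')" using True m(4) m'(4) qq by presburger
      then show ?thesis using m(2) m'(2) by presburger
    qed
    have ij: "i + j = i' + j'" using m(4) m'(4) pp qq by simp
    have pow: "(\<lambda>c. (fst c x * snd c x) ^ n) \<in> box_funs n" if "x \<in> {Ea, Eb}" "n \<le> 1" for x n
    proof (cases "n = 0")
      case True
      then show ?thesis using box_funs_const[OF K_one] by simp
    next
      case False
      then have "n = 1" using that(2) by simp
      then show ?thesis using box_funs_bilinear[of x x] that(1) by auto
    qed
    have "(\<lambda>c. (fst c Ea * snd c Ea) ^ p * ((fst c Eb * snd c Eb) ^ q *
        (fst c Ec ^ i * fst c Ed ^ j * (snd c Ec ^ i' * snd c Ed ^ j')))) \<in> box_funs (p + (q + (i + j)))"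
      by (intro box_funs_mult pow box_funs_cd m(2,3) ij) simp_all
    moreover have "p + (q + (i + j)) = d" using m(4) by simp
    ultimately show ?thesis unfolding avg one unfolding b(3) m(1) m'(1) pp qq by (simp add: power_mult_distrib ac_simps)
  qed
qed

text \<open>The normal form of an invariant function may contain monomials that are not invariant.
  Averaging removes them and, on the cone over E x E, reproduces the function.\<close>

lemma KA_box_funs:
  assumes "f \<in> KA K d"
  shows "f \<in> box_funs d"
proof -
  have f: "f \<in> EEA K d" "\<forall>c\<in>EE. f (rr c) = f c" "\<forall>c\<in>EE. f (tt c) = f c" using assms by (auto simp: inv_funs_def)
  obtain g where g: "g \<in> lspan K ((\<lambda>(b, b') p. b (fst p) * b' (snd p)) ` (emonos d \<times> emonos d))" "\<forall>p\<in>EE. f p = g p"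
    using EEA_span[OF f(1)] by (elim bexE) (rule that)
  obtain F where F: "F \<in> inv_funs BC box_neg (forms K) d"
    "\<forall>p\<in>EE. (g p + g (rr p) + (g (tt p) + g (rr (tt p)))) / 4 = F (box_map p)"
    using box_funs_average[OF g(1)] by (rule box_funsE)
  have "f p = F (box_map p)" if p: "p \<in> EE" for p
  proof -
    have t: "tt p \<in> EE" using p tau_vec_CE by auto
    have r: "rr c \<in> EE" if "c \<in> EE" for c using that rho_vec_CE by auto
    have "g p = f p" "g (rr p) = f p" "g (tt p) = f p" "g (rr (tt p)) = f p"
      using bspec[OF g(2) p] bspec[OF g(2) r[OF p]] bspec[OF g(2) t] bspec[OF g(2) r[OF t]]
        bspec[OF f(2) p] bspec[OF f(3) p] bspec[OF f(2) t] by simp_all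
    then show ?thesis using bspec[OF F(2) p] by simp
  qed
  then show ?thesis unfolding box_funs_def by (intro CollectI bexI[OF _ F(1)] ballI)
qed

text \<open>The lift \<open>box_map\<close> starts from E x E, the cone of the Kummer side, so the
  comparison is set up in that direction and used in reverse. The group enters through its inverse
  map, which is tau on orbits.\<close>

theorem box_kummer_isomorphic:
  assumes G: "\<And>u v. u \<in> CE \<Longrightarrow> v \<in> CE \<Longrightarrow>
    inv\<^bsub>G\<^esub> (OX (proj_pt u, proj_pt v)) = OX (proj_pt (tau_vec u), proj_pt (tau_vec v))"
  shows "isomorphic (quotient_by (box_variety K) box_sigma) (kummer (X_surface K) G)"
proof -
  interpret I: graded_invol K EE Xq "XA K" tt "\<lambda>x. inv\<^bsub>G\<^esub> x" by (rule kummer_invol[OF G])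
  interpret A: graded K EE I.oq "KA K" by (rule I.graded_inv)
  interpret B: graded K BC "\<lambda>c. orbit_map box_sigma (proj_pt c)" "inv_funs BC box_neg (forms K)" by (rule graded_box_quotient)
  interpret AB: graded_pair K EE I.oq "KA K" BC "\<lambda>c. orbit_map box_sigma (proj_pt c)" "inv_funs BC box_neg (forms K)"
    by unfold_locales
  show ?thesis
    unfolding box_quotient_gspace kummer_def X_surface_gspace I.quotient_gspace
  proof (rule AB.isomorphic_gspace(2)[where \<Phi> = box_map])
    show "box_map c \<in> BC" if "c \<in> EE" for c by (rule box_map_BC[OF that])
    show "\<exists>c\<in>EE. orbit_map box_sigma (proj_pt (box_map c)) = orbit_map box_sigma (proj_pt e)" if e: "e \<in> BC" for e
    proof -
      obtain c where c: "c \<in> EE" "box_map c = e \<or> box_map c = box_neg e" using box_map_surj[OF e] by (elim bexE) (rule that)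
      have "orbit_map box_sigma (proj_pt (box_map c)) = orbit_map box_sigma (proj_pt e)"
        using c(2) by (elim disjE) (simp_all only: graded_invol.orbit_t[OF box_invol e])
      then show ?thesis using c(1) by (rule bexI)
    qed
    show "pulls_back EE (KA K) box_map (inv_funs BC box_neg (forms K))"
    proof (rule pulls_back_direct[where k = 1])
      fix d f' assume f': "f' \<in> inv_funs BC box_neg (forms K) d"
      then have "form K d f'" by (simp add: inv_funs_def)
      then obtain f g where f: "f \<in> KA K d" "\<forall>p\<in>EE. f' (box_map p) = f p + box_map p Z3 * g p \<and>
          f' (box_neg (box_map p)) = f p - box_map p Z3 * g p"
        by (drule_tac box_form_pull) (elim bexE, rule that)
      have "f p = f' (box_map p)" if p: "p \<in> EE" for p
      proof -
        have "f' (box_neg (box_map p)) = f' (box_map p)" using f' box_map_BC[OF p] by (simp add: inv_funs_def)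
        then show ?thesis using bspec[OF f(2) p] by auto
      qed
      then show "\<exists>f\<in>KA K (1 * d). \<forall>c\<in>EE. f c = f' (box_map c)" using f(1) by (simp only: mult_1) (intro bexI ballI)
    qed
    show "\<exists>m f' g' l. f' \<in> inv_funs BC box_neg (forms K) m \<and> g' \<in> inv_funs BC box_neg (forms K) m \<and>
        (\<forall>c\<in>EE. l c \<noteq> 0 \<and> f' (box_map c) = l c * f c \<and> g' (box_map c) = l c * g c)"
      if fg: "f \<in> KA K d" "g \<in> KA K d" for d f g
    proof -
      obtain F where F: "F \<in> inv_funs BC box_neg (forms K) d" "\<forall>p\<in>EE. f p = F (box_map p)" using KA_box_funs[OF fg(1)] by (rule box_funsE)
      obtain H where H: "H \<in> inv_funs BC box_neg (forms K) d" "\<forall>p\<in>EE. g p = H (box_map p)" using KA_box_funs[OF fg(2)] by (rule box_funsE)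
      have "\<forall>c\<in>EE. (1::complex) \<noteq> 0 \<and> F (box_map c) = 1 * f c \<and> H (box_map c) = 1 * g c" using F(2) H(2) by simp
      with F(1) H(1) show ?thesis
        by (rule_tac exI[of _ d], rule_tac exI[of _ F], rule_tac exI[of _ H], rule_tac exI[of _ "\<lambda>_. 1"]) (intro conjI)
    qed
    show "gseparating EE I.oq (KA K)" by (rule I.gseparating_quotient[OF gseparating_X])
    show "gseparating BC (\<lambda>c. orbit_map box_sigma (proj_pt c)) (inv_funs BC box_neg (forms K))"
      by (rule graded_invol.gseparating_quotient[OF box_invol gseparating_BC])
  qed
qed

end

theorem mainTheorem14:
  shows "(\<exists>G. abelian_surface \<rat> (X_surface \<rat>) G) \<and>
    (\<exists>G. abelian_surface Q_zeta8 (X_surface Q_zeta8) G \<and>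
         \<one>\<^bsub>G\<^esub> = X_origin \<and>
         (\<forall>x\<in>points (X_surface Q_zeta8). X_tau x = inv\<^bsub>G\<^esub> x) \<and>
         isomorphic (quotient_by (box_variety Q_zeta8) box_sigma)
                    (kummer (X_surface Q_zeta8) G))"
proof (intro conjI)
  \<comment> \<open>Over the rational numbers the origin is the image of the point [1, 1, 1, 0]; the
    origin of the second claim has an irrational coordinate.\<close>
  show "\<exists>G. abelian_surface \<rat> (X_surface \<rat>) G"
    using E_group.abelian_surface_XG[OF E_group_Rats] by (rule exI)
  interpret E_group Q_zeta8 theta tau_vec vo by (rule E_group_Q_zeta8)
  show "\<exists>G. abelian_surface Q_zeta8 (X_surface Q_zeta8) G \<and> \<one>\<^bsub>G\<^esub> = X_origin \<and>
      (\<forall>x\<in>points (X_surface Q_zeta8). X_tau x = inv\<^bsub>G\<^esub> x) \<and>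
      isomorphic (quotient_by (box_variety Q_zeta8) box_sigma) (kummer (X_surface Q_zeta8) G)"
  proof (intro exI[of _ XG] conjI ballI)
    show "abelian_surface Q_zeta8 (X_surface Q_zeta8) XG" by (rule abelian_surface_XG)
    have "E_pt (complex_of_real (sqrt 2)) 0 1 1 = proj_pt vo" unfolding E_pt_def by (rule arg_cong[where f = proj_pt]) (simp add: evec_eq_iff)
    then show "\<one>\<^bsub>XG\<^esub> = X_origin" by (simp add: XG_def X_origin_def X_image_def)
    show "X_tau x = inv\<^bsub>XG\<^esub> x" if "x \<in> points (X_surface Q_zeta8)" for x
    proof -
      have "x \<in> carrier XG" using that by (simp add: XG_def)
      then obtain u v where "u \<in> CE" "v \<in> CE" "x = OX (proj_pt u, proj_pt v)" by (rule XG_carrierE)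
      then show ?thesis using XG_inv X_tau_OX by simp
    qed
    show "isomorphic (quotient_by (box_variety Q_zeta8) box_sigma) (kummer (X_surface Q_zeta8) XG)"
      by (rule box_kummer_isomorphic) (rule XG_inv)
  qed
qed

end
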